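(* There exists a stationary shear flow $U(z)$ such that the following holds. For all $s \in \mathbb{N}$, $\alpha \in (0,1]$, and $k \in \mathbb{N}$, there are families $(\omega_\varepsilon)_{\varepsilon>0}$ of solutions of the hydrostatic Euler equations in vorticity form $$\partial_t \omega + u\,\partial_x \omega + v\,\partial_z \omega = 0, \qquad u = \partial_z \varphi,\quad v = -\partial_x \varphi, \qquad \partial_z^2 \varphi = \omega, \quad \varphi_{|z=\pm 1} = 0, \qquad (x,z)\in \mathbb{T}\times[-1,1],$$ times $t_\varepsilon = \mathcal{O}(\varepsilon |\log \varepsilon|)$, and a point $(x_0, z_0) \in \mathbb{T} \times (-1,1)$ such that $$\lim_{\varepsilon \to 0} \frac{ \| \omega_\varepsilon - U' \|_{L^2([0,t_\varepsilon] \times \Omega_\varepsilon)}}{\| \omega_\varepsilon|_{t=0} -U' \|^\alpha_{H^s(\mathbb{T} \times (-1,1))}}=+\infty,$$ where $\Omega_\varepsilon =B(x_0, \varepsilon^k) \times B(z_0, \varepsilon^k)$.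
   Context: $\mathbb{T} := \mathbb{R}/\mathbb{Z}$ is equipped with the normalized Lebesgue measure. The unknown is the vorticity $\omega=\omega(t,x,z)$, and $\varphi=\varphi(t,x,z)$ is the stream function, determined from $\omega$ by the elliptic problem in $z$. A stationary shear flow $U(z)$ is the stationary solution with velocity field $(u,v) = (U(z),0)$; its vorticity is $\omega = U'(z)$. $B(a,r)$ denotes the ball of center $a$ and radius $r$ (in $\mathbb{T}$, respectively in $\mathbb{R}$). $H^s$ is the usual Sobolev space. The solution $\omega_\varepsilon$ is defined on the time interval $[0,t_\varepsilon]$. *)

theory Defs
  imports "HOL-Analysis.Analysis" "HOL-Library.Landau_Symbols"
begin

text \<open>
  Functions on the torus \<open>\<real>/\<int>\<close> are 1-periodic functions on \<^typ>\<open>real\<close>; integrals over the torus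
  (with its normalized Lebesgue measure) are integrals over the fundamental domain
  \<open>{0..<1}\<close>. Arguments are ordered \<open>t x z\<close>.
\<close>

text \<open>
  Classical solutions on \<open>[0,T] \<times> \<T> \<times> [-1,1]\<close>: the vorticity is \<open>C\<^sup>1\<close> up to the boundary, with
  derivatives at \<open>t = 0\<close>, \<open>t = T\<close> and \<open>z = \<plusminus>1\<close> one-sided. The regularity of \<open>\<phi>\<close>, \<open>u\<close>, \<open>v\<close> then
  follows from the elliptic problem. Only meaningful for \<open>0 < T\<close>.
\<close>
definition hydrostatic_Euler ::
  "real \<Rightarrow> (real \<Rightarrow> real \<Rightarrow> real \<Rightarrow> real) \<Rightarrow> (real \<Rightarrow> real \<Rightarrow> real \<Rightarrow> real) \<Rightarrow>
   (real \<Rightarrow> real \<Rightarrow> real \<Rightarrow> real) \<Rightarrow> (real \<Rightarrow> real \<Rightarrow> real \<Rightarrow> real) \<Rightarrow> bool"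
where
  "hydrostatic_Euler T \<omega> \<phi> u v \<longleftrightarrow>
     (\<forall>t\<in>{0..T}. \<forall>x. \<forall>z\<in>{-1..1}. \<omega> t (x + 1) z = \<omega> t x z \<and> \<phi> t (x + 1) z = \<phi> t x z) \<and>
     (\<forall>t\<in>{0..T}. \<forall>x. \<forall>z\<in>{-1..1}.
        ((\<lambda>\<zeta>. \<phi> t x \<zeta>) has_real_derivative u t x z) (at z within {-1..1}) \<and>
        ((\<lambda>\<xi>. \<phi> t \<xi> z) has_real_derivative - v t x z) (at x) \<and>
        ((\<lambda>\<zeta>. u t x \<zeta>) has_real_derivative \<omega> t x z) (at z within {-1..1})) \<and>
     (\<forall>t\<in>{0..T}. \<forall>x. \<phi> t x (-1) = 0 \<and> \<phi> t x 1 = 0) \<and>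
     (\<exists>\<omega>\<^sub>t \<omega>\<^sub>x \<omega>\<^sub>z.
        continuous_on ({0..T} \<times> UNIV \<times> {-1..1}) (\<lambda>(t, x, z). \<omega>\<^sub>t t x z) \<and>
        continuous_on ({0..T} \<times> UNIV \<times> {-1..1}) (\<lambda>(t, x, z). \<omega>\<^sub>x t x z) \<and>
        continuous_on ({0..T} \<times> UNIV \<times> {-1..1}) (\<lambda>(t, x, z). \<omega>\<^sub>z t x z) \<and>
        (\<forall>t\<in>{0..T}. \<forall>x. \<forall>z\<in>{-1..1}.
           ((\<lambda>\<theta>. \<omega> \<theta> x z) has_real_derivative \<omega>\<^sub>t t x z) (at t within {0..T}) \<and>
           ((\<lambda>\<xi>. \<omega> t \<xi> z) has_real_derivative \<omega>\<^sub>x t x z) (at x) \<and>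
           ((\<lambda>\<zeta>. \<omega> t x \<zeta>) has_real_derivative \<omega>\<^sub>z t x z) (at z within {-1..1}) \<and>
           \<omega>\<^sub>t t x z + u t x z * \<omega>\<^sub>x t x z + v t x z * \<omega>\<^sub>z t x z = 0))"

definition hydrostatic_Euler_solution :: "real \<Rightarrow> (real \<Rightarrow> real \<Rightarrow> real \<Rightarrow> real) \<Rightarrow> bool" where
  "hydrostatic_Euler_solution T \<omega> \<longleftrightarrow> (\<exists>\<phi> u v. hydrostatic_Euler T \<omega> \<phi> u v)"

text \<open>The derivative \<open>U'\<close> on \<open>[-1,1]\<close>, one-sided at the endpoints.\<close>
definition shear_vorticity :: "(real \<Rightarrow> real) \<Rightarrow> real \<Rightarrow> real" where
  "shear_vorticity U z = vector_derivative U (at z within {-1..1})"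

text \<open>
  Since \<open>u = \<partial>\<^sub>z \<phi>\<close> and \<open>\<phi>\<close> vanishes at \<open>z = \<plusminus>1\<close>, this forces \<open>U\<close> to have mean zero; it also
  forces \<open>U\<close> to be \<open>C\<^sup>2\<close> on \<open>[-1,1]\<close>.
\<close>
definition stationary_shear_flow :: "(real \<Rightarrow> real) \<Rightarrow> bool" where
  "stationary_shear_flow U \<longleftrightarrow>
     (\<exists>\<phi> :: real \<Rightarrow> real \<Rightarrow> real. \<forall>T>0.
        hydrostatic_Euler T (\<lambda>t x z. shear_vorticity U z) (\<lambda>t. \<phi>) (\<lambda>t x z. U z) (\<lambda>t x z. 0))"

definition square_integrable_on :: "('a::euclidean_space \<Rightarrow> real) \<Rightarrow> 'a set \<Rightarrow> bool" where
  "square_integrable_on f A \<longleftrightarrow>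
     set_borel_measurable lborel A f \<and> set_integrable lborel A (\<lambda>p. (f p)\<^sup>2)"

definition L2_norm_on :: "'a::euclidean_space set \<Rightarrow> ('a \<Rightarrow> real) \<Rightarrow> real" where
  "L2_norm_on A f = sqrt (LINT p:A|lborel. (f p)\<^sup>2)"

text \<open>The domain \<open>\<T> \<times> (-1,1)\<close>.\<close>
definition channel :: "(real \<times> real) set" where
  "channel = {0..<1} \<times> {-1<..<1}"

text \<open>
  \<open>\<psi> 0 0\<close> is a test function in \<open>C\<^sub>c\<^sup>\<infinity>(\<T> \<times> (-1,1))\<close>, extended by zero to
  \<open>|z| \<ge> 1\<close>, and \<open>\<psi> i j\<close> is its derivative \<open>\<partial>\<^sub>x\<^sup>i \<partial>\<^sub>z\<^sup>j (\<psi> 0 0)\<close>.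
\<close>
definition test_function_jet :: "(nat \<Rightarrow> nat \<Rightarrow> real \<times> real \<Rightarrow> real) \<Rightarrow> bool" where
  "test_function_jet \<psi> \<longleftrightarrow>
     (\<forall>i j. continuous_on UNIV (\<psi> i j) \<and>
        (\<forall>x z. ((\<lambda>\<xi>. \<psi> i j (\<xi>, z)) has_real_derivative \<psi> (Suc i) j (x, z)) (at x) \<and>
               ((\<lambda>\<zeta>. \<psi> i j (x, \<zeta>)) has_real_derivative \<psi> i (Suc j) (x, z)) (at z))) \<and>
     (\<forall>x z. \<psi> 0 0 (x + 1, z) = \<psi> 0 0 (x, z)) \<and>
     (\<exists>r<1. \<forall>x z. r \<le> \<bar>z\<bar> \<longrightarrow> \<psi> 0 0 (x, z) = 0)"

text \<open>\<open>g \<in> L\<^sup>2\<close> is the weak derivative \<open>\<partial>\<^sub>x\<^sup>i \<partial>\<^sub>z\<^sup>j f\<close> on \<open>\<T> \<times> (-1,1)\<close>.\<close>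
definition has_weak_partial ::
  "(real \<times> real \<Rightarrow> real) \<Rightarrow> nat \<Rightarrow> nat \<Rightarrow> (real \<times> real \<Rightarrow> real) \<Rightarrow> bool"
where
  "has_weak_partial f i j g \<longleftrightarrow>
     square_integrable_on g channel \<and>
     (\<forall>\<psi>. test_function_jet \<psi> \<longrightarrow>
        (LINT p:channel|lborel. f p * \<psi> i j p) =
        (-1) ^ (i + j) * (LINT p:channel|lborel. g p * \<psi> 0 0 p))"

definition sobolev_space :: "nat \<Rightarrow> (real \<times> real \<Rightarrow> real) set" where
  "sobolev_space s =
     {f. square_integrable_on f channel \<and> (\<forall>i j. i + j \<le> s \<longrightarrow> (\<exists>g. has_weak_partial f i j g))}"

text \<open>
  Weak derivatives are unique up to null sets, so the choices below do not affect the norm.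
  Only meaningful for \<open>f \<in> sobolev_space s\<close>.
\<close>
definition sobolev_norm :: "nat \<Rightarrow> (real \<times> real \<Rightarrow> real) \<Rightarrow> real" where
  "sobolev_norm s f =
     sqrt (\<Sum>(i, j)\<in>{(i, j). i + j \<le> s}.
       (L2_norm_on channel (SOME g. has_weak_partial f i j g))\<^sup>2)"

text \<open>The ball in \<open>\<real>/\<int>\<close> for the quotient metric, inside the fundamental domain.\<close>
definition torus_ball :: "real \<Rightarrow> real \<Rightarrow> real set" where
  "torus_ball a r = {x \<in> {0..<1}. \<exists>n::int. dist (a + of_int n) x < r}"

text \<open>
  The intersection with \<open>(-1,1)\<close> only matters when the interval leaves the domain, which for
  \<open>k \<ge> 1\<close> does not happen for small \<open>\<epsilon>\<close>.
\<close>
definition Omega_box :: "real \<Rightarrow> real \<Rightarrow> real \<Rightarrow> (real \<times> real) set" where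
  "Omega_box x0 z0 r = torus_ball x0 r \<times> (ball z0 r \<inter> {-1<..<1})"

end

theory Submission
  imports Defs
begin

text \<open>
  Write the vorticity as \<open>1 / dens g\<close>, where \<open>g\<close> is a label transported by the flow. In terms of the
  velocity \<open>w t x a\<close> at label \<open>a\<close> the equations become \<open>w\<^sub>t + (w\<^sup>2 / 2 + \<kappa> w)\<^sub>x = 0\<close>, where \<open>\<kappa>\<close> is a quadratic
  functional of \<open>w\<close>, and the shear flow becomes \<open>w = a\<close>. Its linearization has an explicit mode growing like \<open>exp (t / 2)\<close> at
  frequency 1, while the linear problem at frequency \<open>n\<close> loses at most \<open>exp (\<bar>n\<bar> s t)\<close> for any \<open>s > 1 / 2\<close>. Hence the
  solution that starts on the mode with amplitude \<open>d\<close> is a power series in \<open>d\<close>, which converges and stays close to the growing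
  mode as long as \<open>d * exp (s * t)\<close> is small, that is, until the perturbation has size \<open>d powr \<beta>\<close> with \<open>\<beta>\<close> as small
  as desired. The equations are invariant under scaling \<open>t\<close> and \<open>x\<close> by \<open>2 * pi * N\<close>. With \<open>N\<close> about \<open>1 / \<epsilon>\<close> and
  \<open>d\<close> a large power of \<open>\<epsilon>\<close>, the growth takes time \<open>O(\<epsilon> \<bar>ln \<epsilon>\<bar>)\<close>, whereas the Sobolev norm of the data is at
  most of order \<open>d * N ^ s\<close>.
\<close>

section \<open>Integration against the density and regular coefficients\<close>

text \<open>The growth rate of a frequency is proportional to that frequency, so no Sobolev estimate
  can close. Two facts rescue the expansion. Harmonic \<open>n\<close> occurs only from order
  \<open>\<bar>n\<bar>\<close> in the amplitude on, so a coefficient of order \<open>j\<close> may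
  grow at the rate \<open>j * s\<close>, and such rates add up under products. And the linear
  equation, whose source carries a factor \<open>n\<close>, is solved with a constant independent of
  \<open>n\<close>: the unknown times \<open>a\<^sup>2 + 1 / 4\<close>, corrected by two moments,
  vanishes on the two exponential modes, and only the source changes its weighted energy; in the
  remaining two-dimensional system the factor \<open>n\<close> is compensated by the gap
  \<open>\<bar>n\<bar> * (s - 1 / 2)\<close> between the rates. This gap is why
  \<open>s > 1 / 2\<close>. As to the density, its derivative is
  \<open>15 / 2 * a * (a\<^sup>2 + 1 / 4)\<close>, which clears the denominators of the mode and
  leaves integrals of polynomials; its factor and its constant term are then fixed by the eigenvalue
  relation and by the total mass 2, the height of the channel.\<close>

text \<open>The density is chosen so that \<open>a / (a - \<i> / 2)\<close> is an eigenmode, with growth rate \<open>1/2\<close>, of the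
  linearization at the steady state \<open>w = a\<close>.\<close>

definition dens :: "real \<Rightarrow> real" where
  "dens a = 15 * a^4 / 8 + 15 * a^2 / 16 + 5 / 16"

definition dens' :: "real \<Rightarrow> real" where
  "dens' a = 15 * a^3 / 2 + 15 * a / 8"

text \<open>As \<open>dens 1 = dens (-1) = 25 / 8\<close>, integration by parts turns this into
  minus the integral of \<open>dens * h'\<close> for \<open>h\<close> of class C1; the present form
  asks only for continuity. Minus its value at \<open>w\<close> is the height of the fluid column,
  and minus its value at \<open>w\<^sup>2 / 2 + \<kappa> * w\<close> is the stream function at the
  upper wall.\<close>

definition Idf :: "(real \<Rightarrow> complex) \<Rightarrow> complex" where
  "Idf h = integral {-1..1} (\<lambda>a. of_real (dens' a) * h a) - 25/8 * (h 1 - h (-1))"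

lemma dens'_cont [continuous_intros]: "continuous_on A f \<Longrightarrow> continuous_on A (\<lambda>x. dens' (f x))"
  unfolding dens'_def by (intro continuous_intros) auto

lemma dens'_bound: "\<bar>a\<bar> \<le> 1 \<Longrightarrow> \<bar>dens' a\<bar> \<le> 75/8"
proof -
  assume a: "\<bar>a\<bar> \<le> 1"
  have "\<bar>a^3\<bar> \<le> 1" using power_mono[OF a, of 3] by (simp add: power_abs)
  then show ?thesis using a unfolding dens'_def by linarith
qed

lemma Idf_integrable:
  assumes "continuous_on {-1..1} h"
  shows "(\<lambda>a. of_real (dens' a) * h a :: complex) integrable_on {-1..1}"
  by (intro integrable_continuous_interval continuous_intros assms)

text \<open>The constant is \<open>2 * 75 / 8\<close> from the integral plus
  \<open>2 * 25 / 8\<close> from the endpoint terms.\<close>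

lemma Idf_bound:
  assumes h: "continuous_on {-1..1} h" and b: "\<And>a. \<bar>a\<bar> \<le> 1 \<Longrightarrow> norm (h a) \<le> M"
  shows "norm (Idf h) \<le> 25 * M"
proof -
  have M: "0 \<le> M" using b[of 0] norm_ge_zero[of "h 0"] by (simp del: norm_ge_zero)
  have "norm (integral {-1..1} (\<lambda>a. of_real (dens' a) * h a)) \<le> (75/8 * M) * (1 - (-1))"
  proof (rule integral_bound)
    fix a :: real assume "a \<in> {-1..1}"
    then have "\<bar>a\<bar> \<le> 1" by auto
    then show "norm (of_real (dens' a) * h a) \<le> 75/8 * M"
      unfolding norm_mult using dens'_bound b by (intro mult_mono) auto
  qed (auto intro!: continuous_intros h)
  moreover have "norm (25/8 * (h 1 - h (-1))) \<le> 25/8 * (M + M)"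
    unfolding norm_mult using norm_triangle_le_diff[of "h 1" "h (-1)" "M + M"] b[of 1] b[of "-1"]
    by (intro mult_mono) auto
  ultimately have "norm (Idf h) \<le> (75/8 * M) * (1 - (-1)) + 25/8 * (M + M)"
    unfolding Idf_def by (intro norm_triangle_le_diff) auto
  then show ?thesis by simp
qed

lemma Idf_add:
  assumes "continuous_on {-1..1} h" "continuous_on {-1..1} k"
  shows "Idf (\<lambda>a. h a + k a) = Idf h + Idf k"
  unfolding Idf_def using Idf_integrable[OF assms(1)] Idf_integrable[OF assms(2)]
  by (simp add: ring_distribs integral_add)

lemma Idf_cmult: "Idf (\<lambda>a. c * h a) = c * Idf h"
proof -
  have "integral {-1..1} (\<lambda>a. of_real (dens' a) * (c * h a)) = integral {-1..1} (\<lambda>a. c * (of_real (dens' a) * h a))"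
    by (simp add: mult_ac)
  also have "\<dots> = c * integral {-1..1} (\<lambda>a. of_real (dens' a) * h a)"
    by simp
  finally show ?thesis unfolding Idf_def by (simp add: algebra_simps)
qed

lemma Idf_sum:
  assumes "finite S" "\<And>i. i \<in> S \<Longrightarrow> continuous_on {-1..1} (h i)"
  shows "Idf (\<lambda>a. \<Sum>i\<in>S. h i a) = (\<Sum>i\<in>S. Idf (h i))"
  using assms
proof (induction S rule: finite_induct)
  case empty then show ?case by (simp add: Idf_def)
next
  case (insert x S)
  have "Idf (\<lambda>a. h x a + (\<Sum>i\<in>S. h i a)) = Idf (h x) + Idf (\<lambda>a. \<Sum>i\<in>S. h i a)"
    using insert by (intro Idf_add continuous_intros) auto
  then show ?case using insert by simp
qed

lemma Idf_cnj:
  assumes "continuous_on {-1..1} h"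
  shows "Idf (\<lambda>a. cnj (h a)) = cnj (Idf h)"
proof -
  have "integral {-1..1} (\<lambda>a. cnj (of_real (dens' a) * h a)) = cnj (integral {-1..1} (\<lambda>a. of_real (dens' a) * h a))"
    using integral_linear[OF Idf_integrable[OF assms] bounded_linear_cnj] by (simp add: o_def)
  then show ?thesis unfolding Idf_def by simp
qed

lemma Idf_deriv:
  assumes d: "\<And>t a. t \<ge> 0 \<Longrightarrow> \<bar>a\<bar> \<le> 1 \<Longrightarrow> ((\<lambda>t. G t a) has_vector_derivative H t a) (at t within {0..})"
    and G: "\<And>t. t \<ge> 0 \<Longrightarrow> continuous_on {-1..1} (G t)"
    and H: "continuous_on ({0..} \<times> {-1..1}) (\<lambda>(t, a). H t a)" and t: "t \<ge> 0"
  shows "((\<lambda>t. Idf (G t)) has_vector_derivative Idf (H t)) (at t within {0..})"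
proof -
  have "((\<lambda>t. integral (cbox (-1) 1) (\<lambda>a. of_real (dens' a) * G t a)) has_vector_derivative
      integral (cbox (-1) 1) (\<lambda>a. of_real (dens' a) * H t a)) (at t within {0..})"
  proof (rule leibniz_rule_vector_derivative)
    fix t a :: real assume "t \<in> {0..}" "a \<in> cbox (-1) 1"
    then show "((\<lambda>t. of_real (dens' a) * G t a) has_vector_derivative of_real (dens' a) * H t a) (at t within {0..})"
      using d[of t a] by (intro has_vector_derivative_mult_right) auto
  next
    fix t :: real assume "t \<in> {0..}"
    then show "(\<lambda>a. of_real (dens' a) * G t a) integrable_on cbox (-1) 1"
      using Idf_integrable[OF G] by simp
  next
    show "continuous_on ({0..} \<times> cbox (-1) 1) (\<lambda>(t, a). of_real (dens' a) * H t a)"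
      using H by (auto simp: split_beta intro!: continuous_intros)
  qed (use t in auto)
  moreover have "((\<lambda>t. 25/8 * (G t 1 - G t (-1))) has_vector_derivative 25/8 * (H t 1 - H t (-1))) (at t within {0..})"
    using d[of t 1] d[of t "-1"] t by (intro has_vector_derivative_mult_right has_vector_derivative_diff) auto
  ultimately show ?thesis unfolding Idf_def by (intro has_vector_derivative_diff) auto
qed

section \<open>Coefficients that are continuous in time and C1 in the label\<close>

definition Da :: "(real \<Rightarrow> real \<Rightarrow> complex) \<Rightarrow> real \<Rightarrow> real \<Rightarrow> complex" where
  "Da G t a = vector_derivative (G t) (at a)"

text \<open>Labels run over the whole line, so label derivatives are two-sided. In time only
  continuity is asked, since each construction below supplies its own time derivative.\<close>

definition reg :: "(real \<Rightarrow> real \<Rightarrow> complex) \<Rightarrow> bool" where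
  "reg G \<longleftrightarrow> continuous_on ({0..} \<times> UNIV) (\<lambda>(t, a). G t a) \<and>
     continuous_on ({0..} \<times> UNIV) (\<lambda>(t, a). Da G t a) \<and>
     (\<forall>t\<ge>0. \<forall>a. (G t has_vector_derivative Da G t a) (at a))"

lemma Da_eq: "(G t has_vector_derivative d) (at a) \<Longrightarrow> Da G t a = d"
  unfolding Da_def by (rule vector_derivative_at)

lemma regI:
  assumes "continuous_on ({0..} \<times> UNIV) (\<lambda>(t, a). G t a)"
    and "continuous_on ({0..} \<times> UNIV) (\<lambda>(t, a). G' t a)"
    and "\<And>t a. t \<ge> 0 \<Longrightarrow> (G t has_vector_derivative G' t a) (at a)"
  shows "reg G"
proof -
  have "Da G t a = G' t a" if "t \<ge> 0" for t a using Da_eq assms(3) that by blast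
  then have "continuous_on ({0..} \<times> UNIV) (\<lambda>(t, a). Da G t a) \<longleftrightarrow> continuous_on ({0..} \<times> UNIV) (\<lambda>(t, a). G' t a)"
    by (intro continuous_on_cong) auto
  then show ?thesis using assms Da_eq unfolding reg_def by metis
qed

lemma reg_deriv: "reg G \<Longrightarrow> t \<ge> 0 \<Longrightarrow> (G t has_vector_derivative Da G t a) (at a)"
  unfolding reg_def by auto

lemma reg_cont:
  assumes "reg G" "continuous_on S f" "continuous_on S g" "\<And>x. x \<in> S \<Longrightarrow> f x \<ge> 0"
  shows "continuous_on S (\<lambda>x. G (f x) (g x))"
proof -
  have "continuous_on ({0..} \<times> UNIV) (\<lambda>p. G (fst p) (snd p))"
    using assms(1) unfolding reg_def by (simp add: split_beta)
  from continuous_on_compose2[OF this, of S "\<lambda>x. (f x, g x)"] assms(2-)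
  show ?thesis by (auto intro: continuous_intros)
qed

lemma reg_cont_Da:
  assumes "reg G" "continuous_on S f" "continuous_on S g" "\<And>x. x \<in> S \<Longrightarrow> f x \<ge> 0"
  shows "continuous_on S (\<lambda>x. Da G (f x) (g x))"
proof -
  have "continuous_on ({0..} \<times> UNIV) (\<lambda>p. Da G (fst p) (snd p))"
    using assms(1) unfolding reg_def by (simp add: split_beta)
  from continuous_on_compose2[OF this, of S "\<lambda>x. (f x, g x)"] assms(2-)
  show ?thesis by (auto intro: continuous_intros)
qed

lemma reg_cont1: "reg G \<Longrightarrow> t \<ge> 0 \<Longrightarrow> continuous_on S (G t)"
  by (rule reg_cont) (auto intro: continuous_intros)

lemma reg_time:
  assumes "continuous_on {0..} c"
  shows "reg (\<lambda>t a. c t)" "Da (\<lambda>t a. c t) t a = 0"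
proof -
  show "reg (\<lambda>t a. c t)"
    by (rule regI[where G' = "\<lambda>t a. 0"])
      (auto simp: split_beta intro!: continuous_intros continuous_on_compose2[OF assms])
  show "Da (\<lambda>t a. c t) t a = 0" by (rule Da_eq) auto
qed

lemma reg_id: "reg (\<lambda>t a. of_real a)" and Da_id: "Da (\<lambda>t a. of_real a) t a = 1"
proof -
  have *: "((\<lambda>a. complex_of_real a) has_vector_derivative 1) (at a)" for a
    using has_vector_derivative_of_real[OF DERIV_ident] by simp
  show "Da (\<lambda>t a. of_real a) t a = 1" using * by (rule Da_eq)
  show "reg (\<lambda>t a. of_real a)"
    by (rule regI[where G' = "\<lambda>t a. 1"]) (auto simp: split_beta * intro!: continuous_intros)
qed

lemma reg_add:
  assumes "reg G" "reg H"
  shows "reg (\<lambda>t a. G t a + H t a)" "t \<ge> 0 \<Longrightarrow> Da (\<lambda>t a. G t a + H t a) t a = Da G t a + Da H t a"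
proof -
  have *: "((\<lambda>a. G t a + H t a) has_vector_derivative Da G t a + Da H t a) (at a)" if "t \<ge> 0" for t a
    using that assms by (intro has_vector_derivative_add reg_deriv) auto
  then show "t \<ge> 0 \<Longrightarrow> Da (\<lambda>t a. G t a + H t a) t a = Da G t a + Da H t a"
    by (intro Da_eq) auto
  show "reg (\<lambda>t a. G t a + H t a)"
    by (rule regI[OF _ _ *]) (auto simp: split_beta intro!: continuous_intros reg_cont reg_cont_Da assms)
qed

lemma reg_mult:
  assumes "reg G" "reg H"
  shows "reg (\<lambda>t a. G t a * H t a)" "t \<ge> 0 \<Longrightarrow> Da (\<lambda>t a. G t a * H t a) t a = G t a * Da H t a + Da G t a * H t a"
proof -
  have *: "((\<lambda>a. G t a * H t a) has_vector_derivative G t a * Da H t a + Da G t a * H t a) (at a)" if "t \<ge> 0" for t a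
    using that assms by (intro has_vector_derivative_mult reg_deriv) auto
  then show "t \<ge> 0 \<Longrightarrow> Da (\<lambda>t a. G t a * H t a) t a = G t a * Da H t a + Da G t a * H t a"
    by (intro Da_eq) auto
  show "reg (\<lambda>t a. G t a * H t a)"
    by (rule regI[OF _ _ *]) (auto simp: split_beta intro!: continuous_intros reg_cont reg_cont_Da assms)
qed

lemma reg_const: "reg (\<lambda>t a. c)" "Da (\<lambda>t a. c) t a = 0"
  by (rule reg_time; simp)+

lemma reg_sum:
  assumes "finite S" "\<And>i. i \<in> S \<Longrightarrow> reg (G i)"
  shows "reg (\<lambda>t a. \<Sum>i\<in>S. G i t a) \<and> (\<forall>t\<ge>0. \<forall>a. Da (\<lambda>t a. \<Sum>i\<in>S. G i t a) t a = (\<Sum>i\<in>S. Da (G i) t a))"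
  using assms
proof (induction S rule: finite_induct)
  case empty then show ?case by (simp add: reg_const)
next
  case (insert x S)
  then have 1: "reg (\<lambda>t a. \<Sum>i\<in>S. G i t a)" and 2: "reg (G x)" by auto
  show ?case using insert reg_add[OF 2 1] by simp
qed

lemma reg_cnj:
  assumes "reg G"
  shows "reg (\<lambda>t a. cnj (G t a))" "t \<ge> 0 \<Longrightarrow> Da (\<lambda>t a. cnj (G t a)) t a = cnj (Da G t a)"
proof -
  have *: "((\<lambda>a. cnj (G t a)) has_vector_derivative cnj (Da G t a)) (at a)" if "t \<ge> 0" for t a
    using has_vector_derivative_cnj[OF reg_deriv[OF assms that]] .
  then show "t \<ge> 0 \<Longrightarrow> Da (\<lambda>t a. cnj (G t a)) t a = cnj (Da G t a)"
    by (intro Da_eq) auto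
  show "reg (\<lambda>t a. cnj (G t a))"
    by (rule regI[OF _ _ *]) (auto simp: split_beta intro!: continuous_intros reg_cont reg_cont_Da assms)
qed

lemma Idf_time_cont:
  assumes "reg G"
  shows "continuous_on {0..} (\<lambda>t. Idf (G t))"
proof -
  have "continuous_on {0..} (\<lambda>t. integral (cbox (-1) 1) (\<lambda>a. of_real (dens' a) * G t a))"
    by (rule integral_continuous_on_param)
      (auto simp: split_beta intro!: continuous_intros reg_cont assms)
  then show ?thesis unfolding Idf_def
    by (auto intro!: continuous_intros reg_cont assms)
qed

lemma integral_from_0_deriv:
  fixes f :: "real \<Rightarrow> 'a::banach"
  assumes f: "continuous_on {0..} f" and t: "t \<ge> 0"
  shows "((\<lambda>t. integral {0..t} f) has_vector_derivative f t) (at t within {0..})"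
proof -
  have "((\<lambda>t. integral {0..t} f) has_vector_derivative f t) (at t within {0..t+1})"
    using t by (intro integral_has_vector_derivative continuous_on_subset[OF f]) auto
  moreover have "at t within {0..t+1} = at t within {0..}"
    by (rule at_within_nhd[where S = "{..<t+1}"]) auto
  ultimately show ?thesis by simp
qed

section \<open>The linearized label equation\<close>

text \<open>Duhamel's formula for \<open>y' = - \<i> * n * a * y + F\<close> with
  \<open>y 0 = 0\<close>; the label is a mere parameter.\<close>

definition Tr :: "real \<Rightarrow> (real \<Rightarrow> real \<Rightarrow> complex) \<Rightarrow> real \<Rightarrow> real \<Rightarrow> complex" where
  "Tr n F t a = cis (- n * a * t) * integral {0..t} (\<lambda>s. cis (n * a * s) * F s a)"

lemma cis_cont [continuous_intros]: "continuous_on S f \<Longrightarrow> continuous_on S (\<lambda>x. cis (f x))"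
  unfolding cis_conv_exp by (intro continuous_intros)

lemma cis_deriv [derivative_intros]:
  "(f has_real_derivative d) (at x within S) \<Longrightarrow>
    ((\<lambda>x. cis (f x)) has_vector_derivative of_real d * (\<i> * cis (f x))) (at x within S)"
proof -
  assume f: "(f has_real_derivative d) (at x within S)"
  have "(exp has_field_derivative cis (f x)) (at (\<i> * of_real (f x)))"
    unfolding cis_conv_exp by (rule DERIV_exp)
  moreover have "((\<lambda>x. \<i> * of_real (f x)) has_vector_derivative \<i> * of_real d) (at x within S)"
    using has_vector_derivative_of_real[OF f] by (rule has_vector_derivative_mult_right)
  ultimately have "((exp \<circ> (\<lambda>x. \<i> * of_real (f x))) has_vector_derivative (\<i> * of_real d) * cis (f x)) (at x within S)"
    by (metis field_vector_diff_chain_within has_field_derivative_at_within)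
  then show ?thesis unfolding o_def cis_conv_exp[symmetric] by (simp only: mult_ac)
qed

text \<open>Rescaling the integral to \<open>[0, 1]\<close> moves the variable endpoint into the
  integrand, where joint continuity is available.\<close>

lemma cont_integral_0:
  fixes H :: "real \<Rightarrow> real \<Rightarrow> complex"
  assumes "continuous_on ({0..} \<times> UNIV) (\<lambda>(t, a). H t a)"
  shows "continuous_on ({0..} \<times> UNIV) (\<lambda>(t, a). integral {0..t} (\<lambda>s. H s a))"
proof -
  have H: "continuous_on ({0..} \<times> UNIV) (\<lambda>p. H (fst p) (snd p))" using assms by (simp add: split_beta)
  have "continuous_on ({0..} \<times> UNIV) (\<lambda>p. integral (cbox 0 1) (\<lambda>r. H (fst p * r) (snd p)))"
    by (rule integral_continuous_on_param)
      (auto simp: split_beta intro!: continuous_intros continuous_on_compose2[OF H, of _ "\<lambda>x. (fst (fst x) * snd x, snd (fst x))", simplified])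
  then have "continuous_on ({0..} \<times> UNIV) (\<lambda>p. of_real (fst p) * integral {0..1} (\<lambda>r. H (fst p * r) (snd p)))"
    by (intro continuous_intros) auto
  moreover have "of_real t * integral {0..1} (\<lambda>r. H (t * r) a) = integral {0..t} (\<lambda>s. H s a)" if "t \<ge> 0" for t a
  proof (cases "t = 0")
    case False
    then have t: "t > 0" using that by simp
    have "(\<lambda>x. x / t) ` {0..t} = {0..1}"
      using t image_divide_atLeastAtMost[of t 0 t] by simp
    then have "integral {0..1} (\<lambda>r. H (t * r) a) = integral {0..t} (\<lambda>s. H s a) /\<^sub>R t"
      using integral_stretch_real[of t 0 t "\<lambda>s. H s a"] t by (simp add: divide_inverse)
    then show ?thesis using t by (simp add: scaleR_conv_of_real)
  qed auto
  ultimately show ?thesis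
    by (subst continuous_on_cong[OF refl]) (auto simp: split_beta)
qed


text \<open>The third claim is the label derivative of the second; differentiating the phase
  produces the term \<open>- \<i> * n * Tr n F t a\<close>.\<close>

lemma Tr_reg:
  assumes F: "reg F"
  shows "reg (Tr n F)"
    and "t \<ge> 0 \<Longrightarrow> ((\<lambda>t. Tr n F t a) has_vector_derivative - \<i> * n * a * Tr n F t a + F t a) (at t within {0..})"
    and "t \<ge> 0 \<Longrightarrow> ((\<lambda>t. Da (Tr n F) t a) has_vector_derivative
          - \<i> * n * a * Da (Tr n F) t a - \<i> * n * Tr n F t a + Da F t a) (at t within {0..})"
    and "Tr n F 0 a = 0" and "Da (Tr n F) 0 a = 0"
proof -
  define I where "I t a = integral {0..t} (\<lambda>s. cis (n * a * s) * F s a)" for t a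
  define J where "J t a = integral {0..t} (\<lambda>s. \<i> * n * s * cis (n * a * s) * F s a + cis (n * a * s) * Da F s a)" for t a
  define T' where "T' t a = cis (- n * a * t) * (J t a - \<i> * n * t * I t a)" for t a
  have Tr: "Tr n F = (\<lambda>t a. cis (- n * a * t) * I t a)" by (simp add: Tr_def I_def fun_eq_iff)
  have cI: "continuous_on ({0..} \<times> UNIV) (\<lambda>(t, a). I t a)"
    unfolding I_def by (intro cont_integral_0) (auto simp: split_beta intro!: continuous_intros reg_cont F)
  have cJ: "continuous_on ({0..} \<times> UNIV) (\<lambda>(t, a). J t a)"
    unfolding J_def by (intro cont_integral_0) (auto simp: split_beta intro!: continuous_intros reg_cont reg_cont_Da F)
  have dI: "(I t has_vector_derivative J t a) (at a)" if "t \<ge> 0" for t a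
  proof -
    have "((\<lambda>a. integral (cbox 0 t) (\<lambda>s. cis (n * a * s) * F s a)) has_vector_derivative
       integral (cbox 0 t) (\<lambda>s. \<i> * n * s * cis (n * a * s) * F s a + cis (n * a * s) * Da F s a)) (at a within UNIV)"
    proof (rule leibniz_rule_vector_derivative)
      fix a s :: real assume s: "s \<in> cbox 0 t"
      have 1: "((\<lambda>a. cis (n * a * s)) has_vector_derivative of_real (n * s) * (\<i> * cis (n * a * s))) (at a)"
        by (rule cis_deriv) (auto intro!: derivative_eq_intros)
      show "((\<lambda>a. cis (n * a * s) * F s a) has_vector_derivative
          \<i> * n * s * cis (n * a * s) * F s a + cis (n * a * s) * Da F s a) (at a within UNIV)"
        using has_vector_derivative_mult[OF 1 reg_deriv[OF F, of s a]] s by (simp add: algebra_simps)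
    next
      fix a :: real
      show "(\<lambda>s. cis (n * a * s) * F s a) integrable_on cbox 0 t"
        by (intro integrable_continuous continuous_intros reg_cont F) auto
    next
      show "continuous_on (UNIV \<times> cbox 0 t) (\<lambda>(a, s). \<i> * n * s * cis (n * a * s) * F s a + cis (n * a * s) * Da F s a)"
        by (auto simp: split_beta intro!: continuous_intros reg_cont reg_cont_Da F)
    qed auto
    then show ?thesis by (simp add: I_def[abs_def] J_def)
  qed
  have dT: "(Tr n F t has_vector_derivative T' t a) (at a)" if "t \<ge> 0" for t a
  proof -
    have 1: "((\<lambda>a. cis (- n * a * t)) has_vector_derivative of_real (- n * t) * (\<i> * cis (- n * a * t))) (at a)"
      by (rule cis_deriv) (auto intro!: derivative_eq_intros)
    show ?thesis unfolding Tr T'_def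
      using has_vector_derivative_mult[OF 1 dI[OF that, of a]] by (simp add: algebra_simps)
  qed
  show "reg (Tr n F)"
  proof (rule regI[OF _ _ dT])
    show "continuous_on ({0..} \<times> UNIV) (\<lambda>(t, a). Tr n F t a)"
      using cI unfolding Tr by (auto simp: split_beta intro!: continuous_intros)
    show "continuous_on ({0..} \<times> UNIV) (\<lambda>(t, a). T' t a)"
      using cI cJ unfolding T'_def by (auto simp: split_beta intro!: continuous_intros)
  qed
  have DaT: "Da (Tr n F) t a = T' t a" if "t \<ge> 0" for t a using dT[OF that, of a] by (rule Da_eq)
  have tc: "((\<lambda>t. cis (- n * a * t)) has_vector_derivative of_real (- n * a) * (\<i> * cis (- n * a * t))) (at t within {0..})" for t a
    by (rule cis_deriv) (auto intro!: derivative_eq_intros)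
  have cc: "cis (- n * a * t) * cis (n * a * t) = 1" for t a by (simp add: cis_mult)
  have tI: "((\<lambda>t. I t a) has_vector_derivative cis (n * a * t) * F t a) (at t within {0..})" if "t \<ge> 0" for t a
    unfolding I_def by (intro integral_from_0_deriv that continuous_intros reg_cont F) auto
  have tJ: "((\<lambda>t. J t a) has_vector_derivative
     \<i> * n * t * cis (n * a * t) * F t a + cis (n * a * t) * Da F t a) (at t within {0..})" if "t \<ge> 0" for t a
    unfolding J_def by (rule integral_from_0_deriv[OF _ that]) (auto intro!: continuous_intros reg_cont reg_cont_Da F)
  show "((\<lambda>t. Tr n F t a) has_vector_derivative - \<i> * n * a * Tr n F t a + F t a) (at t within {0..})" if "t \<ge> 0" for t a
  proof -
    have "cis (- n * a * t) * (cis (n * a * t) * F t a) + of_real (- n * a) * (\<i> * cis (- n * a * t)) * I t a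
       = - \<i> * n * a * (cis (- n * a * t) * I t a) + (cis (- n * a * t) * cis (n * a * t)) * F t a"
      by (simp add: algebra_simps del: cis_mult)
    then have e: "cis (- n * a * t) * (cis (n * a * t) * F t a) + of_real (- n * a) * (\<i> * cis (- n * a * t)) * I t a
       = - \<i> * n * a * (cis (- n * a * t) * I t a) + F t a"
      unfolding cc by simp
    show ?thesis unfolding Tr e[symmetric] by (rule has_vector_derivative_mult[OF tc[of a t] tI[OF that, of a]])
  qed
  show "((\<lambda>t. Da (Tr n F) t a) has_vector_derivative
          - \<i> * n * a * Da (Tr n F) t a - \<i> * n * Tr n F t a + Da F t a) (at t within {0..})" if t: "t \<ge> 0" for t a
  proof -
    have 1: "((\<lambda>t. \<i> * n * t * I t a) has_vector_derivative \<i> * n * I t a + \<i> * n * t * (cis (n * a * t) * F t a)) (at t within {0..})"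
    proof -
      have "((\<lambda>t. of_real t) has_vector_derivative of_real 1) (at t within {0..})"
        by (rule has_vector_derivative_of_real) (rule DERIV_ident)
      from has_vector_derivative_mult_right[OF has_vector_derivative_mult[OF this tI[OF t, of a]], of "\<i> * n"]
      show ?thesis by (simp add: algebra_simps)
    qed
    have "(T' t a, cis (- n * a * t) * (\<i> * n * t * cis (n * a * t) * F t a + cis (n * a * t) * Da F t a - (\<i> * n * I t a + \<i> * n * t * (cis (n * a * t) * F t a)))
       + of_real (- n * a) * (\<i> * cis (- n * a * t)) * (J t a - \<i> * n * t * I t a))
      = (T' t a, - \<i> * n * a * T' t a - \<i> * n * Tr n F t a + (cis (- n * a * t) * cis (n * a * t)) * Da F t a)"
      unfolding T'_def Tr by (simp add: algebra_simps)
    then have e: "cis (- n * a * t) * (\<i> * n * t * cis (n * a * t) * F t a + cis (n * a * t) * Da F t a - (\<i> * n * I t a + \<i> * n * t * (cis (n * a * t) * F t a)))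
       + of_real (- n * a) * (\<i> * cis (- n * a * t)) * (J t a - \<i> * n * t * I t a)
      = - \<i> * n * a * Da (Tr n F) t a - \<i> * n * Tr n F t a + Da F t a"
      unfolding cc using DaT[OF t] by simp
    have "((\<lambda>t. T' t a) has_vector_derivative
          - \<i> * n * a * Da (Tr n F) t a - \<i> * n * Tr n F t a + Da F t a) (at t within {0..})"
      unfolding T'_def e[symmetric]
      by (rule has_vector_derivative_mult[OF tc[of a t] has_vector_derivative_diff[OF tJ[OF t, of a] 1]])
    then show ?thesis
      by (rule has_vector_derivative_transform[rotated 2]) (use t DaT in auto)
  qed
  show "Tr n F 0 a = 0" by (simp add: Tr_def)
  show "Da (Tr n F) 0 a = 0" using DaT[of 0 a] by (simp add: T'_def J_def)
qed

lemma has_integral_exp_bound: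
  fixes H :: "real \<Rightarrow> complex"
  assumes H: "(H has_integral I) {0..t}" and b: "\<And>s. s \<ge> 0 \<Longrightarrow> norm (H s) \<le> M * exp (l * s)"
    and l: "l > 0" and t: "t \<ge> 0"
  shows "norm I \<le> M / l * exp (l * t)"
proof -
  have M: "M \<ge> 0" using b[of 0] by (simp add: order_trans[OF norm_ge_zero])
  have d: "((\<lambda>s. M / l * exp (l * s)) has_vector_derivative M * exp (l * s)) (at s within {0..t})" for s
    unfolding has_real_derivative_iff_has_vector_derivative[symmetric]
    using l by (auto intro!: derivative_eq_intros)
  have I: "((\<lambda>s. M * exp (l * s)) has_integral (M / l * exp (l * t) - M / l * exp (l * 0))) {0..t}"
    by (rule fundamental_theorem_of_calculus[OF t d])
  have "norm (integral {0..t} H) \<le> integral {0..t} (\<lambda>s. M * exp (l * s))"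
  proof (rule integral_norm_bound_integral)
    show "H integrable_on {0..t}" using H by (rule has_integral_integrable)
    show "(\<lambda>s. M * exp (l * s)) integrable_on {0..t}" using I by (rule has_integral_integrable)
  qed (use b in auto)
  also have "\<dots> = M / l * exp (l * t) - M / l" using integral_unique[OF I] by simp
  also have "\<dots> \<le> M / l * exp (l * t)" using M l by simp
  finally show ?thesis using H by (simp add: integral_unique)
qed

lemma integral_exp_bound:
  fixes H :: "real \<Rightarrow> complex"
  assumes "continuous_on {0..} H" and "\<And>s. s \<ge> 0 \<Longrightarrow> norm (H s) \<le> M * exp (l * s)"
    and "l > 0" and "t \<ge> 0"
  shows "norm (integral {0..t} H) \<le> M / l * exp (l * t)"
proof (rule has_integral_exp_bound[OF integrable_integral assms(2-)])
  show "H integrable_on {0..t}"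
    by (intro integrable_continuous_interval continuous_on_subset[OF assms(1)]) auto
qed

text \<open>The factor \<open>exp (- c * t)\<close> turns the equation into an integral of the
  source. As the source may grow strictly faster than the homogeneous solutions, its rate
  \<open>m\<close> survives, and the cost is only the gap \<open>m - r\<close> in the
  denominator.\<close>

lemma gronwall_exp:
  fixes y :: "real \<Rightarrow> complex"
  assumes y: "\<And>t. t \<ge> 0 \<Longrightarrow> (y has_vector_derivative c * y t + h t) (at t within {0..})"
    and y0: "y 0 = 0" and h: "\<And>t. t \<ge> 0 \<Longrightarrow> norm (h t) \<le> H * exp (m * t)"
    and c: "Re c \<le> r" "r < m" and t: "t \<ge> 0"
  shows "norm (y t) \<le> H / (m - r) * exp (m * t)"
proof -
  have H: "H \<ge> 0" using h[of 0] by (simp add: order_trans[OF norm_ge_zero])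
  have d: "((\<lambda>t. exp (- c * of_real t) * y t) has_vector_derivative exp (- c * of_real s) * h s) (at s within {0..t})"
    if "s \<ge> 0" for s
  proof -
    have "((\<lambda>t. of_real t) has_vector_derivative of_real 1) (at s within {0..t})"
      by (rule has_vector_derivative_of_real) (rule DERIV_ident)
    from has_vector_derivative_mult_right[OF this, of "- c"]
    have 1: "((\<lambda>t. - c * of_real t) has_vector_derivative - c) (at s within {0..t})" by simp
    have 2: "((exp \<circ> (\<lambda>t. - c * of_real t)) has_vector_derivative - c * exp (- c * of_real s)) (at s within {0..t})"
      by (metis 1 field_vector_diff_chain_within has_field_derivative_at_within DERIV_exp)
    have 3: "(y has_vector_derivative c * y s + h s) (at s within {0..t})"
      by (rule has_vector_derivative_within_subset[OF y[OF that]]) auto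
    show ?thesis using has_vector_derivative_mult[OF 2 3] by (simp add: algebra_simps)
  qed
  have "((\<lambda>s. exp (- c * of_real s) * h s) has_integral (exp (- c * of_real t) * y t - exp (- c * of_real 0) * y 0)) {0..t}"
    by (rule fundamental_theorem_of_calculus[OF t d]) auto
  then have I: "((\<lambda>s. exp (- c * of_real s) * h s) has_integral (exp (- c * of_real t) * y t)) {0..t}"
    by (simp add: y0)
  have "norm (exp (- c * of_real t) * y t) \<le> H / (m - Re c) * exp ((m - Re c) * t)"
  proof (rule has_integral_exp_bound[OF I _ _ t])
    fix s :: real assume s: "s \<ge> 0"
    have "norm (exp (- c * of_real s) * h s) \<le> exp (- Re c * s) * (H * exp (m * s))"
      using mult_left_mono[OF h[OF s], of "exp (- Re c * s)"] by (simp add: norm_mult)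
    also have "\<dots> = H * exp ((m - Re c) * s)" by (simp add: algebra_simps flip: exp_add)
    finally show "norm (exp (- c * of_real s) * h s) \<le> H * exp ((m - Re c) * s)" .
  qed (use c in auto)
  then have "exp (Re c * t) * (exp (- Re c * t) * norm (y t)) \<le> exp (Re c * t) * (H / (m - Re c) * exp ((m - Re c) * t))"
    by (intro mult_left_mono) (auto simp: norm_mult)
  then have "norm (y t) \<le> H / (m - Re c) * exp (m * t)"
    by (simp add: mult.assoc[symmetric] flip: exp_add) (simp add: algebra_simps flip: exp_add)
  also have "\<dots> \<le> H / (m - r) * exp (m * t)"
    using c H by (intro mult_right_mono divide_left_mono) auto
  finally show ?thesis .
qed

lemma Tr_bound:
  assumes F: "reg F" and b: "\<And>s. s \<ge> 0 \<Longrightarrow> norm (F s a) \<le> M * exp (l * s)"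
    and l: "l > 0" and t: "t \<ge> 0"
  shows "norm (Tr n F t a) \<le> M / l * exp (l * t)"
  unfolding Tr_def norm_mult norm_cis mult_1_left
  by (rule integral_exp_bound[OF _ _ l t]) (auto intro!: continuous_intros reg_cont F simp: norm_mult b)

lemma Tr_add:
  assumes F: "reg F" "reg G" and t: "t \<ge> 0"
  shows "Tr n (\<lambda>t a. F t a + G t a) t a = Tr n F t a + Tr n G t a"
proof -
  have "integral {0..t} (\<lambda>s. cis (n * a * s) * F s a + cis (n * a * s) * G s a)
    = integral {0..t} (\<lambda>s. cis (n * a * s) * F s a) + integral {0..t} (\<lambda>s. cis (n * a * s) * G s a)"
    by (intro integral_add integrable_continuous_interval continuous_intros reg_cont assms) auto
  then show ?thesis by (simp add: Tr_def ring_distribs)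
qed

text \<open>Neumann series: \<open>V\<close> halves the sup norm weighted by
  \<open>exp (- l * t)\<close>. Linearity enters only through additivity, applied to partial sums
  and remainders.\<close>

lemma volterra:
  fixes V :: "(real \<Rightarrow> complex) \<Rightarrow> real \<Rightarrow> complex"
  assumes Vc: "\<And>P. continuous_on {0..} P \<Longrightarrow> continuous_on {0..} (V P)"
    and Va: "\<And>P Q t. continuous_on {0..} P \<Longrightarrow> continuous_on {0..} Q \<Longrightarrow> t \<ge> 0 \<Longrightarrow>
         V (\<lambda>t. P t + Q t) t = V P t + V Q t"
    and Vb: "\<And>P M t. continuous_on {0..} P \<Longrightarrow> (\<And>s. s \<ge> 0 \<Longrightarrow> norm (P s) \<le> M * exp (l * s)) \<Longrightarrow> t \<ge> 0 \<Longrightarrow>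
         norm (V P t) \<le> M / 2 * exp (l * t)"
    and q: "continuous_on {0..} q" and qb: "\<And>t. t \<ge> 0 \<Longrightarrow> norm (q t) \<le> Q * exp (l * t)"
  shows "\<exists>P. continuous_on {0..} P \<and> (\<forall>t\<ge>0. P t = q t + V P t)"
proof -
  define D where "D m = (V ^^ m) q" for m
  have D0: "D 0 = q" and DS: "D (Suc m) = V (D m)" for m by (auto simp: D_def)
  have Dc: "continuous_on {0..} (D m)" for m by (induction m) (auto simp: D0 DS q Vc)
  have Db: "norm (D m t) \<le> Q / 2^m * exp (l * t)" if "t \<ge> 0" for m t
    using that
  proof (induction m arbitrary: t)
    case 0 then show ?case using qb by (simp add: D0)
  next
    case (Suc m)
    have "norm (V (D m) t) \<le> Q / 2^m / 2 * exp (l * t)"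
      using Suc by (intro Vb Dc) auto
    then show ?case by (simp add: DS)
  qed
  define P where "P t = (\<Sum>m. D m t)" for t
  define S where "S m t = (\<Sum>k<m. D k t)" for m t
  have Sc: "continuous_on {0..} (S m)" for m unfolding S_def by (intro continuous_intros Dc)
  have geo: "summable (\<lambda>m. Q / 2^m)" using summable_mult[OF summable_geometric[of "1/2::real"], of Q] by (simp add: power_divide)
  \<comment> \<open>With the weight inside the sum the domination is uniform on the unbounded
    half-line, so the limit is continuous there; the weight is divided out afterwards.\<close>
  have u: "uniform_limit {0..} (\<lambda>m t. \<Sum>k<m. exp (- l * t) * D k t) (\<lambda>t. \<Sum>k. exp (- l * t) * D k t) sequentially"
  proof (rule Weierstrass_m_test[OF _ geo])
    fix m t assume t: "t \<in> {0::real..}"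
    have "norm (of_real (exp (- l * t)) * D m t) \<le> exp (- l * t) * (Q / 2^m * exp (l * t))"
      using mult_left_mono[OF Db[of t m], of "exp (- l * t)"] t by (simp add: norm_mult)
    also have "\<dots> = Q / 2^m" by (simp add: exp_minus)
    finally show "norm (exp (- l * t) * D m t) \<le> Q / 2^m" by simp
  qed
  have Dsum: "summable (\<lambda>m. D m t)" if "t \<ge> 0" for t
    by (rule summable_comparison_test[OF _ summable_mult2[OF geo, of "exp (l * t)"]])
      (use Db that in auto)
  have "continuous_on {0..} (\<lambda>t. \<Sum>k. exp (- l * t) * D k t)"
    by (rule uniform_limit_theorem[OF _ u]) (auto intro!: always_eventually continuous_intros Dc)
  then have "continuous_on {0..} (\<lambda>t. exp (l * t) * (\<Sum>k. exp (- l * t) * D k t))"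
    by (intro continuous_intros)
  moreover have "exp (l * t) * (\<Sum>k. exp (- l * t) * D k t) = P t" if "t \<ge> 0" for t
  proof -
    have "(\<Sum>k. of_real (exp (- l * t)) * D k t) = of_real (exp (- l * t)) * P t"
      unfolding P_def by (rule suminf_mult[OF Dsum[OF that]])
    then show ?thesis by (simp add: exp_minus flip: of_real_mult)
  qed
  ultimately have Pc: "continuous_on {0..} P" by (subst continuous_on_cong[OF refl]) auto
  have tail: "norm (P t - S m t) \<le> 2 * Q / 2^m * exp (l * t)" if "t \<ge> 0" for m t
  proof -
    have "P t - S m t = (\<Sum>k. D (k + m) t)"
      unfolding P_def S_def using suminf_split_initial_segment[OF Dsum[OF that], of m] by simp
    also have "norm \<dots> \<le> (\<Sum>k. (Q / 2^m * exp (l * t)) * (1/2)^k)"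
    proof (rule norm_suminf_le)
      show "summable (\<lambda>k. (Q / 2^m * exp (l * t)) * (1/2)^k)" by (intro summable_mult summable_geometric) auto
      fix k show "norm (D (k + m) t) \<le> (Q / 2^m * exp (l * t)) * (1/2)^k"
        using Db[OF that, of "k + m"] by (simp add: power_add power_divide field_simps)
    qed
    also have "\<dots> = 2 * Q / 2^m * exp (l * t)"
      by (subst suminf_mult) (auto intro: summable_geometric simp: suminf_geometric)
    finally show ?thesis .
  qed
  have VS: "V (S m) t = S (Suc m) t - q t" if "t \<ge> 0" for m t
  proof (induction m)
    case 0
    have "V (\<lambda>t. 0 + 0) t = V (\<lambda>t. 0) t + V (\<lambda>t. 0) t" using that by (intro Va) auto
    then show ?case by (simp add: S_def[abs_def] D0)
  next
    case (Suc m)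
    have "V (\<lambda>t. S m t + D m t) t = V (S m) t + V (D m) t" using that by (intro Va Sc Dc)
    then show ?case using Suc by (simp add: S_def[abs_def] DS)
  qed
  have VPS: "norm (V P t - V (S m) t) \<le> Q / 2^m * exp (l * t)" if "t \<ge> 0" for m t
  proof -
    have "V (\<lambda>t. S m t + (P t - S m t)) t = V (S m) t + V (\<lambda>t. P t - S m t) t"
      using that by (intro Va continuous_intros Sc Pc)
    moreover have "norm (V (\<lambda>t. P t - S m t) t) \<le> (2 * Q / 2^m) / 2 * exp (l * t)"
      using that tail by (intro Vb continuous_intros Sc Pc) auto
    ultimately show ?thesis by simp
  qed
  have "P t = q t + V P t" if t: "t \<ge> 0" for t
  proof -
    have "norm (P t - (q t + V P t)) \<le> (2 * Q * exp (l * t)) * (1/2)^m" for m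
    proof -
      have "P t - (q t + V P t) = (P t - S (Suc m) t) - (V P t - V (S m) t)"
        using VS[OF t, of m] by simp
      also have "norm \<dots> \<le> 2 * Q / 2^(Suc m) * exp (l * t) + Q / 2^m * exp (l * t)"
        by (rule norm_triangle_le_diff[OF add_mono[OF tail[OF t] VPS[OF t]]])
      finally show ?thesis by (simp add: power_divide)
    qed
    moreover have "(\<lambda>m. (2 * Q * exp (l * t)) * (1/2)^m) \<longlonglongrightarrow> 0"
      by (intro tendsto_mult_right_zero LIMSEQ_power_zero) auto
    ultimately have "norm (P t - (q t + V P t)) \<le> 0"
      by (intro LIMSEQ_le_const) auto
    then show ?thesis by simp
  qed
  with Pc show ?thesis by blast
qed

text \<open>The labels are coupled only through the scalar
  \<open>Idf (\<lambda>a. a * \<eta> t a) / 2\<close>. If it is treated as a known function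
  \<open>P\<close>, every label solves an ODE by \<open>Tr\<close>, and inserting the result back
  gives a Volterra equation for \<open>P\<close> alone. The crude rate used here yields existence
  only; the sharp growth is the matter of \<open>linear_estimate\<close>.\<close>

lemma linear_solve:
  fixes n m M :: real
  assumes F: "reg F" and b: "\<And>t a. t \<ge> 0 \<Longrightarrow> \<bar>a\<bar> \<le> 1 \<Longrightarrow> norm (F t a) \<le> M * exp (m * t)"
  shows "\<exists>\<eta> :: real \<Rightarrow> real \<Rightarrow> complex. reg \<eta> \<and> (\<forall>a. \<eta> 0 a = 0 \<and> Da \<eta> 0 a = 0) \<and> (\<forall>t\<ge>0. \<forall>a.
     ((\<lambda>t. \<eta> t a) has_vector_derivative
        - \<i> * n * (a * \<eta> t a + a * (Idf (\<lambda>a. a * \<eta> t a) / 2) + F t a)) (at t within {0..}) \<and>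
     ((\<lambda>t. Da \<eta> t a) has_vector_derivative
        - \<i> * n * (a * Da \<eta> t a + \<eta> t a + Idf (\<lambda>a. a * \<eta> t a) / 2 + Da F t a)) (at t within {0..}))"
proof -
  \<comment> \<open>By \<open>Idf_bound\<close> and \<open>Tr_bound\<close> the operator
    \<open>V\<close> has norm at most \<open>25 * \<bar>n\<bar> / (2 * l)\<close> in the weighted
    sup norm, which this rate pushes down to 1 / 2.\<close>
  define l where "l = \<bar>m\<bar> + 25 * \<bar>n\<bar> + 1"
  have l: "l > 0" "m \<le> l" "25 * \<bar>n\<bar> \<le> l" by (auto simp: l_def)
  define M' where "M' = \<bar>M\<bar>"
  have b': "norm (F t a) \<le> M' * exp (l * t)" if "t \<ge> 0" "\<bar>a\<bar> \<le> 1" for t a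
  proof -
    have "norm (F t a) \<le> M * exp (m * t)" using b that by auto
    also have "\<dots> \<le> M' * exp (l * t)" unfolding M'_def using l that by (intro mult_mono) (auto intro: mult_right_mono)
    finally show ?thesis .
  qed
  define L where "L G t = Idf (\<lambda>a. a * Tr n G t a) / 2" for G t
  have Lc: "continuous_on {0..} (L G)" if "reg G" for G
    unfolding L_def using Idf_time_cont[OF reg_mult(1)[OF reg_id Tr_reg(1)[OF that]]]
    by (intro continuous_intros) auto
  have La: "L (\<lambda>t a. G t a + H t a) t = L G t + L H t" if "reg G" "reg H" "t \<ge> 0" for G H t
  proof -
    have "L (\<lambda>t a. G t a + H t a) t = Idf (\<lambda>a. a * Tr n G t a + a * Tr n H t a) / 2"
      unfolding L_def using Tr_add that by (simp add: ring_distribs)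
    also have "\<dots> = L G t + L H t" unfolding L_def
      by (subst Idf_add) (auto intro!: continuous_intros reg_cont Tr_reg that simp: add_divide_distrib)
    finally show ?thesis .
  qed
  have Lb: "norm (L G t) \<le> 25 * (K / l) / 2 * exp (l * t)"
    if G: "reg G" and K: "\<And>s a. s \<ge> 0 \<Longrightarrow> \<bar>a\<bar> \<le> 1 \<Longrightarrow> norm (G s a) \<le> K * exp (l * s)" and t: "t \<ge> 0" for G K t
  proof -
    have "norm (Idf (\<lambda>a. a * Tr n G t a)) \<le> 25 * (K / l * exp (l * t))"
    proof (rule Idf_bound)
      show "continuous_on {-1..1} (\<lambda>a. a * Tr n G t a)"
        using t by (intro continuous_intros reg_cont Tr_reg G) auto
      fix a :: real assume a: "\<bar>a\<bar> \<le> 1"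
      have T: "norm (Tr n G t a) \<le> K / l * exp (l * t)"
        using K a by (intro Tr_bound G l t) auto
      show "norm (a * Tr n G t a) \<le> K / l * exp (l * t)"
        using mult_mono[OF a T] by (simp add: norm_mult)
    qed
    then show ?thesis unfolding L_def by (simp add: norm_divide)
  qed
  define V where "V P = L (\<lambda>t a. of_real a * (- \<i> * n * P t))" for P
  have rP: "reg (\<lambda>t a. of_real a * (- \<i> * n * P t))" if "continuous_on {0..} P" for P
    by (intro reg_mult reg_id reg_time continuous_intros that)
  have rF: "reg (\<lambda>t a. - \<i> * n * F t a)" by (intro reg_mult reg_const F)
  have "\<exists>P. continuous_on {0..} P \<and> (\<forall>t\<ge>0. P t = L (\<lambda>t a. - \<i> * n * F t a) t + V P t)"
  proof (rule volterra[of V l "L (\<lambda>t a. - \<i> * n * F t a)" "25 * ((\<bar>n\<bar> * M') / l) / 2"])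
    show "continuous_on {0..} (V P)" if "continuous_on {0..} P" for P
      unfolding V_def by (intro Lc rP that)
    show "V (\<lambda>t. P t + Q t) t = V P t + V Q t" if "continuous_on {0..} P" "continuous_on {0..} Q" "t \<ge> 0" for P Q t
      unfolding V_def La[OF rP[OF that(1)] rP[OF that(2)] that(3), symmetric] by (simp add: algebra_simps)
    show "norm (V P t) \<le> K / 2 * exp (l * t)"
      if P: "continuous_on {0..} P" and Pb: "\<And>s. s \<ge> 0 \<Longrightarrow> norm (P s) \<le> K * exp (l * s)" and t: "t \<ge> 0" for P K t
    proof -
      have K: "K \<ge> 0" using Pb[of 0] by (simp add: order_trans[OF norm_ge_zero])
      have "norm (V P t) \<le> 25 * ((\<bar>n\<bar> * K) / l) / 2 * exp (l * t)"
        unfolding V_def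
      proof (rule Lb[OF rP[OF P] _ t])
        fix s a :: real assume "s \<ge> 0" "\<bar>a\<bar> \<le> 1"
        then have "\<bar>a\<bar> * (\<bar>n\<bar> * norm (P s)) \<le> 1 * (\<bar>n\<bar> * (K * exp (l * s)))"
          using Pb by (intro mult_mono) auto
        then show "norm (of_real a * (- \<i> * n * P s)) \<le> \<bar>n\<bar> * K * exp (l * s)"
          by (simp add: norm_mult mult_ac)
      qed
      also have "\<dots> \<le> K / 2 * exp (l * t)"
        using mult_right_mono[OF l(3) K] l(1) by (intro mult_right_mono divide_right_mono) (auto simp: field_simps)
      finally show ?thesis .
    qed
    show "continuous_on {0..} (L (\<lambda>t a. - \<i> * n * F t a))" by (intro Lc rF)
    show "norm (L (\<lambda>t a. - \<i> * n * F t a) t) \<le> 25 * ((\<bar>n\<bar> * M') / l) / 2 * exp (l * t)" if "t \<ge> 0" for t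
    proof (rule Lb[OF rF _ that])
      fix s a :: real assume "s \<ge> 0" "\<bar>a\<bar> \<le> 1"
      then show "norm (- \<i> * n * F s a) \<le> \<bar>n\<bar> * M' * exp (l * s)"
        using mult_left_mono[OF b'[of s a], of "\<bar>n\<bar>"] by (simp add: norm_mult mult_ac)
    qed
  qed
  then obtain P where Pc: "continuous_on {0..} P" and P: "\<And>t. t \<ge> 0 \<Longrightarrow> P t = L (\<lambda>t a. - \<i> * n * F t a) t + V P t"
    by blast
  define G where "G t a = - \<i> * n * F t a + of_real a * (- \<i> * n * P t)" for t a
  define \<eta> where "\<eta> = Tr n G"
  have G: "reg G" unfolding G_def by (intro reg_add rF rP Pc)
  have PI: "Idf (\<lambda>a. a * \<eta> t a) / 2 = P t" if "t \<ge> 0" for t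
    unfolding P[OF that] V_def La[OF rF rP[OF Pc] that, symmetric] by (simp only: L_def \<eta>_def G_def[abs_def])
  have DG: "Da G t a = - \<i> * n * Da F t a - \<i> * n * P t" if t: "t \<ge> 0" for t a
  proof -
    have c: "continuous_on {0..} (\<lambda>t. - \<i> * n * P t)" by (intro continuous_intros Pc)
    have "Da G t a = Da (\<lambda>t a. - \<i> * n * F t a) t a + Da (\<lambda>t a. of_real a * (- \<i> * n * P t)) t a"
      unfolding G_def by (rule reg_add(2)[OF rF rP[OF Pc] t])
    moreover have "Da (\<lambda>t a. - \<i> * n * F t a) t a = - \<i> * n * Da F t a"
      using reg_mult(2)[OF reg_const(1) F t, of "- \<i> * n"] by (simp add: reg_const)
    moreover have "Da (\<lambda>t a. of_real a * (- \<i> * n * P t)) t a = - \<i> * n * P t"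
      using reg_mult(2)[OF reg_id reg_time(1)[OF c] t] reg_time(2)[OF c] by (simp add: Da_id)
    ultimately show ?thesis by simp
  qed
  show ?thesis
  proof (rule exI[of _ \<eta>], intro conjI allI impI)
    show "reg \<eta>" unfolding \<eta>_def by (rule Tr_reg(1)[OF G])
    fix a show "\<eta> 0 a = 0" "Da \<eta> 0 a = 0" unfolding \<eta>_def using Tr_reg(4,5)[OF G] by auto
  next
    fix t a :: real assume t: "t \<ge> 0"
    have "- \<i> * n * a * Tr n G t a + G t a = - \<i> * n * (a * \<eta> t a + a * (Idf (\<lambda>a. a * \<eta> t a) / 2) + F t a)"
      unfolding PI[OF t] unfolding G_def \<eta>_def by (simp add: algebra_simps)
    then show "((\<lambda>t. \<eta> t a) has_vector_derivative
        - \<i> * n * (a * \<eta> t a + a * (Idf (\<lambda>a. a * \<eta> t a) / 2) + F t a)) (at t within {0..})"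
      using Tr_reg(2)[OF G t, of n a] by (simp add: \<eta>_def)
    have "- \<i> * n * a * Da (Tr n G) t a - \<i> * n * Tr n G t a + Da G t a
       = - \<i> * n * (a * Da \<eta> t a + \<eta> t a + Idf (\<lambda>a. a * \<eta> t a) / 2 + Da F t a)"
      unfolding PI[OF t] DG[OF t] unfolding \<eta>_def by (simp add: algebra_simps)
    then show "((\<lambda>t. Da \<eta> t a) has_vector_derivative
        - \<i> * n * (a * Da \<eta> t a + \<eta> t a + Idf (\<lambda>a. a * \<eta> t a) / 2 + Da F t a)) (at t within {0..})"
      using Tr_reg(3)[OF G t, of n a] by (simp add: \<eta>_def)
  qed
qed

section \<open>Weighted energy, and a growth estimate with a constant independent of the
  frequency\<close>

definition rho :: "real \<Rightarrow> real" where "rho a = 15/4 * (1 - a^2)"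

text \<open>The weight satisfies \<open>dens' a * (1 - a\<^sup>2) = 2 * rho a * a * (a\<^sup>2 + 1 /
  4)\<close>; it is positive inside the label interval although \<open>dens'\<close> changes sign,
  and it gives \<open>a\<^sup>2\<close> the integral 1.\<close>

definition Wt :: "(real \<Rightarrow> 'c::banach) \<Rightarrow> 'c" where
  "Wt h = integral {-1..1} (\<lambda>a. rho a *\<^sub>R h a)"

lemma rho_cont [continuous_intros]: "continuous_on A f \<Longrightarrow> continuous_on A (\<lambda>x. rho (f x))"
  unfolding rho_def by (intro continuous_intros)

lemma rho_nonneg: "\<bar>a\<bar> \<le> 1 \<Longrightarrow> rho a \<ge> 0"
  by (simp add: rho_def abs_square_le_1)

text \<open>Makes derivatives relative to the half-line unique, also at its endpoint.\<close>

lemma at_within_Ici_neq_bot: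
  fixes t :: real
  assumes "t \<ge> 0"
  shows "at t within {0..} \<noteq> bot"
proof
  assume "at t within {0..} = bot"
  moreover have "at t within {t<..} \<le> at t within {0..}" by (rule at_le) (use assms in auto)
  ultimately show False using trivial_limit_at_right_real[of t] by (simp add: bot_unique)
qed

lemma integral_deriv:
  fixes G :: "real \<Rightarrow> real \<Rightarrow> 'c::banach"
  assumes d: "\<And>t a. t \<ge> 0 \<Longrightarrow> \<bar>a\<bar> \<le> 1 \<Longrightarrow> ((\<lambda>t. G t a) has_vector_derivative H t a) (at t within {0..})"
    and G: "\<And>t. t \<ge> 0 \<Longrightarrow> continuous_on {-1..1} (G t)"
    and H: "continuous_on ({0..} \<times> {-1..1}) (\<lambda>(t, a). H t a)" and t: "t \<ge> 0"
  shows "((\<lambda>t. Wt (G t)) has_vector_derivative Wt (H t)) (at t within {0..})"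
proof -
  have "((\<lambda>t. integral (cbox (-1) 1) (\<lambda>a. rho a *\<^sub>R G t a)) has_vector_derivative
      integral (cbox (-1) 1) (\<lambda>a. rho a *\<^sub>R H t a)) (at t within {0..})"
  proof (rule leibniz_rule_vector_derivative)
    fix t a :: real assume "t \<in> {0..}" "a \<in> cbox (-1) 1"
    then show "((\<lambda>t. rho a *\<^sub>R G t a) has_vector_derivative rho a *\<^sub>R H t a) (at t within {0..})"
      using bounded_linear.has_vector_derivative[OF bounded_linear_scaleR_right d[of t a]] by auto
  next
    fix t :: real assume "t \<in> {0..}"
    then show "(\<lambda>a. rho a *\<^sub>R G t a) integrable_on cbox (-1) 1"
      unfolding cbox_interval by (intro integrable_continuous_interval continuous_intros G) auto
  next
    show "continuous_on ({0..} \<times> cbox (-1) 1) (\<lambda>(t, a). rho a *\<^sub>R H t a)"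
      using H by (auto simp: split_beta intro!: continuous_intros)
  qed (use t in auto)
  then show ?thesis by (simp add: Wt_def)
qed

lemma Wt_integrable:
  fixes h :: "real \<Rightarrow> 'c::banach"
  assumes "continuous_on {-1..1} h"
  shows "(\<lambda>a. rho a *\<^sub>R h a) integrable_on {-1..1}"
  by (rule integrable_continuous_interval) (intro continuous_intros assms)

lemma Wt_add:
  assumes "continuous_on {-1..1} h" "continuous_on {-1..1} k"
  shows "Wt (\<lambda>a. h a + k a) = Wt h + Wt k"
  unfolding Wt_def using Wt_integrable[OF assms(1)] Wt_integrable[OF assms(2)]
  by (simp add: scaleR_add_right integral_add)

lemma Wt_linear:
  assumes "bounded_linear f" "continuous_on {-1..1} h"
  shows "Wt (\<lambda>a. f (h a)) = f (Wt h)"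
proof -
  have "integral {-1..1} (\<lambda>a. f (rho a *\<^sub>R h a)) = f (integral {-1..1} (\<lambda>a. rho a *\<^sub>R h a))"
    using integral_linear[OF Wt_integrable[OF assms(2)] assms(1)] by (simp add: o_def)
  then show ?thesis
    by (simp add: Wt_def linear_simps(5)[OF assms(1)])
qed

lemma Wt_cmult:
  fixes c :: "'a::{real_normed_algebra,banach}"
  shows "continuous_on {-1..1} h \<Longrightarrow> Wt (\<lambda>a. c * h a) = c * Wt h"
  by (rule Wt_linear) (rule bounded_linear_mult_right)

lemma Wt_mono:
  fixes h k :: "real \<Rightarrow> real"
  assumes "continuous_on {-1..1} h" "continuous_on {-1..1} k" "\<And>a. \<bar>a\<bar> \<le> 1 \<Longrightarrow> h a \<le> k a"
  shows "Wt h \<le> Wt k"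
  unfolding Wt_def
  by (intro integral_le Wt_integrable assms scaleR_left_mono rho_nonneg) auto

lemma Wt_norm:
  assumes "continuous_on {-1..1} h"
  shows "norm (Wt h) \<le> Wt (\<lambda>a. norm (h a))"
  unfolding Wt_def
  by (intro integral_norm_bound_integral Wt_integrable assms continuous_intros)
    (auto simp: rho_nonneg)

lemma Wt_poly:
  assumes "\<And>a. (p has_real_derivative rho a * q a) (at a)"
  shows "Wt q = p 1 - p (-1)"
proof -
  have "((\<lambda>a. rho a * q a) has_integral (p 1 - p (-1))) {-1..1}"
    by (rule fundamental_theorem_of_calculus)
      (auto simp flip: has_real_derivative_iff_has_vector_derivative intro: has_field_derivative_at_within assms)
  then show ?thesis by (simp add: Wt_def integral_unique)
qed

lemma Wt_const: "Wt (\<lambda>a. c::real) = 5 * c"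
proof -
  have "Wt (\<lambda>a. c) = (\<lambda>a. c * (15/4) * (a - a^3/3)) 1 - (\<lambda>a. c * (15/4) * (a - a^3/3)) (-1)"
    by (rule Wt_poly) (auto intro!: derivative_eq_intros simp: rho_def power2_eq_square field_simps)
  then show ?thesis by (simp add: field_simps)
qed

lemma Wt_of_real: "continuous_on {-1..1} h \<Longrightarrow> Wt (\<lambda>a. complex_of_real (h a)) = of_real (Wt h)"
  by (rule Wt_linear) (rule bounded_linear_of_real)

lemma Wt_a2: "Wt (\<lambda>a. (of_real a)^2 :: complex) = 1"
proof -
  have "Wt (\<lambda>a. a^2) = (\<lambda>a. (15/4) * (a^3/3 - a^5/5)) 1 - (\<lambda>a. (15/4) * (a^3/3 - a^5/5)) (-1::real)"
    by (rule Wt_poly) (auto intro!: derivative_eq_intros simp: rho_def power2_eq_square power_numeral_reduce field_simps)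
  then show ?thesis using Wt_of_real[of "\<lambda>a. a^2"] by (simp add: continuous_intros)
qed

lemma Wt_a3: "Wt (\<lambda>a. (of_real a)^3 :: complex) = 0"
proof -
  have "Wt (\<lambda>a. a^3) = (\<lambda>a. (15/4) * (a^4/4 - a^6/6)) 1 - (\<lambda>a. (15/4) * (a^4/4 - a^6/6)) (-1::real)"
    by (rule Wt_poly) (auto intro!: derivative_eq_intros simp: rho_def power2_eq_square power_numeral_reduce field_simps)
  then show ?thesis using Wt_of_real[of "\<lambda>a. a^3"] by (simp add: continuous_intros)
qed

lemma Idf_poly:
  assumes "\<And>a. (p has_real_derivative dens' a * q a) (at a)"
  shows "Idf (\<lambda>a. of_real (q a)) = of_real (p 1 - p (-1) - 25/8 * (q 1 - q (-1)))"
proof -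
  have "((\<lambda>a. dens' a * q a) has_integral (p 1 - p (-1))) {-1..1}"
    by (rule fundamental_theorem_of_calculus)
      (auto simp flip: has_real_derivative_iff_has_vector_derivative intro: has_field_derivative_at_within assms)
  from has_integral_linear[OF this bounded_linear_of_real]
  have "((\<lambda>a. of_real (dens' a) * of_real (q a) :: complex) has_integral of_real (p 1 - p (-1))) {-1..1}"
    by (simp add: o_def)
  then show ?thesis by (simp add: Idf_def integral_unique)
qed

lemma Idf_a: "Idf (\<lambda>a. of_real a) = -2"
  by (subst Idf_poly[of "\<lambda>a. 3 * a^5/2 + 5 * a^3/8" "\<lambda>a. a"])
    (auto intro!: derivative_eq_intros simp: dens'_def field_simps power2_eq_square power_numeral_reduce)

lemma Idf_a2: "Idf (\<lambda>a. (of_real a)^2) = 0"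
proof -
  have "Idf (\<lambda>a. of_real (a^2)) = 0"
    by (subst Idf_poly[of "\<lambda>a. 15 * a^6/12 + 15 * a^4/32" "\<lambda>a. a^2"])
      (auto intro!: derivative_eq_intros simp: dens'_def field_simps power2_eq_square power_numeral_reduce)
  then show ?thesis by simp
qed

text \<open>The factor \<open>1 - a\<^sup>2\<close> kills the endpoint terms of \<open>Idf\<close>,
  and \<open>dens'\<close> becomes \<open>a * (a\<^sup>2 + 1 / 4)\<close> times the positive weight.
  This translates the conservation of \<open>Idf (\<eta> t)\<close> into an orthogonality relation
  for the energy.\<close>

lemma Idf_minus_a2:
  assumes h: "continuous_on {-1..1} h"
  shows "Idf (\<lambda>a. (1 - (of_real a)^2) * h a) = 2 * Wt (\<lambda>a. of_real a * ((of_real a)^2 + 1/4) * h a)"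
proof -
  have "of_real (dens' a) * ((1 - (of_real a)^2) * h a) = 2 * (rho a *\<^sub>R (of_real a * ((of_real a)^2 + 1/4) * h a))" for a
  proof -
    have "dens' a * (1 - a^2) = 2 * rho a * (a * (a^2 + 1/4))"
      by (simp add: dens'_def rho_def field_simps power2_eq_square power_numeral_reduce)
    then have "of_real (dens' a * (1 - a^2)) * h a = of_real (2 * rho a * (a * (a^2 + 1/4))) * h a" by simp
    moreover have "of_real (dens' a) * ((1 - (of_real a)^2) * h a) = of_real (dens' a * (1 - a^2)) * h a"
      by (simp add: algebra_simps)
    moreover have "2 * (rho a *\<^sub>R (of_real a * ((of_real a)^2 + 1/4) * h a)) = of_real (2 * rho a * (a * (a^2 + 1/4))) * h a"
      by (simp add: scaleR_conv_of_real algebra_simps)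
    ultimately show ?thesis by (simp only:)
  qed
  then have "Idf (\<lambda>a. (1 - (of_real a)^2) * h a) = integral {-1..1} (\<lambda>a. 2 * (rho a *\<^sub>R (of_real a * ((of_real a)^2 + 1/4) * h a)))"
    by (simp add: Idf_def)
  also have "\<dots> = 2 * Wt (\<lambda>a. of_real a * ((of_real a)^2 + 1/4) * h a)"
    unfolding Wt_def by (rule integral_mult_right)
  finally show ?thesis .
qed

text \<open>The point is a constant free of \<open>n\<close>, although the source enters multiplied
  by \<open>n\<close>. The moments \<open>P\<close> and \<open>R\<close> form a 2 x 2 system with
  rates \<open>n / 2\<close> and \<open>- n / 2\<close>; the combination \<open>X\<close> vanishes
  on both eigenmodes, and its weighted energy is changed by the source only. \<open>X\<close>
  controls the term \<open>\<Lambda>\<close> that forces the moments, the moments are then bounded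
  by their ODE, and finally \<open>\<eta>\<close> and its label derivative by the transport
  equation, which reaches the labels up to 2.\<close>

lemma linear_estimate:
  fixes \<eta> F :: "real \<Rightarrow> real \<Rightarrow> complex"
  fixes n m \<Phi> s :: real
  assumes \<eta>: "reg \<eta>" and F: "reg F" and init: "\<And>a. \<eta> 0 a = 0" "\<And>a. Da \<eta> 0 a = 0"
    and d: "\<And>t a. t \<ge> 0 \<Longrightarrow> ((\<lambda>t. \<eta> t a) has_vector_derivative
        - \<i> * n * (a * \<eta> t a + a * (Idf (\<lambda>a. a * \<eta> t a) / 2) + F t a)) (at t within {0..})"
    and dD: "\<And>t a. t \<ge> 0 \<Longrightarrow> ((\<lambda>t. Da \<eta> t a) has_vector_derivative
        - \<i> * n * (a * Da \<eta> t a + \<eta> t a + Idf (\<lambda>a. a * \<eta> t a) / 2 + Da F t a)) (at t within {0..})"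
    and IF: "\<And>t. t \<ge> 0 \<Longrightarrow> Idf (F t) = 0"
    and Fb: "\<And>t a. t \<ge> 0 \<Longrightarrow> \<bar>a\<bar> \<le> 2 \<Longrightarrow> norm (F t a) \<le> \<Phi> * exp (m * t)"
    and DFb: "\<And>t a. t \<ge> 0 \<Longrightarrow> \<bar>a\<bar> \<le> 2 \<Longrightarrow> norm (Da F t a) \<le> \<Phi> * exp (m * t)"
    and \<Phi>: "\<Phi> > 0" and s: "s > 1/2" and m: "m > 0" "\<bar>n\<bar> * s \<le> m"
  shows "t \<ge> 0 \<Longrightarrow> Idf (\<eta> t) = 0"
    and "t \<ge> 0 \<Longrightarrow> \<bar>a\<bar> \<le> 2 \<Longrightarrow> norm (\<eta> t a) \<le> (8600 / (s - 1/2) + 6) * \<Phi> * exp (m * t)"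
    and "t \<ge> 0 \<Longrightarrow> \<bar>a\<bar> \<le> 2 \<Longrightarrow> norm (Da \<eta> t a) \<le> (8600 / (s - 1/2) + 6) * \<Phi> * exp (m * t)"
proof -
  \<comment> \<open>Multiplication by \<open>a\<close> raises the moment, so the moments form an
    infinite hierarchy; it is cut after the second one.\<close>
  define M where "M k t = Idf (\<lambda>a. (of_real a)^k * \<eta> t a)" for k t
  define fm where "fm k t = Idf (\<lambda>a. (of_real a)^k * F t a)" for k t
  define c where "c k = Idf (\<lambda>a. (of_real a)^k)" for k
  have \<eta>c [continuous_intros]: "t \<ge> 0 \<Longrightarrow> continuous_on S (\<eta> t)" for t S using \<eta> by (rule reg_cont1)
  have Fc [continuous_intros]: "t \<ge> 0 \<Longrightarrow> continuous_on S (F t)" for t S using F by (rule reg_cont1)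
  have M1c: "continuous_on {0..} (M k)" for k
    unfolding M_def using Idf_time_cont[OF reg_mult(1)[OF reg_time(1)[of "\<lambda>t. 1"] \<eta>]]
    apply (rule_tac Idf_time_cont[of "\<lambda>t a. (of_real a)^k * \<eta> t a"])
    apply (rule reg_mult(1)[OF _ \<eta>])
    apply (induction k)
    using reg_const(1)[of 1] reg_mult(1)[OF reg_id] by auto
  have [simp]: "Idf (\<lambda>a. of_real a * \<eta> t a) = M 1 t" for t by (simp add: M_def)
  have dM: "(M k has_vector_derivative - \<i> * n * (M (Suc k) t + M 1 t / 2 * c (Suc k) + fm k t)) (at t within {0..})"
    if t: "t \<ge> 0" for k t
  proof -
    have cM: "continuous_on ({0..} \<times> {-1..1::real}) (\<lambda>x. M 1 (fst x))"
      by (rule continuous_on_compose2[OF M1c]) (auto intro: continuous_intros)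
    have "((\<lambda>t. Idf (\<lambda>a. (of_real a)^k * \<eta> t a)) has_vector_derivative
        Idf (\<lambda>a. (of_real a)^k * (- \<i> * n * (a * \<eta> t a + a * (M 1 t / 2) + F t a)))) (at t within {0..})"
    proof (rule Idf_deriv[OF _ _ _ t])
      fix t a :: real assume "t \<ge> 0"
      then show "((\<lambda>t. (of_real a)^k * \<eta> t a) has_vector_derivative
          (of_real a)^k * (- \<i> * n * (a * \<eta> t a + a * (M 1 t / 2) + F t a))) (at t within {0..})"
        using d[of t a] by (intro has_vector_derivative_mult_right) simp
    next
      fix t :: real assume "t \<ge> 0"
      then show "continuous_on {-1..1} (\<lambda>a. (of_real a)^k * \<eta> t a)" by (intro continuous_intros) auto
    next
      show "continuous_on ({0..} \<times> {-1..1}) (\<lambda>(t, a). (complex_of_real a)^k * (- \<i> * n * (a * \<eta> t a + a * (M 1 t / 2) + F t a)))"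
        unfolding split_beta by (intro continuous_intros reg_cont[OF \<eta>] reg_cont[OF F] cM) auto
    qed
    moreover have "Idf (\<lambda>a. (of_real a)^k * (- \<i> * n * (a * \<eta> t a + a * (M 1 t / 2) + F t a)))
       = - \<i> * n * (M (Suc k) t + M 1 t / 2 * c (Suc k) + fm k t)"
    proof -
      have "Idf (\<lambda>a. (of_real a)^k * (- \<i> * n * (a * \<eta> t a + a * (M 1 t / 2) + F t a)))
        = Idf (\<lambda>a. - \<i> * n * (((of_real a)^Suc k * \<eta> t a + M 1 t / 2 * (of_real a)^Suc k) + (of_real a)^k * F t a))"
        by (simp add: algebra_simps)
      also have "\<dots> = - \<i> * n * ((M (Suc k) t + M 1 t / 2 * c (Suc k)) + fm k t)"
      proof -
        have k: "continuous_on {-1..1} (\<lambda>a. (of_real a)^Suc k * \<eta> t a)" "continuous_on {-1..1} (\<lambda>a. M 1 t / 2 * (complex_of_real a)^Suc k)"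
          "continuous_on {-1..1} (\<lambda>a. (of_real a)^k * F t a)"
          using t by (intro continuous_intros; assumption)+
        show ?thesis
          unfolding Idf_cmult Idf_add[OF continuous_on_add[OF k(1,2)] k(3)] Idf_add[OF k(1,2)]
          unfolding M_def c_def fm_def by (rule refl)
      qed
      finally show ?thesis .
    qed
    ultimately show ?thesis unfolding M_def by simp
  qed
  have c1: "c 1 = -2" using Idf_a by (simp add: c_def)
  have c2: "c 2 = 0" using Idf_a2 by (simp add: c_def)
  have Minit: "M k 0 = 0" for k using Idf_cmult[of 0 "\<lambda>a. 1"] by (simp add: M_def init)
  have f0: "fm 0 t = 0" if "t \<ge> 0" for t using IF[OF that] by (simp add: fm_def)
  have M0: "M 0 t = 0" if t: "t \<ge> 0" for t
  proof -
    have "(M 0 has_vector_derivative 0) (at u within {0..})" if "u \<ge> 0" for u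
      using dM[OF that, of 0] f0[OF that] c1 by simp
    then have "(M 0 has_derivative (\<lambda>h. 0)) (at u within {0..})" if "u \<in> {0..}" for u
      using that by (auto simp: has_vector_derivative_def)
    from has_derivative_zero_unique[OF convex_real_interval(1) this, of 0 t] show ?thesis using t Minit by simp
  qed
  then show "t \<ge> 0 \<Longrightarrow> Idf (\<eta> t) = 0" for t by (simp add: M_def)
  define P where "P t = M 1 t / 2" for t
  define R where "R t = M 2 t / 2" for t
  define \<phi>1 where "\<phi>1 t = fm 1 t / 2" for t
  define \<phi>2 where "\<phi>2 t = fm 2 t / 2" for t
  \<comment> \<open>The closing term: it collects what lies beyond the second moment. The quarter of
    \<open>P\<close> is split off so that the homogeneous system for \<open>P\<close> and
    \<open>R\<close> has the rates \<open>n / 2\<close> and \<open>- n / 2\<close>.\<close>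
  define \<Lambda> where "\<Lambda> t = P t / 4 + M 3 t / 2 + P t * c 3 / 2" for t
  have dP: "(P has_vector_derivative - \<i> * n * (R t + \<phi>1 t)) (at t within {0..})" if "t \<ge> 0" for t
  proof -
    have "- \<i> * n * (M (Suc 1) t + M 1 t / 2 * c (Suc 1) + fm 1 t) / 2 = - \<i> * n * (R t + \<phi>1 t)"
      using c2 by (simp add: R_def \<phi>1_def numeral_2_eq_2 field_simps)
    then show ?thesis
      using has_vector_derivative_divide[OF dM[OF that, of 1], of 2] by (simp only: P_def[abs_def])
  qed
  have dR: "(R has_vector_derivative - \<i> * n * (\<Lambda> t - P t / 4 + \<phi>2 t)) (at t within {0..})" if "t \<ge> 0" for t
  proof -
    have "- \<i> * n * (M (Suc 2) t + M 1 t / 2 * c (Suc 2) + fm 2 t) / 2 = - \<i> * n * (\<Lambda> t - P t / 4 + \<phi>2 t)"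
      by (simp add: P_def \<Lambda>_def \<phi>2_def eval_nat_numeral field_simps)
    then show ?thesis
      using has_vector_derivative_divide[OF dM[OF that, of 2], of 2] by (simp only: R_def[abs_def])
  qed
  have Pc: "continuous_on {0..} P" and Rc: "continuous_on {0..} R"
    unfolding P_def R_def by (intro continuous_intros M1c; simp)+
  have fc: "continuous_on {0..} (fm k)" for k
    unfolding fm_def
    apply (rule_tac Idf_time_cont[of "\<lambda>t a. (of_real a)^k * F t a"])
    apply (rule reg_mult(1)[OF _ F])
    apply (induction k)
    using reg_const(1)[of 1] reg_mult(1)[OF reg_id] by auto
  define H where "H t a = ((of_real a)^2 + 1/4) * F t a + (of_real a)^2 * \<phi>1 t + of_real a * \<phi>2 t" for t a
  \<comment> \<open>On \<open>a / (a - \<i> / 2)\<close> and on its conjugate the three terms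
    cancel: \<open>a\<^sup>2 + 1 / 4\<close> clears the denominator, and \<open>P\<close> and
    \<open>R\<close> are then the half moments of that mode. So \<open>X\<close> sees only what lies
    outside the two eigenmodes.\<close>
  define X where "X t a = ((of_real a)^2 + 1/4) * \<eta> t a + (of_real a)^2 * P t + of_real a * R t" for t a
  define X' where "X' t a = - \<i> * n * (of_real a * X t a + of_real a * \<Lambda> t + H t a)" for t a
  have dX: "((\<lambda>t. X t a) has_vector_derivative X' t a) (at t within {0..})" if t: "t \<ge> 0" for t a
  proof -
    have "((\<lambda>t. X t a) has_vector_derivative ((of_real a)^2 + 1/4) * (- \<i> * n * (a * \<eta> t a + a * P t + F t a))
        + (of_real a)^2 * (- \<i> * n * (R t + \<phi>1 t)) + of_real a * (- \<i> * n * (\<Lambda> t - P t / 4 + \<phi>2 t))) (at t within {0..})"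
      unfolding X_def using d[OF t, of a] dP[OF t] dR[OF t]
      by (intro has_vector_derivative_add has_vector_derivative_mult_right) (simp add: P_def)
    moreover have "((of_real a)^2 + 1/4) * (- \<i> * n * (a * \<eta> t a + a * P t + F t a))
        + (of_real a)^2 * (- \<i> * n * (R t + \<phi>1 t)) + of_real a * (- \<i> * n * (\<Lambda> t - P t / 4 + \<phi>2 t)) = X' t a"
      unfolding X'_def X_def H_def by (simp add: field_simps power2_eq_square)
    ultimately show ?thesis by simp
  qed
  have tc: "continuous_on ({0..} \<times> {-1..1::real}) (\<lambda>x. g (fst x))" if "continuous_on {0..} g" for g :: "real \<Rightarrow> complex"
    by (rule continuous_on_compose2[OF that]) (auto intro: continuous_intros)
  have \<phi>c: "continuous_on {0..} \<phi>1" "continuous_on {0..} \<phi>2" and \<Lambda>c: "continuous_on {0..} \<Lambda>"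
    unfolding \<phi>1_def \<phi>2_def \<Lambda>_def by (intro continuous_intros fc M1c Pc; simp)+
  have Hc2: "continuous_on ({0..} \<times> {-1..1}) (\<lambda>x. H (fst x) (snd x))"
    unfolding H_def by (intro continuous_intros reg_cont[OF F] tc \<phi>c) auto
  have Xc2: "continuous_on ({0..} \<times> {-1..1}) (\<lambda>x. X (fst x) (snd x))"
    unfolding X_def by (intro continuous_intros reg_cont[OF \<eta>] tc Pc Rc) auto
  have X'c2: "continuous_on ({0..} \<times> {-1..1}) (\<lambda>x. X' (fst x) (snd x))"
    unfolding X'_def by (intro continuous_intros Xc2 Hc2 tc \<Lambda>c)
  have Hc [continuous_intros]: "t \<ge> 0 \<Longrightarrow> continuous_on {-1..1} (H t)" for t unfolding H_def by (intro continuous_intros) auto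
  have Xc [continuous_intros]: "t \<ge> 0 \<Longrightarrow> continuous_on {-1..1} (X t)" for t unfolding X_def by (intro continuous_intros) auto
  have X'c [continuous_intros]: "t \<ge> 0 \<Longrightarrow> continuous_on {-1..1} (X' t)" for t unfolding X'_def by (intro continuous_intros) auto
  \<comment> \<open>This is the conservation of \<open>Idf (\<eta> t) = 0\<close>, rewritten by
    \<open>Idf_minus_a2\<close>; the weighted integrals of \<open>a\<^sup>2\<close> and
    \<open>a\<^sup>3\<close> are 1 and 0.\<close>
  have WX: "Wt (\<lambda>a. of_real a * X t a) = 0" if t: "t \<ge> 0" for t
  proof -
    have "Idf (\<lambda>a. (1 - (of_real a)^2) * \<eta> t a) = Idf (\<lambda>a. (of_real a)^0 * \<eta> t a + (-1) * ((of_real a)^2 * \<eta> t a))"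
      by (simp add: algebra_simps)
    also have "\<dots> = M 0 t + (-1) * M 2 t"
    proof -
      have k: "continuous_on {-1..1} (\<lambda>a. (of_real a)^0 * \<eta> t a)" "continuous_on {-1..1} (\<lambda>a. (-1) * ((of_real a)^2 * \<eta> t a))"
        using t by (intro continuous_intros; assumption)+
      show ?thesis unfolding Idf_add[OF k] Idf_cmult M_def by (rule refl)
    qed
    finally have "2 * Wt (\<lambda>a. of_real a * ((of_real a)^2 + 1/4) * \<eta> t a) = - M 2 t"
      using Idf_minus_a2[of "\<eta> t"] t M0[OF t] by (simp add: \<eta>c)
    then have 1: "Wt (\<lambda>a. of_real a * ((of_real a)^2 + 1/4) * \<eta> t a) = - R t"
      by (simp add: R_def field_simps)
    have "Wt (\<lambda>a. of_real a * X t a) = Wt (\<lambda>a. (of_real a * ((of_real a)^2 + 1/4) * \<eta> t a + P t * (of_real a)^3) + R t * (of_real a)^2)"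
      unfolding X_def by (simp add: algebra_simps power2_eq_square power3_eq_cube)
    also have "\<dots> = - R t + P t * 0 + R t * 1"
    proof -
      have k: "continuous_on {-1..1} (\<lambda>a. of_real a * ((of_real a)^2 + 1/4) * \<eta> t a)"
          "continuous_on {-1..1} (\<lambda>a. P t * (complex_of_real a)^3)" "continuous_on {-1..1} (\<lambda>a. R t * (complex_of_real a)^2)"
        using t by (intro continuous_intros; assumption)+
      have e: "Wt (\<lambda>a. P t * (of_real a)^3) = P t * 0" "Wt (\<lambda>a. R t * (of_real a)^2) = R t * 1"
        unfolding Wt_a3[symmetric] Wt_a2[symmetric] by (rule Wt_cmult, intro continuous_intros)+
      show ?thesis unfolding Wt_add[OF continuous_on_add[OF k(1,2)] k(3)] Wt_add[OF k(1,2)] 1 e by (rule refl)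
    qed
    finally show ?thesis by simp
  qed
  have fmb: "norm (fm k t) \<le> 25 * (\<Phi> * exp (m * t))" if t: "t \<ge> 0" for k t
    unfolding fm_def
  proof (rule Idf_bound)
    show "continuous_on {-1..1} (\<lambda>a. (of_real a)^k * F t a)" using t by (intro continuous_intros)
    fix a :: real assume a: "\<bar>a\<bar> \<le> 1"
    show "norm ((of_real a)^k * F t a) \<le> \<Phi> * exp (m * t)"
      using mult_mono[OF power_le_one[OF abs_ge_zero a, of k] Fb[OF t, of a]] a by (simp add: norm_mult norm_power)
  qed
  have Hb: "norm (H t a) \<le> 27 * \<Phi> * exp (m * t)" if t: "t \<ge> 0" and a: "\<bar>a\<bar> \<le> 1" for t a
  proof -
    define e where "e = \<Phi> * exp (m * t)"
    have e: "e > 0" using \<Phi> by (simp add: e_def)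
    have a2: "a^2 \<le> 1" using a by (simp add: abs_square_le_1)
    have n1: "norm (((of_real a)^2 + 1/4 :: complex)) = a^2 + 1/4"
    proof -
      have "((of_real a)^2 + 1/4 :: complex) = of_real (a^2 + 1/4)" by simp
      then show ?thesis by (simp only: norm_of_real) simp
    qed
    have "norm (((of_real a)^2 + 1/4) * F t a) \<le> (5/4) * e"
      unfolding norm_mult n1 using a2 Fb[OF t, of a] a e by (intro mult_mono) (auto simp: e_def)
    moreover have "norm ((of_real a)^2 * \<phi>1 t) \<le> 1 * (25/2 * e)"
      unfolding norm_mult norm_power norm_of_real power2_abs using a2 fmb[OF t, of 1] e
      by (intro mult_mono) (auto simp: e_def \<phi>1_def norm_divide)
    moreover have "norm (of_real a * \<phi>2 t) \<le> 1 * (25/2 * e)"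
      unfolding norm_mult norm_of_real using a fmb[OF t, of 2] e
      by (intro mult_mono) (auto simp: e_def \<phi>2_def norm_divide)
    ultimately have "norm (H t a) \<le> (5/4) * e + 25/2 * e + 25/2 * e"
      unfolding H_def by (intro norm_triangle_le add_mono) auto
    then show ?thesis using e by (simp add: e_def)
  qed
  define E where "E t = Wt (\<lambda>a. X t a \<bullet> X t a)" for t
  define E' where "E' t = Wt (\<lambda>a. 2 * (X t a \<bullet> X' t a))" for t
  have dE: "(E has_real_derivative E' t) (at t within {0..})" if t: "t \<ge> 0" for t
    unfolding has_real_derivative_iff_has_vector_derivative E_def E'_def
  proof (rule integral_deriv[OF _ _ _ t])
    fix t a :: real assume "t \<ge> 0"
    from bounded_bilinear.has_vector_derivative[OF bounded_bilinear_inner dX[OF this] dX[OF this], of a a]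
    show "((\<lambda>t. X t a \<bullet> X t a) has_vector_derivative 2 * (X t a \<bullet> X' t a)) (at t within {0..})"
      by (simp add: inner_commute)
  next
    fix t :: real assume "t \<ge> 0" then show "continuous_on {-1..1} (\<lambda>a. X t a \<bullet> X t a)" by (intro continuous_intros)
  next
    show "continuous_on ({0..} \<times> {-1..1}) (\<lambda>(t, a). 2 * (X t a \<bullet> X' t a))"
      unfolding split_beta by (intro continuous_intros Xc2 X'c2)
  qed
  have E'b: "E' t \<le> m * E t + 5 * (n^2 * (27 * \<Phi> * exp (m * t))^2 / m)" if t: "t \<ge> 0" for t
  proof -
    define h where "h = 27 * \<Phi> * exp (m * t)"
    \<comment> \<open>The transport term \<open>- \<i> * n * a * X\<close> is perpendicular to
      \<open>X\<close> pointwise, and the term with \<open>\<Lambda>\<close> drops by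
      \<open>WX\<close>; only \<open>H\<close> is left.\<close>
    have "E' t = Wt (\<lambda>a. (of_real a * X t a) \<bullet> (- 2 * \<i> * n * \<Lambda> t) + 2 * (X t a \<bullet> (- \<i> * n * H t a)))"
      unfolding E'_def by (rule arg_cong[where f = Wt]) (simp add: X'_def inner_complex_def fun_eq_iff algebra_simps)
    also have "\<dots> = Wt (\<lambda>a. (of_real a * X t a) \<bullet> (- 2 * \<i> * n * \<Lambda> t)) + Wt (\<lambda>a. 2 * (X t a \<bullet> (- \<i> * n * H t a)))"
      using t by (intro Wt_add continuous_intros)
    also have "Wt (\<lambda>a. (of_real a * X t a) \<bullet> (- 2 * \<i> * n * \<Lambda> t)) = Wt (\<lambda>a. of_real a * X t a) \<bullet> (- 2 * \<i> * n * \<Lambda> t)"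
      using t by (intro Wt_linear[OF bounded_linear_inner_left] continuous_intros)
    also have "\<dots> = 0" by (simp only: WX[OF t] inner_zero_left)
    also have "0 + Wt (\<lambda>a. 2 * (X t a \<bullet> (- \<i> * n * H t a))) \<le> Wt (\<lambda>a. m * (X t a \<bullet> X t a) + n^2 * h^2 / m)"
      unfolding add_0
    proof (rule Wt_mono)
      show "continuous_on {-1..1} (\<lambda>a. 2 * (X t a \<bullet> (- \<i> * n * H t a)))" using t by (intro continuous_intros)
      show "continuous_on {-1..1} (\<lambda>a. m * (X t a \<bullet> X t a) + n^2 * h^2 / m)" using t by (intro continuous_intros)
      fix a :: real assume a: "\<bar>a\<bar> \<le> 1"
      have "X t a \<bullet> (- \<i> * n * H t a) \<le> norm (X t a) * norm (- \<i> * n * H t a)" by (rule norm_cauchy_schwarz)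
      also have "\<dots> \<le> norm (X t a) * (\<bar>n\<bar> * h)"
      proof -
        have "norm (- \<i> * n * H t a) = \<bar>n\<bar> * norm (H t a)" by (simp add: norm_mult)
        also have "\<dots> \<le> \<bar>n\<bar> * h" unfolding h_def by (rule mult_left_mono[OF Hb[OF t a] abs_ge_zero])
        finally show ?thesis by (rule mult_left_mono) simp
      qed
      finally have 1: "2 * (X t a \<bullet> (- \<i> * n * H t a)) \<le> 2 * (norm (X t a) * (\<bar>n\<bar> * h))"
        by (rule mult_left_mono) simp
      have "0 \<le> (m * norm (X t a) - \<bar>n\<bar> * h)^2 / m" using m by simp
      also have "\<dots> = m * (norm (X t a))^2 + n^2 * h^2 / m - 2 * (norm (X t a) * (\<bar>n\<bar> * h))"
      proof -
        have "(m * norm (X t a) - \<bar>n\<bar> * h)^2 = m * (m * (norm (X t a))^2) + n^2 * h^2 - m * (2 * (norm (X t a) * (\<bar>n\<bar> * h)))"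
          unfolding power2_diff power_mult_distrib power2_abs by (simp add: power2_eq_square)
        then show ?thesis using m by (simp add: add_divide_distrib diff_divide_distrib)
      qed
      finally show "2 * (X t a \<bullet> (- \<i> * n * H t a)) \<le> m * (X t a \<bullet> X t a) + n^2 * h^2 / m"
        using 1 unfolding power2_norm_eq_inner by linarith
    qed
    also have "\<dots> = Wt (\<lambda>a. m * (X t a \<bullet> X t a)) + Wt (\<lambda>a. n^2 * h^2 / m)"
      using t by (intro Wt_add continuous_intros)
    also have "\<dots> = m * E t + 5 * (n^2 * h^2 / m)"
      unfolding Wt_const E_def using t by (subst Wt_cmult) (intro continuous_intros, auto)
    finally show ?thesis unfolding h_def .
  qed
  have X0: "X 0 a = 0" for a using Minit by (simp add: X_def init P_def R_def)
  have E0: "E 0 = 0" by (simp add: E_def X0 Wt_def)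
  \<comment> \<open>\<open>K * exp (2 * m * t)\<close> solves the comparison equation
    \<open>y' = m * y + K * m * exp (2 * m * t)\<close>, so its difference with the energy, weighted
    by \<open>exp (- m * t)\<close>, cannot increase.\<close>
  define K where "K = 5 * (n^2 * (27 * \<Phi>)^2 / m^2)"
  have Eb: "E t \<le> 14580 * (\<Phi> * exp (m * t))^2" if t: "t \<ge> 0" for t
  proof -
    define G where "G t = E t * exp (- m * t) - K * exp (m * t)" for t
    have "G t \<le> G 0"
    proof (rule DERIV_nonpos_imp_decreasing_open[OF t])
      fix x assume x: "0 < x" "x < t"
      then have "at x within {0..} = at x" by (intro at_within_interior) auto
      then have "(E has_real_derivative E' x) (at x)" using dE[of x] x by simp
      then have "(G has_real_derivative (E' x - m * E x) * exp (- m * x) - K * m * exp (m * x)) (at x)"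
        unfolding G_def by (auto intro!: derivative_eq_intros simp: algebra_simps)
      moreover have "(E' x - m * E x) * exp (- m * x) - K * m * exp (m * x) \<le> 0"
      proof -
        have "(E' x - m * E x) * exp (- m * x) \<le> (5 * (n^2 * (27 * \<Phi> * exp (m * x))^2 / m)) * exp (- m * x)"
          using E'b[of x] x by (intro mult_right_mono) auto
        also have "\<dots> = K * m * (exp (m * x) * (exp (m * x) * exp (- m * x)))"
          using m by (simp add: K_def power2_eq_square field_simps)
        also have "\<dots> = K * m * exp (m * x)" by (simp flip: exp_add)
        finally show ?thesis by simp
      qed
      ultimately show "\<exists>y. (G has_real_derivative y) (at x) \<and> y \<le> 0" by blast
    next
      have "continuous_on {0..} E"
        using dE by (meson DERIV_continuous_on atLeast_iff)
      then have "continuous_on {0..t} E" by (rule continuous_on_subset) auto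
      then show "continuous_on {0..t} G" unfolding G_def by (intro continuous_intros)
    qed
    moreover have "K \<ge> 0" by (simp add: K_def)
    ultimately have "E t * exp (- m * t) \<le> K * exp (m * t)" by (simp add: G_def E0)
    then have "E t * exp (- m * t) * exp (m * t) \<le> K * exp (m * t) * exp (m * t)" by (intro mult_right_mono) auto
    then have "E t \<le> K * (exp (m * t))^2" by (simp add: mult.assoc power2_eq_square flip: exp_add)
    also have "\<dots> \<le> (14580 * \<Phi>^2) * (exp (m * t))^2"
    proof (rule mult_right_mono)
      \<comment> \<open>Here the frequency disappears: \<open>\<bar>n\<bar> \<le> 2 * m\<close>, and
        14580 is \<open>4 * 5 * 27\<^sup>2\<close>.\<close>
      have "\<bar>n\<bar> * (1/2) \<le> m" using mult_left_mono[of "1/2" s "\<bar>n\<bar>"] s m by simp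
      then have "(\<bar>n\<bar>)^2 \<le> (2 * m)^2" by (intro power_mono) auto
      then have "n^2 / m^2 \<le> 4" using m by (simp add: field_simps)
      then have "5 * 27^2 * \<Phi>^2 * (n^2 / m^2) \<le> 5 * 27^2 * \<Phi>^2 * 4" by (intro mult_left_mono) auto
      then show "K \<le> 14580 * \<Phi>^2" by (simp add: K_def power_mult_distrib field_simps)
    qed auto
    finally show ?thesis by (simp add: power_mult_distrib)
  qed
  have \<Lambda>b: "norm (\<Lambda> t) \<le> 407 * (\<Phi> * exp (m * t))" if t: "t \<ge> 0" and n: "n \<noteq> 0" for t
  proof -
    define e where "e = \<Phi> * exp (m * t)"
    have e: "e > 0" using \<Phi> by (simp add: e_def)
    \<comment> \<open>Differentiating the orthogonality relation gives an equation in which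
      \<open>\<Lambda>\<close> has coefficient 1 and a common factor \<open>n\<close> cancels, so no
      power of \<open>n\<close> is lost. The cancellation is where \<open>n \<noteq> 0\<close>
      enters.\<close>
    have "((\<lambda>t. Wt (\<lambda>a. of_real a * X t a)) has_vector_derivative Wt (\<lambda>a. of_real a * X' t a)) (at t within {0..})"
    proof (rule integral_deriv[OF _ _ _ t])
      fix t a :: real assume "t \<ge> 0"
      then show "((\<lambda>t. of_real a * X t a) has_vector_derivative of_real a * X' t a) (at t within {0..})"
        by (intro has_vector_derivative_mult_right dX)
    next
      fix t :: real assume "t \<ge> 0" then show "continuous_on {-1..1} (\<lambda>a. of_real a * X t a)" by (intro continuous_intros)
    next
      show "continuous_on ({0..} \<times> {-1..1}) (\<lambda>(t, a). of_real a * X' t a)"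
        unfolding split_beta by (intro continuous_intros X'c2)
    qed
    moreover have "((\<lambda>t. Wt (\<lambda>a. of_real a * X t a)) has_vector_derivative 0) (at t within {0..})"
      by (rule has_vector_derivative_transform[of t _ _ "\<lambda>t. 0"]) (use t WX in auto)
    ultimately have "Wt (\<lambda>a. of_real a * X' t a) = 0"
      using vector_derivative_unique_within[OF at_within_Ici_neq_bot[OF t]] by blast
    moreover have "Wt (\<lambda>a. of_real a * X' t a) = - \<i> * n * (Wt (\<lambda>a. (of_real a)^2 * X t a) + \<Lambda> t + Wt (\<lambda>a. of_real a * H t a))"
    proof -
      have k: "continuous_on {-1..1} (\<lambda>a. (of_real a)^2 * X t a)" "continuous_on {-1..1} (\<lambda>a. \<Lambda> t * (complex_of_real a)^2)"
         "continuous_on {-1..1} (\<lambda>a. of_real a * H t a)"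
        using t by (intro continuous_intros; assumption)+
      have e: "Wt (\<lambda>a. \<Lambda> t * (complex_of_real a)^2) = \<Lambda> t * 1"
        unfolding Wt_a2[symmetric] by (rule Wt_cmult, intro continuous_intros)
      have "Wt (\<lambda>a. of_real a * X' t a) = Wt (\<lambda>a. - \<i> * n * ((of_real a)^2 * X t a + \<Lambda> t * (of_real a)^2 + of_real a * H t a))"
        unfolding X'_def by (rule arg_cong[where f = Wt]) (simp add: fun_eq_iff power2_eq_square algebra_simps)
      also have "\<dots> = - \<i> * n * Wt (\<lambda>a. (of_real a)^2 * X t a + \<Lambda> t * (of_real a)^2 + of_real a * H t a)"
        using t by (intro Wt_cmult continuous_intros)
      finally show ?thesis unfolding Wt_add[OF continuous_on_add[OF k(1,2)] k(3)] Wt_add[OF k(1,2)] e by simp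
    qed
    ultimately have "- \<i> * n * (Wt (\<lambda>a. (of_real a)^2 * X t a) + \<Lambda> t + Wt (\<lambda>a. of_real a * H t a)) = 0"
      by (simp only:)
    then have "Wt (\<lambda>a. (of_real a)^2 * X t a) + \<Lambda> t + Wt (\<lambda>a. of_real a * H t a) = 0"
      using n by (auto simp only: mult_eq_0_iff) simp_all
    then have L: "\<Lambda> t = - (Wt (\<lambda>a. (of_real a)^2 * X t a) + Wt (\<lambda>a. of_real a * H t a))"
      by (simp only: eq_neg_iff_add_eq_0 add_ac)
    have 1: "norm (Wt (\<lambda>a. of_real a * H t a)) \<le> 5 * (27 * e)"
    proof -
      have "norm (Wt (\<lambda>a. of_real a * H t a)) \<le> Wt (\<lambda>a. norm (of_real a * H t a))"
        using t by (intro Wt_norm continuous_intros)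
      also have "\<dots> \<le> Wt (\<lambda>a. 27 * e)"
      proof (rule Wt_mono)
        show "continuous_on {-1..1} (\<lambda>a. norm (of_real a * H t a))" using t by (intro continuous_intros)
        fix a :: real assume a: "\<bar>a\<bar> \<le> 1"
        show "norm (of_real a * H t a) \<le> 27 * e"
          using mult_mono[OF a Hb[OF t a]] by (simp add: norm_mult e_def)
      qed (intro continuous_intros)
      finally show ?thesis by (simp add: Wt_const)
    qed
    have 2: "norm (Wt (\<lambda>a. (of_real a)^2 * X t a)) \<le> 272 * e"
    proof -
      have "norm (Wt (\<lambda>a. (of_real a)^2 * X t a)) \<le> Wt (\<lambda>a. norm ((of_real a)^2 * X t a))"
        using t by (intro Wt_norm continuous_intros)
      \<comment> \<open>Young's inequality in place of Cauchy-Schwarz: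
        \<open>y \<le> 30 * e + y\<^sup>2 / (120 * e)\<close>, with equality at
        \<open>y = 60 * e\<close>. The constants add up to
        \<open>150 + 14580 / 120 \<le> 272\<close>.\<close>
      also have "\<dots> \<le> Wt (\<lambda>a. 30 * e + (1 / (120 * e)) * (X t a \<bullet> X t a))"
      proof (rule Wt_mono)
        show "continuous_on {-1..1} (\<lambda>a. norm ((of_real a)^2 * X t a))" using t by (intro continuous_intros)
        show "continuous_on {-1..1} (\<lambda>a. 30 * e + (1 / (120 * e)) * (X t a \<bullet> X t a))" using t by (intro continuous_intros)
        fix a :: real assume a: "\<bar>a\<bar> \<le> 1"
        have "norm ((of_real a)^2 * X t a) \<le> 1 * norm (X t a)"
          unfolding norm_mult norm_power using a by (intro mult_right_mono) (auto simp: abs_square_le_1)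
        also have "\<dots> \<le> 30 * e + (1 / (120 * e)) * (norm (X t a))^2"
        proof -
          have "0 \<le> (norm (X t a) - 60 * e)^2 / (120 * e)" using e by simp
          also have "\<dots> = 30 * e + (1 / (120 * e)) * (norm (X t a))^2 - norm (X t a)"
            using e by (simp add: power2_diff field_simps power2_eq_square)
          finally show ?thesis by simp
        qed
        finally show "norm ((of_real a)^2 * X t a) \<le> 30 * e + (1 / (120 * e)) * (X t a \<bullet> X t a)"
          by (simp add: power2_norm_eq_inner)
      qed
      also have "\<dots> = 5 * (30 * e) + (1 / (120 * e)) * E t"
      proof -
        have k: "continuous_on {-1..1} (\<lambda>a. 30 * e)" "continuous_on {-1..1} (\<lambda>a. (1 / (120 * e)) * (X t a \<bullet> X t a))"
            "continuous_on {-1..1} (\<lambda>a. X t a \<bullet> X t a)"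
          using t by (intro continuous_intros; assumption)+
        show ?thesis unfolding Wt_add[OF k(1,2)] Wt_const E_def Wt_cmult[OF k(3)] by (rule refl)
      qed
      also have "\<dots> \<le> 5 * (30 * e) + (1 / (120 * e)) * (14580 * e^2)"
        using Eb[OF t] e by (intro add_left_mono mult_left_mono) (auto simp: e_def)
      also have "\<dots> \<le> 272 * e" using e by (simp add: power2_eq_square)
      finally show ?thesis .
    qed
    show ?thesis unfolding L norm_minus_cancel using norm_triangle_mono[OF 2 1] by (simp add: e_def)
  qed
  define q where "q = s - 1/2"
  have q: "q > 0" using s by (simp add: q_def)
  have Pb: "norm (P t) \<le> 860 / q * \<Phi> * exp (m * t)" if t: "t \<ge> 0" and n: "n \<noteq> 0" for t
  proof -
    \<comment> \<open>These combinations diagonalise the system, with rates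
      \<open>- \<sigma> * n / 2\<close>. Their source carries a factor \<open>\<bar>n\<bar>\<close>,
      and so does the gap \<open>m - \<bar>n\<bar> / 2 \<ge> \<bar>n\<bar> * (s - 1 / 2)\<close>;
      the quotient is free of \<open>n\<close>.\<close>
    have Z: "norm (P t / 2 + \<sigma> * \<i> * R t) \<le> 430 / q * \<Phi> * exp (m * t)" if \<sigma>: "\<sigma> = 1 \<or> \<sigma> = -1" for \<sigma> :: complex
    proof -
      define h where "h t = - \<i> * n / 2 * \<phi>1 t + \<sigma> * n * (\<Lambda> t + \<phi>2 t)" for t
      have m2: "\<bar>n\<bar> * q \<le> m - \<bar>n\<bar> / 2" using m by (simp add: q_def algebra_simps)
      have nq: "\<bar>n\<bar> * q > 0" using n q by simp
      have "norm (P t / 2 + \<sigma> * \<i> * R t) \<le> (430 * \<bar>n\<bar> * \<Phi>) / (m - \<bar>n\<bar> / 2) * exp (m * t)"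
      proof (rule gronwall_exp[where c = "- \<sigma> * n / 2" and h = h])
        show "P 0 / 2 + \<sigma> * \<i> * R 0 = 0" using Minit by (simp add: P_def R_def)
        show "Re (- \<sigma> * n / 2) \<le> \<bar>n\<bar> / 2" using \<sigma> by auto
        show "\<bar>n\<bar> / 2 < m" using m2 nq by linarith
        show "t \<ge> 0" by fact
      next
        fix t :: real assume t: "t \<ge> 0"
        have "((\<lambda>t. P t / 2 + \<sigma> * \<i> * R t) has_vector_derivative
          (- \<i> * n * (R t + \<phi>1 t)) / 2 + \<sigma> * \<i> * (- \<i> * n * (\<Lambda> t - P t / 4 + \<phi>2 t))) (at t within {0..})"
          by (intro has_vector_derivative_add has_vector_derivative_divide has_vector_derivative_mult_right dP dR t)
        moreover have "(- \<i> * n * (R t + \<phi>1 t)) / 2 + \<sigma> * \<i> * (- \<i> * n * (\<Lambda> t - P t / 4 + \<phi>2 t))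
           = - \<sigma> * n / 2 * (P t / 2 + \<sigma> * \<i> * R t) + h t"
          using \<sigma> by (auto simp: h_def field_simps)
        ultimately show "((\<lambda>t. P t / 2 + \<sigma> * \<i> * R t) has_vector_derivative
            - \<sigma> * n / 2 * (P t / 2 + \<sigma> * \<i> * R t) + h t) (at t within {0..})" by simp
        define e where "e = \<Phi> * exp (m * t)"
        have e: "e > 0" using \<Phi> by (simp add: e_def)
        have 1: "norm (- \<i> * n / 2 * \<phi>1 t) \<le> \<bar>n\<bar> * (25/4 * e)"
          using mult_left_mono[OF fmb[OF t, of 1], of "\<bar>n\<bar>"] by (simp add: norm_mult norm_divide \<phi>1_def e_def)
        have "norm (\<phi>2 t) \<le> 25/2 * e" using fmb[OF t, of 2] by (simp add: norm_divide \<phi>2_def e_def)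
        with \<Lambda>b[OF t n] have "norm (\<Lambda> t + \<phi>2 t) \<le> 407 * e + 25/2 * e"
          unfolding e_def by (rule norm_triangle_mono)
        from mult_left_mono[OF this, of "\<bar>n\<bar>"] have 2: "norm (\<sigma> * n * (\<Lambda> t + \<phi>2 t)) \<le> \<bar>n\<bar> * (407 * e + 25/2 * e)"
          using \<sigma> by (auto simp: norm_mult)
        have "norm (h t) \<le> \<bar>n\<bar> * (25/4 * e) + \<bar>n\<bar> * (407 * e + 25/2 * e)"
          unfolding h_def by (rule norm_triangle_mono[OF 1 2])
        also have "\<dots> \<le> 430 * (\<bar>n\<bar> * e)" using mult_nonneg_nonneg[of "\<bar>n\<bar>" e] e by (simp add: algebra_simps)
        finally show "norm (h t) \<le> 430 * \<bar>n\<bar> * \<Phi> * exp (m * t)" by (simp add: e_def mult_ac)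
      qed
      also have "(430 * \<bar>n\<bar> * \<Phi>) / (m - \<bar>n\<bar> / 2) \<le> (430 * \<bar>n\<bar> * \<Phi>) / (\<bar>n\<bar> * q)"
      proof -
        have "m - \<bar>n\<bar> / 2 > 0" using m2 nq by linarith
        then show ?thesis using m2 nq \<Phi> by (intro divide_left_mono) auto
      qed
      also have "(430 * \<bar>n\<bar> * \<Phi>) / (\<bar>n\<bar> * q) = 430 / q * \<Phi>" using n by simp
      finally show ?thesis by simp
    qed
    have "P t = (P t / 2 + 1 * \<i> * R t) + (P t / 2 + (-1) * \<i> * R t)" by simp
    also have "norm \<dots> \<le> 430 / q * \<Phi> * exp (m * t) + 430 / q * \<Phi> * exp (m * t)"
      by (rule norm_triangle_mono[OF Z Z]) auto
    finally show ?thesis by simp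
  qed
  define C where "C = 860 / q"
  have C: "C > 0" using q by (simp add: C_def)
  have nm: "\<bar>n\<bar> / m \<le> 2"
  proof -
    have "\<bar>n\<bar> * (1/2) \<le> m" using mult_left_mono[of "1/2" s "\<bar>n\<bar>"] s m by simp
    then show ?thesis using m by (simp add: field_simps)
  qed
  \<comment> \<open>For a single label the rate \<open>- \<i> * n * a\<close> is imaginary, so the
    whole of \<open>m\<close> serves as the gap, and
    \<open>\<bar>n\<bar> / m \<le> 2\<close>.\<close>
  have g: "norm (y t) \<le> 2 * K * \<Phi> * exp (m * t)"
    if y: "\<And>t. t \<ge> 0 \<Longrightarrow> (y has_vector_derivative - \<i> * n * a * y t + - \<i> * n * h t) (at t within {0..})"
      and y0: "y 0 = 0" and h: "\<And>t. t \<ge> 0 \<Longrightarrow> n \<noteq> 0 \<Longrightarrow> norm (h t) \<le> K * \<Phi> * exp (m * t)" and t: "t \<ge> 0" and K: "K \<ge> 0"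
    for y h K t and a :: real
  proof -
    have "norm (y t) \<le> (\<bar>n\<bar> * (K * \<Phi>)) / (m - 0) * exp (m * t)"
    proof (rule gronwall_exp[OF y y0 _ _ m(1) t])
      fix t :: real assume t: "t \<ge> 0"
      show "norm (- \<i> * n * h t) \<le> \<bar>n\<bar> * (K * \<Phi>) * exp (m * t)"
      proof (cases "n = 0")
        case False
        from mult_left_mono[OF h[OF t False], of "\<bar>n\<bar>"] show ?thesis by (simp add: norm_mult mult_ac)
      qed auto
    qed auto
    also have "\<dots> = (\<bar>n\<bar> / m) * (K * \<Phi> * exp (m * t))" by simp
    also have "\<dots> \<le> 2 * (K * \<Phi> * exp (m * t))" using nm K \<Phi> by (intro mult_right_mono) auto
    finally show ?thesis by simp
  qed
  have \<eta>b: "norm (\<eta> t a) \<le> 2 * (2 * C + 1) * \<Phi> * exp (m * t)" if t: "t \<ge> 0" and a: "\<bar>a\<bar> \<le> 2" for t a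
  proof (rule g[where y = "\<lambda>t. \<eta> t a" and h = "\<lambda>t. of_real a * P t + F t a" and a = a])
    fix t :: real assume t: "t \<ge> 0"
    show "((\<lambda>t. \<eta> t a) has_vector_derivative - \<i> * n * a * \<eta> t a + - \<i> * n * (of_real a * P t + F t a)) (at t within {0..})"
      using d[OF t, of a] by (simp add: P_def algebra_simps)
    assume n: "n \<noteq> 0"
    have "norm (of_real a * P t) \<le> 2 * (C * \<Phi> * exp (m * t))"
      unfolding norm_mult using Pb[OF t n] a by (intro mult_mono) (auto simp: C_def)
    with Fb[OF t a] have "norm (of_real a * P t + F t a) \<le> 2 * (C * \<Phi> * exp (m * t)) + \<Phi> * exp (m * t)"
      by (intro norm_triangle_mono)
    then show "norm (of_real a * P t + F t a) \<le> (2 * C + 1) * \<Phi> * exp (m * t)" by (simp add: algebra_simps)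
  qed (use t C init in auto)
  have CC: "8600 / (s - 1/2) = 10 * C" by (simp add: C_def q_def)
  show "norm (\<eta> t a) \<le> (8600 / (s - 1/2) + 6) * \<Phi> * exp (m * t)" if t: "t \<ge> 0" and a: "\<bar>a\<bar> \<le> 2" for t a
  proof (rule order_trans[OF \<eta>b[OF t a]])
    show "2 * (2 * C + 1) * \<Phi> * exp (m * t) \<le> (8600 / (s - 1/2) + 6) * \<Phi> * exp (m * t)"
      unfolding CC using C \<Phi> by (intro mult_right_mono) auto
  qed
  show "norm (Da \<eta> t a) \<le> (8600 / (s - 1/2) + 6) * \<Phi> * exp (m * t)" if t: "t \<ge> 0" and a: "\<bar>a\<bar> \<le> 2" for t a
  proof -
    have "norm (Da \<eta> t a) \<le> 2 * (5 * C + 3) * \<Phi> * exp (m * t)"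
    proof (rule g[where y = "\<lambda>t. Da \<eta> t a" and h = "\<lambda>t. \<eta> t a + P t + Da F t a" and a = a])
      fix t :: real assume t: "t \<ge> 0"
      show "((\<lambda>t. Da \<eta> t a) has_vector_derivative - \<i> * n * a * Da \<eta> t a + - \<i> * n * (\<eta> t a + P t + Da F t a)) (at t within {0..})"
        using dD[OF t, of a] by (simp add: P_def algebra_simps)
      assume n: "n \<noteq> 0"
      have "norm (\<eta> t a + P t + Da F t a) \<le> 2 * (2 * C + 1) * \<Phi> * exp (m * t) + C * \<Phi> * exp (m * t) + \<Phi> * exp (m * t)"
        using Pb[OF t n] by (intro norm_triangle_mono \<eta>b t a DFb) (auto simp: C_def)
      then show "norm (\<eta> t a + P t + Da F t a) \<le> (5 * C + 3) * \<Phi> * exp (m * t)" by (simp add: algebra_simps)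
    qed (use t C init in auto)
    then show ?thesis unfolding CC by (simp add: algebra_simps)
  qed
qed

section \<open>Coefficients of the power series\<close>

type_synonym family = "nat \<Rightarrow> nat \<Rightarrow> real \<Rightarrow> real \<Rightarrow> complex"

definition conv :: "family \<Rightarrow> family \<Rightarrow> family" where
  "conv G H p q t a = (\<Sum>i\<le>p. \<Sum>j\<le>q. G i j t a * H (p - i) (q - j) t a)"

definition kap :: "family \<Rightarrow> family" where
  "kap G p q t a = Idf (conv G G p q t) / 4"

definition Flux :: "family \<Rightarrow> family" where
  "Flux G p q t a = conv G G p q t a / 2 + conv (kap G) G p q t a"

text \<open>For \<open>w = a + G\<close> the background contributes nothing to
  \<open>\<kappa>\<close>, because \<open>Idf\<close> of \<open>a\<^sup>2\<close> vanishes; the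
  cross term and the square remain.\<close>

definition kap_pert :: "family \<Rightarrow> family" where
  "kap_pert G p q t a = Idf (\<lambda>a. of_real a * G p q t a) / 2 + Idf (conv G G p q t) / 4"

text \<open>What the flux at \<open>w = a + G\<close> leaves after \<open>a\<^sup>2 / 2\<close> and
  the part linear in \<open>G\<close>: the terms of degree two and three.\<close>

definition Flux_pert :: "family \<Rightarrow> family" where
  "Flux_pert G p q t a = conv G G p q t a / 2 + of_real a * (Idf (conv G G p q t) / 4) + conv (kap_pert G) G p q t a"

definition linear_sol :: "real \<Rightarrow> (real \<Rightarrow> real \<Rightarrow> complex) \<Rightarrow> (real \<Rightarrow> real \<Rightarrow> complex) \<Rightarrow> bool" where
  "linear_sol n F \<eta> \<longleftrightarrow> reg \<eta> \<and> (\<forall>a. \<eta> 0 a = 0 \<and> Da \<eta> 0 a = 0) \<and> (\<forall>t\<ge>0. \<forall>a.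
     ((\<lambda>t. \<eta> t a) has_vector_derivative
        - \<i> * n * (of_real a * \<eta> t a + of_real a * (Idf (\<lambda>a. of_real a * \<eta> t a) / 2) + F t a)) (at t within {0..}) \<and>
     ((\<lambda>t. Da \<eta> t a) has_vector_derivative
        - \<i> * n * (of_real a * Da \<eta> t a + \<eta> t a + Idf (\<lambda>a. of_real a * \<eta> t a) / 2 + Da F t a)) (at t within {0..}))"

definition Sol :: "real \<Rightarrow> (real \<Rightarrow> real \<Rightarrow> complex) \<Rightarrow> real \<Rightarrow> real \<Rightarrow> complex" where
  "Sol n F = (SOME \<eta>. linear_sol n F \<eta>)"

definition seed :: "real \<Rightarrow> real \<Rightarrow> complex" where
  "seed t a = of_real (exp (t / 2)) * (of_real a / (of_real a - \<i> / 2))"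

text \<open>\<open>E p q\<close> is the coefficient of \<open>d ^ (p + q) * cis ((p - q) * x)\<close> in the expansion of \<open>w\<close> in powers of the
  amplitude \<open>d\<close>.\<close>

function E :: family where
  "E p q = (if p = q then (if p = 0 then (\<lambda>t a. of_real a) else (\<lambda>t a. 0))
     else if p < q then (\<lambda>t a. cnj (E q p t a))
     else if p + q = 1 then seed
     else Sol (real p - real q) (Flux_pert (\<lambda>i j. if i + j = 0 then (\<lambda>t a. 0)
       else if i + j < p + q then E i j else (\<lambda>t a. 0)) p q))"
  by pat_completeness auto
termination
  by (relation "measures [\<lambda>(p, q). p + q, \<lambda>(p, q). q]") auto

declare E.simps [simp del]

text \<open>Both the background of order 0 and the orders from \<open>m\<close> on are removed: a
  source built from this involves only coefficients that are already known at order
  \<open>m\<close>.\<close>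

definition trunc :: "nat \<Rightarrow> family \<Rightarrow> family" where
  "trunc m G i j = (if i + j = 0 then (\<lambda>t a. 0) else if i + j < m then G i j else (\<lambda>t a. 0))"

lemma E_00: "E 0 0 t a = a" by (simp add: E.simps)
text \<open>The equation is an exact \<open>x\<close>-derivative, so frequency 0 never changes, and
  its corrections start from zero.\<close>

lemma E_diag: "p > 0 \<Longrightarrow> E p p t a = 0" by (simp add: E.simps)
lemma E_cnj: "E q p t a = cnj (E p q t a)"
proof (cases "p = q")
  case True then show ?thesis by (simp add: E.simps)
next
  case False
  then consider "p < q" | "q < p" by linarith
  then show ?thesis
  proof cases
    case 1 then show ?thesis using E.simps[of p q] by simp
  next
    case 2 then show ?thesis using E.simps[of q p] by simp
  qed
qed
lemma E_10: "E 1 0 = seed" by (subst E.simps) simp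
lemma E_Sol: "q < p \<Longrightarrow> 2 \<le> p + q \<Longrightarrow> E p q = Sol (real p - real q) (Flux_pert (trunc (p + q) E) p q)"
  by (subst E.simps) (simp add: trunc_def[abs_def])

section \<open>Bounds that are stable under Cauchy products\<close>

definition wgt :: "nat \<Rightarrow> real" where "wgt p = 1 / (real p + 1)^2"

lemma wgt_pos: "wgt p > 0" by (simp add: wgt_def add_pos_pos)

lemma sum_wgt: "(\<Sum>i\<le>p. wgt i) \<le> 2 - 1 / (real p + 1)"
proof (induction p)
  case 0 then show ?case by (simp add: wgt_def)
next
  case (Suc p)
  have "1 / (real p + 2)^2 \<le> 1 / ((real p + 1) * (real p + 2))"
    by (intro divide_left_mono) (auto simp: power2_eq_square intro!: mult_right_mono mult_pos_pos add_nonneg_pos)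
  also have "\<dots> = 1 / (real p + 1) - 1 / (real p + 2)" by (simp add: field_simps)
  finally have "wgt (Suc p) \<le> 1 / (real p + 1) - 1 / (real p + 2)" by (simp add: wgt_def add_ac)
  with Suc show ?case by (simp add: add_ac)
qed

text \<open>As \<open>(u + v)\<^sup>2 \<le> 2 * (u\<^sup>2 + v\<^sup>2)\<close>, each product is at
  most \<open>2 * wgt p\<close> times the sum of its two weights, and all weights together amount to
  at most 2.\<close>

lemma wgt_conv: "(\<Sum>i\<le>p. wgt i * wgt (p - i)) \<le> 8 * wgt p"
proof -
  have "wgt i * wgt (p - i) \<le> 2 * wgt p * (wgt i + wgt (p - i))" if i: "i \<le> p" for i
  proof -
    define u v where "u = real i + 1" and "v = real (p - i) + 1"
    have uv: "u > 0" "v > 0" "u + v = real p + 2" using i by (auto simp: u_def v_def)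
    have "1 / (u^2 * v^2) * (real p + 1)^2 \<le> 1 / (u^2 * v^2) * (u + v)^2"
      using uv by (intro mult_left_mono power_mono) auto
    also have "\<dots> \<le> 1 / (u^2 * v^2) * (2 * (u^2 + v^2))"
      using sum_squares_bound[of u v] by (intro mult_left_mono) (auto simp: power2_sum)
    also have "\<dots> = 2 * (1 / u^2 + 1 / v^2)" using uv by (simp add: field_simps)
    finally have "1 / (u^2 * v^2) \<le> 2 * (1 / u^2 + 1 / v^2) / (real p + 1)^2"
      by (subst pos_le_divide_eq) auto
    then show ?thesis by (simp add: wgt_def u_def v_def)
  qed
  then have "(\<Sum>i\<le>p. wgt i * wgt (p - i)) \<le> (\<Sum>i\<le>p. 2 * wgt p * (wgt i + wgt (p - i)))"
    by (intro sum_mono) auto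
  also have "\<dots> = 2 * wgt p * ((\<Sum>i\<le>p. wgt i) + (\<Sum>i\<le>p. wgt (p - i)))"
    by (simp add: sum.distrib sum_distrib_left distrib_left)
  also have "(\<Sum>i\<le>p. wgt (p - i)) = (\<Sum>i\<le>p. wgt i)"
    by (rule sum.nat_diff_reindex[of "\<lambda>i. wgt i" "Suc p", simplified lessThan_Suc_atMost diff_Suc_1', simplified])
  also have "2 * wgt p * ((\<Sum>i\<le>p. wgt i) + (\<Sum>i\<le>p. wgt i)) \<le> 2 * wgt p * (2 + 2)"
  proof -
    have "(\<Sum>i\<le>p. wgt i) \<le> 2" by (rule order_trans[OF sum_wgt]) simp
    then show ?thesis using wgt_pos[of p] by (intro mult_left_mono add_mono) auto
  qed
  finally show ?thesis by simp
qed

definition bd :: "real \<Rightarrow> real \<Rightarrow> (real \<Rightarrow> real \<Rightarrow> complex) \<Rightarrow> bool" where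
  "bd M m G \<longleftrightarrow> (\<forall>t\<ge>0. \<forall>a. \<bar>a\<bar> \<le> 2 \<longrightarrow> norm (G t a) \<le> M * exp (m * t) \<and> norm (Da G t a) \<le> M * exp (m * t))"

lemma bdD: "bd M m G \<Longrightarrow> t \<ge> 0 \<Longrightarrow> \<bar>a\<bar> \<le> 2 \<Longrightarrow> norm (G t a) \<le> M * exp (m * t)"
  "bd M m G \<Longrightarrow> t \<ge> 0 \<Longrightarrow> \<bar>a\<bar> \<le> 2 \<Longrightarrow> norm (Da G t a) \<le> M * exp (m * t)"
  by (auto simp: bd_def)

lemma bd_nonneg: "bd M m G \<Longrightarrow> 0 \<le> M"
  using bdD(1)[of M m G 0 0] by (simp add: order_trans[OF norm_ge_zero])

lemma bd_mono: "bd M m G \<Longrightarrow> M \<le> M' \<Longrightarrow> bd M' m G"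
  unfolding bd_def by (meson exp_ge_zero mult_right_mono order_trans)

lemma bd_add:
  assumes "reg G" "reg H" "bd M m G" "bd N m H"
  shows "bd (M + N) m (\<lambda>t a. G t a + H t a)"
  unfolding bd_def using assms(3,4)
  by (auto simp: reg_add(2)[OF assms(1,2)] distrib_right intro!: norm_triangle_mono bdD)

lemma bd_mult:
  assumes "reg G" "reg H" "bd M m G" "bd N l H"
  shows "bd (2 * M * N) (m + l) (\<lambda>t a. G t a * H t a)"
  unfolding bd_def
proof (intro allI impI conjI)
  fix t a :: real assume t: "t \<ge> 0" and a: "\<bar>a\<bar> \<le> 2"
  have *: "norm x * norm y \<le> M * N * exp ((m + l) * t)"
    if "norm x \<le> M * exp (m * t)" "norm y \<le> N * exp (l * t)" for x y :: complex
  proof -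
    have "norm x * norm y \<le> (M * exp (m * t)) * (N * exp (l * t))"
      using that bd_nonneg[OF assms(3)] by (intro mult_mono) auto
    moreover have "exp ((m + l) * t) = exp (m * t) * exp (l * t)" by (simp add: distrib_right exp_add)
    ultimately show ?thesis by (simp add: mult_ac)
  qed
  have nn: "0 \<le> M * N * exp ((m + l) * t)" using bd_nonneg[OF assms(3)] bd_nonneg[OF assms(4)] by simp
  show "norm (G t a * H t a) \<le> 2 * M * N * exp ((m + l) * t)"
    using *[OF bdD(1)[OF assms(3) t a] bdD(1)[OF assms(4) t a]] nn by (simp add: norm_mult)
  have "norm (G t a * Da H t a + Da G t a * H t a) \<le> M * N * exp ((m + l) * t) + M * N * exp ((m + l) * t)"
    using *[OF bdD(1)[OF assms(3) t a] bdD(2)[OF assms(4) t a]] *[OF bdD(2)[OF assms(3) t a] bdD(1)[OF assms(4) t a]]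
    by (intro norm_triangle_mono) (auto simp: norm_mult)
  then show "norm (Da (\<lambda>t a. G t a * H t a) t a) \<le> 2 * M * N * exp ((m + l) * t)"
    by (simp add: reg_mult(2)[OF assms(1,2) t])
qed

lemma bd_sum:
  assumes "finite S" "\<And>i. i \<in> S \<Longrightarrow> reg (G i)" "\<And>i. i \<in> S \<Longrightarrow> bd (M i) m (G i)"
  shows "bd (\<Sum>i\<in>S. M i) m (\<lambda>t a. \<Sum>i\<in>S. G i t a)"
  unfolding bd_def
  using reg_sum[of S G] assms(1,2)
  by (auto simp: sum_distrib_right intro!: sum_norm_le bdD assms(3))

text \<open>The rate \<open>(p + q) * s\<close> is additive, hence stable under products, and it
  dominates the rate \<open>\<bar>p - q\<bar> * s\<close> that the linear estimate requires at
  frequency \<open>p - q\<close>. The weights keep one constant \<open>M\<close> through all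
  orders.\<close>

definition fam_bd :: "real \<Rightarrow> real \<Rightarrow> real \<Rightarrow> family \<Rightarrow> bool" where
  "fam_bd B s M G \<longleftrightarrow> (\<forall>p q. reg (G p q) \<and> bd (M * (B^(p + q) * wgt p * wgt q)) (real (p + q) * s) (G p q))"

lemma fam_bdD: "fam_bd B s M G \<Longrightarrow> reg (G p q)"
   "fam_bd B s M G \<Longrightarrow> bd (M * (B^(p + q) * wgt p * wgt q)) (real (p + q) * s) (G p q)"
  by (auto simp: fam_bd_def)

lemma conv_reg:
  assumes "\<And>i j. reg (G i j)" "\<And>i j. reg (H i j)"
  shows "reg (conv G H p q)"
proof -
  have "reg (\<lambda>t a. \<Sum>i\<le>p. \<Sum>j\<le>q. G i j t a * H (p - i) (q - j) t a)"
    by (intro conjunct1[OF reg_sum] finite_atMost reg_mult(1) assms)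
  then show ?thesis by (simp add: conv_def[abs_def])
qed

text \<open>The Leibniz rule for the label derivative costs a factor 2, and each of the two indices
  a factor 8 by \<open>wgt_conv\<close>; the powers of \<open>B\<close> and the rates add up
  exactly.\<close>

lemma conv_fam_bd:
  assumes G: "fam_bd B s M G" and H: "fam_bd B s N H" and B: "B \<ge> 0" and M: "M \<ge> 0" "N \<ge> 0"
  shows "fam_bd B s (128 * M * N) (conv G H)"
  unfolding fam_bd_def
proof (intro allI conjI)
  fix p q
  note rG = fam_bdD(1)[OF G] and rH = fam_bdD(1)[OF H]
  show "reg (conv G H p q)" by (rule conv_reg[OF rG rH])
  define L where "L i j = 2 * (M * (B^(i + j) * wgt i * wgt j)) * (N * (B^((p - i) + (q - j)) * wgt (p - i) * wgt (q - j)))" for i j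
  have 1: "bd (L i j) (real (p + q) * s) (\<lambda>t a. G i j t a * H (p - i) (q - j) t a)" if "i \<le> p" "j \<le> q" for i j
  proof -
    have "real (i + j) * s + real ((p - i) + (q - j)) * s = real (p + q) * s"
      using that by (simp add: algebra_simps of_nat_diff)
    then show ?thesis
      using bd_mult[OF rG rH fam_bdD(2)[OF G, of i j] fam_bdD(2)[OF H, of "p - i" "q - j"]] by (simp add: L_def)
  qed
  have 2: "bd (\<Sum>i\<le>p. \<Sum>j\<le>q. L i j) (real (p + q) * s) (\<lambda>t a. \<Sum>i\<le>p. \<Sum>j\<le>q. G i j t a * H (p - i) (q - j) t a)"
    by (intro bd_sum conjunct1[OF reg_sum] finite_atMost reg_mult(1) rG rH 1) auto
  have "(\<Sum>i\<le>p. \<Sum>j\<le>q. L i j) = 2 * M * N * B^(p + q) * ((\<Sum>i\<le>p. wgt i * wgt (p - i)) * (\<Sum>j\<le>q. wgt j * wgt (q - j)))"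
    unfolding sum_product unfolding sum_distrib_left
  proof (rule sum.cong[OF refl], rule sum.cong[OF refl])
    fix i j assume "i \<in> {..p}" "j \<in> {..q}"
    then have "B^(i + j) * B^((p - i) + (q - j)) = B^(p + q)" by (simp flip: power_add)
    then show "L i j = 2 * M * N * B ^ (p + q) * (wgt i * wgt (p - i) * (wgt j * wgt (q - j)))"
      by (simp add: L_def mult_ac)
  qed
  also have "\<dots> \<le> 2 * M * N * B^(p + q) * ((8 * wgt p) * (8 * wgt q))"
  proof (intro mult_left_mono mult_mono wgt_conv)
    show "0 \<le> 8 * wgt p" using wgt_pos[of p] by simp
    show "0 \<le> (\<Sum>j\<le>q. wgt j * wgt (q - j))"
      by (intro sum_nonneg mult_nonneg_nonneg less_imp_le wgt_pos)
    show "0 \<le> 2 * M * N * B ^ (p + q)" using B M by simp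
  qed
  finally have "(\<Sum>i\<le>p. \<Sum>j\<le>q. L i j) \<le> 128 * M * N * (B^(p + q) * wgt p * wgt q)" by (simp add: mult_ac)
  from bd_mono[OF 2 this] show "bd (128 * M * N * (B ^ (p + q) * wgt p * wgt q)) (real (p + q) * s) (conv G H p q)"
    by (simp add: conv_def[abs_def])
qed

lemma Idf_bd:
  assumes "reg G" "bd M m G" "t \<ge> 0"
  shows "norm (Idf (G t)) \<le> 25 * M * exp (m * t)"
  using Idf_bound[OF reg_cont1[OF assms(1,3)], of "M * exp (m * t)"] bdD(1)[OF assms(2,3)] by simp

lemma Idf_fam_bd:
  assumes G: "fam_bd B s M G" 
  shows "fam_bd B s (25 * M) (\<lambda>p q t a. Idf (G p q t))"
  unfolding fam_bd_def
proof (intro allI conjI)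
  fix p q
  note c = Idf_time_cont[OF fam_bdD(1)[OF G, of p q]]
  show "reg (\<lambda>t a. Idf (G p q t))" using reg_time(1)[OF c] .
  have "0 \<le> M * (B ^ (p + q) * wgt p * wgt q)" by (rule bd_nonneg[OF fam_bdD(2)[OF G]])
  then have nn: "0 \<le> 25 * M * (B ^ (p + q) * wgt p * wgt q) * exp (real (p + q) * s * t)" for t
    by (metis mult.assoc mult_nonneg_nonneg exp_ge_zero zero_le_numeral)
  show "bd (25 * M * (B ^ (p + q) * wgt p * wgt q)) (real (p + q) * s) (\<lambda>t a. Idf (G p q t))"
    unfolding bd_def reg_time(2)[OF c] norm_zero
    using Idf_bd[OF fam_bdD[OF G, of p q]] nn by (auto simp: mult.assoc)
qed

lemma fam_bd_mono:
  assumes "fam_bd B s M G" "M \<le> N" "B \<ge> 0"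
  shows "fam_bd B s N G"
  unfolding fam_bd_def
proof (intro allI conjI)
  fix p q
  show "reg (G p q)" by (rule fam_bdD(1)[OF assms(1)])
  have "0 \<le> B ^ (p + q) * wgt p * wgt q" using assms(3) wgt_pos[of p] wgt_pos[of q] by simp
  from bd_mono[OF fam_bdD(2)[OF assms(1)] mult_right_mono[OF assms(2) this]]
  show "bd (N * (B ^ (p + q) * wgt p * wgt q)) (real (p + q) * s) (G p q)" .
qed

lemma fam_bd_add:
  assumes "fam_bd B s M G" "fam_bd B s N H"
  shows "fam_bd B s (M + N) (\<lambda>p q t a. G p q t a + H p q t a)"
  using bd_add[OF fam_bdD(1)[OF assms(1)] fam_bdD(1)[OF assms(2)] fam_bdD(2)[OF assms(1)] fam_bdD(2)[OF assms(2)]]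
    reg_add(1)[OF fam_bdD(1)[OF assms(1)] fam_bdD(1)[OF assms(2)]]
  unfolding fam_bd_def by (simp add: distrib_right)

lemma fam_bd_cmult:
  assumes "fam_bd B s M G"
  shows "fam_bd B s (norm c * M) (\<lambda>p q t a. c * G p q t a)"
  unfolding fam_bd_def bd_def
proof (intro allI impI conjI)
  fix p q show r: "reg (\<lambda>t a. c * G p q t a)" by (intro reg_mult(1) reg_const fam_bdD(1)[OF assms])
  fix t a :: real assume t: "t \<ge> 0" and a: "\<bar>a\<bar> \<le> 2"
  show "norm (c * G p q t a) \<le> norm c * M * (B ^ (p + q) * wgt p * wgt q) * exp (real (p + q) * s * t)"
    using mult_left_mono[OF bdD(1)[OF fam_bdD(2)[OF assms] t a], of "norm c"] by (simp add: norm_mult mult_ac)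
  show "norm (Da (\<lambda>t a. c * G p q t a) t a) \<le> norm c * M * (B ^ (p + q) * wgt p * wgt q) * exp (real (p + q) * s * t)"
    using mult_left_mono[OF bdD(2)[OF fam_bdD(2)[OF assms] t a], of "norm c"]
    by (simp add: norm_mult mult_ac reg_mult(2)[OF reg_const(1) fam_bdD(1)[OF assms] t] reg_const)
qed

lemma fam_bd_amult:
  assumes "fam_bd B s M G"
  shows "fam_bd B s (4 * M) (\<lambda>p q t a. of_real a * G p q t a)"
  unfolding fam_bd_def
proof (intro allI conjI)
  fix p q show "reg (\<lambda>t a. of_real a * G p q t a)" by (intro reg_mult(1) reg_id fam_bdD(1)[OF assms])
  have "bd 2 0 (\<lambda>t a. of_real a)" by (auto simp: bd_def Da_id)
  from bd_mult[OF reg_id fam_bdD(1)[OF assms] this fam_bdD(2)[OF assms]]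
  show "bd (4 * M * (B ^ (p + q) * wgt p * wgt q)) (real (p + q) * s) (\<lambda>t a. of_real a * G p q t a)"
    by (simp add: mult_ac)
qed

text \<open>Splits off the two products in which a coefficient of index \<open>(p, q)\<close> meets
  the background; all others involve lower orders only.\<close>

lemma conv_split:
  assumes "p + q \<ge> 1"
  shows "conv G H p q t a = G 0 0 t a * H p q t a + G p q t a * H 0 0 t a
     + conv (trunc (p + q) G) (trunc (p + q) H) p q t a"
proof -
  define S where "S = {..p} \<times> {..q}"
  define g where "g x = G (fst x) (snd x) t a * H (p - fst x) (q - snd x) t a" for x
  define h where "h x = trunc (p + q) G (fst x) (snd x) t a * trunc (p + q) H (p - fst x) (q - snd x) t a" for x
  have fin: "finite S" by (simp add: S_def)
  have cg: "conv G H p q t a = sum g S"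
    by (simp add: conv_def g_def S_def sum.cartesian_product split_beta)
  have ch: "conv (trunc (p + q) G) (trunc (p + q) H) p q t a = sum h S"
    by (simp add: conv_def h_def S_def sum.cartesian_product split_beta)
  have ne: "(0, 0) \<noteq> (p, q)" using assms by auto
  have mem: "(0, 0) \<in> S" "(p, q) \<in> S - {(0, 0)}" using ne by (auto simp: S_def)
  have h0: "h (0, 0) = 0" "h (p, q) = 0" by (auto simp: h_def trunc_def)
  have "h x = g x" if "x \<in> S - {(0, 0)} - {(p, q)}" for x
  proof -
    obtain i j where x: "x = (i, j)" by (cases x)
    have ij: "i \<le> p" "j \<le> q" "i + j \<noteq> 0" "i + j \<noteq> p + q" using that by (auto simp: S_def x)
    then show ?thesis by (auto simp: h_def g_def trunc_def x)
  qed
  then have "sum h (S - {(0, 0)} - {(p, q)}) = sum g (S - {(0, 0)} - {(p, q)})" by (rule sum.cong[OF refl])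
  moreover have "sum g S = g (0, 0) + (g (p, q) + sum g (S - {(0, 0)} - {(p, q)}))" "sum h S = h (0, 0) + (h (p, q) + sum h (S - {(0, 0)} - {(p, q)}))"
    using sum.remove[OF fin mem(1)] sum.remove[OF finite_Diff[OF fin] mem(2)] by metis+
  ultimately show ?thesis unfolding cg ch using h0 by (simp add: g_def)
qed

lemma trunc_trunc: "m \<le> n \<Longrightarrow> trunc m (trunc n G) = trunc m G"
  by (auto simp: trunc_def fun_eq_iff)

lemma conv_cong:
  assumes "\<And>i j. i \<le> p \<Longrightarrow> j \<le> q \<Longrightarrow> G i j t a = G' i j t a" "\<And>i j. i \<le> p \<Longrightarrow> j \<le> q \<Longrightarrow> H i j t a = H' i j t a"
  shows "conv G H p q t a = conv G' H' p q t a"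
  unfolding conv_def using assms by (intro sum.cong refl) auto

text \<open>The level \<open>m\<close> of the cut is immaterial once it is at least
  \<open>i + j\<close>, because without the background both factors have order strictly below
  \<open>i + j\<close>.\<close>

lemma conv_EE:
  assumes m: "1 \<le> i + j" "i + j \<le> m"
  shows "conv E E i j t a = 2 * of_real a * E i j t a + conv (trunc m E) (trunc m E) i j t a"
proof -
  have "conv (trunc m E) (trunc m E) i j t a = conv (trunc (i + j) E) (trunc (i + j) E) i j t a"
    using conv_split[OF m(1), of "trunc m E" "trunc m E" t a] m by (simp add: trunc_trunc) (simp add: trunc_def)
  then show ?thesis using conv_split[OF m(1), of E E t a] by (simp add: E_00)
qed

text \<open>The equation at order \<open>p + q\<close> is linear in \<open>E p q\<close>: as
  \<open>E 0 0\<close> is the label and \<open>kap E 0 0\<close> vanishes, the unknown enters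
  through the linearized flux, and the rest is a source made of known orders.\<close>

lemma Flux_E:
  assumes pq: "2 \<le> p + q" and t: "t \<ge> 0" and r: "\<And>i j. reg (E i j)"
  shows "Flux E p q t a = of_real a * E p q t a + of_real a * (Idf (\<lambda>a. of_real a * E p q t a) / 2) + Flux_pert (trunc (p + q) E) p q t a"
proof -
  define T where "T = trunc (p + q) E"
  have rT: "reg (T i j)" for i j using r reg_const(1)[of 0] by (simp add: T_def trunc_def)
  have rc: "reg (conv T T i j)" for i j by (intro conv_reg rT)
  have k: "kap E i j t b = Idf (\<lambda>a. of_real a * E i j t a) / 2 + Idf (conv T T i j t) / 4"
    if "1 \<le> i + j" "i + j \<le> p + q" for i j b
  proof -
    have "conv E E i j t = (\<lambda>a. 2 * (of_real a * E i j t a) + conv T T i j t a)"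
      using conv_EE[OF that] by (simp add: T_def fun_eq_iff mult.assoc)
    then have "Idf (conv E E i j t) = 2 * Idf (\<lambda>a. of_real a * E i j t a) + Idf (conv T T i j t)"
    proof -
      have k: "continuous_on {-1..1} (\<lambda>a. 2 * (of_real a * E i j t a))" "continuous_on {-1..1} (conv T T i j t)"
        by (intro continuous_intros reg_cont1[OF r t] reg_cont1[OF rc t])+
      assume "conv E E i j t = (\<lambda>a. 2 * (of_real a * E i j t a) + conv T T i j t a)"
      then show ?thesis by (simp only: Idf_add[OF k] Idf_cmult)
    qed
    then show ?thesis by (simp add: kap_def add_divide_distrib)
  qed
  have k0: "kap E 0 0 t b = 0" for b
    using Idf_a2 by (simp add: kap_def conv_def[abs_def] E_00 power2_eq_square)
  have kp0: "kap_pert T 0 0 t b = 0" for b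
    using Idf_cmult[of 0 "\<lambda>a. 1"] by (simp add: kap_pert_def T_def trunc_def conv_def[abs_def])
  have "conv (kap E) E p q t a = kap E p q t a * of_real a + conv (trunc (p + q) (kap E)) (trunc (p + q) E) p q t a"
    using conv_split[of p q "kap E" E t a] pq by (simp add: k0 E_00)
  also have "conv (trunc (p + q) (kap E)) (trunc (p + q) E) p q t a = conv (trunc (p + q) (kap_pert T)) (trunc (p + q) T) p q t a"
  proof (rule conv_cong)
    fix i j assume "i \<le> p" "j \<le> q"
    show "trunc (p + q) E i j t a = trunc (p + q) T i j t a" by (simp add: T_def trunc_trunc)
    show "trunc (p + q) (kap E) i j t a = trunc (p + q) (kap_pert T) i j t a"
      using k[of i j a] by (auto simp: trunc_def kap_pert_def T_def)
  qed
  also have "\<dots> = conv (kap_pert T) T p q t a"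
    using conv_split[of p q "kap_pert T" T t a] pq by (simp add: kp0) (simp add: T_def trunc_def)
  finally have 1: "conv (kap E) E p q t a = kap E p q t a * of_real a + conv (kap_pert T) T p q t a" .
  show ?thesis
    unfolding Flux_def 1 Flux_pert_def T_def[symmetric] using conv_EE[of p q "p + q" t a] k[of p q a] pq
    by (simp add: T_def[symmetric] add_divide_distrib algebra_simps)
qed

text \<open>The bound is quadratic in the size \<open>e\<close>. Smallness of \<open>e\<close>
  absorbs the cubic terms, and \<open>64 + 3200 + 6528\<close> is rounded up to 10000.\<close>

lemma Flux_pert_bd:
  assumes T: "fam_bd B s e T" and e: "0 < e" "e \<le> 1 / 1000" and B: "B \<ge> 0"
  shows "fam_bd B s (10000 * e^2) (Flux_pert T)"
proof -
  note c = conv_fam_bd[OF T T B less_imp_le[OF e(1)] less_imp_le[OF e(1)]]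
  note I = Idf_fam_bd[OF c]
  have k: "fam_bd B s (norm (1/2 :: complex) * (25 * (4 * e)) + norm (1/4 :: complex) * (25 * (128 * e * e))) (kap_pert T)"
    using fam_bd_add[OF fam_bd_cmult[OF Idf_fam_bd[OF fam_bd_amult[OF T]], of "1/2"] fam_bd_cmult[OF I, of "1/4"]]
    by (simp add: kap_pert_def[abs_def])
  have "800 * e * e \<le> 1 * e" using e by (intro mult_right_mono) auto
  then have k: "fam_bd B s (51 * e) (kap_pert T)"
    using e B by (intro fam_bd_mono[OF k]) (auto simp: norm_divide)
  have "fam_bd B s (norm (1/2 :: complex) * (128 * e * e) + 4 * (norm (1/4 :: complex) * (25 * (128 * e * e))) + 128 * (51 * e) * e) (Flux_pert T)"
    using fam_bd_add[OF fam_bd_add[OF fam_bd_cmult[OF c, of "1/2"] fam_bd_amult[OF fam_bd_cmult[OF I, of "1/4"]]] conv_fam_bd[OF k T B _ less_imp_le[OF e(1)]]] e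
    by (simp add: Flux_pert_def[abs_def])
  then show ?thesis
    by (rule fam_bd_mono) (use B in \<open>auto simp: norm_divide power2_eq_square\<close>)
qed

lemma Idf_conv_0:
  assumes "\<And>i j. reg (G i j)" "\<And>i j. reg (H i j)" and t: "t \<ge> 0"
    and k: "\<And>i j a. G i j t a = g i j" and z: "\<And>i j. Idf (H i j t) = 0"
  shows "Idf (conv G H p q t) = 0"
proof -
  have "conv G H p q t = (\<lambda>a. \<Sum>i\<le>p. \<Sum>j\<le>q. g i j * H (p - i) (q - j) t a)"
    by (simp add: conv_def fun_eq_iff k)
  moreover have "Idf (\<lambda>a. \<Sum>i\<le>p. \<Sum>j\<le>q. g i j * H (p - i) (q - j) t a) = (\<Sum>i\<le>p. Idf (\<lambda>a. \<Sum>j\<le>q. g i j * H (p - i) (q - j) t a))"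
    by (intro Idf_sum finite_atMost continuous_intros reg_cont1[OF assms(2) t])
  moreover have "Idf (\<lambda>a. \<Sum>j\<le>q. g i j * H (p - i) (q - j) t a) = (\<Sum>j\<le>q. Idf (\<lambda>a. g i j * H (p - i) (q - j) t a))" for i
    by (intro Idf_sum finite_atMost continuous_intros reg_cont1[OF assms(2) t])
  ultimately show ?thesis by (simp add: Idf_cmult z)
qed

text \<open>The square contributes \<open>Idf (conv T T p q t) / 2\<close> and, since
  \<open>Idf\<close> of the label is -2, the same amount with the opposite sign; the last term
  consists of label-free factors times \<open>T\<close>. So the height of the column stays 2 at
  every order, which is the hypothesis on the source in \<open>linear_estimate\<close>.\<close>

lemma Flux_pert_Idf:
  assumes T: "fam_bd B s e T" and t: "t \<ge> 0" and z: "\<And>i j. Idf (T i j t) = 0"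
  shows "Idf (Flux_pert T p q t) = 0"
proof -
  note rT = fam_bdD(1)[OF T]
  have rc: "reg (conv T T i j)" for i j by (intro conv_reg rT)
  have rk: "reg (kap_pert T i j)" for i j
    unfolding kap_pert_def using Idf_time_cont[OF rc[of i j]] Idf_time_cont[OF reg_mult(1)[OF reg_id rT[of i j]]]
    by (intro reg_time) (intro continuous_intros, auto)
  have z2: "Idf (conv (kap_pert T) T p q t) = 0"
    by (rule Idf_conv_0[OF rk rT t _ z]) (simp add: kap_pert_def)
  have k: "continuous_on {-1..1} (\<lambda>a. 1/2 * conv T T p q t a)" "continuous_on {-1..1} (\<lambda>a. Idf (conv T T p q t) / 4 * complex_of_real a)"
    "continuous_on {-1..1} (conv (kap_pert T) T p q t)"
    by (intro continuous_intros reg_cont1[OF rc t] reg_cont1[OF conv_reg[OF rk rT] t])+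
  have "Idf (Flux_pert T p q t) = Idf (\<lambda>a. (1/2 * conv T T p q t a + Idf (conv T T p q t) / 4 * complex_of_real a) + conv (kap_pert T) T p q t a)"
    by (simp add: Flux_pert_def[abs_def] mult_ac)
  also have "\<dots> = 0" unfolding Idf_add[OF continuous_on_add[OF k(1,2)] k(3)] Idf_add[OF k(1,2)] Idf_cmult Idf_a z2 by simp
  finally show ?thesis .
qed

section \<open>The growing mode\<close>

lemma Idf_quot:
  assumes "\<And>a. (p has_real_derivative 15/2 * a * q a) (at a)"
  shows "Idf (\<lambda>a. of_real (q a / (a^2 + 1/4))) = of_real (p 1 - p (-1) - 5/2 * (q 1 - q (-1)))"
proof -
  \<comment> \<open>\<open>dens'\<close> is divisible by \<open>a\<^sup>2 + 1 / 4\<close>, so no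
    denominator is left; at the endpoints 25 / 8 over 5 / 4 gives the 5 / 2 of the
    statement.\<close>
  have "dens' a * (q a / (a^2 + 1/4)) = 15/2 * a * q a" for a
  proof -
    have "a^2 + 1/4 \<noteq> 0" by (smt (verit) zero_le_power2 divide_pos_pos)
    moreover define D where "D = a^2 + 1/4"
    moreover have e: "dens' a = 15/2 * a * D" by (simp add: D_def dens'_def power2_eq_square power3_eq_cube field_simps)
    ultimately show ?thesis unfolding D_def[symmetric] e by simp
  qed
  then have "(p has_real_derivative dens' a * (q a / (a^2 + 1/4))) (at a)" for a
    using assms by (simp only:)
  note I = Idf_poly[OF this]
  have "p 1 - p (-1) - 25/8 * (q 1 / (1^2 + 1/4) - q (-1) / ((-1)^2 + 1/4)) = p 1 - p (-1) - 5/2 * (q 1 - q (-1))"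
    by (simp add: field_simps)
  with I show ?thesis by (simp only:)
qed

lemma a_ne: "complex_of_real a - \<i> / 2 \<noteq> 0"
  by (simp add: complex_eq_iff)

lemma seed_split: "complex_of_real a / (of_real a - \<i> / 2) = of_real (a^2 / (a^2 + 1/4)) + \<i> / 2 * of_real (a / (a^2 + 1/4))"
proof -
  have "a^2 + 1/4 \<noteq> 0" by (smt (verit) zero_le_power2 divide_pos_pos)
  moreover define r where "r = 1 / (a^2 + 1/4)"
  ultimately have r: "a * (r * (a^2 + 1/4)) = a" by simp
  have "complex_of_real a = (of_real (a^2 * r) + \<i> / 2 * of_real (a * r)) * (of_real a - \<i> / 2)"
    using r by (simp add: complex_eq_iff power2_eq_square algebra_simps)
  then show ?thesis using a_ne[of a] by (simp add: r_def nonzero_divide_eq_eq)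
qed

lemma quot_cont: "continuous_on S (\<lambda>a. complex_of_real (a^k / (a^2 + 1/4)))"
proof -
  have "a^2 + 1/4 \<noteq> 0" for a :: real by (smt (verit) zero_le_power2 divide_pos_pos)
  then show ?thesis by (intro continuous_intros) auto
qed

text \<open>The value -2 is the eigenvalue relation: it makes the nonlocal term of the linearized
  flux equal to \<open>- a\<close>, and \<open>a * y - a = \<i> / 2 * y\<close> for
  \<open>y = a / (a - \<i> / 2)\<close>. The value 0 says that the mode preserves the height of the
  column.\<close>

lemma Idf_seed: "Idf (\<lambda>a. of_real a / (of_real a - \<i> / 2)) = 0"
  and Idf_a_seed: "Idf (\<lambda>a. of_real a * (of_real a / (of_real a - \<i> / 2))) = -2"
proof -
  have I: "Idf (\<lambda>a. of_real (a^1 / (a^2 + 1/4))) = 0" "Idf (\<lambda>a. of_real (a^2 / (a^2 + 1/4))) = 0"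
     "Idf (\<lambda>a. of_real (a^3 / (a^2 + 1/4))) = -2"
    by (subst Idf_quot[of "\<lambda>a. 5/2 * a^3"] Idf_quot[of "\<lambda>a. 15/8 * a^4"] Idf_quot[of "\<lambda>a. 3/2 * a^5"];
        auto intro!: derivative_eq_intros simp: field_simps power2_eq_square power_numeral_reduce)+
  have c: "continuous_on {-1..1} (\<lambda>a. \<i> / 2 * complex_of_real (a^k / (a^2 + 1/4)))" for k
    by (intro continuous_intros quot_cont)
  have "Idf (\<lambda>a. of_real a / (of_real a - \<i> / 2)) = Idf (\<lambda>a. of_real (a^2 / (a^2 + 1/4)) + \<i> / 2 * of_real (a^1 / (a^2 + 1/4)))"
    unfolding seed_split by simp
  also have "\<dots> = 0" unfolding Idf_add[OF quot_cont c] Idf_cmult I by simp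
  finally show "Idf (\<lambda>a. of_real a / (of_real a - \<i> / 2)) = 0" .
  have "Idf (\<lambda>a. of_real a * (of_real a / (of_real a - \<i> / 2))) = Idf (\<lambda>a. of_real (a^3 / (a^2 + 1/4)) + \<i> / 2 * of_real (a^2 / (a^2 + 1/4)))"
    unfolding seed_split by (simp add: algebra_simps power2_eq_square power3_eq_cube)
  also have "\<dots> = -2" unfolding Idf_add[OF quot_cont c] Idf_cmult I by simp
  finally show "Idf (\<lambda>a. of_real a * (of_real a / (of_real a - \<i> / 2))) = -2" .
qed

lemma seed_reg: "reg seed" and seed_Da: "Da seed t a = of_real (exp (t / 2)) * (- (\<i> / 2) / (of_real a - \<i> / 2)^2)"
proof -
  have d: "(seed t has_vector_derivative of_real (exp (t / 2)) * (- (\<i> / 2) / (of_real a - \<i> / 2)^2)) (at a)" for t a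
  proof -
    have "((\<lambda>z. z / (z - \<i> / 2)) has_field_derivative (- (\<i> / 2) / (of_real a - \<i> / 2)^2)) (at (of_real a))"
      using a_ne[of a] by (auto intro!: derivative_eq_intros simp: power2_eq_square)
    from has_vector_derivative_mult_right[OF has_vector_derivative_real_field[OF this]]
    show ?thesis unfolding seed_def by simp
  qed
  then show "Da seed t a = of_real (exp (t / 2)) * (- (\<i> / 2) / (of_real a - \<i> / 2)^2)" by (rule Da_eq)
  show "reg seed"
    by (rule regI[OF _ _ d]; unfold split_beta seed_def; intro continuous_intros ballI a_ne power_not_zero; simp)
qed

lemma norm_a_ge: "norm (of_real a - \<i> / 2) \<ge> \<bar>a\<bar>" "norm (of_real a - \<i> / 2) \<ge> 1/2"
  using abs_Re_le_cmod[of "of_real a - \<i> / 2"] abs_Im_le_cmod[of "of_real a - \<i> / 2"] by auto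

lemma seed_bd:
  assumes "s > 1/2"
  shows "bd 4 s seed"
  unfolding bd_def seed_Da
proof (intro allI impI conjI)
  fix t a :: real assume t: "t \<ge> 0"
  have e: "exp (t / 2) \<le> exp (s * t)" using mult_right_mono[of "1/2" s t] assms t by simp
  have 1: "norm (complex_of_real a / (of_real a - \<i> / 2)) \<le> 1"
    using norm_a_ge(1)[of a] a_ne[of a] by (simp add: norm_divide divide_le_eq_1)
  have "exp (t / 2) * norm (complex_of_real a / (of_real a - \<i> / 2)) \<le> exp (s * t) * 1"
    by (intro mult_mono e 1) auto
  then show "norm (seed t a) \<le> 4 * exp (s * t)"
    unfolding seed_def norm_mult by (simp add: order_trans)
  have "(1/2)^2 \<le> (norm (of_real a - \<i> / 2))^2" by (intro power_mono norm_a_ge) auto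
  then have "(1/2) / (norm (of_real a - \<i> / 2))^2 \<le> (1/2) / (1/2)^2"
    using norm_a_ge(2)[of a] a_ne[of a] by (intro divide_left_mono mult_pos_pos zero_less_power) auto
  then have 2: "norm (- (\<i> / 2) / (of_real a - \<i> / 2)^2) \<le> 2"
    by (simp add: norm_divide norm_power norm_mult power2_eq_square)
  have "exp (t / 2) * norm (- (\<i> / 2) / (of_real a - \<i> / 2)^2) \<le> exp (s * t) * 2"
    by (intro mult_mono e 2) auto
  then show "norm (complex_of_real (exp (t / 2)) * (- (\<i> / 2) / (of_real a - \<i> / 2)^2)) \<le> 4 * exp (s * t)"
    unfolding norm_mult by (simp add: order_trans)
qed

text \<open>The nonzero size that is reproduced by
  \<open>e \<mapsto> (8600 / (s - 1 / 2) + 6) * (10000 * e\<^sup>2)\<close>, the bound on the source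
  followed by the bound on the linear solution.\<close>

definition amp :: "real \<Rightarrow> real" where "amp s = 1 / (10000 * (8600 / (s - 1/2) + 6))"

lemma amp: "s > 1/2 \<Longrightarrow> amp s > 0" "s > 1/2 \<Longrightarrow> amp s \<le> 1/1000"
  "s > 1/2 \<Longrightarrow> (8600 / (s - 1/2) + 6) * (10000 * (amp s)^2) = amp s"
proof -
  assume s: "s > 1/2"
  define C where "C = 8600 / (s - 1/2) + 6"
  have C: "C > 6" using s by (simp add: C_def)
  have a: "amp s = 1 / (10000 * C)" by (simp add: amp_def C_def)
  show "amp s > 0" "amp s \<le> 1/1000" using C unfolding a by (auto simp: field_simps)
  show "(8600 / (s - 1/2) + 6) * (10000 * (amp s)^2) = amp s"
    unfolding C_def[symmetric] a using C by (simp add: field_simps power2_eq_square)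
qed

lemma Sol_props:
  fixes n :: real
  assumes F: "reg F" and b: "bd M m F"
  shows "reg (Sol n F)" "Sol n F 0 a = 0" "Da (Sol n F) 0 a = 0"
    "t \<ge> 0 \<Longrightarrow> ((\<lambda>t. Sol n F t a) has_vector_derivative
        - \<i> * n * (a * Sol n F t a + a * (Idf (\<lambda>a. a * Sol n F t a) / 2) + F t a)) (at t within {0..})"
    "t \<ge> 0 \<Longrightarrow> ((\<lambda>t. Da (Sol n F) t a) has_vector_derivative
        - \<i> * n * (a * Da (Sol n F) t a + Sol n F t a + Idf (\<lambda>a. a * Sol n F t a) / 2 + Da F t a)) (at t within {0..})"
proof -
  have "\<exists>\<eta>. linear_sol n F \<eta>"
    unfolding linear_sol_def by (rule linear_solve[OF F, of M m n]) (use bdD(1)[OF b] in auto)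
  then have "linear_sol n F (Sol n F)" unfolding Sol_def by (rule someI_ex)
  then show "reg (Sol n F)" "Sol n F 0 a = 0" "Da (Sol n F) 0 a = 0"
    "t \<ge> 0 \<Longrightarrow> ((\<lambda>t. Sol n F t a) has_vector_derivative
        - \<i> * n * (a * Sol n F t a + a * (Idf (\<lambda>a. a * Sol n F t a) / 2) + F t a)) (at t within {0..})"
    "t \<ge> 0 \<Longrightarrow> ((\<lambda>t. Da (Sol n F) t a) has_vector_derivative
        - \<i> * n * (a * Da (Sol n F) t a + Sol n F t a + Idf (\<lambda>a. a * Sol n F t a) / 2 + Da F t a)) (at t within {0..})"
    unfolding linear_sol_def by blast+
qed

lemma bd_cnj: "reg G \<Longrightarrow> bd M m G \<Longrightarrow> bd M m (\<lambda>t a. cnj (G t a))"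
  by (simp add: bd_def reg_cnj(2))

text \<open>Size \<open>amp s\<close> on all lower orders gives a source of size
  \<open>10000 * (amp s)\<^sup>2\<close>, which the linear estimate turns back into
  \<open>amp s\<close>; hence the constants do not deteriorate along the induction.\<close>

lemma E_step:
  assumes s: "s > 1/2" and B: "B = 16 / amp s" and m: "2 \<le> p + q" "q < p"
    and IH: "\<And>i j. i + j < p + q \<Longrightarrow> reg (E i j) \<and> (1 \<le> i + j \<longrightarrow>
       bd (amp s * (B^(i + j) * wgt i * wgt j)) (real (i + j) * s) (E i j) \<and> (\<forall>t\<ge>0. Idf (E i j t) = 0))"
  shows "reg (E p q)" "bd (amp s * (B^(p + q) * wgt p * wgt q)) (real (p + q) * s) (E p q)"
    "t \<ge> 0 \<Longrightarrow> Idf (E p q t) = 0"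
proof -
  define T where "T = trunc (p + q) E"
  note a = amp[OF s]
  have Bp: "B > 0" using a by (simp add: B)
  have T: "fam_bd B s (amp s) T"
    unfolding fam_bd_def
  proof (intro allI conjI)
    fix i j
    show "reg (T i j)" using IH[of i j] reg_const(1)[of 0] by (auto simp: T_def trunc_def)
    have "0 \<le> amp s * (B^(i + j) * wgt i * wgt j)" using a Bp wgt_pos[of i] wgt_pos[of j] by simp
    then show "bd (amp s * (B^(i + j) * wgt i * wgt j)) (real (i + j) * s) (T i j)"
      using IH[of i j] reg_const(2)[of 0] by (auto simp: T_def trunc_def bd_def)
  qed
  have z: "Idf (T i j t) = 0" if "t \<ge> 0" for i j t
    using IH[of i j] that Idf_cmult[of 0 "\<lambda>a. 1"] by (auto simp: T_def trunc_def)
  note FB = Flux_pert_bd[OF T a(1,2) less_imp_le[OF Bp]]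
  define \<Phi> where "\<Phi> = 10000 * (amp s)^2 * (B^(p + q) * wgt p * wgt q)"
  have \<Phi>: "\<Phi> > 0" using a Bp wgt_pos[of p] wgt_pos[of q] by (simp add: \<Phi>_def)
  have E: "E p q = Sol (real p - real q) (Flux_pert T p q)" using E_Sol m by (simp add: T_def)
  note F = fam_bdD(1)[OF FB, of p q] and Fb = fam_bdD(2)[OF FB, of p q, folded \<Phi>_def]
  note S = Sol_props[OF F Fb, where n = "real p - real q", folded E]
  have m1: "real (p + q) * s > 0" using m s by simp
  \<comment> \<open>The frequency never exceeds the order; this is why rates that add up with the
    order are admissible in the linear estimate.\<close>
  have m2: "\<bar>real p - real q\<bar> * s \<le> real (p + q) * s" using s m by (intro mult_right_mono) auto
  note L = linear_estimate[OF S(1) F S(2,3) S(4,5) Flux_pert_Idf[OF T _ z] bdD(1)[OF Fb] bdD(2)[OF Fb] \<Phi> s m1 m2]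
  show "reg (E p q)" by (rule S(1))
  show "t \<ge> 0 \<Longrightarrow> Idf (E p q t) = 0" by (rule L(1))
  have "(8600 / (s - 1/2) + 6) * \<Phi> = amp s * (B^(p + q) * wgt p * wgt q)"
    unfolding \<Phi>_def using a(3) by (simp only: mult.assoc[symmetric])
  then show "bd (amp s * (B^(p + q) * wgt p * wgt q)) (real (p + q) * s) (E p q)"
    unfolding bd_def using L(2,3) by auto
qed

lemma E_inv:
  assumes s: "s > 1/2" and B: "B = 16 / amp s"
  shows "reg (E p q) \<and> (1 \<le> p + q \<longrightarrow>
       bd (amp s * (B^(p + q) * wgt p * wgt q)) (real (p + q) * s) (E p q) \<and> (\<forall>t\<ge>0. Idf (E p q t) = 0))"
proof (induction "p + q" arbitrary: p q rule: less_induct)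
  case less
  note a = amp[OF s]
  have Bp: "B > 0" using a by (simp add: B)
  have *: "reg (E p q) \<and> (1 \<le> p + q \<longrightarrow>
       bd (amp s * (B^(p + q) * wgt p * wgt q)) (real (p + q) * s) (E p q) \<and> (\<forall>t\<ge>0. Idf (E p q t) = 0))"
    if qp: "q < p" and IH: "\<And>i j. i + j < p + q \<Longrightarrow> reg (E i j) \<and> (1 \<le> i + j \<longrightarrow>
       bd (amp s * (B^(i + j) * wgt i * wgt j)) (real (i + j) * s) (E i j) \<and> (\<forall>t\<ge>0. Idf (E i j t) = 0))" for p q
  proof (cases "2 \<le> p + q")
    case True
    from E_step[OF s B this qp IH] show ?thesis by blast
  next
    case False
    then have p: "p = 1" "q = 0" using qp by auto
    \<comment> \<open>This fixes \<open>B\<close>: at order 1 the claimed bound is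
      \<open>amp s * B / 4\<close>, and the 16 in \<open>B\<close> makes it the 4 of
      \<open>seed_bd\<close>.\<close>
    have "amp s * (B^(p + q) * wgt p * wgt q) = 4" using a by (simp add: p B wgt_def)
    moreover have "Idf (seed t) = 0" for t
  proof -
    have "Idf (seed t) = of_real (exp (t / 2)) * Idf (\<lambda>a. of_real a / (of_real a - \<i> / 2))"
      unfolding seed_def by (rule Idf_cmult)
    then show ?thesis by (simp only: Idf_seed mult_zero_right)
  qed
    ultimately show ?thesis using seed_reg seed_bd[OF s] E_10 by (simp add: p)
  qed
  consider "q < p" | "p < q" | "p = q" "p = 0" | "p = q" "p > 0" by linarith
  then show ?case
  proof cases
    case 1 then show ?thesis by (rule *) (rule less.hyps)
  next
    case 2
    have q: "reg (E q p) \<and> (1 \<le> q + p \<longrightarrow>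
       bd (amp s * (B^(q + p) * wgt q * wgt p)) (real (q + p) * s) (E q p) \<and> (\<forall>t\<ge>0. Idf (E q p t) = 0))"
      using 2 by (rule *) (rule less.hyps, simp only: add.commute)
    have e: "E p q = (\<lambda>t a. cnj (E q p t a))" by (intro ext) (rule E_cnj)
    have w: "B^(q + p) * wgt q * wgt p = B^(p + q) * wgt p * wgt q" by (simp add: add.commute)
    have q1: "reg (E q p)" and q2: "1 \<le> p + q \<Longrightarrow> bd (amp s * (B^(p + q) * wgt p * wgt q)) (real (p + q) * s) (E q p)"
      and q3: "1 \<le> p + q \<Longrightarrow> t \<ge> 0 \<Longrightarrow> Idf (E q p t) = 0" for t
      using q unfolding w by (auto simp: add.commute)
    show ?thesis unfolding e
      by (intro conjI impI allI reg_cnj(1) q1 bd_cnj q2; (simp add: Idf_cnj[OF reg_cont1[OF q1]] q3)?)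
  next
    case 3 then show ?thesis using reg_id by (simp add: E.simps)
  next
    case 4
    have "0 \<le> amp s * (B^(p + q) * wgt p * wgt q)" using a Bp wgt_pos[of p] wgt_pos[of q] by simp
    moreover have "E p q = (\<lambda>t a. 0)" using 4 by (simp add: E.simps)
    ultimately show ?thesis using reg_const[of 0] Idf_cmult[of 0 "\<lambda>a. 1"] by (simp add: bd_def)
  qed
qed

lemma E_reg: "reg (E p q)"
  using E_inv[of 1] by simp

text \<open>All corrections start from zero, so at time 0 the series is exactly the shear plus the
  first-order mode. In the proof the rate 1 stands for any rate above 1 / 2.\<close>

lemma E_init: "2 \<le> p + q \<Longrightarrow> E p q 0 a = 0"
proof -
  assume m: "2 \<le> p + q"
  have *: "E p q 0 a = 0" if qp: "q < p" and m: "2 \<le> p + q" for p q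
  proof -
    define B where "B = 16 / amp 1"
    have s: "(1::real) > 1/2" by simp
    note a = amp[OF s]
    have Bp: "B > 0" using a by (simp add: B_def)
    define T where "T = trunc (p + q) E"
    have T: "fam_bd B 1 (amp 1) T"
      unfolding fam_bd_def
    proof (intro allI conjI)
      fix i j
      show "reg (T i j)" using E_reg reg_const(1)[of 0] by (auto simp: T_def trunc_def)
      have "0 \<le> amp 1 * (B^(i + j) * wgt i * wgt j)" using a Bp wgt_pos[of i] wgt_pos[of j] by simp
      then show "bd (amp 1 * (B^(i + j) * wgt i * wgt j)) (real (i + j) * 1) (T i j)"
        using E_inv[OF s B_def, of i j] reg_const(2)[of 0] by (auto simp: T_def trunc_def bd_def)
    qed
    note FB = Flux_pert_bd[OF T a(1,2) less_imp_le[OF Bp]]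
    have E: "E p q = Sol (real p - real q) (Flux_pert T p q)" using E_Sol m qp by (simp add: T_def)
    show ?thesis unfolding E by (rule Sol_props(2)[OF fam_bdD[OF FB]])
  qed
  consider "q < p" | "p < q" | "p = q" by linarith
  then show ?thesis
  proof cases
    case 2 then show ?thesis using *[of p q] m E_cnj[of p q] by (simp add: add.commute)
  next
    case 3 then show ?thesis using m E_diag[of p] by simp
  qed (use * m in auto)
qed

section \<open>Summation of the series\<close>

lemma conv_cnj:
  assumes "\<And>p q. G q p t a = cnj (G p q t a)" "\<And>p q. H q p t a = cnj (H p q t a)"
  shows "conv G H q p t a = cnj (conv G H p q t a)"
proof -
  have "conv G H q p t a = (\<Sum>i\<le>q. \<Sum>j\<le>p. cnj (G j i t a) * cnj (H (p - j) (q - i) t a))"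
    unfolding conv_def by (intro sum.cong refl arg_cong2[where f = "(*)"] assms)
  also have "\<dots> = (\<Sum>j\<le>p. \<Sum>i\<le>q. cnj (G j i t a) * cnj (H (p - j) (q - i) t a))"
    by (rule sum.swap)
  finally show ?thesis by (simp add: conv_def)
qed

lemma E_conv_reg: "reg (conv E E p q)" by (intro conv_reg E_reg)

lemma kap_cnj: "t \<ge> 0 \<Longrightarrow> kap E q p t a = cnj (kap E p q t a)"
proof -
  assume t: "t \<ge> 0"
  have "conv E E q p t = (\<lambda>a. cnj (conv E E p q t a))"
    by (intro ext conv_cnj E_cnj)
  then show ?thesis by (simp add: kap_def Idf_cnj[OF reg_cont1[OF E_conv_reg t]])
qed

lemma Flux_cnj: "t \<ge> 0 \<Longrightarrow> Flux E q p t a = cnj (Flux E p q t a)"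
proof -
  assume t: "t \<ge> 0"
  have "conv E E q p t a = cnj (conv E E p q t a)" by (rule conv_cnj[OF E_cnj E_cnj])
  moreover have "conv (kap E) E q p t a = cnj (conv (kap E) E p q t a)" by (rule conv_cnj) (rule kap_cnj[OF t], rule E_cnj)
  ultimately show ?thesis by (simp add: Flux_def)
qed

lemma conv_trunc_1: "conv (trunc (Suc 0) G) H p q t a = 0"
proof -
  have "trunc (Suc 0) G i j = (\<lambda>t a. 0)" for i j by (auto simp: trunc_def)
  then show ?thesis by (simp add: conv_def)
qed

text \<open>The eigenvalue relation in terms of coefficients: the seed obeys the equation of order 1
  with growth rate 1 / 2.\<close>

lemma Flux_10: "t \<ge> 0 \<Longrightarrow> - \<i> * Flux E 1 0 t a = seed t a / 2"
proof -
  assume t: "t \<ge> 0"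
  have c: "conv E E 1 0 t b = 2 * (of_real b * seed t b)" for b
    using conv_EE[of 1 0 1 t b] by (simp add: conv_trunc_1 E_10[simplified] E_10)
  have "Idf (\<lambda>b. of_real b * seed t b) = Idf (\<lambda>b. of_real (exp (t / 2)) * (of_real b * (of_real b / (of_real b - \<i> / 2))))"
    by (simp add: seed_def mult_ac)
  also have "\<dots> = -2 * of_real (exp (t / 2))" unfolding Idf_cmult Idf_a_seed by simp
  finally have k: "kap E 1 0 t a = - of_real (exp (t / 2))" for a
    unfolding kap_def c Idf_cmult by simp
  have k0: "kap E 0 0 t a = 0"
    using Idf_a2 by (simp add: kap_def conv_def[abs_def] E_00 power2_eq_square)
  have "conv (kap E) E 1 0 t a = - of_real (exp (t / 2)) * of_real a"
    using conv_split[of 1 0 "kap E" E t a] by (simp add: conv_trunc_1 k0 k[simplified] E_00)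
  then have "- \<i> * Flux E 1 0 t a = - \<i> * (of_real a * seed t a - of_real (exp (t / 2)) * of_real a)"
    unfolding Flux_def c by simp
  also have "\<dots> = seed t a / 2"
  proof -
    define y where "y = of_real a / (of_real a - \<i> / 2)"
    have y: "of_real a = y * (of_real a - \<i> / 2)" using a_ne[of a] by (simp add: y_def)
    have "of_real a * seed t a - of_real (exp (t / 2)) * of_real a = of_real (exp (t / 2)) * (of_real a * y - of_real a)"
      by (simp add: seed_def y_def algebra_simps)
    also have "of_real a * y - of_real a = of_real a * y - y * (of_real a - \<i> / 2)" using y by simp
    also have "of_real (exp (t / 2)) * (of_real a * y - y * (of_real a - \<i> / 2)) = \<i> / 2 * seed t a"
      by (simp add: seed_def y_def[symmetric] algebra_simps)
    finally have e: "of_real a * seed t a - of_real (exp (t / 2)) * of_real a = \<i> / 2 * seed t a" .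
    show ?thesis unfolding e by simp
  qed
  finally show ?thesis .
qed

lemma E_deriv:
  assumes t: "t \<ge> 0"
  shows "((\<lambda>t. E p q t a) has_vector_derivative - (\<i> * of_real (real p - real q) * Flux E p q t a)) (at t within {0..})"
proof -
  have *: "((\<lambda>t. E p q t a) has_vector_derivative - (\<i> * of_real (real p - real q) * Flux E p q t a)) (at t within {0..})"
    if qp: "q < p" for p q
  proof (cases "2 \<le> p + q")
    case True
    define B where "B = 16 / amp 1"
    have s: "(1::real) > 1/2" by simp
    note am = amp[OF s]
    have Bp: "B > 0" using am by (simp add: B_def)
    define T where "T = trunc (p + q) E"
    have T: "fam_bd B 1 (amp 1) T"
      unfolding fam_bd_def
    proof (intro allI conjI)
      fix i j
      show "reg (T i j)" using E_reg reg_const(1)[of 0] by (auto simp: T_def trunc_def)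
      have "0 \<le> amp 1 * (B^(i + j) * wgt i * wgt j)" using am Bp wgt_pos[of i] wgt_pos[of j] by simp
      then show "bd (amp 1 * (B^(i + j) * wgt i * wgt j)) (real (i + j) * 1) (T i j)"
        using E_inv[OF s B_def, of i j] reg_const(2)[of 0] by (auto simp: T_def trunc_def bd_def)
    qed
    note FB = Flux_pert_bd[OF T am(1,2) less_imp_le[OF Bp]]
    have E: "E p q = Sol (real p - real q) (Flux_pert T p q)" using E_Sol True qp by (simp add: T_def)
    have e: "- (\<i> * of_real (real p - real q) * Flux E p q t a) = - \<i> * of_real (real p - real q) *
       (of_real a * E p q t a + of_real a * (Idf (\<lambda>a. of_real a * E p q t a) / 2) + Flux_pert T p q t a)"
      unfolding Flux_E[OF True t E_reg] T_def by simp
    show ?thesis unfolding e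
      by (rule Sol_props(4)[OF fam_bdD[OF FB, of p q] t, where n = "real p - real q", folded E])
  next
    case False
    then have p: "p = 1" "q = 0" using qp by auto
    have "((\<lambda>t. of_real (exp (t / 2))) has_vector_derivative of_real (exp (t / 2) / 2)) (at t within {0..})"
      by (rule has_vector_derivative_of_real) (auto intro!: derivative_eq_intros)
    then have "((\<lambda>t. seed t a) has_vector_derivative of_real (exp (t / 2) / 2) * (of_real a / (of_real a - \<i> / 2))) (at t within {0..})"
      unfolding seed_def by (rule has_vector_derivative_mult_left)
    moreover have "of_real (exp (t / 2) / 2) * (of_real a / (of_real a - \<i> / 2)) = seed t a / 2" by (simp add: seed_def)
    ultimately have "((\<lambda>t. seed t a) has_vector_derivative - \<i> * Flux E 1 0 t a) (at t within {0..})"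
      by (simp only: Flux_10[OF t])
    then show ?thesis using E_10 by (simp add: p)
  qed
  consider "q < p" | "p < q" | "p = q" "p = 0" | "p = q" "p > 0" by linarith
  then show ?thesis
  proof cases
    case 2
    have e: "cnj (- (\<i> * of_real (real q - real p) * Flux E q p t a)) = - (\<i> * of_real (real p - real q) * Flux E p q t a)"
      unfolding Flux_cnj[OF t, of q p] by (simp add: algebra_simps)
    show ?thesis unfolding E_cnj[of p q] e[symmetric] by (rule has_vector_derivative_cnj[OF *[OF 2]])
  next
    case 1 then show ?thesis by (rule *)
  next
    case 3 then show ?thesis by (simp add: E_00)
  next
    case 4 then show ?thesis by (simp add: E_diag)
  qed
qed

text \<open>The constant 2 instead of \<open>amp s\<close> accommodates the background
  \<open>a\<close> on labels up to 2.\<close>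

lemma E_fam_bd:
  assumes s: "s > 1/2" and B: "B = 16 / amp s"
  shows "fam_bd B s 2 E"
  unfolding fam_bd_def
proof (intro allI conjI)
  fix p q
  note a = amp[OF s]
  have Bp: "B > 0" using a by (simp add: B)
  show "reg (E p q)" by (rule E_reg)
  show "bd (2 * (B^(p + q) * wgt p * wgt q)) (real (p + q) * s) (E p q)"
  proof (cases "p + q = 0")
    case True
    then have "E p q = (\<lambda>t a. of_real a)" by (simp add: E.simps)
    then show ?thesis using True by (simp add: bd_def Da_id wgt_def)
  next
    case False
    have "0 \<le> B^(p + q) * wgt p * wgt q" using Bp wgt_pos[of p] wgt_pos[of q] by simp
    then have "amp s * (B^(p + q) * wgt p * wgt q) \<le> 2 * (B^(p + q) * wgt p * wgt q)"
      using a(2) by (intro mult_right_mono) auto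
    moreover have "1 \<le> p + q" using False by linarith
    ultimately show ?thesis using E_inv[OF s B, of p q] bd_mono by blast
  qed
qed

lemma kap_fam_bd: "fam_bd B s 2 E \<Longrightarrow> B \<ge> 0 \<Longrightarrow> fam_bd B s 3200 (kap E)"
  using fam_bd_cmult[OF Idf_fam_bd[OF conv_fam_bd[of B s 2 E 2 E]], of "1/4"]
  by (simp add: kap_def[abs_def] norm_divide)

lemma Flux_fam_bd: "fam_bd B s 2 E \<Longrightarrow> B \<ge> 0 \<Longrightarrow> fam_bd B s 1000000 (Flux E)"
proof -
  assume E: "fam_bd B s 2 E" and B: "B \<ge> 0"
  have "fam_bd B s (norm (1/2 :: complex) * 512 + 128 * 3200 * 2) (Flux E)"
    using fam_bd_add[OF fam_bd_cmult[OF conv_fam_bd[OF E E B], of "1/2"] conv_fam_bd[OF kap_fam_bd[OF E B] E B]]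
    by (simp add: Flux_def[abs_def])
  then show ?thesis by (rule fam_bd_mono) (use B in \<open>auto simp: norm_divide\<close>)
qed

text \<open>The part that is homogeneous of degree \<open>j\<close> in the amplitude;
  \<open>2 * p - j\<close> is the frequency \<open>p - q\<close> for
  \<open>q = j - p\<close>.\<close>

definition trm :: "real \<Rightarrow> family \<Rightarrow> nat \<Rightarrow> real \<Rightarrow> real \<Rightarrow> real \<Rightarrow> complex" where
  "trm d G j t x a = of_real d ^ j * (\<Sum>p\<le>j. cis ((2 * real p - real j) * x) * G p (j - p) t a)"

definition ser :: "real \<Rightarrow> family \<Rightarrow> real \<Rightarrow> real \<Rightarrow> real \<Rightarrow> complex" where
  "ser d G t x a = (\<Sum>j. trm d G j t x a)"

definition freq :: "family \<Rightarrow> family" where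
  "freq G p q t a = \<i> * of_real (real p - real q) * G p q t a"

lemma series_vector_derivative:
  fixes f :: "nat \<Rightarrow> real \<Rightarrow> complex"
  assumes S: "convex S" and d: "\<And>n x. x \<in> S \<Longrightarrow> (f n has_vector_derivative f' n x) (at x within S)"
    and b: "\<And>n x. x \<in> S \<Longrightarrow> norm (f' n x) \<le> M n" and M: "summable M"
    and s: "\<And>x. x \<in> S \<Longrightarrow> summable (\<lambda>n. f n x)" and x: "x \<in> S"
  shows "((\<lambda>x. \<Sum>n. f n x) has_vector_derivative (\<Sum>n. f' n x)) (at x within S)"
proof -
  have u: "uniform_limit S (\<lambda>n x. \<Sum>i<n. f' i x) (\<lambda>x. \<Sum>i. f' i x) sequentially"
    by (rule Weierstrass_m_test[OF b M])
  have "\<exists>g. \<forall>x\<in>S. (\<lambda>n. f n x) sums g x \<and> (g has_derivative (\<lambda>h. h *\<^sub>R (\<Sum>i. f' i x))) (at x within S)"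
  proof (rule has_derivative_series[where f = f and x = x and l = "\<Sum>n. f n x", OF S _ _ x])
    show "(\<lambda>n. f n x) sums (\<Sum>n. f n x)" by (rule summable_sums[OF s[OF x]])
    show "(f n has_derivative (\<lambda>h. h *\<^sub>R f' n x)) (at x within S)" if "x \<in> S" for n x
      using d[OF that] by (simp add: has_vector_derivative_def)
    fix e :: real assume e: "e > 0"
    show "\<forall>\<^sub>F n in sequentially. \<forall>x\<in>S. \<forall>h. norm ((\<Sum>i<n. h *\<^sub>R f' i x) - h *\<^sub>R (\<Sum>i. f' i x)) \<le> e * norm h"
      using uniform_limitD[OF u e]
    proof eventually_elim
      case (elim n)
      show ?case
      proof (intro ballI allI)
        fix x h assume "x \<in> S"
        then have "norm ((\<Sum>i<n. f' i x) - (\<Sum>i. f' i x)) \<le> e" using elim by (auto simp: dist_norm less_imp_le)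
        then have "\<bar>h\<bar> * norm ((\<Sum>i<n. f' i x) - (\<Sum>i. f' i x)) \<le> \<bar>h\<bar> * e" by (intro mult_left_mono) auto
        then show "norm ((\<Sum>i<n. h *\<^sub>R f' i x) - h *\<^sub>R (\<Sum>i. f' i x)) \<le> e * norm h"
          by (simp add: scaleR_sum_right[symmetric] scaleR_diff_right[symmetric] mult.commute)
      qed
    qed
  qed
  then obtain g where g: "\<And>x. x \<in> S \<Longrightarrow> (\<lambda>n. f n x) sums g x" "\<And>x. x \<in> S \<Longrightarrow> (g has_vector_derivative (\<Sum>i. f' i x)) (at x within S)"
    unfolding has_vector_derivative_def by blast
  have "g y = (\<Sum>n. f n y)" if "y \<in> S" for y using g(1)[OF that] by (rule sums_unique)
  then show ?thesis using has_vector_derivative_transform[OF x _ g(2)[OF x]] by metis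
qed

text \<open>The second claim has lost its weight: an \<open>x\<close>-derivative costs a factor
  \<open>j\<close>, and \<open>j * wgt j \<le> 1\<close>. So one derivative is paid by the weight
  and not by the radius of convergence.\<close>

lemma trm_bound:
  assumes G: "fam_bd B s M G" and B: "B \<ge> 0" "d \<ge> 0" and t: "t \<ge> 0" and a: "\<bar>a\<bar> \<le> 2"
  shows "norm (trm d G j t x a) \<le> 8 * M * (d * B * exp (s * t))^j * wgt j"
    and "norm (trm d (freq G) j t x a) \<le> 8 * M * (d * B * exp (s * t))^j"
    and "norm (trm d (\<lambda>p q. Da (G p q)) j t x a) \<le> 8 * M * (d * B * exp (s * t))^j * wgt j"
proof -
  have M: "M \<ge> 0" using bd_nonneg[OF fam_bdD(2)[OF G, of 0 0]] by (simp add: wgt_def)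
  have gen: "norm (trm d H j t x a) \<le> c * (8 * M * (d * B * exp (s * t))^j * wgt j)"
    if H: "\<And>p. p \<le> j \<Longrightarrow> norm (H p (j - p) t a) \<le> c * (M * (B^(p + (j - p)) * wgt p * wgt (j - p)) * exp (real (p + (j - p)) * s * t))"
      and c: "c \<ge> 0" for H c
  proof -
    have "norm (trm d H j t x a) \<le> d^j * (\<Sum>p\<le>j. c * (M * (B^j * wgt p * wgt (j - p)) * exp (real j * s * t)))"
      unfolding trm_def norm_mult norm_power
    proof (intro mult_mono sum_norm_le)
      fix p assume "p \<in> {..j}"
      then show "norm (cis ((2 * real p - real j) * x) * H p (j - p) t a) \<le> c * (M * (B^j * wgt p * wgt (j - p)) * exp (real j * s * t))"
        using H[of p] by (simp add: norm_mult)
    qed (use B in auto)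
    also have "\<dots> = c * (M * (d * B)^j * exp (real j * s * t)) * (\<Sum>p\<le>j. wgt p * wgt (j - p))"
      by (simp add: sum_distrib_left power_mult_distrib mult_ac)
    also have "\<dots> \<le> c * (M * (d * B)^j * exp (real j * s * t)) * (8 * wgt j)"
      using M B c by (intro mult_left_mono wgt_conv) auto
    also have "exp (real j * s * t) = exp (s * t)^j" by (simp add: exp_of_nat_mult[symmetric] mult_ac)
    finally show ?thesis by (simp add: power_mult_distrib mult_ac)
  qed
  show "norm (trm d G j t x a) \<le> 8 * M * (d * B * exp (s * t))^j * wgt j"
  proof -
    have "norm (trm d G j t x a) \<le> 1 * (8 * M * (d * B * exp (s * t))^j * wgt j)"
      by (rule gen) (simp_all only: mult_1 zero_le_one bdD(1)[OF fam_bdD(2)[OF G] t a])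
    then show ?thesis by simp
  qed
  show "norm (trm d (\<lambda>p q. Da (G p q)) j t x a) \<le> 8 * M * (d * B * exp (s * t))^j * wgt j"
  proof -
    have "norm (trm d (\<lambda>p q. Da (G p q)) j t x a) \<le> 1 * (8 * M * (d * B * exp (s * t))^j * wgt j)"
      by (rule gen) (simp_all only: mult_1 zero_le_one bdD(2)[OF fam_bdD(2)[OF G] t a])
    then show ?thesis by simp
  qed
  have "norm (trm d (freq G) j t x a) \<le> real j * (8 * M * (d * B * exp (s * t))^j * wgt j)"
  proof (rule gen)
    fix p assume p: "p \<le> j"
    have "\<bar>real p - real (j - p)\<bar> \<le> real j" using p by (simp add: of_nat_diff)
    then show "norm (freq G p (j - p) t a) \<le> real j * (M * (B^(p + (j - p)) * wgt p * wgt (j - p)) * exp (real (p + (j - p)) * s * t))"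
      unfolding freq_def norm_mult norm_of_real norm_ii mult_1
      using bdD(1)[OF fam_bdD(2)[OF G, of p "j - p"] t a] by (intro mult_mono) auto
  qed auto
  also have "\<dots> = (8 * M * (d * B * exp (s * t))^j) * (real j * wgt j)" by simp
  also have "\<dots> \<le> (8 * M * (d * B * exp (s * t))^j) * 1"
  proof (rule mult_left_mono)
    have "real j * 1 \<le> (real j + 1) * (real j + 1)" by (intro mult_mono) auto
    then show "real j * wgt j \<le> 1" by (simp add: wgt_def power2_eq_square add_pos_pos)
  qed (use M B in auto)
  finally show "norm (trm d (freq G) j t x a) \<le> 8 * M * (d * B * exp (s * t))^j" by simp
qed

text \<open>\<open>d * B * exp (s * t)\<close> is the ratio of the geometric series that dominates
  the expansion. It stays small until a perturbation of size \<open>d\<close>, growing at the rate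
  \<open>s\<close>, reaches a fixed size.\<close>

definition ok :: "real \<Rightarrow> real \<Rightarrow> real \<Rightarrow> real \<Rightarrow> bool" where
  "ok d B s T \<longleftrightarrow> 0 \<le> d \<and> 0 \<le> B \<and> 0 \<le> s \<and> 0 \<le> T \<and> d * B * exp (s * T) \<le> 1 / 64"

lemma ok_le:
  assumes "ok d B s T" "t \<in> {0..T}"
  shows "0 \<le> d * B * exp (s * t)" "d * B * exp (s * t) \<le> 1 / 64"
proof -
  show "0 \<le> d * B * exp (s * t)" using assms by (simp add: ok_def)
  have "d * B * exp (s * t) \<le> d * B * exp (s * T)"
    using assms by (intro mult_left_mono) (auto simp: ok_def intro: mult_left_mono)
  then show "d * B * exp (s * t) \<le> 1 / 64" using assms by (simp add: ok_def)
qed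

lemma geo64: "summable (\<lambda>j. K * (1 / 64 :: real)^j)"
  by (intro summable_mult summable_geometric) auto

lemma geo64_sum: "(\<Sum>j. K * (1 / 64 :: real)^j) = K * (64 / 63)"
proof -
  have "(\<lambda>j. (1 / 64 :: real)^j) sums (1 / (1 - 1 / 64))" by (rule geometric_sums) simp
  then have "(\<lambda>j. (1 / 64 :: real)^j) sums (64 / 63)" by simp
  from sums_mult[OF this, of K] show ?thesis by (rule sums_unique[symmetric])
qed

text \<open>One geometric majorant for all times, phases and labels: enough to differentiate,
  multiply and integrate the series termwise.\<close>

definition tame :: "real \<Rightarrow> real \<Rightarrow> real \<Rightarrow> family \<Rightarrow> bool" where
  "tame d T K G \<longleftrightarrow> (\<forall>p q. continuous_on ({0..} \<times> UNIV) (\<lambda>(t, a). G p q t a)) \<and>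
     (\<forall>j. \<forall>t\<in>{0..T}. \<forall>x. \<forall>a\<in>{-2..2}. norm (trm d G j t x a) \<le> K * (1 / 64)^j)"

lemma tame_fam:
  assumes o: "ok d B s T" and G: "fam_bd B s M G"
  shows "tame d T (8 * M) G" "tame d T (8 * M) (freq G)" "tame d T (8 * M) (\<lambda>p q. Da (G p q))"
proof -
  have M: "M \<ge> 0" using bd_nonneg[OF fam_bdD(2)[OF G, of 0 0]] by (simp add: wgt_def)
  note r = fam_bdD(1)[OF G]
  have p: "(d * B * exp (s * t))^j \<le> (1 / 64)^j" if "t \<in> {0..T}" for t j
    using ok_le[OF o that] by (intro power_mono) auto
  have w: "wgt j \<le> 1" for j by (simp add: wgt_def)
  have b: "8 * M * (d * B * exp (s * t))^j * wgt j \<le> 8 * M * (1 / 64)^j" if "t \<in> {0..T}" for t j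
  proof -
    have "(8 * M * (d * B * exp (s * t))^j) * wgt j \<le> (8 * M * (1 / 64)^j) * 1"
      using p[OF that] M w[of j] wgt_pos[of j] by (intro mult_mono mult_left_mono) auto
    then show ?thesis by simp
  qed
  have b2: "8 * M * (d * B * exp (s * t))^j \<le> 8 * M * (1 / 64)^j" if "t \<in> {0..T}" for t j
    using p[OF that] M by (intro mult_left_mono) auto
  have dB: "B \<ge> 0" "d \<ge> 0" using o by (auto simp: ok_def)
  have a2: "a \<in> {-2..2} \<Longrightarrow> \<bar>a\<bar> \<le> 2" for a :: real by auto
  have t0: "t \<in> {0..T} \<Longrightarrow> 0 \<le> t" for t by auto
  note tb = trm_bound[OF G dB t0 a2]
  show "tame d T (8 * M) G"
    unfolding tame_def using r by (auto simp: reg_def intro!: order_trans[OF tb(1) b] simp del: atLeastAtMost_iff)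
  show "tame d T (8 * M) (\<lambda>p q. Da (G p q))"
    unfolding tame_def using r by (auto simp: reg_def intro!: order_trans[OF tb(3) b] simp del: atLeastAtMost_iff)
  have "reg (freq G p q)" for p q
    unfolding freq_def by (intro reg_mult(1) reg_const r)
  then show "tame d T (8 * M) (freq G)"
    unfolding tame_def by (auto simp: reg_def intro!: order_trans[OF tb(2) b2] simp del: atLeastAtMost_iff)
qed

lemma tame_summable:
  assumes "tame d T K G" "t \<in> {0..T}" "a \<in> {-2..2}"
  shows "summable (\<lambda>j. norm (trm d G j t x a))" "summable (\<lambda>j. trm d G j t x a)"
proof -
  show "summable (\<lambda>j. norm (trm d G j t x a))"
    by (rule summable_comparison_test[OF _ geo64[of K]]) (use assms in \<open>auto simp: tame_def\<close>)
  then show "summable (\<lambda>j. trm d G j t x a)" by (rule summable_norm_cancel)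
qed

lemma trm_cont:
  assumes "\<And>p q. continuous_on ({0..} \<times> UNIV) (\<lambda>(t, a). G p q t a)"
    and f: "continuous_on S f" "continuous_on S g" "continuous_on S h" "\<And>y. y \<in> S \<Longrightarrow> f y \<ge> 0"
  shows "continuous_on S (\<lambda>y. trm d G j (f y) (g y) (h y))"
proof -
  have G: "continuous_on ({0..} \<times> UNIV) (\<lambda>x. G p q (fst x) (snd x))" for p q using assms(1) by (simp add: split_beta)
  have "continuous_on S (\<lambda>y. G p q (f y) (h y))" for p q
    using continuous_on_compose2[OF G, of S "\<lambda>y. (f y, h y)"] f by (auto intro: continuous_intros)
  then show ?thesis unfolding trm_def by (intro continuous_intros f)
qed

lemma ser_cont:
  assumes G: "tame d T K G"
    and f: "continuous_on S f" "continuous_on S g" "continuous_on S h"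
      "\<And>y. y \<in> S \<Longrightarrow> f y \<in> {0..T}" "\<And>y. y \<in> S \<Longrightarrow> h y \<in> {-2..2}"
  shows "continuous_on S (\<lambda>y. ser d G (f y) (g y) (h y))"
proof -
  have u: "uniform_limit S (\<lambda>n y. \<Sum>j<n. trm d G j (f y) (g y) (h y)) (\<lambda>y. ser d G (f y) (g y) (h y)) sequentially"
    unfolding ser_def by (rule Weierstrass_m_test[OF _ geo64[of K]]) (use G f(4,5) in \<open>auto simp: tame_def\<close>)
  have c: "continuous_on S (\<lambda>y. \<Sum>j<n. trm d G j (f y) (g y) (h y))" for n
    using G f by (intro continuous_intros trm_cont) (auto simp: tame_def)
  show ?thesis by (rule uniform_limit_theorem[OF _ u]) (use c in auto)
qed

lemma trm_dx: "((\<lambda>x. trm d G j t x a) has_vector_derivative trm d (freq G) j t x a) (at x)"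
proof -
  have "((\<lambda>x. cis ((2 * real p - real j) * x) * G p (j - p) t a) has_vector_derivative
      of_real (2 * real p - real j) * (\<i> * cis ((2 * real p - real j) * x)) * G p (j - p) t a) (at x)" for p
    by (rule has_vector_derivative_mult_left, rule cis_deriv) (auto intro!: derivative_eq_intros)
  then have "((\<lambda>x. trm d G j t x a) has_vector_derivative
     of_real d ^ j * (\<Sum>p\<le>j. of_real (2 * real p - real j) * (\<i> * cis ((2 * real p - real j) * x)) * G p (j - p) t a)) (at x)"
    unfolding trm_def by (intro has_vector_derivative_mult_right has_vector_derivative_sum)
  moreover have "(\<Sum>p\<le>j. of_real (2 * real p - real j) * (\<i> * cis ((2 * real p - real j) * x)) * G p (j - p) t a)
     = (\<Sum>p\<le>j. cis ((2 * real p - real j) * x) * freq G p (j - p) t a)"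
    by (rule sum.cong[OF refl]) (simp add: freq_def of_nat_diff)
  ultimately show ?thesis by (simp only: trm_def)
qed

lemma ser_dx:
  assumes G: "tame d T K G" "tame d T L (freq G)" and t: "t \<in> {0..T}" and a: "a \<in> {-2..2}"
  shows "((\<lambda>x. ser d G t x a) has_vector_derivative ser d (freq G) t x a) (at x)"
  unfolding ser_def
proof (rule series_vector_derivative[of UNIV, where M = "\<lambda>j. L * (1 / 64)^j"])
  show "norm (trm d (freq G) j t x a) \<le> L * (1 / 64)^j" for j x using G(2) t a by (auto simp: tame_def)
qed (use trm_dx tame_summable[OF G(1) t a] geo64 in auto)

lemma ser_da:
  assumes G: "tame d T K G" "tame d T L (\<lambda>p q. Da (G p q))" and r: "\<And>p q. reg (G p q)"
    and t: "t \<in> {0..T}" and a: "a \<in> {-2..2}"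
  shows "((\<lambda>a. ser d G t x a) has_vector_derivative ser d (\<lambda>p q. Da (G p q)) t x a) (at a within {-2..2})"
  unfolding ser_def
proof (rule series_vector_derivative[of "{-2..2}", where M = "\<lambda>j. L * (1 / 64)^j"])
  show "norm (trm d (\<lambda>p q. Da (G p q)) j t x a) \<le> L * (1 / 64)^j" if "a \<in> {-2..2}" for j a using G(2) t that by (auto simp: tame_def)
  show "((\<lambda>a. trm d G j t x a) has_vector_derivative trm d (\<lambda>p q. Da (G p q)) j t x a) (at a within {-2..2})" for j a
    unfolding trm_def using t
    by (intro has_vector_derivative_mult_right has_vector_derivative_sum has_vector_derivative_at_within[OF reg_deriv[OF r]]) auto
qed (use tame_summable[OF G(1) t] geo64 a in auto)

lemma ser_dt_E:
  assumes G: "tame d T K E" "tame d T L (freq (Flux E))"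
    and t: "t \<in> {0..T}" and a: "a \<in> {-2..2}"
  shows "((\<lambda>t. ser d E t x a) has_vector_derivative - ser d (freq (Flux E)) t x a) (at t within {0..T})"
proof -
  have "((\<lambda>t. \<Sum>j. trm d E j t x a) has_vector_derivative (\<Sum>j. - trm d (freq (Flux E)) j t x a)) (at t within {0..T})"
  proof (rule series_vector_derivative[of "{0..T}", where M = "\<lambda>j. L * (1 / 64)^j"])
    show "norm (- trm d (freq (Flux E)) j t x a) \<le> L * (1 / 64)^j" if "t \<in> {0..T}" for j t using G(2) a that by (auto simp: tame_def)
    show "((\<lambda>t. trm d E j t x a) has_vector_derivative - trm d (freq (Flux E)) j t x a) (at t within {0..T})"
      if t: "t \<in> {0..T}" for j t
    proof -
      have "((\<lambda>t. E p q t a) has_vector_derivative - freq (Flux E) p q t a) (at t within {0..T})" for p q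
        unfolding freq_def
        by (rule has_vector_derivative_within_subset[OF E_deriv]) (use t in auto)
      then have "((\<lambda>t. trm d E j t x a) has_vector_derivative
         of_real d ^ j * (\<Sum>p\<le>j. cis ((2 * real p - real j) * x) * (- freq (Flux E) p (j - p) t a))) (at t within {0..T})"
        unfolding trm_def by (intro has_vector_derivative_mult_right has_vector_derivative_sum)
      then show ?thesis by (simp add: trm_def sum_negf)
    qed
  qed (use tame_summable[OF G(1) _ a] geo64 t in auto)
  then show ?thesis using tame_summable(2)[OF G(2) t a] by (simp add: ser_def suminf_minus)
qed

text \<open>A triple \<open>(p, i, k)\<close> of total first index and left index pair is renamed
  \<open>(l, i, i')\<close>, with the order \<open>l = i + k\<close> of the left factor and
  \<open>i' = p - i\<close>; the frequencies add up accordingly.\<close>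

lemma trm_conv: "trm d (conv G H) j t x a = (\<Sum>l\<le>j. trm d G l t x a * trm d H (j - l) t x a)"
proof -
  define f where "f p i k = cis ((2 * real p - real j) * x) * (G i k t a * H (p - i) (j - p - k) t a)" for p i k
  define g where "g l i i' = (cis ((2 * real i - real l) * x) * G i (l - i) t a) *
     (cis ((2 * real i' - real (j - l)) * x) * H i' (j - l - i') t a)" for l i i'
  have "(\<Sum>p\<le>j. cis ((2 * real p - real j) * x) * conv G H p (j - p) t a) = (\<Sum>p\<le>j. \<Sum>i\<le>p. \<Sum>k\<le>j - p. f p i k)"
    by (simp add: conv_def f_def sum_distrib_left)
  also have "\<dots> = (\<Sum>(p, i, k)\<in>Sigma {..j} (\<lambda>p. {..p} \<times> {..j - p}). f p i k)"
    by (simp add: sum.Sigma sum.cartesian_product split_beta)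
  also have "\<dots> = (\<Sum>(l, i, i')\<in>Sigma {..j} (\<lambda>l. {..l} \<times> {..j - l}). g l i i')"
  proof (rule sum.reindex_bij_witness[where i = "\<lambda>(l, i, i'). (i + i', i, l - i)" and j = "\<lambda>(p, i, k). (i + k, i, p - i)"])
    fix y assume "y \<in> Sigma {..j} (\<lambda>p. {..p} \<times> {..j - p})"
    then obtain p i k where y: "y = (p, i, k)" "p \<le> j" "i \<le> p" "k \<le> j - p" by auto
    have "(2 * real i - real (i + k)) * x + (2 * real (p - i) - real (j - (i + k))) * x = (2 * real p - real j) * x"
      using y by (simp add: of_nat_diff algebra_simps)
    then have "cis ((2 * real i - real (i + k)) * x) * cis ((2 * real (p - i) - real (j - (i + k))) * x) = cis ((2 * real p - real j) * x)"
      unfolding cis_mult by (simp only:)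
    moreover have "j - (i + k) - (p - i) = j - p - k" using y by auto
    ultimately have "g (i + k) i (p - i) = f p i k" by (simp add: f_def g_def mult_ac)
    then show "(case (case y of (p, i, k) \<Rightarrow> (i + k, i, p - i)) of (l, i, i') \<Rightarrow> g l i i') = (case y of (p, i, k) \<Rightarrow> f p i k)"
      by (simp add: y)
  qed auto
  also have "\<dots> = (\<Sum>l\<le>j. \<Sum>i\<le>l. \<Sum>i'\<le>j - l. g l i i')"
    by (simp add: sum.Sigma sum.cartesian_product split_beta)
  also have "\<dots> = (\<Sum>l\<le>j. (\<Sum>i\<le>l. cis ((2 * real i - real l) * x) * G i (l - i) t a) *
      (\<Sum>i'\<le>j - l. cis ((2 * real i' - real (j - l)) * x) * H i' (j - l - i') t a))"
    by (simp add: g_def sum_product)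
  finally have "trm d (conv G H) j t x a = (\<Sum>l\<le>j. of_real d ^ j * ((\<Sum>i\<le>l. cis ((2 * real i - real l) * x) * G i (l - i) t a) *
      (\<Sum>i'\<le>j - l. cis ((2 * real i' - real (j - l)) * x) * H i' (j - l - i') t a)))"
    unfolding trm_def by (simp add: sum_distrib_left)
  also have "\<dots> = (\<Sum>l\<le>j. trm d G l t x a * trm d H (j - l) t x a)"
  proof (rule sum.cong[OF refl])
    fix l assume "l \<in> {..j}"
    then have "(of_real d :: complex) ^ j = of_real d ^ l * of_real d ^ (j - l)" by (simp flip: power_add)
    then show "of_real d ^ j * ((\<Sum>i\<le>l. cis ((2 * real i - real l) * x) * G i (l - i) t a) *
      (\<Sum>i'\<le>j - l. cis ((2 * real i' - real (j - l)) * x) * H i' (j - l - i') t a)) = trm d G l t x a * trm d H (j - l) t x a"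
      by (simp add: trm_def mult_ac)
  qed
  finally show ?thesis .
qed

lemma ser_conv:
  assumes "tame d T K G" "tame d T L H" "t \<in> {0..T}" "a \<in> {-2..2}"
  shows "ser d (conv G H) t x a = ser d G t x a * ser d H t x a"
  unfolding ser_def trm_conv
  using Cauchy_product_sums[OF tame_summable(1)[OF assms(1,3,4)] tame_summable(1)[OF assms(2,3,4)]]
  by (simp add: sums_iff)

lemma ser_lin:
  assumes "tame d T K G" "tame d T L H" "t \<in> {0..T}" "a \<in> {-2..2}"
  shows "ser d (\<lambda>p q t a. c * G p q t a + H p q t a) t x a = c * ser d G t x a + ser d H t x a"
proof -
  have "trm d (\<lambda>p q t a. c * G p q t a + H p q t a) j t x a = c * trm d G j t x a + trm d H j t x a" for j
    by (simp add: trm_def sum_distrib_left sum.distrib algebra_simps)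
  then show ?thesis
    unfolding ser_def using tame_summable(2)[OF assms(1,3,4), of x] tame_summable(2)[OF assms(2,3,4), of x]
    by (simp add: suminf_add[symmetric] suminf_mult summable_mult)
qed

text \<open>\<open>Idf\<close> is bounded in the sup norm on the label interval, where the partial
  sums converge geometrically.\<close>

lemma ser_Idf:
  assumes G: "tame d T K G" and t: "t \<in> {0..T}"
  shows "Idf (ser d G t x) = ser d (\<lambda>p q t a. Idf (G p q t)) t x a"
proof -
  have t0: "t \<ge> 0" using t by simp
  have Gc: "continuous_on S (G p q t)" for p q S
  proof -
    have "continuous_on ({0..} \<times> UNIV) (\<lambda>x. G p q (fst x) (snd x))" using G by (simp add: tame_def split_beta)
    moreover have "continuous_on S (\<lambda>a::real. (t, a))" by (intro continuous_intros)
    ultimately show ?thesis using continuous_on_compose2[of "{0..} \<times> UNIV" "\<lambda>x. G p q (fst x) (snd x)" S "\<lambda>a. (t, a)"] t0 by auto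
  qed
  have tc: "continuous_on {-1..1} (trm d G j t x)" for j unfolding trm_def by (intro continuous_intros Gc)
  have sc: "continuous_on {-1..1} (ser d G t x)"
    by (rule ser_cont[OF G]) (use t in \<open>auto intro: continuous_intros\<close>)
  have It: "Idf (trm d G j t x) = trm d (\<lambda>p q t a. Idf (G p q t)) j t x a" for j
  proof -
    have "Idf (\<lambda>a. \<Sum>p\<le>j. cis ((2 * real p - real j) * x) * G p (j - p) t a) = (\<Sum>p\<le>j. Idf (\<lambda>a. cis ((2 * real p - real j) * x) * G p (j - p) t a))"
      by (intro Idf_sum finite_atMost continuous_intros Gc)
    then show ?thesis unfolding trm_def Idf_cmult by simp
  qed
  have part: "Idf (ser d G t x) - (\<Sum>j<n. Idf (trm d G j t x)) = Idf (\<lambda>a. ser d G t x a + (-1) * (\<Sum>j<n. trm d G j t x a))" for n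
  proof -
    have k: "continuous_on {-1..1} (\<lambda>a. (-1) * (\<Sum>j<n. trm d G j t x a))" by (intro continuous_intros tc)
    show ?thesis unfolding Idf_add[OF sc k] Idf_cmult by (subst Idf_sum) (auto intro: tc)
  qed
  have bnd: "norm (Idf (ser d G t x) - (\<Sum>j<n. Idf (trm d G j t x))) \<le> 25 * (2 * K * (1 / 64)^n)" for n
    unfolding part
  proof (rule Idf_bound)
    show "continuous_on {-1..1} (\<lambda>a. ser d G t x a + (-1) * (\<Sum>j<n. trm d G j t x a))" by (intro continuous_intros tc sc)
    fix a :: real assume "\<bar>a\<bar> \<le> 1"
    then have a: "a \<in> {-2..2}" by auto
    have K: "K \<ge> 0"
    proof -
      have "norm (trm d G 0 t x a) \<le> K * (1 / 64)^0" using G t a unfolding tame_def by blast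
      then show ?thesis by (simp add: order_trans[OF norm_ge_zero])
    qed
    have "ser d G t x a + (-1) * (\<Sum>j<n. trm d G j t x a) = (\<Sum>j. trm d G (j + n) t x a)"
      unfolding ser_def using suminf_split_initial_segment[OF tame_summable(2)[OF G t a], of x n] by simp
    also have "norm \<dots> \<le> (\<Sum>j. K * (1 / 64)^n * (1 / 64)^j)"
    proof (rule norm_suminf_le[OF _ geo64])
      fix j
      have "norm (trm d G (j + n) t x a) \<le> K * (1 / 64)^(j + n)" using G t a unfolding tame_def by blast
      then show "norm (trm d G (j + n) t x a) \<le> K * (1 / 64)^n * (1 / 64)^j" by (simp add: power_add mult_ac)
    qed
    also have "\<dots> = K * (1 / 64)^n * (64 / 63)" by (rule geo64_sum)
    also have "\<dots> = (64 / 63 * K) * (1 / 64)^n" by (simp only: mult_ac)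
    also have "\<dots> \<le> 2 * K * (1 / 64)^n"
    proof (rule mult_right_mono)
      show "64 / 63 * K \<le> 2 * K" using K by simp
    qed simp
    finally show "norm (ser d G t x a + (-1) * (\<Sum>j<n. trm d G j t x a)) \<le> 2 * K * (1 / 64)^n" .
  qed
  have lim: "(\<lambda>n. 25 * (2 * K * (1 / 64 :: real)^n)) \<longlonglongrightarrow> 0"
    by (intro tendsto_mult_right_zero LIMSEQ_power_zero) simp
  have "(\<lambda>n. norm (Idf (ser d G t x) - (\<Sum>j<n. Idf (trm d G j t x)))) \<longlonglongrightarrow> 0"
    by (rule tendsto_sandwich[OF _ _ tendsto_const lim]) (rule always_eventually, rule allI, (rule norm_ge_zero | rule bnd))+
  then have "(\<lambda>n. Idf (ser d G t x) - (\<Sum>j<n. Idf (trm d G j t x))) \<longlonglongrightarrow> 0" by (rule tendsto_norm_zero_cancel)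
  then have "(\<lambda>n. Idf (ser d G t x) - (Idf (ser d G t x) - (\<Sum>j<n. Idf (trm d G j t x)))) \<longlonglongrightarrow> Idf (ser d G t x) - 0"
    by (intro tendsto_intros)
  then have "(\<lambda>j. Idf (trm d G j t x)) sums Idf (ser d G t x)" by (simp add: sums_def)
  then show ?thesis unfolding ser_def It by (simp add: sums_iff)
qed

text \<open>Exchanging \<open>p\<close> and \<open>q\<close> pairs opposite frequencies with
  conjugate coefficients.\<close>

lemma ser_cnj:
  assumes "\<And>p q. G q p t a = cnj (G p q t a)"
  shows "Im (trm d G j t x a) = 0"
proof -
  have "cnj (trm d G j t x a) = of_real d ^ j * (\<Sum>p\<le>j. cis (- ((2 * real p - real j) * x)) * G (j - p) p t a)"
    unfolding trm_def by (simp add: cis_cnj flip: assms)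
  also have "(\<Sum>p\<le>j. cis (- ((2 * real p - real j) * x)) * G (j - p) p t a) = (\<Sum>p\<le>j. cis ((2 * real p - real j) * x) * G p (j - p) t a)"
    by (rule sum.reindex_bij_witness[where i = "\<lambda>p. j - p" and j = "\<lambda>p. j - p"])
      (auto simp: of_nat_diff algebra_simps)
  finally have "cnj (trm d G j t x a) = trm d G j t x a" by (simp add: trm_def)
  then show ?thesis by (simp add: complex_eq_iff)
qed

definition ridf :: "(real \<Rightarrow> real) \<Rightarrow> real" where
  "ridf h = integral {-1..1} (\<lambda>a. dens' a * h a) - 25/8 * (h 1 - h (-1))"

lemma Idf_of_real:
  assumes "continuous_on {-1..1} h"
  shows "Idf (\<lambda>a. of_real (h a)) = of_real (ridf h)"
proof -
  have "(\<lambda>a. dens' a * h a) integrable_on {-1..1}"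
    by (intro integrable_continuous_interval continuous_intros assms)
  from integral_linear[OF this bounded_linear_of_real]
  have "integral {-1..1} (\<lambda>a. of_real (dens' a) * of_real (h a) :: complex) = of_real (integral {-1..1} (\<lambda>a. dens' a * h a))"
    by (simp add: o_def)
  then show ?thesis by (simp add: Idf_def ridf_def)
qed

lemma Idf_cong:
  assumes "\<And>a. a \<in> {-1..1} \<Longrightarrow> f a = g a"
  shows "Idf f = Idf g"
proof -
  have "integral {-1..1} (\<lambda>a. of_real (dens' a) * f a) = integral {-1..1} (\<lambda>a. of_real (dens' a) * g a)"
    by (rule integral_cong) (simp add: assms)
  then show ?thesis using assms[of 1] assms[of "-1"] by (simp add: Idf_def)
qed

lemma has_vector_derivative_Re:
  "(f has_vector_derivative f') F \<Longrightarrow> ((\<lambda>x. Re (f x)) has_real_derivative Re f') F"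
  unfolding has_real_derivative_iff_has_vector_derivative
  by (rule bounded_linear.has_vector_derivative[OF bounded_linear_Re])

text \<open>Labels range over \<open>{-2..2}\<close> rather than \<open>{-1..1}\<close>, so that the labels of the fluid particles stay in the
  interior when the implicit function theorem is applied.\<close>

definition label_flow :: "real \<Rightarrow> (real \<Rightarrow> real \<Rightarrow> real \<Rightarrow> real) \<Rightarrow> (real \<Rightarrow> real \<Rightarrow> real \<Rightarrow> real) \<Rightarrow>
  (real \<Rightarrow> real \<Rightarrow> real \<Rightarrow> real) \<Rightarrow> (real \<Rightarrow> real \<Rightarrow> real \<Rightarrow> real) \<Rightarrow> (real \<Rightarrow> real \<Rightarrow> real) \<Rightarrow> bool" where
  "label_flow T w wt wx wa \<kappa> \<longleftrightarrow>
    continuous_on ({0..T} \<times> UNIV \<times> {-2..2}) (\<lambda>(t, x, a). w t x a) \<and>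
    continuous_on ({0..T} \<times> UNIV \<times> {-2..2}) (\<lambda>(t, x, a). wt t x a) \<and>
    continuous_on ({0..T} \<times> UNIV \<times> {-2..2}) (\<lambda>(t, x, a). wx t x a) \<and>
    continuous_on ({0..T} \<times> UNIV \<times> {-2..2}) (\<lambda>(t, x, a). wa t x a) \<and>
    (\<forall>t\<in>{0..T}. \<forall>x. \<forall>a\<in>{-2..2}.
       ((\<lambda>t. w t x a) has_real_derivative wt t x a) (at t within {0..T}) \<and>
       ((\<lambda>x. w t x a) has_real_derivative wx t x a) (at x) \<and>
       ((\<lambda>a. w t x a) has_real_derivative wa t x a) (at a within {-2..2}) \<and>
       ((\<lambda>x. (w t x a)^2 / 2 + \<kappa> t x * w t x a) has_real_derivative - wt t x a) (at x) \<and>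
       1 / 2 \<le> wa t x a) \<and>
    (\<forall>t\<in>{0..T}. \<forall>x. ridf (w t x) = -2 \<and> ridf (\<lambda>a. (w t x a)^2 / 2 + \<kappa> t x * w t x a) = 0) \<and>
    (\<forall>t x. w t (x + 2 * pi) = w t x \<and> \<kappa> t (x + 2 * pi) = \<kappa> t x) \<and> (\<forall>t\<in>{0..T}. continuous_on UNIV (\<kappa> t))"

text \<open>Summing the geometric tail of ratio 1 / 64 turns 16 into \<open>16 * 64 / 63\<close>,
  which is below 17.\<close>

lemma ser_tail:
  fixes c :: "nat \<Rightarrow> complex"
  assumes o: "ok d B s T" and b: "\<And>j. j \<ge> m \<Longrightarrow> norm (c j) \<le> 16 * (d * B * exp (s * t))^j" and t: "t \<in> {0..T}"
  shows "summable c" "norm (suminf c - (\<Sum>j<m. c j)) \<le> 17 * (d * B * exp (s * t))^m"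
proof -
  define r where "r = d * B * exp (s * t)"
  have r: "0 \<le> r" "r \<le> 1 / 64" using ok_le[OF o t] by (auto simp: r_def)
  have b': "norm (c (j + m)) \<le> 16 * r^m * (1 / 64)^j" for j
  proof -
    have "norm (c (j + m)) \<le> 16 * r^(j + m)" using b[of "j + m"] by (simp add: r_def)
    also have "\<dots> = 16 * r^m * r^j" by (simp add: power_add)
    also have "\<dots> \<le> 16 * r^m * (1 / 64)^j" using r by (intro mult_left_mono power_mono) auto
    finally show ?thesis .
  qed
  have "summable (\<lambda>j. c (j + m))"
    by (rule summable_comparison_test'[OF geo64 b'])
  then show sm: "summable c" by (rule summable_iff_shift[THEN iffD1])
  have "suminf c - (\<Sum>j<m. c j) = (\<Sum>j. c (j + m))"
    using suminf_split_initial_segment[OF sm, of m] by simp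
  also have "norm \<dots> \<le> (\<Sum>j. 16 * r^m * (1 / 64)^j)" by (rule norm_suminf_le) (rule b', rule geo64)
  also have "\<dots> = (16 * (64 / 63)) * r^m" unfolding geo64_sum by simp
  also have "\<dots> \<le> 17 * r^m" using r by (intro mult_right_mono) auto
  finally show "norm (suminf c - (\<Sum>j<m. c j)) \<le> 17 * (d * B * exp (s * t))^m" by (simp add: r_def)
qed

lemma cis_add_2pi_mult: "cis (of_int k * (x + 2 * pi)) = cis (of_int k * x)"
proof -
  have "cis (of_int k * (x + 2 * pi)) = cis (of_int k * x) * cis (2 * pi * of_int k)"
    unfolding cis_mult by (simp add: algebra_simps)
  also have "cis (2 * pi * of_int k) = 1" by (rule cis_multiple_2pi) simp
  finally show ?thesis by simp
qed

lemma trm_periodic: "trm d G j t (x + 2 * pi) a = trm d G j t x a"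
proof -
  have "cis ((2 * real p - real j) * (x + 2 * pi)) = cis ((2 * real p - real j) * x)" for p
    using cis_add_2pi_mult[of "2 * int p - int j" x] by simp
  then show ?thesis by (simp add: trm_def)
qed

lemma Re_of_real_mult: "Re (of_real r * z) = r * Re z"
  by simp

lemma trm_E_0: "trm d E 0 t x a = a" by (simp add: trm_def E_00)

lemma trm_E_1: "trm d E 1 t x a = of_real (d * (2 * Re (cis x * seed t a)))"
proof -
  have e: "E 0 (Suc 0) t a = cnj (seed t a)" using E_cnj[of 0 1] E_10 by simp
  have "trm d E 1 t x a = of_real d * (cis (- x) * cnj (seed t a) + cis x * seed t a)"
    using E_10 by (simp add: trm_def e)
  also have "cis (- x) * cnj (seed t a) + cis x * seed t a = of_real (2 * Re (cis x * seed t a))"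
    using complex_add_cnj[of "cis x * seed t a"] by (simp add: cis_cnj add.commute)
  finally show ?thesis by simp
qed

lemma lt_2: "{..<2::nat} = {0, 1}" by auto

text \<open>Orders 0 and 1 of the series are kept explicit and the rest is a geometric tail, hence
  quadratic in \<open>d * B * exp (s * t)\<close>. At time 0 the tail vanishes altogether by
  \<open>E_init\<close>.\<close>

lemma label_flow_exists:
  assumes s: "s > 1/2"
  shows "\<exists>B>0. \<forall>d T. ok d B s T \<longrightarrow> (\<exists>w wt wx wa \<kappa>. label_flow T w wt wx wa \<kappa> \<and>
    (\<forall>t\<in>{0..T}. \<forall>x. \<forall>a\<in>{-2..2}.
       \<bar>w t x a - a - d * exp (t / 2) * (2 * Re (cis x * (of_real a / (of_real a - \<i> / 2))))\<bar> \<le> 17 * (d * B * exp (s * t))^2) \<and>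
    (\<forall>x. \<forall>a\<in>{-2..2}. w 0 x a = a + d * (2 * Re (cis x * (of_real a / (of_real a - \<i> / 2))))))"
proof -
  define B where "B = 16 / amp s"
  have Bp: "B > 0" using amp[OF s] by (simp add: B_def)
  have E: "fam_bd B s 2 E" by (rule E_fam_bd[OF s B_def])
  note K = kap_fam_bd[OF E less_imp_le[OF Bp]]
  note F = Flux_fam_bd[OF E less_imp_le[OF Bp]]
  note CE = conv_fam_bd[OF E E less_imp_le[OF Bp]]
  note CK = conv_fam_bd[OF K E less_imp_le[OF Bp]]
  have "\<exists>w wt wx wa \<kappa>. label_flow T w wt wx wa \<kappa> \<and>
    (\<forall>t\<in>{0..T}. \<forall>x. \<forall>a\<in>{-2..2}.
       \<bar>w t x a - a - d * exp (t / 2) * (2 * Re (cis x * (of_real a / (of_real a - \<i> / 2))))\<bar> \<le> 17 * (d * B * exp (s * t))^2) \<and>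
    (\<forall>x. \<forall>a\<in>{-2..2}. w 0 x a = a + d * (2 * Re (cis x * (of_real a / (of_real a - \<i> / 2)))))"
    if o: "ok d B s T" for d T
  proof -
    note tE = tame_fam[OF o E] and tK = tame_fam[OF o K] and tF = tame_fam[OF o F]
    have tCE: "tame d T (8 * (128 * 2 * 2)) (conv E E)" using tame_fam(1)[OF o CE] by simp
    have tCK: "tame d T (8 * (128 * 3200 * 2)) (conv (kap E) E)" using tame_fam(1)[OF o CK] by simp
    have dB: "d \<ge> 0" "B \<ge> 0" and T0: "0 \<le> T" using o by (auto simp: ok_def)
    define w where "w t x a = Re (ser d E t x a)" for t x a
    \<comment> \<open>The coefficients \<open>kap E\<close> do not depend on the label, so label 0
      is an arbitrary representative.\<close>
    define \<kappa> where "\<kappa> t x = Re (ser d (kap E) t x 0)" for t x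
    define wt where "wt t x a = - Re (ser d (freq (Flux E)) t x a)" for t x a
    define wx where "wx t x a = Re (ser d (freq E) t x a)" for t x a
    define wa where "wa t x a = Re (ser d (\<lambda>p q. Da (E p q)) t x a)" for t x a
    have real: "ser d G t x a = of_real (Re (ser d G t x a))"
      if G: "tame d T L G" and c: "\<And>p q. G q p t a = cnj (G p q t a)" and t: "t \<in> {0..T}" "a \<in> {-2..2}" for G L t x a
    proof -
      have "trm d G j t x a = of_real (Re (trm d G j t x a))" for j
        using ser_cnj[where G = G and t = t and a = a and d = d and j = j and x = x, OF c] by (simp add: complex_eq_iff)
      then have "ser d G t x a = (\<Sum>j. of_real (Re (trm d G j t x a)))" unfolding ser_def by metis
      also have "\<dots> = of_real (\<Sum>j. Re (trm d G j t x a))"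
        using summable_Re[OF tame_summable(2)[OF G t, of x]] by (rule suminf_of_real[symmetric])
      finally show ?thesis by simp
    qed
    have wE: "ser d E t x a = of_real (w t x a)" if "t \<in> {0..T}" "a \<in> {-2..2}" for t x a
      unfolding w_def by (rule real[OF tE(1) E_cnj that])
    have k0: "ser d (kap E) t x a = ser d (kap E) t x 0" for t x a
      by (simp add: ser_def trm_def kap_def)
    have kE: "ser d (kap E) t x a = of_real (\<kappa> t x)" if "t \<in> {0..T}" for t x a
      unfolding \<kappa>_def by (subst k0, rule real[OF tK(1) kap_cnj]) (use that in auto)
    have FE: "ser d (Flux E) t x a = of_real ((w t x a)^2 / 2 + \<kappa> t x * w t x a)" if ta: "t \<in> {0..T}" "a \<in> {-2..2}" for t x a
    proof -
      have "Flux E = (\<lambda>p q t a. 1 / 2 * conv E E p q t a + conv (kap E) E p q t a)"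
        by (simp add: Flux_def fun_eq_iff)
      then have "ser d (Flux E) t x a = 1 / 2 * ser d (conv E E) t x a + ser d (conv (kap E) E) t x a"
        by (simp only: ser_lin[OF tCE tCK ta])
      also have "\<dots> = 1 / 2 * (of_real (w t x a) * of_real (w t x a)) + of_real (\<kappa> t x) * of_real (w t x a)"
        unfolding ser_conv[OF tE(1) tE(1) ta] ser_conv[OF tK(1) tE(1) ta] wE[OF ta] kE[OF ta(1)] ..
      finally show ?thesis by (simp add: power2_eq_square)
    qed
    have cnt: "continuous_on ({0..T} \<times> UNIV \<times> {-2..2}) (\<lambda>(t, x, a). Re (ser d G t x a))" if "tame d T L G" for G L
    proof -
      have "continuous_on ({0..T} \<times> UNIV \<times> {-2..2}) (\<lambda>y. ser d G (fst y) (fst (snd y)) (snd (snd y)))"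
        by (rule ser_cont[OF that]) (auto intro!: continuous_intros)
      then show ?thesis unfolding split_beta by (intro continuous_intros)
    qed
    have wcont: "continuous_on {-1..1} (w t x)" if "t \<in> {0..T}" for t x
      unfolding w_def using that by (intro continuous_intros ser_cont[OF tE(1)]) auto
    have Iw: "ridf (w t x) = -2" if t: "t \<in> {0..T}" for t x
    proof -
      have "complex_of_real (ridf (w t x)) = Idf (\<lambda>a. of_real (w t x a))"
        by (rule Idf_of_real[symmetric, OF wcont[OF t]])
      also have "\<dots> = Idf (ser d E t x)" by (rule Idf_cong) (use wE[OF t] in auto)
      also have "\<dots> = ser d (\<lambda>p q t a. Idf (E p q t)) t x 0" by (rule ser_Idf[OF tE(1) t])
      \<comment> \<open>Only the background contributes to the height of the column;
        \<open>E_inv\<close> annihilates all higher orders.\<close>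
      also have "\<dots> = (\<Sum>j. if j = 0 then -2 else 0)"
        unfolding ser_def
      proof (rule suminf_cong)
        fix j
        have z: "Idf (E p (j - p) t) = 0" if "j \<noteq> 0" "p \<le> j" for p
          using E_inv[OF s B_def, of p "j - p"] that t by auto
        have "E 0 0 t = (\<lambda>a. of_real a)" by (simp add: E.simps)
        then have "Idf (E 0 0 t) = -2" by (simp add: Idf_a)
        then show "trm d (\<lambda>p q t a. Idf (E p q t)) j t x 0 = (if j = 0 then -2 else 0)"
          using z by (simp add: trm_def)
      qed
      also have "\<dots> = -2" by (subst suminf_finite[of "{0}"]) auto
      finally have "complex_of_real (ridf (w t x)) = of_real (-2)" by simp
      then show ?thesis by (simp only: of_real_eq_iff)
    qed
    have Iw2: "ridf (\<lambda>a. (w t x a)^2) = 4 * \<kappa> t x" if t: "t \<in> {0..T}" for t x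
    proof -
      have "complex_of_real (ridf (\<lambda>a. (w t x a)^2)) = Idf (\<lambda>a. of_real ((w t x a)^2))"
        by (rule Idf_of_real[symmetric]) (intro continuous_intros wcont[OF t])
      also have "\<dots> = Idf (ser d (conv E E) t x)"
        by (rule Idf_cong) (use wE[OF t] ser_conv[OF tE(1) tE(1) t] in \<open>auto simp: power2_eq_square\<close>)
      also have "\<dots> = ser d (\<lambda>p q t a. Idf (conv E E p q t)) t x 0" by (rule ser_Idf[OF tCE t])
      also have "\<dots> = 4 * ser d (kap E) t x 0"
        using tame_summable(2)[OF tK(1) t, of 0 x]
        by (simp add: ser_def suminf_mult[symmetric]) (simp add: trm_def kap_def sum_distrib_left mult_ac)
      also have "\<dots> = of_real (4 * \<kappa> t x)" by (simp add: kE[OF t])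
      finally show ?thesis by (simp only: of_real_eq_iff)
    qed
    have IF: "ridf (\<lambda>a. (w t x a)^2 / 2 + \<kappa> t x * w t x a) = 0" if t: "t \<in> {0..T}" for t x
    proof -
      have i: "(\<lambda>a. 1/2 * (dens' a * (w t x a)^2)) integrable_on {-1..1}" "(\<lambda>a. \<kappa> t x * (dens' a * w t x a)) integrable_on {-1..1}"
        by (intro integrable_continuous_interval continuous_intros wcont[OF t])+
      have "integral {-1..1} (\<lambda>a. dens' a * ((w t x a)^2 / 2 + \<kappa> t x * w t x a))
         = integral {-1..1} (\<lambda>a. 1/2 * (dens' a * (w t x a)^2) + \<kappa> t x * (dens' a * w t x a))"
        by (simp add: algebra_simps)
      also have "\<dots> = 1/2 * integral {-1..1} (\<lambda>a. dens' a * (w t x a)^2) + \<kappa> t x * integral {-1..1} (\<lambda>a. dens' a * w t x a)"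
        by (subst integral_add[OF i]) simp
      finally have e: "integral {-1..1} (\<lambda>a. dens' a * ((w t x a)^2 / 2 + \<kappa> t x * w t x a))
         = 1/2 * integral {-1..1} (\<lambda>a. dens' a * (w t x a)^2) + \<kappa> t x * integral {-1..1} (\<lambda>a. dens' a * w t x a)" .
      have "ridf (\<lambda>a. (w t x a)^2 / 2 + \<kappa> t x * w t x a) = ridf (\<lambda>a. (w t x a)^2) / 2 + \<kappa> t x * ridf (w t x)"
        unfolding ridf_def e by (simp add: field_simps)
      then show ?thesis by (simp add: Iw[OF t] Iw2[OF t])
    qed
    have bE: "norm (trm d E j t x a) \<le> 16 * (d * B * exp (s * t))^j" "norm (trm d (\<lambda>p q. Da (E p q)) j t x a) \<le> 16 * (d * B * exp (s * t))^j"
      if "t \<in> {0..T}" "a \<in> {-2..2}" for t a j x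
    proof -
      have p: "0 \<le> 16 * (d * B * exp (s * t))^j" using ok_le(1)[OF o that(1)] by simp
      have "wgt j \<le> 1" by (simp add: wgt_def)
      from mult_left_mono[OF this p] show "norm (trm d E j t x a) \<le> 16 * (d * B * exp (s * t))^j" "norm (trm d (\<lambda>p q. Da (E p q)) j t x a) \<le> 16 * (d * B * exp (s * t))^j"
        using trm_bound(1,3)[OF E dB(2,1), of t a j x] that by (fastforce simp: abs_le_iff)+
    qed
    \<comment> \<open>Order 0 contributes the derivative 1 of the label and the tail at most
      \<open>17 / 64 < 1 / 2\<close>, so \<open>w\<close> remains strictly increasing in the
      label.\<close>
    have wa1: "1 / 2 \<le> wa t x a" if ta: "t \<in> {0..T}" "a \<in> {-2..2}" for t x a
    proof -
      have "norm (ser d (\<lambda>p q. Da (E p q)) t x a - (\<Sum>j<1. trm d (\<lambda>p q. Da (E p q)) j t x a)) \<le> 17 * (d * B * exp (s * t))^1"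
        unfolding ser_def by (rule ser_tail(2)[OF o bE(2)[OF ta] ta(1)])
      moreover have "(\<Sum>j<1. trm d (\<lambda>p q. Da (E p q)) j t x a) = 1"
      proof -
        have "E 0 0 = (\<lambda>t a. of_real a)" by (simp add: E.simps)
        then show ?thesis by (simp add: trm_def Da_id)
      qed
      ultimately have "norm (ser d (\<lambda>p q. Da (E p q)) t x a - 1) \<le> 17 / 64" using ok_le(2)[OF o ta(1)] by simp
      moreover have "\<bar>Re (ser d (\<lambda>p q. Da (E p q)) t x a - 1)\<bar> \<le> norm (ser d (\<lambda>p q. Da (E p q)) t x a - 1)"
        by (rule abs_Re_le_cmod)
      ultimately show ?thesis unfolding wa_def minus_complex.sel one_complex.sel by linarith
    qed
    have exp2: "\<bar>w t x a - a - d * exp (t / 2) * (2 * Re (cis x * (of_real a / (of_real a - \<i> / 2))))\<bar> \<le> 17 * (d * B * exp (s * t))^2"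
      if ta: "t \<in> {0..T}" "a \<in> {-2..2}" for t x a
    proof -
      have "norm (ser d E t x a - (\<Sum>j<2. trm d E j t x a)) \<le> 17 * (d * B * exp (s * t))^2"
        unfolding ser_def by (rule ser_tail(2)[OF o bE(1)[OF ta] ta(1)])
      moreover have "(\<Sum>j<2. trm d E j t x a) = of_real (a + d * exp (t / 2) * (2 * Re (cis x * (of_real a / (of_real a - \<i> / 2)))))"
      proof -
        have "cis x * seed t a = of_real (exp (t / 2)) * (cis x * (of_real a / (of_real a - \<i> / 2)))" by (simp add: seed_def)
        then have re: "Re (cis x * seed t a) = exp (t / 2) * Re (cis x * (of_real a / (of_real a - \<i> / 2)))"
          by (simp only: Re_of_real_mult)
        have s2: "(\<Sum>j<2. trm d E j t x a) = trm d E 0 t x a + trm d E 1 t x a" by (simp add: lt_2)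
        show ?thesis unfolding s2 trm_E_0 trm_E_1 re by simp
      qed
      ultimately have "norm (complex_of_real (w t x a - (a + d * exp (t / 2) * (2 * Re (cis x * (of_real a / (of_real a - \<i> / 2))))))) \<le> 17 * (d * B * exp (s * t))^2"
        unfolding wE[OF ta] by (simp only: of_real_diff)
      then show ?thesis unfolding norm_of_real by (simp add: diff_diff_eq)
    qed
    have w0: "w 0 x a = a + d * (2 * Re (cis x * (of_real a / (of_real a - \<i> / 2))))" if a: "a \<in> {-2..2}" for x a
    proof -
      have "trm d E j 0 x a = 0" if "j \<notin> {..<2}" for j
      proof -
        have "E p (j - p) 0 a = 0" if "p \<le> j" for p using \<open>j \<notin> {..<2}\<close> that by (intro E_init) auto
        then show ?thesis by (simp add: trm_def)
      qed
      then have "ser d E 0 x a = (\<Sum>j<2. trm d E j 0 x a)" unfolding ser_def by (intro suminf_finite) auto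
      also have "\<dots> = trm d E 0 0 x a + trm d E 1 0 x a" by (simp add: lt_2)
      also have "\<dots> = of_real (a + d * (2 * Re (cis x * seed 0 a)))"
        unfolding trm_E_0 trm_E_1 by (rule of_real_add[symmetric])
      finally show ?thesis by (simp add: w_def seed_def)
    qed
    have dw: "((\<lambda>t. w t x a) has_real_derivative wt t x a) (at t within {0..T})"
      "((\<lambda>x. w t x a) has_real_derivative wx t x a) (at x)"
      "((\<lambda>a. w t x a) has_real_derivative wa t x a) (at a within {-2..2})"
      "((\<lambda>x. (w t x a)^2 / 2 + \<kappa> t x * w t x a) has_real_derivative - wt t x a) (at x)"
      if ta: "t \<in> {0..T}" "a \<in> {-2..2}" for t x a
    proof -
      show "((\<lambda>t. w t x a) has_real_derivative wt t x a) (at t within {0..T})"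
        unfolding w_def wt_def using has_vector_derivative_Re[OF ser_dt_E[OF tE(1) tF(2) ta]] by simp
      show "((\<lambda>x. w t x a) has_real_derivative wx t x a) (at x)"
        unfolding w_def wx_def by (rule has_vector_derivative_Re[OF ser_dx[OF tE(1,2) ta]])
      show "((\<lambda>a. w t x a) has_real_derivative wa t x a) (at a within {-2..2})"
        unfolding w_def wa_def by (rule has_vector_derivative_Re[OF ser_da[OF tE(1,3) E_reg ta]])
      show "((\<lambda>x. (w t x a)^2 / 2 + \<kappa> t x * w t x a) has_real_derivative - wt t x a) (at x)"
        using has_vector_derivative_Re[OF ser_dx[OF tF(1,2) ta]] by (simp add: FE[OF ta] wt_def)
    qed
    have per: "w t (x + 2 * pi) = w t x" "\<kappa> t (x + 2 * pi) = \<kappa> t x" for t x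
      by (simp_all add: w_def \<kappa>_def ser_def trm_periodic fun_eq_iff)
    have c1: "continuous_on ({0..T} \<times> UNIV \<times> {-2..2}) (\<lambda>(t, x, a). wt t x a)"
      using continuous_on_minus[OF cnt[OF tF(2)]] by (simp add: wt_def split_beta)
    have c2: "continuous_on ({0..T} \<times> UNIV \<times> {-2..2}) (\<lambda>(t, x, a). w t x a)" unfolding w_def by (rule cnt[OF tE(1)])
    have c3: "continuous_on ({0..T} \<times> UNIV \<times> {-2..2}) (\<lambda>(t, x, a). wx t x a)" unfolding wx_def by (rule cnt[OF tE(2)])
    have c4: "continuous_on ({0..T} \<times> UNIV \<times> {-2..2}) (\<lambda>(t, x, a). wa t x a)" unfolding wa_def by (rule cnt[OF tE(3)])
    have c5: "continuous_on UNIV (\<kappa> t)" if "t \<in> {0..T}" for t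
      unfolding \<kappa>_def by (intro continuous_intros ser_cont[OF tK(1)]) (use that in auto)
    have "label_flow T w wt wx wa \<kappa>"
      unfolding label_flow_def by (intro conjI ballI allI c1 c2 c3 c4 c5 dw wa1 per Iw IF)
    then show ?thesis using exp2 w0 by blast
  qed
  with Bp show ?thesis by blast
qed

section \<open>From labels to the hydrostatic Euler equations\<close>

lemma antideriv:
  fixes F :: "real \<Rightarrow> real"
  assumes F: "continuous_on {-2..2} F" and a: "a \<in> {-2..2}"
  shows "((\<lambda>a. integral {-2..a} F) has_real_derivative F a) (at a within {-2..2})"
  unfolding has_real_derivative_iff_has_vector_derivative by (rule integral_has_vector_derivative[OF F a])

text \<open>The affine substitution onto \<open>[0, 1]\<close> makes the variable endpoint a
  parameter of the integrand.\<close>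

lemma cont_antideriv:
  fixes f :: "'y::topological_space \<Rightarrow> real \<Rightarrow> real"
  assumes f: "continuous_on (Y \<times> {-2..2}) (\<lambda>(y, a). f y a)"
  shows "continuous_on (Y \<times> {-2..2}) (\<lambda>(y, a). integral {-2..a} (f y))"
proof -
  have f': "continuous_on (Y \<times> {-2..2}) (\<lambda>p. f (fst p) (snd p))" using f by (simp add: split_beta)
  have fy: "continuous_on {-2..2} (f y)" if "y \<in> Y" for y
  proof -
    have "continuous_on {-2..2::real} (\<lambda>a. (y, a))" by (intro continuous_intros)
    from continuous_on_compose2[OF f' this] that show ?thesis by auto
  qed
  have "continuous_on (Y \<times> {-2..2}) (\<lambda>p. integral (cbox 0 1) (\<lambda>r. f (fst p) (-2 + r * (snd p + 2)) * (snd p + 2)))"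
  proof (rule integral_continuous_on_param)
    have "continuous_on ((Y \<times> {-2..2}) \<times> cbox 0 1) (\<lambda>q. f (fst (fst q)) (-2 + snd q * (snd (fst q) + 2)))"
    proof -
      have 1: "continuous_on ((Y \<times> {-2..2}) \<times> cbox 0 (1::real)) (\<lambda>q. (fst (fst q), -2 + snd q * (snd (fst q) + 2)))"
        by (intro continuous_intros)
      have "b * (a + 2) \<le> 4" if "a \<le> 2" "0 \<le> b" "b \<le> 1" "-2 \<le> a" for a b :: real
        using mult_mono[of b 1 "a + 2" 4] that by simp
      then have 2: "(\<lambda>q. (fst (fst q), -2 + snd q * (snd (fst q) + 2))) ` ((Y \<times> {-2..2::real}) \<times> cbox 0 1) \<subseteq> Y \<times> {-2..2}"
        by fastforce
      show ?thesis using continuous_on_compose2[OF f' 1 2] by simp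
    qed
    then show "continuous_on ((Y \<times> {-2..2}) \<times> cbox 0 1) (\<lambda>(p, r). f (fst p) (-2 + r * (snd p + 2)) * (snd p + 2))"
      unfolding split_beta by (intro continuous_intros)
  qed
  moreover have "integral {0..1} (\<lambda>r. f y (-2 + r * (a + 2)) * (a + 2)) = integral {-2..a} (f y)"
    if "y \<in> Y" "a \<in> {-2..2}" for y a
  proof -
    have "(\<lambda>a. integral {-2..a} (f y)) (-2 + (a + 2)) - (\<lambda>a. integral {-2..a} (f y)) (-2)
      = integral {0..1} (\<lambda>r. (\<lambda>x h. f y x * h) (-2 + r *\<^sub>R (a + 2)) (a + 2))"
    proof (rule mvt_integral[where S = "{-2..2}"])
      show "((\<lambda>a. integral {-2..a} (f y)) has_derivative (\<lambda>h. f y x * h)) (at x within {-2..2})" if "x \<in> {-2..2}" for x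
        using antideriv[OF fy[OF \<open>y \<in> Y\<close>] that] by (simp add: has_field_derivative_def)
      show "-2 + r *\<^sub>R (a + 2) \<in> {-2..2}" if "r \<in> {0..1}" for r
        using that \<open>a \<in> {-2..2}\<close> mult_mono[of r 1 "a + 2" 4] by auto
    qed
    then show ?thesis by simp
  qed
  ultimately show ?thesis
    by (subst continuous_on_cong[OF refl]) (auto simp: split_beta)
qed

text \<open>For \<open>h\<close> of class C1 this is the integral of \<open>dens * h'\<close> from
  -1 to \<open>a\<close>, in a form that asks only for continuity. As the label derivatives satisfy
  \<open>z\<^sub>a = dens * w\<^sub>a\<close>, it yields the height above the lower wall when
  applied to \<open>w\<close>, and the stream function when applied to
  \<open>w\<^sup>2 / 2 + \<kappa> * w\<close>. The integrals start at -2 so that -1 is an interior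
  label.\<close>

definition Bop :: "(real \<Rightarrow> real) \<Rightarrow> real \<Rightarrow> real" where
  "Bop h a = dens a * h a - dens (-1) * h (-1) - (integral {-2..a} (\<lambda>b. dens' b * h b) - integral {-2..-1} (\<lambda>b. dens' b * h b))"

lemma dens_cont [continuous_intros]: "continuous_on A f \<Longrightarrow> continuous_on A (\<lambda>x. dens (f x))"
  unfolding dens_def by (intro continuous_intros) auto

lemma dens_deriv: "(dens has_real_derivative dens' a) (at a within S)"
  unfolding dens_def[abs_def] dens'_def
  by (auto intro!: derivative_eq_intros simp: field_simps power2_eq_square power_numeral_reduce)

lemma dens_ge: "dens a \<ge> 5/16"
proof -
  have "0 \<le> a^4" by (metis zero_le_even_power even_numeral)
  then show ?thesis unfolding dens_def using zero_le_power2[of a] by linarith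
qed

lemma Bop_minus1: "Bop h (-1) = 0"
  by (simp add: Bop_def)

lemma Bop_1:
  assumes "continuous_on {-2..2} h"
  shows "Bop h 1 = - ridf h"
proof -
  have "integral {-2..-1} (\<lambda>b. dens' b * h b) + integral {-1..1} (\<lambda>b. dens' b * h b) = integral {-2..1} (\<lambda>b. dens' b * h b)"
    by (rule Henstock_Kurzweil_Integration.integral_combine) (auto intro!: integrable_continuous_interval continuous_intros continuous_on_subset[OF assms])
  moreover have d: "dens 1 = 25/8" "dens (-1) = 25/8" by (simp_all add: dens_def)
  ultimately show ?thesis unfolding Bop_def ridf_def d by (simp add: algebra_simps)
qed

lemma Bop_deriv:
  assumes h: "\<And>a. a \<in> {-2..2} \<Longrightarrow> (h has_real_derivative h' a) (at a within {-2..2})" and a: "a \<in> {-2..2}"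
  shows "(Bop h has_real_derivative dens a * h' a) (at a within {-2..2})"
proof -
  have hc: "continuous_on {-2..2} h" by (rule DERIV_continuous_on[OF h])
  have "((\<lambda>a. integral {-2..a} (\<lambda>b. dens' b * h b)) has_real_derivative dens' a * h a) (at a within {-2..2})"
    by (rule antideriv[OF _ a]) (intro continuous_intros hc)
  then have "((\<lambda>a. dens a * h a - dens (-1) * h (-1) - (integral {-2..a} (\<lambda>b. dens' b * h b) - integral {-2..-1} (\<lambda>b. dens' b * h b)))
     has_real_derivative (dens' a * h a + h' a * dens a) - 0 - (dens' a * h a - 0)) (at a within {-2..2})"
    by (intro DERIV_diff DERIV_mult dens_deriv h a DERIV_const)
  then show ?thesis by (simp add: Bop_def[abs_def] mult.commute)
qed

lemma Bop_param_deriv: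
  fixes h :: "real \<Rightarrow> real \<Rightarrow> real"
  assumes d: "\<And>s a. s \<in> S \<Longrightarrow> a \<in> {-2..2} \<Longrightarrow> ((\<lambda>s. h s a) has_real_derivative h' s a) (at s within S)"
    and c: "\<And>s. s \<in> S \<Longrightarrow> continuous_on {-2..2} (h s)" and c': "continuous_on (S \<times> {-2..2}) (\<lambda>(s, a). h' s a)"
    and S: "convex S" "s \<in> S" and a: "a \<in> {-2..2}"
  shows "((\<lambda>s. Bop (h s) a) has_real_derivative Bop (h' s) a) (at s within S)"
proof -
  have I: "((\<lambda>s. integral (cbox (-2) b) (\<lambda>a. dens' a * h s a)) has_real_derivative integral (cbox (-2) b) (\<lambda>a. dens' a * h' s a)) (at s within S)"
    if b: "b \<in> {-2..2}" for b
  proof (rule leibniz_rule_field_derivative)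
    show "((\<lambda>s. dens' a * h s a) has_real_derivative dens' a * h' s a) (at s within S)" if "s \<in> S" "a \<in> cbox (-2) b" for s a
      using d[of s a] that b by (intro DERIV_cmult) auto
    show "(\<lambda>a. dens' a * h s a) integrable_on cbox (-2) b" if "s \<in> S" for s
      unfolding cbox_interval using b that
      by (intro integrable_continuous_interval continuous_intros continuous_on_subset[OF c]) auto
    have "continuous_on (S \<times> cbox (-2) b) (\<lambda>(s, a). h' s a)"
      using b by (intro continuous_on_subset[OF c']) auto
    then show "continuous_on (S \<times> cbox (-2) b) (\<lambda>(s, a). dens' a * h' s a)"
      unfolding split_beta by (intro continuous_intros)
  qed (use S in auto)
  show ?thesis unfolding Bop_def
    using I[of a] I[of "-1"] a d[OF S(2), of a] d[OF S(2), of "-1"]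
    by (auto intro!: DERIV_diff DERIV_cmult)
qed

lemma Bop_cont:
  fixes h :: "'y::topological_space \<Rightarrow> real \<Rightarrow> real"
  assumes h: "continuous_on (Y \<times> {-2..2}) (\<lambda>(y, a). h y a)"
  shows "continuous_on (Y \<times> {-2..2}) (\<lambda>(y, a). Bop (h y) a)"
proof -
  have "continuous_on (Y \<times> {-2..2}) (\<lambda>(y, b). dens' b * h y b)"
    using h unfolding split_beta by (intro continuous_intros)
  note J = cont_antideriv[OF this]
  have c: "continuous_on (Y \<times> {-2..2::real}) (\<lambda>p. (fst p, -1::real))" by (intro continuous_intros)
  have sub: "(\<lambda>p. (fst p, -1::real)) ` (Y \<times> {-2..2::real}) \<subseteq> Y \<times> {-2..2}" by fastforce
  have "continuous_on (Y \<times> {-2..2::real}) (\<lambda>p. h (fst p) (-1))"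
    using continuous_on_compose2[OF h c sub] by simp
  moreover have "continuous_on (Y \<times> {-2..2::real}) (\<lambda>p. integral {-2..-1} (\<lambda>b. dens' b * h (fst p) b))"
    using continuous_on_compose2[OF J c sub] by simp
  ultimately show ?thesis unfolding split_beta Bop_def
    using h J unfolding split_beta by (intro continuous_intros)
qed

text \<open>The localisation of the mean value point makes it converge together with the endpoints
  in the two lemmas below.\<close>

lemma mean_value_within:
  fixes f :: "real \<Rightarrow> real"
  assumes f: "\<And>x. x \<in> {l..r} \<Longrightarrow> (f has_real_derivative f' x) (at x within {l..r})" and ab: "a \<in> {l..r}" "b \<in> {l..r}"
  shows "\<exists>\<xi>\<in>{l..r}. \<bar>\<xi> - a\<bar> \<le> \<bar>b - a\<bar> \<and> f b - f a = f' \<xi> * (b - a)"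
proof -
  have *: "\<exists>\<xi>\<in>{a..b}. f b - f a = f' \<xi> * (b - a)" if "a \<le> b" "a \<in> {l..r}" "b \<in> {l..r}" for a b
  proof (rule mvt_very_simple[OF that(1)])
    fix x assume "a \<le> x" "x \<le> b"
    then have "(f has_real_derivative f' x) (at x within {a..b})"
      using that by (intro has_field_derivative_subset[OF f]) auto
    then show "(f has_derivative (\<lambda>h. f' x * h)) (at x within {a..b})" by (simp add: has_field_derivative_def)
  qed
  show ?thesis
  proof (cases "a \<le> b")
    case True
    then obtain \<xi> where "\<xi> \<in> {a..b}" "f b - f a = f' \<xi> * (b - a)" using *[OF True ab] by auto
    then show ?thesis using ab by (intro bexI[of _ \<xi>]) auto
  next
    case False
    then obtain \<xi> where "\<xi> \<in> {b..a}" "f a - f b = f' \<xi> * (a - b)" using *[of b a] ab by auto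
    then show ?thesis using ab False by (intro bexI[of _ \<xi>]) (auto simp: algebra_simps)
  qed
qed

text \<open>A chain rule from partial derivatives alone: a mean value point in the second variable
  replaces total differentiability, and joint continuity of \<open>\<Phi>a\<close> gives the limit
  there.\<close>

lemma chain_partial:
  fixes \<Phi> :: "real \<Rightarrow> real \<Rightarrow> real"
  assumes s: "s \<in> S" and g: "(g has_real_derivative g') (at s within S)" and gr: "\<And>\<sigma>. \<sigma> \<in> S \<Longrightarrow> g \<sigma> \<in> {-2..2}"
    and ds: "((\<lambda>\<sigma>. \<Phi> \<sigma> (g s)) has_real_derivative \<Phi>s) (at s within S)"
    and da: "\<And>\<sigma> a. \<sigma> \<in> S \<Longrightarrow> a \<in> {-2..2} \<Longrightarrow> (\<Phi> \<sigma> has_real_derivative \<Phi>a \<sigma> a) (at a within {-2..2})"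
    and c: "continuous_on (S \<times> {-2..2}) (\<lambda>(\<sigma>, a). \<Phi>a \<sigma> a)"
  shows "((\<lambda>\<sigma>. \<Phi> \<sigma> (g \<sigma>)) has_real_derivative \<Phi>s + \<Phi>a s (g s) * g') (at s within S)"
proof -
  have "\<exists>\<xi>\<in>{-2..2}. \<bar>\<xi> - g s\<bar> \<le> \<bar>g \<sigma> - g s\<bar> \<and> \<Phi> \<sigma> (g \<sigma>) - \<Phi> \<sigma> (g s) = \<Phi>a \<sigma> \<xi> * (g \<sigma> - g s)" if "\<sigma> \<in> S" for \<sigma>
    using da[OF that] gr[OF that] gr[OF s] by (intro mean_value_within)
  then obtain \<xi> where \<xi>: "\<And>\<sigma>. \<sigma> \<in> S \<Longrightarrow> \<xi> \<sigma> \<in> {-2..2}" "\<And>\<sigma>. \<sigma> \<in> S \<Longrightarrow> \<bar>\<xi> \<sigma> - g s\<bar> \<le> \<bar>g \<sigma> - g s\<bar>"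
    "\<And>\<sigma>. \<sigma> \<in> S \<Longrightarrow> \<Phi> \<sigma> (g \<sigma>) - \<Phi> \<sigma> (g s) = \<Phi>a \<sigma> (\<xi> \<sigma>) * (g \<sigma> - g s)" by metis
  have evS: "\<forall>\<^sub>F \<sigma> in at s within S. \<sigma> \<in> S" by (simp add: eventually_at_filter)
  have gl: "(g \<longlongrightarrow> g s) (at s within S)"
    using has_field_derivative_imp_has_derivative[OF g, THEN has_derivative_continuous] by (simp add: continuous_within)
  have "((\<lambda>\<sigma>. \<xi> \<sigma> - g s) \<longlongrightarrow> 0) (at s within S)"
  proof (rule Lim_null_comparison[where g = "\<lambda>\<sigma>. \<bar>g \<sigma> - g s\<bar>"])
    show "\<forall>\<^sub>F \<sigma> in at s within S. norm (\<xi> \<sigma> - g s) \<le> \<bar>g \<sigma> - g s\<bar>"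
      using evS by eventually_elim (use \<xi>(2) in auto)
    show "((\<lambda>\<sigma>. \<bar>g \<sigma> - g s\<bar>) \<longlongrightarrow> 0) (at s within S)"
      using gl by (intro tendsto_rabs_zero) (simp add: LIM_zero_iff)
  qed
  then have \<xi>l: "(\<xi> \<longlongrightarrow> g s) (at s within S)" by (simp add: LIM_zero_iff)
  have "((\<lambda>\<sigma>. (\<sigma>, \<xi> \<sigma>)) \<longlongrightarrow> (s, g s)) (at s within S)" by (intro tendsto_Pair tendsto_ident_at \<xi>l)
  moreover have ev: "\<forall>\<^sub>F \<sigma> in at s within S. (\<sigma>, \<xi> \<sigma>) \<in> S \<times> {-2..2}"
    using evS by eventually_elim (use \<xi>(1) in auto)
  ultimately have \<Phi>l: "((\<lambda>\<sigma>. \<Phi>a \<sigma> (\<xi> \<sigma>)) \<longlongrightarrow> \<Phi>a s (g s)) (at s within S)"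
    using continuous_on_tendsto_compose[OF c, where g = "\<lambda>\<sigma>. (\<sigma>, \<xi> \<sigma>)"] s gr[OF s] by auto
  have "((\<lambda>\<sigma>. (\<Phi> \<sigma> (g s) - \<Phi> s (g s)) / (\<sigma> - s) + \<Phi>a \<sigma> (\<xi> \<sigma>) * ((g \<sigma> - g s) / (\<sigma> - s))) \<longlongrightarrow> \<Phi>s + \<Phi>a s (g s) * g') (at s within S)"
    using ds g unfolding has_field_derivative_iff by (intro tendsto_intros \<Phi>l)
  then have "((\<lambda>\<sigma>. (\<Phi> \<sigma> (g \<sigma>) - \<Phi> s (g s)) / (\<sigma> - s)) \<longlongrightarrow> \<Phi>s + \<Phi>a s (g s) * g') (at s within S)"
  proof (rule Lim_transform_eventually)
    show "\<forall>\<^sub>F \<sigma> in at s within S. (\<Phi> \<sigma> (g s) - \<Phi> s (g s)) / (\<sigma> - s) + \<Phi>a \<sigma> (\<xi> \<sigma>) * ((g \<sigma> - g s) / (\<sigma> - s)) = (\<Phi> \<sigma> (g \<sigma>) - \<Phi> s (g s)) / (\<sigma> - s)"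
      using evS
    proof eventually_elim
      case (elim \<sigma>)
      show ?case using \<xi>(3)[OF elim] by (simp add: add_divide_distrib[symmetric])
    qed
  qed
  then show ?thesis by (simp add: has_field_derivative_iff)
qed

lemma implicit_lipschitz:
  fixes Z :: "real \<Rightarrow> real"
  assumes da: "\<And>a. a \<in> {-2..2} \<Longrightarrow> (Z has_real_derivative Za a) (at a within {-2..2})"
    and m: "m > 0" "\<And>a. a \<in> {-2..2} \<Longrightarrow> Za a \<ge> m" and ab: "a \<in> {-2..2}" "b \<in> {-2..2}"
  shows "m * \<bar>b - a\<bar> \<le> \<bar>Z b - Z a\<bar>"
proof -
  obtain \<xi> where "\<xi> \<in> {-2..2}" "Z b - Z a = Za \<xi> * (b - a)" using mean_value_within[OF da ab] by auto
  then show ?thesis using m by (auto simp: abs_mult intro!: mult_right_mono order_trans[OF m(2) abs_ge_self])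
qed

text \<open>Continuity of \<open>g\<close> comes for free: the slope bound \<open>m\<close> controls
  \<open>g \<sigma> - g s\<close> by the change of \<open>Z\<close> in its first variable.\<close>

lemma implicit_deriv:
  fixes Z :: "real \<Rightarrow> real \<Rightarrow> real"
  assumes s: "s \<in> S" and gr: "\<And>\<sigma>. \<sigma> \<in> S \<Longrightarrow> g \<sigma> \<in> {-2..2}" and gz: "\<And>\<sigma>. \<sigma> \<in> S \<Longrightarrow> Z \<sigma> (g \<sigma>) = z"
    and ds: "((\<lambda>\<sigma>. Z \<sigma> (g s)) has_real_derivative Zs) (at s within S)"
    and da: "\<And>\<sigma> a. \<sigma> \<in> S \<Longrightarrow> a \<in> {-2..2} \<Longrightarrow> (Z \<sigma> has_real_derivative Za \<sigma> a) (at a within {-2..2})"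
    and m: "m > 0" "\<And>\<sigma> a. \<sigma> \<in> S \<Longrightarrow> a \<in> {-2..2} \<Longrightarrow> Za \<sigma> a \<ge> m"
    and c: "continuous_on (S \<times> {-2..2}) (\<lambda>(\<sigma>, a). Za \<sigma> a)"
  shows "(g has_real_derivative - Zs / Za s (g s)) (at s within S)"
proof -
  have "\<exists>\<xi>\<in>{-2..2}. \<bar>\<xi> - g s\<bar> \<le> \<bar>g \<sigma> - g s\<bar> \<and> Z \<sigma> (g \<sigma>) - Z \<sigma> (g s) = Za \<sigma> \<xi> * (g \<sigma> - g s)" if "\<sigma> \<in> S" for \<sigma>
    using da[OF that] gr[OF that] gr[OF s] by (intro mean_value_within)
  then obtain \<xi> where \<xi>: "\<And>\<sigma>. \<sigma> \<in> S \<Longrightarrow> \<xi> \<sigma> \<in> {-2..2}" "\<And>\<sigma>. \<sigma> \<in> S \<Longrightarrow> \<bar>\<xi> \<sigma> - g s\<bar> \<le> \<bar>g \<sigma> - g s\<bar>"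
    "\<And>\<sigma>. \<sigma> \<in> S \<Longrightarrow> Z \<sigma> (g \<sigma>) - Z \<sigma> (g s) = Za \<sigma> (\<xi> \<sigma>) * (g \<sigma> - g s)" by metis
  have evS: "\<forall>\<^sub>F \<sigma> in at s within S. \<sigma> \<in> S" by (simp add: eventually_at_filter)
  have Zl: "((\<lambda>\<sigma>. Z \<sigma> (g s)) \<longlongrightarrow> z) (at s within S)"
    using has_field_derivative_imp_has_derivative[OF ds, THEN has_derivative_continuous] gz[OF s] by (simp add: continuous_within)
  have lip: "m * \<bar>g \<sigma> - g s\<bar> \<le> \<bar>Z \<sigma> (g s) - z\<bar>" if "\<sigma> \<in> S" for \<sigma>
    using implicit_lipschitz[OF da[OF that] m(1) m(2)[OF that] gr[OF s] gr[OF that]] gz[OF that] by simp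
  have "((\<lambda>\<sigma>. \<xi> \<sigma> - g s) \<longlongrightarrow> 0) (at s within S)"
  proof (rule Lim_null_comparison[where g = "\<lambda>\<sigma>. \<bar>Z \<sigma> (g s) - z\<bar> / m"])
    show "\<forall>\<^sub>F \<sigma> in at s within S. norm (\<xi> \<sigma> - g s) \<le> \<bar>Z \<sigma> (g s) - z\<bar> / m"
      using evS
    proof eventually_elim
      case (elim \<sigma>)
      have "\<bar>\<xi> \<sigma> - g s\<bar> \<le> \<bar>g \<sigma> - g s\<bar>" by (rule \<xi>(2)[OF elim])
      also have "\<dots> \<le> \<bar>Z \<sigma> (g s) - z\<bar> / m" using lip[OF elim] m(1) by (simp add: field_simps)
      finally show ?case by simp
    qed
    show "((\<lambda>\<sigma>. \<bar>Z \<sigma> (g s) - z\<bar> / m) \<longlongrightarrow> 0) (at s within S)"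
      using Zl by (intro tendsto_divide_zero tendsto_rabs_zero) (simp add: LIM_zero_iff)
  qed
  then have \<xi>l: "(\<xi> \<longlongrightarrow> g s) (at s within S)" by (simp add: LIM_zero_iff)
  have "((\<lambda>\<sigma>. (\<sigma>, \<xi> \<sigma>)) \<longlongrightarrow> (s, g s)) (at s within S)" by (intro tendsto_Pair tendsto_ident_at \<xi>l)
  moreover have ev: "\<forall>\<^sub>F \<sigma> in at s within S. (\<sigma>, \<xi> \<sigma>) \<in> S \<times> {-2..2}"
    using evS by eventually_elim (use \<xi>(1) in auto)
  ultimately have Zal: "((\<lambda>\<sigma>. Za \<sigma> (\<xi> \<sigma>)) \<longlongrightarrow> Za s (g s)) (at s within S)"
    using continuous_on_tendsto_compose[OF c, where g = "\<lambda>\<sigma>. (\<sigma>, \<xi> \<sigma>)"] s gr[OF s] by auto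
  have "((\<lambda>\<sigma>. - ((Z \<sigma> (g s) - Z s (g s)) / (\<sigma> - s)) / Za \<sigma> (\<xi> \<sigma>)) \<longlongrightarrow> - Zs / Za s (g s)) (at s within S)"
    using ds m(2)[OF s gr[OF s]] m(1) unfolding has_field_derivative_iff by (intro tendsto_intros Zal) auto
  then have "((\<lambda>\<sigma>. (g \<sigma> - g s) / (\<sigma> - s)) \<longlongrightarrow> - Zs / Za s (g s)) (at s within S)"
  proof (rule Lim_transform_eventually)
    show "\<forall>\<^sub>F \<sigma> in at s within S. - ((Z \<sigma> (g s) - Z s (g s)) / (\<sigma> - s)) / Za \<sigma> (\<xi> \<sigma>) = (g \<sigma> - g s) / (\<sigma> - s)"
      using evS
    proof eventually_elim
      case (elim \<sigma>)
      have "Za \<sigma> (\<xi> \<sigma>) > 0" using m(1) m(2)[OF elim \<xi>(1)[OF elim]] by linarith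
      moreover have "- (Z \<sigma> (g s) - Z s (g s)) = Za \<sigma> (\<xi> \<sigma>) * (g \<sigma> - g s)"
        using \<xi>(3)[OF elim] gz[OF s] gz[OF elim] by simp
      ultimately show ?case by (simp add: minus_divide_left)
    qed
  qed
  then show ?thesis by (simp add: has_field_derivative_iff)
qed

lemma triple_cont:
  assumes h: "continuous_on (A \<times> UNIV \<times> B) (\<lambda>(t, x, a). h t x a)"
    and f: "continuous_on S f" "continuous_on S g" "continuous_on S k" "\<And>y. y \<in> S \<Longrightarrow> f y \<in> A" "\<And>y. y \<in> S \<Longrightarrow> k y \<in> B"
  shows "continuous_on S (\<lambda>y. h (f y) (g y) (k y))"
proof -
  have 1: "continuous_on S (\<lambda>y. (f y, g y, k y))" by (intro continuous_intros f)
  have 2: "(\<lambda>y. (f y, g y, k y)) ` S \<subseteq> A \<times> UNIV \<times> B" using f(4,5) by auto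
  show ?thesis using continuous_on_compose2[OF h 1 2] by simp
qed

lemma Bop_uminus: "Bop (\<lambda>a. - h a) a = - Bop h a"
  by (simp add: Bop_def)

lemma periodic_nat:
  assumes "\<And>x. f (x + p) = f x"
  shows "f (x + real n * p) = f x"
proof (induction n arbitrary: x)
  case (Suc n)
  have "f (x + real (Suc n) * p) = f ((x + p) + real n * p)" by (simp add: algebra_simps)
  then show ?case using Suc[of "x + p"] assms by simp
qed simp

lemma scale_deriv:
  assumes f: "(f has_real_derivative d) (at (L * t) within {0..T})" and L: "L > 0" and t: "t \<in> {0..T / L}"
  shows "((\<lambda>t. f (L * t)) has_real_derivative L * d) (at t within {0..T / L})"
proof -
  have "(\<lambda>t. L * t) ` {0..T / L} \<subseteq> {0..T}" using L by (auto simp: field_simps)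
  then have "(f has_real_derivative d) (at (L * t) within (\<lambda>t. L * t) ` {0..T / L})"
    by (rule has_field_derivative_subset[OF f])
  moreover have "((\<lambda>t. L * t) has_real_derivative L) (at t within {0..T / L})"
    by (auto intro!: derivative_eq_intros)
  ultimately have "(f \<circ> (\<lambda>t. L * t) has_real_derivative d * L) (at t within {0..T / L})"
    by (rule DERIV_image_chain)
  then show ?thesis by (simp add: o_def mult.commute)
qed

lemma scale_deriv_UNIV:
  assumes f: "(f has_real_derivative d) (at (L * x))"
  shows "((\<lambda>x. f (L * x)) has_real_derivative L * d) (at x)"
proof -
  have "((\<lambda>x. L * x) has_real_derivative L) (at x)" by (auto intro!: derivative_eq_intros)
  from DERIV_chain2[where f = f and g = "\<lambda>x. L * x", OF f this] show ?thesis by (simp add: mult.commute)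
qed

section \<open>Eulerian fields of a label flow\<close>

context
  fixes T w wt wx wa \<kappa>
  assumes lf: "label_flow T w wt wx wa \<kappa>"
begin

lemma flow_facts:
  "continuous_on ({0..T} \<times> UNIV \<times> {-2..2}) (\<lambda>(t, x, a). w t x a)"
  "continuous_on ({0..T} \<times> UNIV \<times> {-2..2}) (\<lambda>(t, x, a). wt t x a)"
  "continuous_on ({0..T} \<times> UNIV \<times> {-2..2}) (\<lambda>(t, x, a). wx t x a)"
  "continuous_on ({0..T} \<times> UNIV \<times> {-2..2}) (\<lambda>(t, x, a). wa t x a)"
  "t \<in> {0..T} \<Longrightarrow> a \<in> {-2..2} \<Longrightarrow> ((\<lambda>t. w t x a) has_real_derivative wt t x a) (at t within {0..T})"
  "t \<in> {0..T} \<Longrightarrow> a \<in> {-2..2} \<Longrightarrow> ((\<lambda>x. w t x a) has_real_derivative wx t x a) (at x)"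
  "t \<in> {0..T} \<Longrightarrow> a \<in> {-2..2} \<Longrightarrow> (w t x has_real_derivative wa t x a) (at a within {-2..2})"
  "t \<in> {0..T} \<Longrightarrow> a \<in> {-2..2} \<Longrightarrow> ((\<lambda>x. (w t x a)^2 / 2 + \<kappa> t x * w t x a) has_real_derivative - wt t x a) (at x)"
  "t \<in> {0..T} \<Longrightarrow> a \<in> {-2..2} \<Longrightarrow> 1 / 2 \<le> wa t x a"
  "t \<in> {0..T} \<Longrightarrow> ridf (w t x) = -2"
  "t \<in> {0..T} \<Longrightarrow> ridf (\<lambda>a. (w t x a)^2 / 2 + \<kappa> t x * w t x a) = 0"
  "w t (x + 2 * pi) = w t x" "\<kappa> t (x + 2 * pi) = \<kappa> t x" "t \<in> {0..T} \<Longrightarrow> continuous_on UNIV (\<kappa> t)"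
  using lf unfolding label_flow_def by auto

abbreviation Q where "Q t x \<equiv> (\<lambda>a. (w t x a)^2 / 2 + \<kappa> t x * w t x a)"

lemma w_slice: "t \<in> {0..T} \<Longrightarrow> continuous_on {-2..2} (w t x)"
  by (rule DERIV_continuous_on[OF flow_facts(7)])

lemma Z_da: "t \<in> {0..T} \<Longrightarrow> a \<in> {-2..2} \<Longrightarrow> (Bop (w t x) has_real_derivative dens a * wa t x a) (at a within {-2..2})"
  by (rule Bop_deriv[OF flow_facts(7)])

lemma Za_ge: "t \<in> {0..T} \<Longrightarrow> a \<in> {-2..2} \<Longrightarrow> 5 / 32 \<le> dens a * wa t x a"
  using mult_mono[OF dens_ge[of a] flow_facts(9)[of t a x]] dens_ge[of a] by simp

lemma Za_pos: "t \<in> {0..T} \<Longrightarrow> a \<in> {-2..2} \<Longrightarrow> dens a * wa t x a > 0"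
  using Za_ge[of t a x] by linarith

lemma Z_dt: "t \<in> {0..T} \<Longrightarrow> a \<in> {-2..2} \<Longrightarrow> ((\<lambda>t. Bop (w t x) a) has_real_derivative Bop (wt t x) a) (at t within {0..T})"
proof (rule Bop_param_deriv)
  have "continuous_on ({0..T} \<times> {-2..2}) (\<lambda>p. wt (fst p) x (snd p))"
    by (rule triple_cont[OF flow_facts(2)]) (auto intro: continuous_intros)
  then show "continuous_on ({0..T} \<times> {-2..2}) (\<lambda>(s, a). wt s x a)" by (simp add: split_beta)
qed (auto intro: flow_facts w_slice)

lemma Z_dx: "t \<in> {0..T} \<Longrightarrow> a \<in> {-2..2} \<Longrightarrow> ((\<lambda>x. Bop (w t x) a) has_real_derivative Bop (wx t x) a) (at x)"
proof (rule Bop_param_deriv)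
  assume "t \<in> {0..T}"
  then have "continuous_on (UNIV \<times> {-2..2}) (\<lambda>p. wx t (fst p) (snd p))"
    by (intro triple_cont[OF flow_facts(3)]) (auto intro: continuous_intros)
  then show "continuous_on (UNIV \<times> {-2..2}) (\<lambda>(s, a). wx t s a)" by (simp add: split_beta)
qed (auto intro: flow_facts w_slice)

lemma Q_cont: "t \<in> {0..T} \<Longrightarrow> continuous_on {-2..2} (Q t x)"
  by (intro continuous_intros w_slice) auto

lemma \<Phi>_dx: "t \<in> {0..T} \<Longrightarrow> a \<in> {-2..2} \<Longrightarrow> ((\<lambda>x. Bop (Q t x) a) has_real_derivative - Bop (wt t x) a) (at x)"
proof -
  assume t: "t \<in> {0..T}" and a: "a \<in> {-2..2}"
  have "continuous_on (UNIV \<times> {-2..2}) (\<lambda>p. wt t (fst p) (snd p))"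
    using t by (intro triple_cont[OF flow_facts(2)]) (auto intro: continuous_intros)
  then have "continuous_on (UNIV \<times> {-2..2}) (\<lambda>(s, a). - wt t s a)" by (simp add: split_beta continuous_on_minus)
  then have "((\<lambda>x. Bop (Q t x) a) has_real_derivative Bop (\<lambda>a. - wt t x a) a) (at x)"
    by (intro Bop_param_deriv flow_facts(8) Q_cont t a) auto
  then show ?thesis by (simp only: Bop_uminus)
qed

lemma \<Phi>_da: "t \<in> {0..T} \<Longrightarrow> a \<in> {-2..2} \<Longrightarrow>
    (Bop (Q t x) has_real_derivative dens a * ((w t x a + \<kappa> t x) * wa t x a)) (at a within {-2..2})"
proof (rule Bop_deriv)
  show "(Q t x has_real_derivative (w t x a + \<kappa> t x) * wa t x a) (at a within {-2..2})" if "t \<in> {0..T}" "a \<in> {-2..2}" for a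
    using flow_facts(7)[OF that, of x] by (auto intro!: derivative_eq_intros simp: algebra_simps)
qed

text \<open>The height of label \<open>a\<close> in the column at \<open>x\<close> is
  \<open>Bop (w t x) a - 1\<close>, and this inverts it; the choice is unique because the height
  increases strictly with the label.\<close>

definition lab :: "real \<Rightarrow> real \<Rightarrow> real \<Rightarrow> real" where
  "lab t x z = (SOME a. a \<in> {-1..1} \<and> Bop (w t x) a = z + 1)"

lemma lab:
  assumes t: "t \<in> {0..T}" and z: "z \<in> {-1..1}"
  shows "lab t x z \<in> {-1..1}" "Bop (w t x) (lab t x z) = z + 1"
proof -
  have "continuous_on {-1..1} (Bop (w t x))"
    by (rule continuous_on_subset[OF DERIV_continuous_on[OF Z_da[OF t]]]) auto
  moreover have "Bop (w t x) (-1) = 0" "Bop (w t x) 1 = 2"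
    using Bop_1[OF w_slice[OF t]] flow_facts(10)[OF t] by (auto simp: Bop_minus1)
  ultimately have "\<exists>a. a \<in> {-1..1} \<and> Bop (w t x) a = z + 1"
    using IVT'[of "Bop (w t x)" "-1" "z + 1" 1] z by auto
  from someI_ex[OF this] show "lab t x z \<in> {-1..1}" "Bop (w t x) (lab t x z) = z + 1" by (auto simp: lab_def)
qed

lemma lab2: "t \<in> {0..T} \<Longrightarrow> z \<in> {-1..1} \<Longrightarrow> lab t x z \<in> {-2..2}"
  using lab(1)[of t z x] by auto

lemma Z_lipschitz:
  "t \<in> {0..T} \<Longrightarrow> a \<in> {-2..2} \<Longrightarrow> b \<in> {-2..2} \<Longrightarrow> 5 / 32 * \<bar>b - a\<bar> \<le> \<bar>Bop (w t x) b - Bop (w t x) a\<bar>"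
  by (rule implicit_lipschitz[OF Z_da _ Za_ge]) auto

lemma Z_cont: "continuous_on (({0..T} \<times> UNIV) \<times> {-2..2}) (\<lambda>(y, a). Bop (w (fst y) (snd y)) a)"
  "continuous_on (({0..T} \<times> UNIV) \<times> {-2..2}) (\<lambda>(y, a). Bop (wt (fst y) (snd y)) a)"
  "continuous_on (({0..T} \<times> UNIV) \<times> {-2..2}) (\<lambda>(y, a). Bop (wx (fst y) (snd y)) a)"
proof -
  have *: "continuous_on (({0..T} \<times> UNIV) \<times> {-2..2}) (\<lambda>(y, a). h (fst y) (snd y) a)"
    if "continuous_on ({0..T} \<times> UNIV \<times> {-2..2}) (\<lambda>(t, x, a). h t x a)" for h :: "real \<Rightarrow> real \<Rightarrow> real \<Rightarrow> real"
    unfolding split_beta by (rule triple_cont[OF that]) (auto intro!: continuous_intros)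
  show "continuous_on (({0..T} \<times> UNIV) \<times> {-2..2}) (\<lambda>(y, a). Bop (w (fst y) (snd y)) a)"
    "continuous_on (({0..T} \<times> UNIV) \<times> {-2..2}) (\<lambda>(y, a). Bop (wt (fst y) (snd y)) a)"
    "continuous_on (({0..T} \<times> UNIV) \<times> {-2..2}) (\<lambda>(y, a). Bop (wx (fst y) (snd y)) a)"
    by (rule Bop_cont[OF *[OF flow_facts(1)]] Bop_cont[OF *[OF flow_facts(2)]] Bop_cont[OF *[OF flow_facts(3)]])+
qed

lemma Bop_comp:
  assumes h: "continuous_on (({0..T} \<times> UNIV) \<times> {-2..2}) (\<lambda>(y, a). Bop (h (fst y) (snd y)) a)"
    and f: "continuous_on S f" "continuous_on S g" "continuous_on S k" "\<And>y. y \<in> S \<Longrightarrow> f y \<in> {0..T}" "\<And>y. y \<in> S \<Longrightarrow> k y \<in> {-2..2}"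
  shows "continuous_on S (\<lambda>y. Bop (h (f y) (g y)) (k y))"
proof -
  have 1: "continuous_on S (\<lambda>y. ((f y, g y), k y))" by (intro continuous_intros f)
  have 2: "(\<lambda>y. ((f y, g y), k y)) ` S \<subseteq> ({0..T} \<times> UNIV) \<times> {-2..2}" using f(4,5) by auto
  show ?thesis using continuous_on_compose2[OF h 1 2] by simp
qed

text \<open>At a frozen label the height varies continuously, and the lower Lipschitz bound converts
  the residual \<open>R\<close> into a bound on the label.\<close>

lemma lab_cont: "continuous_on ({0..T} \<times> UNIV \<times> {-1..1}) (\<lambda>(t, x, z). lab t x z)"
  unfolding continuous_on_def
proof
  fix y0 assume y0: "y0 \<in> {0..T} \<times> (UNIV :: real set) \<times> {-1..1::real}"
  define g where "g y = lab (fst y) (fst (snd y)) (snd (snd y))" for y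
  define S where "S = {0..T} \<times> (UNIV :: real set) \<times> {-1..1::real}"
  define R where "R y = Bop (w (fst y) (fst (snd y))) (g y0) - (snd (snd y) + 1)" for y
  have g2: "g y \<in> {-2..2}" if "y \<in> S" for y unfolding g_def by (rule lab2) (use that in \<open>auto simp: S_def\<close>)
  have gZ: "Bop (w (fst y) (fst (snd y))) (g y) = snd (snd y) + 1" if "y \<in> S" for y
    unfolding g_def by (rule lab(2)) (use that in \<open>auto simp: S_def\<close>)
  have y0S: "y0 \<in> S" using y0 by (simp add: S_def)
  have "continuous_on S (\<lambda>y. Bop (w (fst y) (fst (snd y))) (g y0))"
    by (rule Bop_comp[OF Z_cont(1)]) (use g2[OF y0S] in \<open>auto simp: S_def intro!: continuous_intros\<close>)
  then have "continuous_on S R" unfolding R_def by (intro continuous_intros)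
  then have "(R \<longlongrightarrow> R y0) (at y0 within S)" using y0S by (auto simp: continuous_on_def)
  moreover have "R y0 = 0" unfolding R_def gZ[OF y0S] by simp
  ultimately have "(R \<longlongrightarrow> 0) (at y0 within S)" by (simp only:)
  then have R: "((\<lambda>y. 32 / 5 * \<bar>R y\<bar>) \<longlongrightarrow> 0) (at y0 within S)"
    by (intro tendsto_mult_right_zero tendsto_rabs_zero)
  have "((\<lambda>y. g y - g y0) \<longlongrightarrow> 0) (at y0 within S)"
  proof (rule Lim_null_comparison[OF _ R])
    have "\<forall>\<^sub>F y in at y0 within S. y \<in> S" by (simp add: eventually_at_filter)
    then show "\<forall>\<^sub>F y in at y0 within S. norm (g y - g y0) \<le> 32 / 5 * \<bar>R y\<bar>"
    proof eventually_elim
      case (elim y)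
      have "5 / 32 * \<bar>g y - g y0\<bar> \<le> \<bar>Bop (w (fst y) (fst (snd y))) (g y) - Bop (w (fst y) (fst (snd y))) (g y0)\<bar>"
        by (rule Z_lipschitz[OF _ g2[OF y0S] g2[OF elim]]) (use elim in \<open>auto simp: S_def\<close>)
      then show ?case unfolding R_def gZ[OF elim] by (simp add: abs_minus_commute mult.commute)
    qed
  qed
  then have "(g \<longlongrightarrow> g y0) (at y0 within S)" by (simp add: LIM_zero_iff)
  then show "((\<lambda>(t, x, z). lab t x z) \<longlongrightarrow> (case y0 of (t, x, z) \<Rightarrow> lab t x z)) (at y0 within {0..T} \<times> UNIV \<times> {-1..1})"
    unfolding S_def g_def by (simp add: case_prod_unfold)
qed

lemma Za_cont_S:
  assumes "continuous_on S f" "continuous_on S g" "continuous_on S k" "\<And>y. y \<in> S \<Longrightarrow> f y \<in> {0..T}" "\<And>y. y \<in> S \<Longrightarrow> k y \<in> {-2..2}"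
  shows "continuous_on S (\<lambda>y. dens (k y) * wa (f y) (g y) (k y))"
  by (intro continuous_intros triple_cont[OF flow_facts(4)] assms)

lemma lab_dt:
  assumes t: "t \<in> {0..T}" and z: "z \<in> {-1..1}"
  shows "((\<lambda>t. lab t x z) has_real_derivative - Bop (wt t x) (lab t x z) / (dens (lab t x z) * wa t x (lab t x z))) (at t within {0..T})"
proof (rule implicit_deriv[where Z = "\<lambda>t. Bop (w t x)" and z = "z + 1" and m = "5 / 32" and Za = "\<lambda>t a. dens a * wa t x a"])
  show "continuous_on ({0..T} \<times> {-2..2}) (\<lambda>(\<sigma>, a). dens a * wa \<sigma> x a)"
    unfolding split_beta by (rule Za_cont_S) (auto intro: continuous_intros)
qed (use assms Za_ge in \<open>auto intro!: lab lab2 Z_dt Z_da simp del: atLeastAtMost_iff\<close>)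

lemma lab_dx:
  assumes t: "t \<in> {0..T}" and z: "z \<in> {-1..1}"
  shows "((\<lambda>x. lab t x z) has_real_derivative - Bop (wx t x) (lab t x z) / (dens (lab t x z) * wa t x (lab t x z))) (at x)"
proof (rule implicit_deriv[where Z = "\<lambda>x. Bop (w t x)" and z = "z + 1" and m = "5 / 32" and Za = "\<lambda>x a. dens a * wa t x a"])
  show "continuous_on (UNIV \<times> {-2..2}) (\<lambda>(\<sigma>, a). dens a * wa t \<sigma> a)"
    unfolding split_beta by (rule Za_cont_S) (use t in \<open>auto intro: continuous_intros\<close>)
qed (use assms Za_ge in \<open>auto intro!: lab lab2 Z_dx Z_da simp del: atLeastAtMost_iff\<close>)

lemma lab_dz:
  assumes t: "t \<in> {0..T}" and z: "z \<in> {-1..1}"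
  shows "((\<lambda>z. lab t x z) has_real_derivative 1 / (dens (lab t x z) * wa t x (lab t x z))) (at z within {-1..1})"
proof -
  have "((\<lambda>z. lab t x z) has_real_derivative - (-1) / (dens (lab t x z) * wa t x (lab t x z))) (at z within {-1..1})"
  proof (rule implicit_deriv[where Z = "\<lambda>z a. Bop (w t x) a - z" and z = 1 and m = "5 / 32" and Za = "\<lambda>z a. dens a * wa t x a"])
    show "continuous_on ({-1..1} \<times> {-2..2}) (\<lambda>(\<sigma>, a). dens a * wa t x a)"
      unfolding split_beta by (rule Za_cont_S) (use t in \<open>auto intro: continuous_intros\<close>)
    show "((\<lambda>a. Bop (w t x) a - \<sigma>) has_real_derivative dens a * wa t x a) (at a within {-2..2})" if "a \<in> {-2..2}" for \<sigma> a
      using DERIV_diff[OF Z_da[OF t that] DERIV_const] by simp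
    show "((\<lambda>\<sigma>. Bop (w t x) (lab t x z) - \<sigma>) has_real_derivative - 1) (at z within {-1..1})"
      by (auto intro!: derivative_eq_intros)
    show "Bop (w t x) (lab t x \<sigma>) - \<sigma> = 1" if "\<sigma> \<in> {-1..1}" for \<sigma> using lab(2)[OF t that] by simp
  qed (use assms Za_ge in \<open>auto intro!: lab2 simp del: atLeastAtMost_iff\<close>)
  then show ?thesis by simp
qed

text \<open>Replacing \<open>(t, x)\<close> by \<open>(L * t, L * x)\<close> preserves the system if
  \<open>v\<close> is multiplied by \<open>L\<close>, because there is no equation for the vertical
  momentum. The period \<open>2 * pi\<close> becomes \<open>1 / N\<close>, so 1 is a period, and the
  lifespan shrinks to \<open>T / L\<close>.\<close>

lemma flow_euler:
  assumes T: "T > 0" and N: "N \<ge> 1"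
  defines "L \<equiv> 2 * pi * real N"
  shows "hydrostatic_Euler_solution (T / L) (\<lambda>t x z. 1 / dens (lab (L * t) (L * x) z))"
proof -
  have L: "L > 0" using N by (simp add: L_def)
  define u where "u t x z = w t x (lab t x z) + \<kappa> t x" for t x z
  define \<phi> where "\<phi> t x z = Bop (Q t x) (lab t x z)" for t x z
  \<comment> \<open>With \<open>Bop (w t x) a - 1\<close> as the height of a label, this is the rate
    of change of that height along the horizontal flow, so surfaces of constant label are
    material.\<close>
  define v where "v t x z = Bop (wt t x) (lab t x z) + u t x z * Bop (wx t x) (lab t x z)" for t x z
  define q where "q t x z = - dens' (lab t x z) / (dens (lab t x z))^2" for t x z
  define D where "D t x z = dens (lab t x z) * wa t x (lab t x z)" for t x z
  define ot where "ot t x z = q t x z * (- Bop (wt t x) (lab t x z) / D t x z)" for t x z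
  define ox where "ox t x z = q t x z * (- Bop (wx t x) (lab t x z) / D t x z)" for t x z
  define oz where "oz t x z = q t x z * (1 / D t x z)" for t x z
  have Dp: "D t x z > 0" if "t \<in> {0..T}" "z \<in> {-1..1}" for t x z
    unfolding D_def by (rule Za_pos[OF that(1) lab2[OF that]])
  have dp: "dens a > 0" for a using dens_ge[of a] by linarith
  have wap: "wa t x (lab t x z) > 0" if "t \<in> {0..T}" "z \<in> {-1..1}" for t x z
    using flow_facts(9)[OF that(1) lab2[OF that, of x], of x] by linarith
  have inv: "((\<lambda>s. 1 / dens (g s)) has_real_derivative (- dens' (g s) / (dens (g s))^2) * g') (at s within S)"
    if "(g has_real_derivative g') (at s within S)" for g g' s S
    using DERIV_chain2[OF dens_deriv that] dp[of "g s"]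
    by (auto intro!: derivative_eq_intros simp: power2_eq_square)
  have do: "((\<lambda>t. 1 / dens (lab t x z)) has_real_derivative ot t x z) (at t within {0..T})"
    "((\<lambda>x. 1 / dens (lab t x z)) has_real_derivative ox t x z) (at x)"
    "((\<lambda>z. 1 / dens (lab t x z)) has_real_derivative oz t x z) (at z within {-1..1})"
    if tz: "t \<in> {0..T}" "z \<in> {-1..1}" for t x z
    unfolding ot_def ox_def oz_def q_def D_def
    by (rule inv[OF lab_dt[OF tz]] inv[OF lab_dx[OF tz]] inv[OF lab_dz[OF tz]])+
  \<comment> \<open>The three partial derivatives of the vorticity share the factor
    \<open>q / D\<close>, and \<open>v\<close> is the combination that cancels the other
    two.\<close>
  have transport: "ot t x z + u t x z * ox t x z + v t x z * oz t x z = 0" for t x z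
    by (simp add: ot_def ox_def oz_def v_def algebra_simps add_divide_distrib)
  have d\<phi>z: "(\<phi> t x has_real_derivative u t x z) (at z within {-1..1})" if tz: "t \<in> {0..T}" "z \<in> {-1..1}" for t x z
  proof -
    have "((\<lambda>z. Bop (Q t x) (lab t x z)) has_real_derivative 0 + dens (lab t x z) * ((w t x (lab t x z) + \<kappa> t x) * wa t x (lab t x z)) *
       (1 / (dens (lab t x z) * wa t x (lab t x z)))) (at z within {-1..1})"
    proof (rule chain_partial[where \<Phi> = "\<lambda>z. Bop (Q t x)" and \<Phi>a = "\<lambda>z a. dens a * ((w t x a + \<kappa> t x) * wa t x a)", OF tz(2) lab_dz[OF tz]])
      show "continuous_on ({-1..1} \<times> {-2..2}) (\<lambda>(\<sigma>, a). dens a * ((w t x a + \<kappa> t x) * wa t x a))"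
        unfolding split_beta
        by (intro continuous_intros triple_cont[OF flow_facts(4)] triple_cont[OF flow_facts(1)]) (use tz in auto)
    qed (use tz in \<open>auto intro!: lab2 \<Phi>_da simp del: atLeastAtMost_iff\<close>)
    then show ?thesis using dp[of "lab t x z"] wap[OF tz, of x] by (simp add: \<phi>_def[abs_def] u_def)
  qed
  have duz: "(u t x has_real_derivative 1 / dens (lab t x z)) (at z within {-1..1})" if tz: "t \<in> {0..T}" "z \<in> {-1..1}" for t x z
  proof -
    have "((\<lambda>z. w t x (lab t x z)) has_real_derivative 0 + wa t x (lab t x z) * (1 / (dens (lab t x z) * wa t x (lab t x z)))) (at z within {-1..1})"
    proof (rule chain_partial[where \<Phi> = "\<lambda>z. w t x" and \<Phi>a = "\<lambda>z. wa t x", OF tz(2) lab_dz[OF tz]])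
      show "continuous_on ({-1..1} \<times> {-2..2}) (\<lambda>(\<sigma>, a). wa t x a)"
        unfolding split_beta by (intro continuous_intros triple_cont[OF flow_facts(4)]) (use tz in auto)
    qed (use tz in \<open>auto intro!: lab2 flow_facts(7) simp del: atLeastAtMost_iff\<close>)
    then have "((\<lambda>z. w t x (lab t x z) + \<kappa> t x) has_real_derivative 1 / dens (lab t x z) + 0) (at z within {-1..1})"
      using dp[of "lab t x z"] wap[OF tz, of x] by (intro DERIV_add DERIV_const) simp
    then show ?thesis by (simp add: u_def[abs_def])
  qed
  have d\<phi>x: "((\<lambda>x. \<phi> t x z) has_real_derivative - v t x z) (at x)" if tz: "t \<in> {0..T}" "z \<in> {-1..1}" for t x z
  proof -
    have "((\<lambda>x. Bop (Q t x) (lab t x z)) has_real_derivative - Bop (wt t x) (lab t x z) + dens (lab t x z) * ((w t x (lab t x z) + \<kappa> t x) * wa t x (lab t x z)) *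
       (- Bop (wx t x) (lab t x z) / (dens (lab t x z) * wa t x (lab t x z)))) (at x)"
    proof (rule chain_partial[where \<Phi> = "\<lambda>x. Bop (Q t x)" and \<Phi>a = "\<lambda>x a. dens a * ((w t x a + \<kappa> t x) * wa t x a)" and S = UNIV, OF UNIV_I lab_dx[OF tz]])
      have "continuous_on (UNIV \<times> {-2..2::real}) (\<lambda>p. \<kappa> t (fst p))"
        by (rule continuous_on_compose2[OF flow_facts(14)[OF tz(1)]]) (auto intro: continuous_intros)
      then show "continuous_on (UNIV \<times> {-2..2}) (\<lambda>(\<sigma>, a). dens a * ((w t \<sigma> a + \<kappa> t \<sigma>) * wa t \<sigma> a))"
        unfolding split_beta
        by (intro continuous_intros triple_cont[OF flow_facts(4)] triple_cont[OF flow_facts(1)]) (use tz in auto)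
    qed (use tz in \<open>auto intro!: lab2 \<Phi>_da \<Phi>_dx simp del: atLeastAtMost_iff\<close>)
    moreover have "- Bop (wt t x) (lab t x z) + dens (lab t x z) * ((w t x (lab t x z) + \<kappa> t x) * wa t x (lab t x z)) *
       (- Bop (wx t x) (lab t x z) / (dens (lab t x z) * wa t x (lab t x z))) = - v t x z"
      using dp[of "lab t x z"] wap[OF tz, of x] by (simp add: v_def u_def)
    ultimately show ?thesis unfolding \<phi>_def by (simp only:)
  qed
  \<comment> \<open>The walls carry the labels -1 and 1: the heights agree there, and the lower
    Lipschitz bound identifies the labels.\<close>
  have lab_end: "lab t x (-1) = -1" "lab t x 1 = 1" if t: "t \<in> {0..T}" for t x
    using Z_lipschitz[OF t, of "-1" "lab t x (-1)" x] Z_lipschitz[OF t, of 1 "lab t x 1" x] lab2[OF t, of "-1" x] lab2[OF t, of 1 x]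
      lab(2)[OF t, of "-1" x] lab(2)[OF t, of 1 x] Bop_1[OF w_slice[OF t], of x] flow_facts(10)[OF t, of x] by (auto simp: Bop_minus1)
  have \<phi>_end: "\<phi> t x (-1) = 0" "\<phi> t x 1 = 0" if t: "t \<in> {0..T}" for t x
    using lab_end[OF t, of x] Bop_1[OF Q_cont[OF t], of x] flow_facts(11)[OF t, of x] by (auto simp: \<phi>_def Bop_minus1)
  have per: "lab t (x + 2 * pi) z = lab t x z" "\<phi> t (x + 2 * pi) z = \<phi> t x z" for t x z
    by (simp_all add: lab_def \<phi>_def flow_facts(12,13))
  have perN: "lab t (x + L) z = lab t x z" "\<phi> t (x + L) z = \<phi> t x z" for t x z
    using periodic_nat[of "\<lambda>x. lab t x z" "2 * pi" x N, OF per(1)] periodic_nat[of "\<lambda>x. \<phi> t x z" "2 * pi" x N, OF per(2)]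
    by (simp_all add: L_def mult_ac)
  define S where "S = {0..T / L} \<times> (UNIV :: real set) \<times> {-1..1::real}"
  have LT: "L * t \<in> {0..T}" if "t \<in> {0..T / L}" for t using that L by (auto simp: field_simps)
  have SL: "L * fst y \<in> {0..T}" "snd (snd y) \<in> {-1..1}" if "y \<in> S" for y using LT[of "fst y"] that by (auto simp: S_def)
  have cf: "continuous_on S (\<lambda>y. L * fst y)" "continuous_on S (\<lambda>y. L * fst (snd y))" "continuous_on S (\<lambda>y. snd (snd y))"
    by (intro continuous_intros)+
  define g where "g y = lab (L * fst y) (L * fst (snd y)) (snd (snd y))" for y
  have gc: "continuous_on S g" unfolding g_def by (rule triple_cont[OF lab_cont cf SL])
  have g2: "g y \<in> {-2..2}" if "y \<in> S" for y unfolding g_def by (rule lab2[OF SL[OF that]])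
  have Dc: "continuous_on S (\<lambda>y. D (L * fst y) (L * fst (snd y)) (snd (snd y)))"
    unfolding D_def g_def[symmetric] by (rule Za_cont_S[OF cf(1,2) gc SL(1) g2])
  have Dn: "D (L * fst y) (L * fst (snd y)) (snd (snd y)) \<noteq> 0" if "y \<in> S" for y using Dp[OF SL[OF that], of "L * fst (snd y)"] by simp
  have qc: "continuous_on S (\<lambda>y. q (L * fst y) (L * fst (snd y)) (snd (snd y)))"
    unfolding q_def g_def[symmetric] using dp by (intro continuous_intros gc) (auto simp: less_imp_neq[symmetric])
  have Bc: "continuous_on S (\<lambda>y. Bop (wt (L * fst y) (L * fst (snd y))) (g y))" "continuous_on S (\<lambda>y. Bop (wx (L * fst y) (L * fst (snd y))) (g y))"
    by (rule Bop_comp[OF Z_cont(2) cf(1,2) gc SL(1) g2] Bop_comp[OF Z_cont(3) cf(1,2) gc SL(1) g2]; assumption)+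
  have oc: "continuous_on S (\<lambda>y. L * ot (L * fst y) (L * fst (snd y)) (snd (snd y)))"
     "continuous_on S (\<lambda>y. L * ox (L * fst y) (L * fst (snd y)) (snd (snd y)))"
     "continuous_on S (\<lambda>y. oz (L * fst y) (L * fst (snd y)) (snd (snd y)))"
    unfolding ot_def ox_def oz_def g_def[symmetric] using Dn by (intro continuous_intros qc Dc Bc; blast)+
  have "hydrostatic_Euler (T / L) (\<lambda>t x z. 1 / dens (lab (L * t) (L * x) z)) (\<lambda>t x. \<phi> (L * t) (L * x))
     (\<lambda>t x. u (L * t) (L * x)) (\<lambda>t x z. L * v (L * t) (L * x) z)"
    unfolding hydrostatic_Euler_def
  proof (intro conjI ballI allI; (rule exI[of _ "\<lambda>t x z. L * ot (L * t) (L * x) z"], rule exI[of _ "\<lambda>t x z. L * ox (L * t) (L * x) z"],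
      rule exI[of _ "\<lambda>t x z. oz (L * t) (L * x) z"], intro conjI ballI allI)?)
    fix t x z :: real assume t: "t \<in> {0..T / L}" and z: "z \<in> {-1..1}"
    have tz: "L * t \<in> {0..T}" "z \<in> {-1..1}" using LT[OF t] z by auto
    show "1 / dens (lab (L * t) (L * (x + 1)) z) = 1 / dens (lab (L * t) (L * x) z)" "\<phi> (L * t) (L * (x + 1)) z = \<phi> (L * t) (L * x) z"
      using perN[of "L * t" "L * x" z] by (simp_all add: distrib_left)
    show "((\<lambda>\<zeta>. \<phi> (L * t) (L * x) \<zeta>) has_real_derivative u (L * t) (L * x) z) (at z within {-1..1})" by (rule d\<phi>z[OF tz])
    show "((\<lambda>\<xi>. \<phi> (L * t) (L * \<xi>) z) has_real_derivative - (L * v (L * t) (L * x) z)) (at x)"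
      using scale_deriv_UNIV[OF d\<phi>x[OF tz, of "L * x"]] by simp
    show "((\<lambda>\<zeta>. u (L * t) (L * x) \<zeta>) has_real_derivative 1 / dens (lab (L * t) (L * x) z)) (at z within {-1..1})" by (rule duz[OF tz])
    show "((\<lambda>\<theta>. 1 / dens (lab (L * \<theta>) (L * x) z)) has_real_derivative L * ot (L * t) (L * x) z) (at t within {0..T / L})"
      by (rule scale_deriv[OF do(1)[OF tz] L t])
    show "((\<lambda>\<xi>. 1 / dens (lab (L * t) (L * \<xi>) z)) has_real_derivative L * ox (L * t) (L * x) z) (at x)"
      by (rule scale_deriv_UNIV[OF do(2)[OF tz]])
    show "((\<lambda>\<zeta>. 1 / dens (lab (L * t) (L * x) \<zeta>)) has_real_derivative oz (L * t) (L * x) z) (at z within {-1..1})"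
      by (rule do(3)[OF tz])
    have "L * ot (L * t) (L * x) z + u (L * t) (L * x) z * (L * ox (L * t) (L * x) z) + L * v (L * t) (L * x) z * oz (L * t) (L * x) z
      = L * (ot (L * t) (L * x) z + u (L * t) (L * x) z * ox (L * t) (L * x) z + v (L * t) (L * x) z * oz (L * t) (L * x) z)"
      by (simp add: algebra_simps)
    then show "L * ot (L * t) (L * x) z + u (L * t) (L * x) z * (L * ox (L * t) (L * x) z) + L * v (L * t) (L * x) z * oz (L * t) (L * x) z = 0"
      unfolding transport by simp
  next
    fix t x :: real assume t: "t \<in> {0..T / L}"
    show "\<phi> (L * t) (L * x) (-1) = 0" "\<phi> (L * t) (L * x) 1 = 0" by (rule \<phi>_end[OF LT[OF t]])+
  qed (use oc in \<open>simp_all add: S_def split_beta\<close>)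
  then show ?thesis unfolding hydrostatic_Euler_solution_def by blast
qed

end

section \<open>Test functions and weak derivatives\<close>

definition smooth_fun :: "(real \<Rightarrow> real) \<Rightarrow> bool" where
  "smooth_fun f \<longleftrightarrow> (\<exists>D. D 0 = f \<and> (\<forall>n x. (D n has_real_derivative D (Suc n) x) (at x)))"

text \<open>The algebra with constants generated by \<open>A\<close>. If the derivatives of the
  generators stay inside, every element has derivatives of all orders inside. The device serves
  twice: for smooth test functions, and for bounds on all derivatives of the initial data.\<close>

inductive_set alg :: "('a \<Rightarrow> real) set \<Rightarrow> ('a \<Rightarrow> real) set" for A where
  gen: "f \<in> A \<Longrightarrow> f \<in> alg A"
| const: "(\<lambda>x. c) \<in> alg A"
| add: "f \<in> alg A \<Longrightarrow> g \<in> alg A \<Longrightarrow> (\<lambda>x. f x + g x) \<in> alg A"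
| mult: "f \<in> alg A \<Longrightarrow> g \<in> alg A \<Longrightarrow> (\<lambda>x. f x * g x) \<in> alg A"

text \<open>A derivative chosen inside \<open>S\<close> is iterated; no formula for the higher
  derivatives is required.\<close>

lemma smooth_coinduct:
  assumes S: "\<And>f. f \<in> S \<Longrightarrow> \<exists>f'\<in>S. \<forall>x. (f has_real_derivative f' x) (at x)" and f: "f \<in> S"
  shows "smooth_fun f"
proof -
  obtain d where d: "\<And>f. f \<in> S \<Longrightarrow> d f \<in> S" "\<And>f x. f \<in> S \<Longrightarrow> (f has_real_derivative d f x) (at x)"
    using S by metis
  have m: "(d ^^ n) f \<in> S" for n by (induction n) (use d f in auto)
  show ?thesis unfolding smooth_fun_def
    by (rule exI[of _ "\<lambda>n. (d ^^ n) f"]) (use d(2)[OF m] in auto)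
qed

lemma alg_smooth:
  assumes A: "\<And>f. f \<in> A \<Longrightarrow> \<exists>f'\<in>alg A. \<forall>x. (f has_real_derivative f' x) (at x)" and f: "f \<in> alg A"
  shows "smooth_fun f"
proof (rule smooth_coinduct[OF _ f])
  fix f assume "f \<in> alg A"
  then show "\<exists>f'\<in>alg A. \<forall>x. (f has_real_derivative f' x) (at x)"
  proof induction
    case (gen f) then show ?case by (rule A)
  next
    case (const c) show ?case by (rule bexI[of _ "\<lambda>x. 0"]) (auto intro: alg.const)
  next
    case (add f g)
    then obtain f' g' where "f' \<in> alg A" "g' \<in> alg A" "\<forall>x. (f has_real_derivative f' x) (at x)" "\<forall>x. (g has_real_derivative g' x) (at x)" by auto
    then show ?case by (intro bexI[of _ "\<lambda>x. f' x + g' x"]) (auto intro: DERIV_add alg.add)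
  next
    case (mult f g)
    then obtain f' g' where d: "f' \<in> alg A" "g' \<in> alg A" "\<forall>x. (f has_real_derivative f' x) (at x)" "\<forall>x. (g has_real_derivative g' x) (at x)" by auto
    then have "((\<lambda>x. f x * g x) has_real_derivative f' x * g x + g' x * f x) (at x)" for x by (intro DERIV_mult) auto
    moreover have "(\<lambda>x. f' x * g x + g' x * f x) \<in> alg A" using d mult by (intro alg.add alg.mult)
    ultimately show ?case by (intro bexI[of _ "\<lambda>x. f' x * g x + g' x * f x"] allI)
  qed
qed

text \<open>All derivatives of \<open>exp (- (1 / y))\<close>, extended by zero, have this shape, so
  the class is closed under differentiation.\<close>

definition bump_poly :: "real poly \<Rightarrow> real \<Rightarrow> real" where
  "bump_poly P y = (if y > 0 then poly P (1 / y) * exp (- (1 / y)) else 0)"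

lemma poly_exp_lim: "((\<lambda>u. u ^ k * poly P u * exp (- u)) \<longlongrightarrow> (0::real)) at_top"
proof (induction P arbitrary: k)
  case 0 then show ?case by simp
next
  case (pCons a P)
  have "((\<lambda>u. a * (u ^ k / exp u) + u ^ Suc k * poly P u * exp (- u)) \<longlongrightarrow> a * 0 + 0) at_top"
    by (intro tendsto_intros tendsto_power_div_exp_0 pCons.IH)
  then show ?case by (simp add: algebra_simps exp_minus divide_inverse)
qed

lemma bump_poly_tendsto: "(bump_poly P \<longlongrightarrow> 0) (at 0)"
proof (rule filterlim_split_at)
  show "(bump_poly P \<longlongrightarrow> 0) (at_left 0)"
    by (rule tendsto_eventually) (auto simp: eventually_at_filter bump_poly_def)
  have "((\<lambda>u. poly P u * exp (- u)) \<longlongrightarrow> 0) at_top" using poly_exp_lim[of 0 P] by simp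
  then have "((\<lambda>y. poly P (1 / y) * exp (- (1 / y))) \<longlongrightarrow> 0) (at_right 0)"
    by (rule filterlim_compose[OF _ filterlim_inverse_at_top_right, unfolded inverse_eq_divide])
  then show "(bump_poly P \<longlongrightarrow> 0) (at_right 0)"
    by (rule Lim_transform_eventually) (auto simp: eventually_at_filter bump_poly_def)
qed

lemma bump_poly_deriv: "(bump_poly P has_real_derivative bump_poly ([:0, 0, 1:] * (P - pderiv P)) y) (at y)"
proof -
  consider "y > 0" | "y < 0" | "y = 0" by linarith
  then show ?thesis
  proof cases
    case 1
    have "((\<lambda>y. poly P (1 / y) * exp (- (1 / y))) has_real_derivative
       poly ([:0, 0, 1:] * (P - pderiv P)) (1 / y) * exp (- (1 / y))) (at y)"
      using 1 by (auto intro!: derivative_eq_intros poly_DERIV[THEN DERIV_chain2] simp: power2_eq_square field_simps)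
    then have "(bump_poly P has_real_derivative poly ([:0, 0, 1:] * (P - pderiv P)) (1 / y) * exp (- (1 / y))) (at y)"
      by (rule has_field_derivative_transform_within_open[of _ _ _ "{0<..}"]) (use 1 in \<open>auto simp: bump_poly_def\<close>)
    then show ?thesis using 1 by (simp add: bump_poly_def)
  next
    case 2
    have "(bump_poly P has_real_derivative 0) (at y)"
      by (rule has_field_derivative_transform_within_open[of "\<lambda>_. 0" _ _ "{..<0}"]) (use 2 in \<open>auto simp: bump_poly_def\<close>)
    then show ?thesis using 2 by (simp add: bump_poly_def)
  next
    case 3
    \<comment> \<open>The difference quotient at 0 is of the same shape, with \<open>P\<close>
      multiplied by its variable.\<close>
    have "((\<lambda>y. (bump_poly P y - bump_poly P 0) / (y - 0)) \<longlongrightarrow> 0) (at 0)"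
    proof (rule Lim_transform_eventually[OF bump_poly_tendsto[of "[:0, 1:] * P"]])
      show "\<forall>\<^sub>F y in at 0. bump_poly ([:0, 1:] * P) y = (bump_poly P y - bump_poly P 0) / (y - 0)"
        by (auto simp: eventually_at_filter bump_poly_def)
    qed
    then show ?thesis using 3 by (simp add: has_field_derivative_iff bump_poly_def)
  qed
qed

definition bump :: "real \<Rightarrow> real" where "bump y = (if y > 0 then exp (- (1 / y)) else 0)"

lemma bump_range: "0 \<le> bump y" "bump y \<le> 1"
  by (auto simp: bump_def)

lemma smooth_bump_comp:
  assumes "smooth_fun b"
  shows "smooth_fun (\<lambda>x. bump (b x))"
proof -
  obtain D where D: "D 0 = b" "\<And>n x. (D n has_real_derivative D (Suc n) x) (at x)"
    using assms unfolding smooth_fun_def by blast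
  define A where "A = range D \<union> range (\<lambda>P x. bump_poly P (b x))"
  show ?thesis
  proof (rule alg_smooth[of A])
    show "\<exists>f'\<in>alg A. \<forall>x. (f has_real_derivative f' x) (at x)" if "f \<in> A" for f
    proof -
      from that consider n where "f = D n" | P where "f = (\<lambda>x. bump_poly P (b x))" by (auto simp: A_def)
      then show ?thesis
      proof cases
        case 1
        then show ?thesis using D(2) by (intro bexI[of _ "D (Suc n)"]) (auto simp: A_def intro!: alg.gen)
      next
        case 2
        have "(f has_real_derivative bump_poly ([:0, 0, 1:] * (P - pderiv P)) (b x) * D 1 x) (at x)" for x
          unfolding 2 using D(2)[of 0 x] by (intro DERIV_chain2[OF bump_poly_deriv]) (simp add: D(1))
        moreover have "(\<lambda>x. bump_poly ([:0, 0, 1:] * (P - pderiv P)) (b x) * D 1 x) \<in> alg A"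
          by (rule alg.mult; rule alg.gen) (auto simp: A_def)
        ultimately show ?thesis
          by (intro bexI[of _ "\<lambda>x. bump_poly ([:0, 0, 1:] * (P - pderiv P)) (b x) * D 1 x"] allI)
      qed
    qed
    have "(\<lambda>x. bump (b x)) = (\<lambda>x. bump_poly 1 (b x))" by (simp add: bump_def bump_poly_def fun_eq_iff)
    then show "(\<lambda>x. bump (b x)) \<in> alg A" by (intro alg.gen) (auto simp: A_def)
  qed
qed

lemma smooth_quadratic: "smooth_fun (\<lambda>z. m * ((z - r) * (s - z)))"
proof (rule alg_smooth[of "{\<lambda>x. x}"])
  show "\<exists>f'\<in>alg {\<lambda>x. x}. \<forall>x. (f has_real_derivative f' x) (at x)" if "f \<in> {\<lambda>x. x}" for f :: "real \<Rightarrow> real"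
    using that by (intro bexI[of _ "\<lambda>x. 1"]) (auto intro: alg.const)
  have "(\<lambda>z. m * ((z + (-r)) * (s + (-1) * z))) \<in> alg {\<lambda>x. x}"
    by (intro alg.mult alg.add alg.const alg.gen) auto
  then show "(\<lambda>z. m * ((z - r) * (s - z))) \<in> alg {\<lambda>x. x}" by simp
qed

lemma smooth_trig: "smooth_fun (\<lambda>x. m * (cos (2 * pi * (x - c)) - k))"
proof -
  define A where "A = {\<lambda>x. cos (2 * pi * (x - c)), \<lambda>x. sin (2 * pi * (x - c))}"
  show ?thesis
  proof (rule alg_smooth[of A])
    fix f assume "f \<in> A"
    then consider "f = (\<lambda>x. cos (2 * pi * (x - c)))" | "f = (\<lambda>x. sin (2 * pi * (x - c)))" by (auto simp: A_def)
    then show "\<exists>f'\<in>alg A. \<forall>x. (f has_real_derivative f' x) (at x)"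
    proof cases
      case 1
      have m: "(\<lambda>x. (- 2 * pi) * sin (2 * pi * (x - c))) \<in> alg A"
        by (rule alg.mult[OF alg.const alg.gen]) (simp add: A_def)
      show ?thesis unfolding 1 by (rule bexI[OF _ m]) (auto intro!: derivative_eq_intros)
    next
      case 2
      have m: "(\<lambda>x. (2 * pi) * cos (2 * pi * (x - c))) \<in> alg A"
        by (rule alg.mult[OF alg.const alg.gen]) (simp add: A_def)
      show ?thesis unfolding 2 by (rule bexI[OF _ m]) (auto intro!: derivative_eq_intros)
    qed
  next
    have "(\<lambda>x. m * (cos (2 * pi * (x - c)) + (- k))) \<in> alg A"
      by (intro alg.mult alg.add alg.const alg.gen) (auto simp: A_def)
    then show "(\<lambda>x. m * (cos (2 * pi * (x - c)) - k)) \<in> alg A" by simp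
  qed
qed

lemma test_product:
  assumes A: "smooth_fun A" "\<And>x. A (x + 1) = A x" and B: "smooth_fun B" "r < 1" "\<And>z. r \<le> \<bar>z\<bar> \<Longrightarrow> B z = 0"
  shows "\<exists>\<psi>. test_function_jet \<psi> \<and> \<psi> 0 0 = (\<lambda>(x, z). A x * B z)"
proof -
  obtain D where D: "D 0 = A" "\<And>n x. (D n has_real_derivative D (Suc n) x) (at x)"
    using A(1) unfolding smooth_fun_def by blast
  obtain E where E: "E 0 = B" "\<And>n x. (E n has_real_derivative E (Suc n) x) (at x)"
    using B(1) unfolding smooth_fun_def by blast
  have c: "continuous_on UNIV (D n)" "continuous_on UNIV (E n)" for n
    using D(2) E(2) by (intro continuous_at_imp_continuous_on ballI DERIV_isCont; blast)+
  define \<psi> where "\<psi> i j p = D i (fst p) * E j (snd p)" for i j :: nat and p :: "real \<times> real"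
  have "test_function_jet \<psi>"
    unfolding test_function_jet_def \<psi>_def
  proof (intro conjI allI)
    show "continuous_on UNIV (\<lambda>p. D i (fst p) * E j (snd p))" for i j
      by (intro continuous_intros continuous_on_compose2[OF c(1)] continuous_on_compose2[OF c(2)]) auto
    show "\<exists>r<1. \<forall>x z. r \<le> \<bar>z\<bar> \<longrightarrow> D 0 (fst (x, z)) * E 0 (snd (x, z)) = 0"
      using B(2,3) E(1) by auto
  qed (use A(2) D E in \<open>auto intro!: derivative_eq_intros\<close>)
  then show ?thesis by (intro exI[of _ \<psi>]) (auto simp: \<psi>_def D(1) E(1) fun_eq_iff)
qed

lemma channel_sets [measurable]: "channel \<in> sets borel"
proof -
  have "{0..<1::real} \<times> {-1<..<1::real} \<in> sets (borel \<Otimes>\<^sub>M borel)" by (intro pair_measureI) auto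
  then show ?thesis unfolding channel_def borel_prod .
qed

lemma emeasure_channel: "emeasure lborel channel < \<infinity>"
proof -
  have "channel \<subseteq> cbox (0, -1) (1, 1)" by (auto simp: channel_def)
  then have "emeasure lborel channel \<le> emeasure lborel (cbox (0, -1) (1, 1) :: (real \<times> real) set)" by (intro emeasure_mono) auto
  also have "\<dots> < \<infinity>" by (rule emeasure_lborel_cbox_finite)
  finally show ?thesis .
qed

lemma square_integrable_integrable:
  assumes "square_integrable_on g channel"
  shows "set_integrable lborel channel g"
  unfolding set_integrable_def
proof (rule Bochner_Integration.integrable_bound)
  have "integrable lborel (\<lambda>p. indicat_real channel p *\<^sub>R (1 :: real))"
    using emeasure_channel by (simp add: integrable_indicator_iff)
  moreover have "integrable lborel (\<lambda>p. indicat_real channel p *\<^sub>R (g p)^2)"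
    using assms unfolding square_integrable_on_def set_integrable_def by simp
  ultimately show "integrable lborel (\<lambda>p. indicat_real channel p *\<^sub>R 1 + indicat_real channel p *\<^sub>R (g p)^2)"
    by (rule Bochner_Integration.integrable_add)
  show "(\<lambda>p. indicat_real channel p *\<^sub>R g p) \<in> borel_measurable lborel"
    using assms unfolding square_integrable_on_def set_borel_measurable_def by simp
  have "\<bar>y\<bar> \<le> 1 + y^2" for y :: real
    using zero_le_power2[of "\<bar>y\<bar> - 1"] by (simp add: power2_diff)
  then show "AE p in lborel. norm (indicat_real channel p *\<^sub>R g p) \<le> norm (indicat_real channel p *\<^sub>R 1 + indicat_real channel p *\<^sub>R (g p)^2)"
    by (auto simp: indicator_def)
qed

lemma set_integrable_mult_bounded:
  fixes g h :: "real \<times> real \<Rightarrow> real"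
  assumes "set_integrable lborel S g" "h \<in> borel_measurable borel" "\<And>p. \<bar>h p\<bar> \<le> C"
  shows "set_integrable lborel S (\<lambda>p. g p * h p)"
  unfolding set_integrable_def
proof (rule Bochner_Integration.integrable_bound)
  show "integrable lborel (\<lambda>p. C * (indicat_real S p *\<^sub>R g p))"
    using assms(1) unfolding set_integrable_def by (rule integrable_mult_right)
  have "(\<lambda>p. (indicat_real S p *\<^sub>R g p) * h p) \<in> borel_measurable lborel"
    using assms(1,2) unfolding set_integrable_def by (intro borel_measurable_times) auto
  then show "(\<lambda>p. indicat_real S p *\<^sub>R (g p * h p)) \<in> borel_measurable lborel" by (simp add: mult.assoc)
  have "\<bar>g p\<bar> * \<bar>h p\<bar> \<le> \<bar>C\<bar> * \<bar>g p\<bar>" for p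
    using mult_right_mono[OF order_trans[OF assms(3)[of p] abs_ge_self], of "\<bar>g p\<bar>"] by (simp add: mult.commute)
  then show "AE p in lborel. norm (indicat_real S p *\<^sub>R (g p * h p)) \<le> norm (C * (indicat_real S p *\<^sub>R g p))"
    by (auto simp: indicator_def abs_mult)
qed

lemma bump_lim: "(\<lambda>m. bump (real m * y)) \<longlonglongrightarrow> (if y > 0 then 1 else 0)"
proof (cases "y > 0")
  case True
  have "(\<lambda>m. exp (- (1 / y * inverse (real (Suc m))))) \<longlonglongrightarrow> exp (- (1 / y * 0))"
    by (intro tendsto_intros LIMSEQ_inverse_real_of_nat)
  moreover have "bump (real (Suc m) * y) = exp (- (1 / y * inverse (real (Suc m))))" for m
  proof -
    have "0 < real (Suc m) * y" using True by (intro mult_pos_pos) auto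
    moreover have "1 / (real (Suc m) * y) = 1 / y * inverse (real (Suc m))" by (simp only: inverse_eq_divide times_divide_times_eq mult_1 mult.commute)
    ultimately show ?thesis by (simp only: bump_def if_True)
  qed
  ultimately have "(\<lambda>m. bump (real (Suc m) * y)) \<longlonglongrightarrow> 1" by simp
  then show ?thesis using True LIMSEQ_imp_Suc[of "\<lambda>m. bump (real m * y)" 1] by simp
next
  case False
  then have "bump (real m * y) = 0" for m by (simp add: bump_def mult_nonneg_nonpos not_less)
  then show ?thesis using False by simp
qed

text \<open>The shift by \<open>1/m\<close> keeps the support compact in the open channel when the strip reaches \<open>z = \<plusminus>1\<close>.\<close>

lemma bump_strip_lim:
  assumes "r < s"
  shows "(\<lambda>m. bump (real (m * m) * ((z - (r + 1 / real m)) * ((s - 1 / real m) - z)))) \<longlonglongrightarrow> (if r < z \<and> z < s then 1 else 0)"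
proof -
  have l0: "(\<lambda>m. 1 / real m) \<longlonglongrightarrow> 0" by (rule lim_1_over_n)
  show ?thesis
  proof (cases "r < z \<and> z < s")
    case True
    define y where "y m = (z - (r + 1 / real m)) * ((s - 1 / real m) - z)" for m
    have y: "y \<longlonglongrightarrow> (z - (r + 0)) * ((s - 0) - z)" unfolding y_def by (intro tendsto_intros l0)
    define c where "c = (z - r) * (s - z) / 2"
    have c: "c > 0" using True by (simp add: c_def)
    have "\<forall>\<^sub>F m in sequentially. c < y m"
      by (rule order_tendstoD(1)[OF y]) (use c in \<open>simp add: c_def mult.commute\<close>)
    then have ev: "\<forall>\<^sub>F m in sequentially. bump (real m * c) \<le> bump (real (m * m) * y m)"
      using eventually_ge_at_top[of 1]
    proof eventually_elim
      case (elim m)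
      have "real m * c \<le> real m * y m" using elim by (intro mult_left_mono) auto
      also have "\<dots> \<le> real (m * m) * y m" using elim c by (intro mult_right_mono) auto
      finally have "real m * c \<le> real (m * m) * y m" .
      moreover have "0 < real m * c" using elim c by simp
      ultimately have "0 < real m * c" "0 < real (m * m) * y m" "1 / (real (m * m) * y m) \<le> 1 / (real m * c)"
        by (auto intro!: frac_le simp del: of_nat_mult)
      then show ?case by (simp only: bump_def if_True exp_le_cancel_iff neg_le_iff_le)
    qed
    have "(\<lambda>m. bump (real (m * m) * y m)) \<longlonglongrightarrow> 1"
    proof (rule tendsto_sandwich[OF ev _ _ tendsto_const])
      show "\<forall>\<^sub>F m in sequentially. bump (real (m * m) * y m) \<le> 1" by (simp add: bump_range)
      show "(\<lambda>m. bump (real m * c)) \<longlonglongrightarrow> 1" using bump_lim[of c] c by simp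
    qed
    then show ?thesis using True by (simp add: y_def)
  next
    case False
    have "\<forall>\<^sub>F m in sequentially. 1 / real m < (s - r) / 2"
      using l0 assms by (intro order_tendstoD(2)) auto
    then have "\<forall>\<^sub>F m in sequentially. bump (real (m * m) * ((z - (r + 1 / real m)) * ((s - 1 / real m) - z))) = 0"
    proof eventually_elim
      case (elim m)
      have nn: "0 \<le> 1 / real m" by simp
      have "(z - (r + 1 / real m)) * ((s - 1 / real m) - z) \<le> 0"
      proof (cases "z \<le> r")
        case True
        have "z - (r + v) \<le> 0 \<and> 0 \<le> (s - v) - z" if "v < (s - r) / 2" "0 \<le> v" for v
          using True assms that by auto
        from this[OF elim nn] have "z - (r + 1 / real m) \<le> 0" "0 \<le> (s - 1 / real m) - z" by auto
        then show ?thesis by (rule mult_nonpos_nonneg)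
      next
        case F: False
        have "0 \<le> z - (r + v) \<and> (s - v) - z \<le> 0" if "v < (s - r) / 2" "0 \<le> v" for v
          using F False assms that by auto
        from this[OF elim nn] have "0 \<le> z - (r + 1 / real m)" "(s - 1 / real m) - z \<le> 0" by auto
        then show ?thesis by (rule mult_nonneg_nonpos)
      qed
      then have "real (m * m) * ((z - (r + 1 / real m)) * ((s - 1 / real m) - z)) \<le> 0" by (rule mult_nonneg_nonpos[OF of_nat_0_le_iff])
      then show ?case by (simp add: bump_def)
    qed
    then have "(\<lambda>m. bump (real (m * m) * ((z - (r + 1 / real m)) * ((s - 1 / real m) - z)))) \<longlonglongrightarrow> 0" by (rule tendsto_eventually)
    then show ?thesis unfolding if_not_P[OF False] .
  qed
qed

text \<open>Both sides express that \<open>x\<close> lies within \<open>(q - p) / 2\<close> of the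
  midpoint on the circle: the cosine decreases with the distance up to half a period, and larger
  distances are folded back. This yields smooth periodic cutoffs of an arc inside the fundamental
  domain.\<close>

lemma cos_window:
  assumes p: "0 \<le> p" "p < q" "q \<le> 1" and x: "x \<in> {0..<1}"
  shows "cos (2 * pi * (x - (p + q) / 2)) - cos (pi * (q - p)) > 0 \<longleftrightarrow> p < x \<and> x < q"
proof -
  define y where "y = \<bar>x - (p + q) / 2\<bar>"
  have c: "cos (2 * pi * (x - (p + q) / 2)) = cos (2 * pi * y)"
    unfolding y_def by (cases "x \<ge> (p + q) / 2") (auto simp: abs_if, metis cos_minus minus_diff_eq mult_minus_right)
  have y: "p < x \<and> x < q \<longleftrightarrow> y < (q - p) / 2" unfolding y_def by (auto simp: abs_if field_simps)
  have y1: "0 \<le> y" "y \<le> 1 - (q - p) / 2" using p x unfolding y_def by (auto simp: abs_if field_simps)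
  show ?thesis
  proof (cases "y < (q - p) / 2")
    case True
    have "cos (pi * (q - p)) < cos (2 * pi * y)"
    proof (rule cos_monotone_0_pi)
      show "2 * pi * y < pi * (q - p)" using mult_strict_left_mono[OF True, of "2 * pi"] by simp
      show "pi * (q - p) \<le> pi" using p by simp
    qed (use y1 in auto)
    then show ?thesis using True y c by simp
  next
    case False
    have "cos (2 * pi * y) \<le> cos (pi * (q - p))"
    proof (cases "y \<le> 1 / 2")
      case True
      show ?thesis
      proof (rule cos_monotone_0_pi_le)
        show "pi * (q - p) \<le> 2 * pi * y" using mult_left_mono[of "(q - p) / 2" y "2 * pi"] False by simp
        show "2 * pi * y \<le> pi" using mult_left_mono[OF True, of "2 * pi"] by simp
      qed (use p in auto)
    next
      case F: False
      have "cos (2 * pi * y) = cos (2 * pi * (1 - y))"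
        by (simp add: right_diff_distrib cos_diff)
      also have "\<dots> \<le> cos (pi * (q - p))"
      proof (rule cos_monotone_0_pi_le)
        show "pi * (q - p) \<le> 2 * pi * (1 - y)" using mult_left_mono[of "(q - p) / 2" "1 - y" "2 * pi"] y1(2) by (simp add: le_diff_eq add.commute)
        show "2 * pi * (1 - y) \<le> pi" using mult_left_mono[of "1 - y" "1 / 2" "2 * pi"] F by simp
      qed (use p in auto)
      finally show ?thesis .
    qed
    then show ?thesis using False y c by simp
  qed
qed

definition opench :: "(real \<times> real) set" where "opench = {0<..<1} \<times> {-1<..<1}"

lemma opench_box: "opench = box (0, -1) (1, 1)"
  unfolding opench_def by (auto simp: mem_box Basis_prod_def)

lemma opench_sets: "opench \<in> sets borel" by (simp add: opench_box)

lemma AE_channel_opench: "AE p in lborel. p \<in> channel \<longleftrightarrow> p \<in> opench"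
proof -
  have "cbox (0, -1) (0, 1) \<in> null_sets (lborel :: (real \<times> real) measure)"
    by (intro null_setsI) (auto simp: emeasure_lborel_cbox_eq Basis_prod_def inner_prod_def)
  from AE_not_in[OF this] show ?thesis
    by eventually_elim (auto simp: channel_def opench_def mem_box Basis_prod_def le_less)
qed

text \<open>The fundamental lemma of the calculus of variations on the periodic channel: products of
  one-dimensional cutoffs approximate indicators of rectangles, and rectangles generate the Borel
  sets.\<close>

lemma weak_zero:
  assumes G: "set_integrable lborel channel G"
    and z: "\<And>\<psi>. test_function_jet \<psi> \<Longrightarrow> (LINT p:channel|lborel. G p * \<psi> 0 0 p) = 0"
  shows "AE p in lborel. p \<in> channel \<longrightarrow> G p = 0"
proof -
  define H where "H p = indicat_real opench p *\<^sub>R G p" for p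
  have HG: "AE p in lborel. H p = indicat_real channel p *\<^sub>R G p"
    using AE_channel_opench by eventually_elim (auto simp: H_def indicator_def)
  have oc: "opench \<subseteq> channel" by (auto simp: opench_def channel_def)
  have Hi: "integrable lborel H"
    using set_integrable_subset[OF G _ oc] opench_sets unfolding set_integrable_def H_def[abs_def] by simp
  have test: "(LINT p|lborel. H p * (A (fst p) * B (snd p))) = 0"
    if A: "smooth_fun A" "\<And>x. A (x + 1) = A x" and B: "smooth_fun B" "r < 1" "\<And>z. r \<le> \<bar>z\<bar> \<Longrightarrow> B z = 0" for A B r
  proof -
    obtain \<psi> where \<psi>: "test_function_jet \<psi>" "\<psi> 0 0 = (\<lambda>(x, z). A x * B z)" using test_product[OF A B] by blast
    have "(LINT p|lborel. H p * \<psi> 0 0 p) = (LINT p:channel|lborel. G p * \<psi> 0 0 p)"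
      unfolding set_lebesgue_integral_def
    proof (rule integral_cong_AE)
      have "continuous_on UNIV (\<psi> 0 0)" using \<psi>(1) unfolding test_function_jet_def by blast
      then have m: "\<psi> 0 0 \<in> borel_measurable lborel" using borel_measurable_continuous_onI by simp
      have H: "H \<in> borel_measurable lborel" by (rule borel_measurable_integrable[OF Hi])
      have G': "(\<lambda>p. indicat_real channel p *\<^sub>R G p) \<in> borel_measurable lborel"
        using G unfolding set_integrable_def by (rule borel_measurable_integrable)
      show "(\<lambda>p. H p * \<psi> 0 0 p) \<in> borel_measurable lborel" by (intro borel_measurable_times H m)
      have "(\<lambda>p. (indicat_real channel p *\<^sub>R G p) * \<psi> 0 0 p) \<in> borel_measurable lborel" by (intro borel_measurable_times G' m)
      then show "(\<lambda>p. indicat_real channel p *\<^sub>R (G p * \<psi> 0 0 p)) \<in> borel_measurable lborel" by (simp add: mult.assoc)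
      show "AE p in lborel. H p * \<psi> 0 0 p = indicat_real channel p *\<^sub>R (G p * \<psi> 0 0 p)"
        using HG by eventually_elim (simp add: mult.assoc)
    qed
    then show ?thesis using z[OF \<psi>(1)] \<psi>(2) by (simp add: split_beta)
  qed
  \<comment> \<open>Dominated convergence with dominant \<open>norm (H y)\<close>: the cutoffs lie
    between 0 and 1 and tend to the indicator, and for large \<open>m\<close> their product is an
    admissible test function.\<close>
  have rect0: "(LINT y|lborel. indicat_real ({p<..<q} \<times> {r<..<s}) y *\<^sub>R H y) = 0"
    if p: "0 \<le> p" "p < q" "q \<le> 1" and r: "-1 \<le> r" "r < s" "s \<le> 1" for p q r s
  proof -
    define A where "A m x = bump (real m * (cos (2 * pi * (x - (p + q) / 2)) - cos (pi * (q - p))))" for m x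
    define B where "B m z = bump (real (m * m) * ((z - (r + 1 / real m)) * ((s - 1 / real m) - z)))" for m z
    have As: "smooth_fun (A m)" for m unfolding A_def by (rule smooth_bump_comp[OF smooth_trig])
    have Bs: "smooth_fun (B m)" for m unfolding B_def by (rule smooth_bump_comp[OF smooth_quadratic])
    have smc: "continuous_on UNIV f" if f: "smooth_fun f" for f
    proof -
      obtain D where "D 0 = f" "\<And>n x. (D n has_real_derivative D (Suc n) x) (at x)" using f unfolding smooth_fun_def by blast
      then show ?thesis by (metis DERIV_isCont continuous_at_imp_continuous_on)
    qed
    have ABm: "(\<lambda>y. A m (fst y) * B m (snd y)) \<in> borel_measurable lborel" for m
    proof -
      have "continuous_on UNIV (\<lambda>y. A m (fst y) * B m (snd y))"
        by (intro continuous_intros continuous_on_compose2[OF smc[OF As]] continuous_on_compose2[OF smc[OF Bs]]) auto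
      then show ?thesis using borel_measurable_continuous_onI by simp
    qed
    have per: "A m (x + 1) = A m x" for m x
    proof -
      have "2 * pi * (x + 1 - (p + q) / 2) = 2 * pi * (x - (p + q) / 2) + 2 * pi" by (simp add: algebra_simps)
      then show ?thesis unfolding A_def by (simp only: cos_periodic)
    qed
    have Hm: "H \<in> borel_measurable lborel" by (rule borel_measurable_integrable[OF Hi])
    have rm: "{p<..<q} \<times> {r<..<s} \<in> sets (borel :: (real \<times> real) measure)"
      by (intro borel_open open_Times) auto
    have "(\<lambda>m. LINT y|lborel. H y * (A m (fst y) * B m (snd y))) \<longlonglongrightarrow> (LINT y|lborel. indicat_real ({p<..<q} \<times> {r<..<s}) y *\<^sub>R H y)"
    proof (rule integral_dominated_convergence[where w = "\<lambda>y. norm (H y)"])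
      show "(\<lambda>y. indicat_real ({p<..<q} \<times> {r<..<s}) y *\<^sub>R H y) \<in> borel_measurable lborel"
        using Hm rm by (intro borel_measurable_scaleR borel_measurable_indicator) auto
      show "(\<lambda>y. H y * (A m (fst y) * B m (snd y))) \<in> borel_measurable lborel" for m by (intro borel_measurable_times Hm ABm)
      show "integrable lborel (\<lambda>y. norm (H y))" by (rule integrable_norm[OF Hi])
      have "norm (H y * (A m (fst y) * B m (snd y))) \<le> norm (H y)" for m y
      proof -
        have "\<bar>A m (fst y) * B m (snd y)\<bar> \<le> 1 * 1"
          unfolding abs_mult by (intro mult_mono) (auto simp: A_def B_def bump_range)
        then show ?thesis by (simp add: abs_mult mult_left_le del: real_norm_def flip: abs_mult) (simp add: abs_mult mult_left_le)
      qed
      then show "AE y in lborel. norm (H y * (A m (fst y) * B m (snd y))) \<le> norm (H y)" for m by simp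
      have "(\<lambda>m. H y * (A m (fst y) * B m (snd y))) \<longlonglongrightarrow> indicat_real ({p<..<q} \<times> {r<..<s}) y *\<^sub>R H y" for y
      proof (cases "y \<in> opench")
        case False
        then show ?thesis by (simp add: H_def)
      next
        case True
        then have x: "fst y \<in> {0..<1}" by (auto simp: opench_def)
        have "(\<lambda>m. A m (fst y)) \<longlonglongrightarrow> (if p < fst y \<and> fst y < q then 1 else 0)"
          unfolding A_def using bump_lim[of "cos (2 * pi * (fst y - (p + q) / 2)) - cos (pi * (q - p))"] unfolding cos_window[OF p x] .
        moreover have "(\<lambda>m. B m (snd y)) \<longlonglongrightarrow> (if r < snd y \<and> snd y < s then 1 else 0)"
          unfolding B_def by (rule bump_strip_lim[OF r(2)])
        ultimately have "(\<lambda>m. H y * (A m (fst y) * B m (snd y))) \<longlonglongrightarrow> H y * ((if p < fst y \<and> fst y < q then 1 else 0) * (if r < snd y \<and> snd y < s then 1 else 0))"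
          by (intro tendsto_intros)
        moreover have "H y * ((if p < fst y \<and> fst y < q then 1 else 0) * (if r < snd y \<and> snd y < s then 1 else 0)) = indicat_real ({p<..<q} \<times> {r<..<s}) y *\<^sub>R H y"
          by (cases y) (auto simp: indicator_def)
        ultimately show ?thesis by simp
      qed
      then show "AE y in lborel. (\<lambda>m. H y * (A m (fst y) * B m (snd y))) \<longlonglongrightarrow> indicat_real ({p<..<q} \<times> {r<..<s}) y *\<^sub>R H y" by simp
    qed
    moreover have "(\<lambda>m. LINT y|lborel. H y * (A m (fst y) * B m (snd y))) \<longlonglongrightarrow> 0"
    proof (rule tendsto_eventually)
      have "\<forall>\<^sub>F m in sequentially. 1 / real m < (s - r) / 2"
        using r by (intro order_tendstoD(2)[OF lim_1_over_n]) auto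
      then show "\<forall>\<^sub>F m in sequentially. (LINT y|lborel. H y * (A m (fst y) * B m (snd y))) = 0"
        using eventually_gt_at_top[of 0]
      proof eventually_elim
        case (elim m)
        have m: "0 < 1 / real m" using elim by simp
        show ?case
        proof (rule test[OF As per Bs])
          have "\<bar>r + v\<bar> < 1 \<and> \<bar>s - v\<bar> < 1" if "v < (s - r) / 2" "0 < v" for v
            using r that by auto
          from this[OF elim(1) m]
          show "max \<bar>r + 1 / real m\<bar> \<bar>s - 1 / real m\<bar> < 1" by simp
          fix z assume z: "max \<bar>r + 1 / real m\<bar> \<bar>s - 1 / real m\<bar> \<le> \<bar>z\<bar>"
          have "(z - (r + 1 / real m)) * ((s - 1 / real m) - z) \<le> 0"
          proof (cases "z \<ge> 0")
            case True
            then have "0 \<le> z - (r + 1 / real m)" "(s - 1 / real m) - z \<le> 0" using z by linarith+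
            then show ?thesis by (rule mult_nonneg_nonpos)
          next
            case False
            then have "z - (r + 1 / real m) \<le> 0" "0 \<le> (s - 1 / real m) - z" using z by linarith+
            then show ?thesis by (rule mult_nonpos_nonneg)
          qed
          then have "real (m * m) * ((z - (r + 1 / real m)) * ((s - 1 / real m) - z)) \<le> 0" by (rule mult_nonneg_nonpos[OF of_nat_0_le_iff])
          then show "B m z = 0" by (simp add: B_def bump_def)
        qed
      qed
    qed
    ultimately show ?thesis by (rule LIMSEQ_unique)
  qed
  \<comment> \<open>\<open>H\<close> vanishes off the open channel, so a box may be clipped to
    it.\<close>
  have bx: "(LINT y|lborel. indicat_real (box a b) y *\<^sub>R H y) = 0" for a b
  proof -
    define p q r s where "p = max 0 (fst a)" and "q = min 1 (fst b)" and "r = max (-1) (snd a)" and "s = min 1 (snd b)"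
    have e: "indicat_real (box a b) y *\<^sub>R H y = indicat_real ({p<..<q} \<times> {r<..<s}) y *\<^sub>R H y" for y
      by (cases y) (auto simp: H_def indicator_def opench_def p_def q_def r_def s_def mem_box Basis_prod_def inner_prod_def)
    show ?thesis
    proof (cases "p < q \<and> r < s")
      case True
      then show ?thesis unfolding e by (intro rect0) (auto simp: p_def q_def r_def s_def)
    next
      case False
      then have emp: "{p<..<q} \<times> {r<..<s} = {}" by auto
      show ?thesis unfolding e emp by simp
    qed
  qed
  have tot: "(LINT y|lborel. H y) = 0"
  proof -
    have e: "(\<lambda>y. indicat_real (box (0, -1) (1, 1)) y *\<^sub>R H y) = H"
      unfolding H_def opench_box by (auto simp: fun_eq_iff indicator_def)
    show ?thesis using bx[of "(0, -1)" "(1, 1)"] by (simp only: e)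
  qed
  have sub: "integrable lborel (\<lambda>y. indicat_real S y *\<^sub>R H y)" if "S \<in> sets borel" for S
    using integrable_mult_indicator[OF _ Hi, of S] that by simp
  \<comment> \<open>Boxes are stable under intersection and generate the Borel sets, and the sets
    with vanishing integral form a Dynkin system.\<close>
  have all: "(LINT y|lborel. indicat_real S y *\<^sub>R H y) = 0" if "S \<in> sets borel" for S
  proof -
    have m: "S \<in> sigma_sets UNIV (range (\<lambda>(a, b). box a b :: (real \<times> real) set))"
      using that by (simp add: borel_eq_box)
    have i: "Int_stable (range (\<lambda>(a, b). box a b :: (real \<times> real) set))"
      by (auto simp: Int_stable_def box_Int_box)
    have p: "range (\<lambda>(a, b). box a b :: (real \<times> real) set) \<subseteq> Pow UNIV" by simp
    from i p m show ?thesis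
    proof (induction rule: sigma_sets_induct_disjoint)
      case (basic S) then show ?case using bx by auto
    next
      case empty show ?case by simp
    next
      case (compl S)
      have S: "S \<in> sets borel" using compl by (simp add: borel_eq_box)
      have "(\<lambda>y. indicat_real (UNIV - S) y *\<^sub>R H y) = (\<lambda>y. H y - indicat_real S y *\<^sub>R H y)"
        by (auto simp: indicator_def fun_eq_iff)
      then show ?case using Bochner_Integration.integral_diff[OF Hi sub[OF S]] compl tot by simp
    next
      case (union F)
      have F: "F i \<in> sets borel" for i using union by (auto simp: borel_eq_box subset_eq)
      have d: "F i \<inter> F j = {}" if "i \<noteq> j" for i j using union(1) that by (auto simp: disjoint_family_on_def)
      have "(LINT y:(\<Union>i. F i)|lborel. H y) = (\<Sum>i. (LINT y:(F i)|lborel. H y))"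
        by (rule lebesgue_integral_countable_add[OF _ d]) (use F sub[of "\<Union>i. F i"] in \<open>auto simp: set_integrable_def\<close>)
      then show ?case using union by (simp add: set_lebesgue_integral_def)
    qed
  qed
  have "AE y in lborel. H y = 0"
    by (rule density_unique_real[OF Hi, of "\<lambda>_. 0"]) (use all in \<open>auto simp: set_lebesgue_integral_def\<close>)
  with HG show ?thesis by eventually_elim (auto simp: indicator_def split: if_splits)
qed

text \<open>Test functions separate square integrable functions, so the choice hidden in
  \<open>sobolev_norm\<close> does not influence its value.\<close>

lemma L2_norm_unique:
  assumes g: "square_integrable_on g1 channel" "square_integrable_on g2 channel"
    and e: "\<And>\<psi>. test_function_jet \<psi> \<Longrightarrow> (LINT p:channel|lborel. g1 p * \<psi> 0 0 p) = (LINT p:channel|lborel. g2 p * \<psi> 0 0 p)"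
    and b: "\<And>\<psi>. test_function_jet \<psi> \<Longrightarrow> \<exists>C. \<forall>p. \<bar>\<psi> 0 0 p\<bar> \<le> C"
  shows "L2_norm_on channel g1 = L2_norm_on channel g2"
proof -
  note i1 = square_integrable_integrable[OF g(1)] and i2 = square_integrable_integrable[OF g(2)]
  have z: "AE p in lborel. p \<in> channel \<longrightarrow> g1 p - g2 p = 0"
  proof (rule weak_zero)
    show "set_integrable lborel channel (\<lambda>p. g1 p - g2 p)" using i1 i2 by (rule set_integral_diff)
    fix \<psi> assume \<psi>: "test_function_jet \<psi>"
    obtain C where C: "\<And>p. \<bar>\<psi> 0 0 p\<bar> \<le> C" using b[OF \<psi>] by blast
    have "continuous_on UNIV (\<psi> 0 0)" using \<psi> unfolding test_function_jet_def by blast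
    then have m: "\<psi> 0 0 \<in> borel_measurable borel" by (rule borel_measurable_continuous_onI)
    show "(LINT p:channel|lborel. (g1 p - g2 p) * \<psi> 0 0 p) = 0"
      using set_integral_diff(2)[OF set_integrable_mult_bounded[OF i1 m C] set_integrable_mult_bounded[OF i2 m C]] e[OF \<psi>]
      by (simp add: left_diff_distrib)
  qed
  have "(LINT p:channel|lborel. (g1 p)^2) = (LINT p:channel|lborel. (g2 p)^2)"
    unfolding set_lebesgue_integral_def
  proof (rule integral_cong_AE)
    show "(\<lambda>p. indicat_real channel p *\<^sub>R (g1 p)^2) \<in> borel_measurable lborel" "(\<lambda>p. indicat_real channel p *\<^sub>R (g2 p)^2) \<in> borel_measurable lborel"
      using g unfolding square_integrable_on_def set_integrable_def by (blast intro: borel_measurable_integrable)+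
    show "AE p in lborel. indicat_real channel p *\<^sub>R (g1 p)^2 = indicat_real channel p *\<^sub>R (g2 p)^2"
      using z by eventually_elim (auto simp: indicator_def)
  qed
  then show ?thesis by (simp add: L2_norm_on_def)
qed

lemma periodic_1_frac:
  fixes f :: "real \<Rightarrow> 'a"
  assumes "\<And>x. f (x + 1) = f x"
  shows "f (frac x) = f x"
proof -
  have n: "f (x + real n) = f x" for x n
  proof (induction n)
    case (Suc n)
    have "x + real (Suc n) = (x + real n) + 1" by simp
    then show ?case using assms[of "x + real n"] Suc by (simp only:)
  qed simp
  show ?thesis
  proof (cases "\<lfloor>x\<rfloor> \<ge> 0")
    case True
    then show ?thesis using n[of "frac x" "nat \<lfloor>x\<rfloor>"] by (simp add: frac_def)
  next
    case False
    then show ?thesis using n[of x "nat (- \<lfloor>x\<rfloor>)"] by (simp add: frac_def)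
  qed
qed

text \<open>The inequality is strict, unlike in \<open>test_function_jet\<close>: vanishing passes
  to \<open>z\<close>-derivatives on the open set \<open>r < \<bar>z\<bar>\<close>.\<close>

lemma jet_support:
  assumes "test_function_jet \<psi>"
  shows "\<exists>r<1. \<forall>i j x z. r < \<bar>z\<bar> \<longrightarrow> \<psi> i j (x, z) = 0"
proof -
  have dx: "((\<lambda>\<xi>. \<psi> i j (\<xi>, z)) has_real_derivative \<psi> (Suc i) j (x, z)) (at x)"
    and dz: "((\<lambda>\<zeta>. \<psi> i j (x, \<zeta>)) has_real_derivative \<psi> i (Suc j) (x, z)) (at z)" for i j x z
    using assms unfolding test_function_jet_def by blast+
  obtain r where r: "r < 1" "\<And>x z. r \<le> \<bar>z\<bar> \<Longrightarrow> \<psi> 0 0 (x, z) = 0"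
    using assms unfolding test_function_jet_def by blast
  have i: "\<forall>x z. r < \<bar>z\<bar> \<longrightarrow> \<psi> i 0 (x, z) = 0" for i
  proof (induction i)
    case 0 then show ?case using r by simp
  next
    case (Suc i)
    show ?case
    proof (intro allI impI)
      fix x z :: real assume z: "r < \<bar>z\<bar>"
      then have "(\<lambda>\<xi>. \<psi> i 0 (\<xi>, z)) = (\<lambda>_. 0)" using Suc by auto
      with dx[of i 0 z x] show "\<psi> (Suc i) 0 (x, z) = 0" using DERIV_unique[OF _ DERIV_const] by metis
    qed
  qed
  have j: "\<forall>x z. r < \<bar>z\<bar> \<longrightarrow> \<psi> i j (x, z) = 0" for i j
  proof (induction j)
    case 0 show ?case by (rule i)
  next
    case (Suc j)
    have "open {z. r < \<bar>z\<bar>}" by (intro open_Collect_less continuous_intros)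
    then have "((\<lambda>\<zeta>. \<psi> i j (x, \<zeta>)) has_real_derivative 0) (at z)" if "r < \<bar>z\<bar>" for x z
      by (rule has_field_derivative_transform_within_open[OF DERIV_const[of 0]]) (use that Suc in auto)
    then show ?case using DERIV_unique[OF dz] by blast
  qed
  then show ?thesis using r(1) by blast
qed

lemma jet_periodic:
  assumes "test_function_jet \<psi>"
  shows "\<psi> i j (x + 1, z) = \<psi> i j (x, z)"
proof -
  have dx: "((\<lambda>\<xi>. \<psi> i j (\<xi>, z)) has_real_derivative \<psi> (Suc i) j (x, z)) (at x)"
    and dz: "((\<lambda>\<zeta>. \<psi> i j (x, \<zeta>)) has_real_derivative \<psi> i (Suc j) (x, z)) (at z)" for i j x z
    using assms unfolding test_function_jet_def by blast+
  have i: "\<forall>x z. \<psi> i 0 (x + 1, z) = \<psi> i 0 (x, z)" for i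
  proof (induction i)
    case 0 then show ?case using assms unfolding test_function_jet_def by blast
  next
    case (Suc i)
    have "((\<lambda>\<xi>. \<psi> i 0 (\<xi> + 1, z)) has_real_derivative \<psi> (Suc i) 0 (x + 1, z)) (at x)" for x z
      using dx[of i 0 z "x + 1"] DERIV_shift[of "\<lambda>\<xi>. \<psi> i 0 (\<xi>, z)" _ x 1] by simp
    then have "((\<lambda>\<xi>. \<psi> i 0 (\<xi>, z)) has_real_derivative \<psi> (Suc i) 0 (x + 1, z)) (at x)" for x z using Suc by simp
    then show ?case using DERIV_unique[OF _ dx] by blast
  qed
  have "\<forall>x z. \<psi> i j (x + 1, z) = \<psi> i j (x, z)" for i j
  proof (induction j)
    case 0 show ?case by (rule i)
  next
    case (Suc j)
    then have "((\<lambda>\<zeta>. \<psi> i j (x, \<zeta>)) has_real_derivative \<psi> i (Suc j) (x + 1, z)) (at z)" for x z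
      using dz[of i j "x + 1" z] by simp
    then show ?case using DERIV_unique[OF _ dz] by blast
  qed
  then show ?thesis by blast
qed

lemma jet_bounded:
  assumes \<psi>: "test_function_jet \<psi>"
  shows "\<exists>C. \<forall>p. \<bar>\<psi> i j p\<bar> \<le> C"
proof -
  obtain r where r: "r < 1" "\<And>i j x z. r < \<bar>z\<bar> \<Longrightarrow> \<psi> i j (x, z) = 0" using jet_support[OF \<psi>] by blast
  have "continuous_on UNIV (\<psi> i j)" using \<psi> unfolding test_function_jet_def by blast
  then have "compact (\<psi> i j ` cbox (0, -1) (1, 1))"
    by (intro compact_continuous_image[OF continuous_on_subset[OF _ subset_UNIV] compact_cbox])
  then obtain C where C: "\<And>y. y \<in> \<psi> i j ` cbox (0, -1) (1, 1) \<Longrightarrow> \<bar>y\<bar> \<le> C"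
    using compact_imp_bounded[of "\<psi> i j ` cbox (0, -1) (1, 1)"] unfolding bounded_iff real_norm_def by blast
  have "\<bar>\<psi> i j (x, z)\<bar> \<le> max C 0" for x z
  proof (cases "\<bar>z\<bar> \<le> 1")
    case True
    have "(frac x, z) \<in> cbox (0, -1) (1, 1)"
      using True frac_ge_0[of x] frac_lt_1[of x] by (auto simp: mem_box Basis_prod_def)
    then have "\<bar>\<psi> i j (frac x, z)\<bar> \<le> C" by (intro C imageI)
    then show ?thesis using periodic_1_frac[of "\<lambda>x. \<psi> i j (x, z)" x, OF jet_periodic[OF \<psi>]] by simp
  next
    case False then show ?thesis using r by simp
  qed
  then show ?thesis by (intro exI[of _ "max C 0"]) auto
qed

text \<open>The \<open>x\<close>-derivatives are only required before any \<open>z\<close>-derivative is taken, so that no commutation of mixed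
  partial derivatives is needed.\<close>

definition channel_family :: "(nat \<Rightarrow> nat \<Rightarrow> real \<times> real \<Rightarrow> real) \<Rightarrow> bool" where
  "channel_family D \<longleftrightarrow> (\<forall>i j.
     continuous_on (UNIV \<times> {-1<..<1}) (D i j) \<and> (\<exists>C. \<forall>x. \<forall>z\<in>{-1<..<1}. \<bar>D i j (x, z)\<bar> \<le> C) \<and>
     (\<forall>x. \<forall>z\<in>{-1<..<1}. D i j (x + 1, z) = D i j (x, z) \<and>
       ((\<lambda>\<xi>. D i 0 (\<xi>, z)) has_real_derivative D (Suc i) 0 (x, z)) (at x) \<and>
       ((\<lambda>\<zeta>. D i j (x, \<zeta>)) has_real_derivative D i (Suc j) (x, z)) (at z)))"

lemma set_integrable_bounded_continuous:
  fixes f :: "'a::euclidean_space \<Rightarrow> real"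
  assumes A: "A \<in> sets borel" "emeasure lborel A < \<infinity>" and f: "continuous_on A f" "\<And>p. p \<in> A \<Longrightarrow> \<bar>f p\<bar> \<le> C"
  shows "set_borel_measurable lborel A f" "set_integrable lborel A f"
proof -
  show m: "set_borel_measurable lborel A f"
    unfolding set_borel_measurable_def using borel_measurable_continuous_on_indicator[OF A(1) f(1)] by simp
  show "set_integrable lborel A f" unfolding set_integrable_def
  proof (rule Bochner_Integration.integrable_bound)
    show "integrable lborel (\<lambda>p. indicat_real A p *\<^sub>R C)" using A by (simp add: integrable_indicator_iff)
    show "(\<lambda>p. indicat_real A p *\<^sub>R f p) \<in> borel_measurable lborel" using m by (simp add: set_borel_measurable_def)
    show "AE p in lborel. norm (indicat_real A p *\<^sub>R f p) \<le> norm (indicat_real A p *\<^sub>R C)"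
      using f(2) by (auto simp: indicator_def intro: order_trans[OF _ abs_ge_self])
  qed
qed

lemma L2_norm_bounded_continuous:
  fixes f :: "'a::euclidean_space \<Rightarrow> real"
  assumes A: "A \<in> sets borel" "emeasure lborel A < \<infinity>" and f: "continuous_on A f" "\<And>p. p \<in> A \<Longrightarrow> \<bar>f p\<bar> \<le> C"
  shows "square_integrable_on f A" "(L2_norm_on A f)^2 \<le> measure lborel A * C^2"
proof -
  have b: "\<bar>(f p)^2\<bar> \<le> C^2" if "p \<in> A" for p using f(2)[OF that] by (simp add: abs_le_square_iff[symmetric] power2_abs abs_le_iff)
  have c: "continuous_on A (\<lambda>p. (f p)^2)" by (intro continuous_intros f)
  note i = set_integrable_bounded_continuous[OF A c b]
  show "square_integrable_on f A" unfolding square_integrable_on_def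
    using set_integrable_bounded_continuous(1)[OF A f] i(2) by auto
  have "(LINT p:A|lborel. (f p)^2) \<le> (LINT p:A|lborel. C^2)"
    unfolding set_lebesgue_integral_def
  proof (rule integral_mono)
    show "integrable lborel (\<lambda>p. indicat_real A p *\<^sub>R C^2)" using A by (simp add: integrable_indicator_iff)
  qed (use i(2) b in \<open>auto simp: set_integrable_def indicator_def\<close>)
  also have "\<dots> = measure lborel A * C^2" using A by (simp add: set_lebesgue_integral_def)
  finally show "(L2_norm_on A f)^2 \<le> measure lborel A * C^2"
    unfolding L2_norm_on_def by (subst real_sqrt_pow2) (auto simp: set_lebesgue_integral_def)
qed

lemma channel_fubini_zero:
  fixes k :: "real \<times> real \<Rightarrow> real"
  assumes k: "set_integrable lborel channel k"
  shows "(\<And>z. z \<in> {-1<..<1} \<Longrightarrow> (LINT x:{0..<1}|lborel. k (x, z)) = 0) \<Longrightarrow> (LINT p:channel|lborel. k p) = 0"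
    and "(\<And>x. x \<in> {0..<1} \<Longrightarrow> (LINT z:{-1<..<1}|lborel. k (x, z)) = 0) \<Longrightarrow> (LINT p:channel|lborel. k p) = 0"
proof -
  define K where "K x z = indicat_real channel (x, z) *\<^sub>R k (x, z)" for x z
  have K: "K x z = indicat_real {-1<..<1} z * (indicat_real {0..<1} x * k (x, z))" for x z by (auto simp: K_def channel_def indicator_def)
  have i: "integrable (lborel \<Otimes>\<^sub>M lborel) (case_prod K)" using k unfolding set_integrable_def lborel_prod K_def split_beta by simp
  have e: "(LINT p:channel|lborel. k p) = integral\<^sup>L (lborel \<Otimes>\<^sub>M lborel) (case_prod K)"
    unfolding lborel_prod set_lebesgue_integral_def by (rule Bochner_Integration.integral_cong) (auto simp: K_def)
  show "(LINT p:channel|lborel. k p) = 0" if z: "\<And>z. z \<in> {-1<..<1} \<Longrightarrow> (LINT x:{0..<1}|lborel. k (x, z)) = 0"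
  proof -
    have "(LINT x|lborel. K x z) = 0" for z
      using z[of z] by (cases "z \<in> {-1<..<1}") (auto simp: K set_lebesgue_integral_def)
    then show ?thesis using lborel_pair.integral_snd[OF i] e by simp
  qed
  show "(LINT p:channel|lborel. k p) = 0" if x: "\<And>x. x \<in> {0..<1} \<Longrightarrow> (LINT z:{-1<..<1}|lborel. k (x, z)) = 0"
  proof -
    have "(LINT z|lborel. K x z) = 0" for x
      using x[of x] by (cases "x \<in> {0..<1}") (auto simp: K set_lebesgue_integral_def)
    then show ?thesis using lborel_pair.integral_fst[OF i] e by simp
  qed
qed

lemma strip_slice:
  fixes f :: "real \<times> real \<Rightarrow> real"
  assumes "continuous_on (UNIV \<times> {-1<..<1}) f"
  shows "z \<in> {-1<..<1} \<Longrightarrow> isCont (\<lambda>x. f (x, z)) x" "z \<in> {-1<..<1} \<Longrightarrow> isCont (\<lambda>z. f (x, z)) z"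
proof -
  have o: "open (UNIV \<times> {-1<..<1} :: (real \<times> real) set)" by (intro open_Times) auto
  show "isCont (\<lambda>x. f (x, z)) x" if "z \<in> {-1<..<1}"
    by (rule continuous_at_compose[of x "\<lambda>x. (x, z)", unfolded o_def]) (use assms[unfolded continuous_on_eq_continuous_at[OF o]] that in auto)
  show "isCont (\<lambda>z. f (x, z)) z" if "z \<in> {-1<..<1}"
    by (rule continuous_at_compose[of z "\<lambda>z. (x, z)", unfolded o_def]) (use assms[unfolded continuous_on_eq_continuous_at[OF o]] that in auto)
qed

lemma channel_sub: "channel \<subseteq> UNIV \<times> {-1<..<1}" by (auto simp: channel_def)

text \<open>Fubini reduces each claim to one variable. In \<open>x\<close> the boundary terms cancel
  by periodicity, and in \<open>z\<close> they vanish with the test function.\<close>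

lemma integration_by_parts_step:
  assumes D: "channel_family D" and \<psi>: "test_function_jet \<psi>"
  shows "(LINT p:channel|lborel. D a 0 p * \<psi> (Suc i) j p) = - (LINT p:channel|lborel. D (Suc a) 0 p * \<psi> i j p)"
    and "(LINT p:channel|lborel. D a b p * \<psi> i (Suc j) p) = - (LINT p:channel|lborel. D a (Suc b) p * \<psi> i j p)"
proof -
  have Dc: "continuous_on (UNIV \<times> {-1<..<1}) (D i j)" for i j using D unfolding channel_family_def by blast
  have Dp: "D i j (x + 1, z) = D i j (x, z)" if "z \<in> {-1<..<1}" for i j x z using D that unfolding channel_family_def by blast
  have Dx: "((\<lambda>\<xi>. D i 0 (\<xi>, z)) has_real_derivative D (Suc i) 0 (x, z)) (at x)"
    and Dz: "((\<lambda>\<zeta>. D i j (x, \<zeta>)) has_real_derivative D i (Suc j) (x, z)) (at z)" if "z \<in> {-1<..<1}" for i j x z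
    using D that unfolding channel_family_def by blast+
  have \<psi>x: "((\<lambda>\<xi>. \<psi> i j (\<xi>, z)) has_real_derivative \<psi> (Suc i) j (x, z)) (at x)"
    and \<psi>z: "((\<lambda>\<zeta>. \<psi> i j (x, \<zeta>)) has_real_derivative \<psi> i (Suc j) (x, z)) (at z)"
    and \<psi>c: "continuous_on UNIV (\<psi> i j)" for i j x z
    using \<psi> unfolding test_function_jet_def by blast+
  have \<psi>s: "continuous_on (UNIV \<times> {-1<..<1}) (\<psi> i j)" for i j using continuous_on_subset[OF \<psi>c] by blast
  obtain r where r: "r < 1" "\<And>i j x z. r < \<bar>z\<bar> \<Longrightarrow> \<psi> i j (x, z) = 0" using jet_support[OF \<psi>] by blast
  have int: "set_integrable lborel channel (\<lambda>p. D a b p * \<psi> i j p)" for a b i j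
  proof -
    obtain C where C: "\<And>x z. z \<in> {-1<..<1} \<Longrightarrow> \<bar>D a b (x, z)\<bar> \<le> C" using D unfolding channel_family_def by blast
    obtain C' where C': "\<And>p. \<bar>\<psi> i j p\<bar> \<le> C'" using jet_bounded[OF \<psi>] by blast
    have m: "\<psi> i j \<in> borel_measurable borel" by (rule borel_measurable_continuous_onI[OF \<psi>c])
    have "set_integrable lborel channel (D a b)"
      by (rule set_integrable_bounded_continuous(2)[OF channel_sets emeasure_channel continuous_on_subset[OF Dc channel_sub], of _ _ C])
        (use C in \<open>auto simp: channel_def\<close>)
    then show ?thesis by (rule set_integrable_mult_bounded[OF _ m C'])
  qed
  have fin: "X = - Y" if "set_integrable lborel channel f" "set_integrable lborel channel g" "X = (LINT p:channel|lborel. f p)" "Y = (LINT p:channel|lborel. g p)" "(LINT p:channel|lborel. f p + g p) = 0" for X Y and f g :: "real \<times> real \<Rightarrow> real"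
    using set_integral_add(2)[OF that(1,2)] that(3-) by simp
  show "(LINT p:channel|lborel. D a 0 p * \<psi> (Suc i) j p) = - (LINT p:channel|lborel. D (Suc a) 0 p * \<psi> i j p)"
  proof (rule fin[OF int int refl refl], rule channel_fubini_zero(1)[OF set_integral_add(1)[OF int int]])
    fix z :: real assume z: "z \<in> {-1<..<1}"
    let ?k = "\<lambda>x. D a 0 (x, z) * \<psi> (Suc i) j (x, z) + D (Suc a) 0 (x, z) * \<psi> i j (x, z)"
    have c: "isCont ?k x" for x
      by (intro isCont_add isCont_mult strip_slice(1)[OF Dc z] strip_slice(1)[OF \<psi>s z])
    have "(LINT x|lborel. ?k x * indicator {0..1} x) = D a 0 (1, z) * \<psi> i j (1, z) - D a 0 (0, z) * \<psi> i j (0, z)"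
    proof (rule integral_FTC_Icc_real[of 0 1 "\<lambda>x. D a 0 (x, z) * \<psi> i j (x, z)" ?k])
      show "((\<lambda>x. D a 0 (x, z) * \<psi> i j (x, z)) has_real_derivative ?k x) (at x)" for x
        using DERIV_mult[OF Dx[OF z, of a x] \<psi>x[of i j z x]] by (simp add: algebra_simps)
    qed (use c in auto)
    also have "\<dots> = 0" using Dp[OF z, of a 0 0] jet_periodic[OF \<psi>, of i j 0 z] by simp
    finally have "(LINT x|lborel. ?k x * indicator {0..1} x) = 0" .
    moreover have "(LINT x:{0..<1}|lborel. ?k x) = (LINT x|lborel. ?k x * indicator {0..1} x)"
      unfolding set_lebesgue_integral_def
    proof (rule integral_cong_AE)
      have m: "?k \<in> borel_measurable borel" by (rule borel_measurable_continuous_onI[OF continuous_at_imp_continuous_on]) (use c in auto)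
      show "(\<lambda>x. indicat_real {0..<1} x *\<^sub>R ?k x) \<in> borel_measurable lborel" "(\<lambda>x. ?k x * indicat_real {0..1} x) \<in> borel_measurable lborel"
        using m by auto
      show "AE x in lborel. indicat_real {0..<1} x *\<^sub>R ?k x = ?k x * indicat_real {0..1} x"
        using AE_lborel_singleton[of "1::real"] by eventually_elim (auto simp: indicator_def)
    qed
    ultimately show "(LINT x:{0..<1}|lborel. ?k x) = 0" by simp
  qed
  show "(LINT p:channel|lborel. D a b p * \<psi> i (Suc j) p) = - (LINT p:channel|lborel. D a (Suc b) p * \<psi> i j p)"
  proof (rule fin[OF int int refl refl], rule channel_fubini_zero(2)[OF set_integral_add(1)[OF int int]])
    fix x :: real
    let ?k = "\<lambda>z. D a b (x, z) * \<psi> i (Suc j) (x, z) + D a (Suc b) (x, z) * \<psi> i j (x, z)"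
    have op: "open {z. r < \<bar>z\<bar>}" by (intro open_Collect_less continuous_intros)
    have "(LINT z|lborel. ?k z * indicator {-1..1} z) = D a b (x, 1) * \<psi> i j (x, 1) - D a b (x, -1) * \<psi> i j (x, -1)"
    proof (rule integral_FTC_Icc_real[of "-1" 1 "\<lambda>z. D a b (x, z) * \<psi> i j (x, z)" ?k])
      fix z :: real
      show "((\<lambda>z. D a b (x, z) * \<psi> i j (x, z)) has_real_derivative ?k z) (at z)"
      \<comment> \<open>Outside the open channel \<open>D\<close> is unconstrained, but there the
        test function vanishes in a neighbourhood, so the product is locally zero.\<close>
      proof (cases "z \<in> {-1<..<1}")
        case True
        show ?thesis using DERIV_mult[OF Dz[OF True, of a b x] \<psi>z[of i j x z]] by (simp add: algebra_simps)
      next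
        case False
        then have z: "r < \<bar>z\<bar>" using r(1) by auto
        have "((\<lambda>z. D a b (x, z) * \<psi> i j (x, z)) has_real_derivative 0) (at z)"
          by (rule has_field_derivative_transform_within_open[OF DERIV_const[of 0] op]) (use z r(2) in auto)
        then show ?thesis using r(2)[OF z] by simp
      qed
      show "isCont ?k z"
      proof (cases "z \<in> {-1<..<1}")
        case True
        show ?thesis by (intro isCont_add isCont_mult strip_slice(2)[OF Dc True] strip_slice(2)[OF \<psi>s True])
      next
        case False
        then have z: "r < \<bar>z\<bar>" using r(1) by auto
        then have "\<forall>\<^sub>F z in nhds z. z \<in> {z. r < \<bar>z\<bar>}" using op by (intro eventually_nhds_in_open) auto
        then have "\<forall>\<^sub>F z in nhds z. ?k z = 0" by eventually_elim (use r(2) in auto)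
        then have "isCont ?k z = isCont (\<lambda>_. 0 :: real) z" by (rule isCont_cong)
        then show ?thesis by simp
      qed
    qed simp
    also have "\<dots> = 0" using r by simp
    finally have "(LINT z|lborel. ?k z * indicator {-1..1} z) = 0" .
    moreover have "?k z * indicator {-1..1} z = indicat_real {-1<..<1} z *\<^sub>R ?k z" for z
      using r by (auto simp: indicator_def)
    ultimately show "(LINT z:{-1<..<1}|lborel. ?k z) = 0" by (simp add: set_lebesgue_integral_def)
  qed
qed

text \<open>The \<open>x\<close>-derivatives are moved first, while no \<open>z\<close>-derivative
  is on \<open>D\<close>; this is the order that \<open>channel_family\<close> provides.\<close>

lemma integration_by_parts:
  assumes D: "channel_family D" and \<psi>: "test_function_jet \<psi>"
  shows "(LINT p:channel|lborel. D a 0 p * \<psi> i j p) = (-1)^(i + j) * (LINT p:channel|lborel. D (a + i) j p * \<psi> 0 0 p)"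
proof (induction i arbitrary: a)
  case 0
  have "(LINT p:channel|lborel. D a b p * \<psi> 0 j p) = (-1)^j * (LINT p:channel|lborel. D a (b + j) p * \<psi> 0 0 p)" for b
  proof (induction j arbitrary: b)
    case (Suc j)
    show ?case unfolding integration_by_parts_step(2)[OF D \<psi>] Suc by simp
  qed simp
  from this[of 0] show ?case by simp
next
  case (Suc i)
  show ?case unfolding integration_by_parts_step(1)[OF D \<psi>] Suc by simp
qed

lemma family_weak_partial:
  assumes D: "channel_family D" and f: "\<And>x z. z \<in> {-1<..<1} \<Longrightarrow> f (x, z) = D 0 0 (x, z)"
  shows "has_weak_partial f i j (D i j)"
  unfolding has_weak_partial_def
proof (intro conjI allI impI)
  obtain C where C: "\<And>x z. z \<in> {-1<..<1} \<Longrightarrow> \<bar>D i j (x, z)\<bar> \<le> C" and c: "continuous_on (UNIV \<times> {-1<..<1}) (D i j)"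
    using D unfolding channel_family_def by blast
  show "square_integrable_on (D i j) channel"
    by (rule L2_norm_bounded_continuous(1)[OF channel_sets emeasure_channel continuous_on_subset[OF c channel_sub], of C])
      (use C in \<open>auto simp: channel_def\<close>)
  fix \<psi> assume \<psi>: "test_function_jet \<psi>"
  have "(LINT p:channel|lborel. f p * \<psi> i j p) = (LINT p:channel|lborel. D 0 0 p * \<psi> i j p)"
    by (rule set_lebesgue_integral_cong) (simp add: channel_sets, auto simp: channel_def f)
  then show "(LINT p:channel|lborel. f p * \<psi> i j p) = (-1)^(i + j) * (LINT p:channel|lborel. D i j p * \<psi> 0 0 p)"
    using integration_by_parts[OF D \<psi>, of 0 i j] by simp
qed

text \<open>Explicit classical derivatives replace the chosen weak ones, by uniqueness; this is what
  makes the norm computable.\<close>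

lemma sobolev_norm_family:
  assumes D: "channel_family D" and f: "\<And>x z. z \<in> {-1<..<1} \<Longrightarrow> f (x, z) = D 0 0 (x, z)"
  shows "f \<in> sobolev_space s"
    "sobolev_norm s f = sqrt (\<Sum>(i, j)\<in>{(i, j). i + j \<le> s}. (L2_norm_on channel (D i j))^2)"
proof -
  have w: "has_weak_partial f i j (D i j)" for i j using family_weak_partial[of D f] D f by blast
  have "square_integrable_on (D 0 0) channel" using w[of 0 0] by (simp add: has_weak_partial_def)
  moreover have "(\<lambda>p. indicat_real channel p *\<^sub>R f p) = (\<lambda>p. indicat_real channel p *\<^sub>R D 0 0 p)"
    "(\<lambda>p. indicat_real channel p *\<^sub>R (f p)^2) = (\<lambda>p. indicat_real channel p *\<^sub>R (D 0 0 p)^2)"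
    using f by (auto simp: channel_def indicator_def)
  ultimately have "square_integrable_on f channel"
    unfolding square_integrable_on_def set_borel_measurable_def set_integrable_def by (simp only:)
  then show "f \<in> sobolev_space s" unfolding sobolev_space_def using w by blast
  have "L2_norm_on channel G = L2_norm_on channel (D i j)" if g: "has_weak_partial f i j G" for i j G
  proof (rule L2_norm_unique)
    show "square_integrable_on G channel" "square_integrable_on (D i j) channel"
      using g w by (simp_all add: has_weak_partial_def)
    fix \<psi> assume \<psi>: "test_function_jet \<psi>"
    show "\<exists>C. \<forall>p. \<bar>\<psi> 0 0 p\<bar> \<le> C" by (rule jet_bounded[OF \<psi>])
    have "(-1)^(i + j) * (LINT p:channel|lborel. G p * \<psi> 0 0 p) = (-1)^(i + j) * (LINT p:channel|lborel. D i j p * \<psi> 0 0 p)"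
      using g w[of i j] \<psi> unfolding has_weak_partial_def by metis
    then show "(LINT p:channel|lborel. G p * \<psi> 0 0 p) = (LINT p:channel|lborel. D i j p * \<psi> 0 0 p)" by simp
  qed
  from this[OF someI[of "has_weak_partial f _ _", OF w]]
  show "sobolev_norm s f = sqrt (\<Sum>(i, j)\<in>{(i, j). i + j \<le> s}. (L2_norm_on channel (D i j))^2)"
    unfolding sobolev_norm_def by (intro arg_cong[of _ _ sqrt] sum.cong) auto
qed

lemma finite_orders: "finite {(i, j). i + j \<le> (s::nat)}"
  by (rule finite_subset[of _ "{..s} \<times> {..s}"]) auto

lemma sobolev_norm_upper:
  assumes D: "channel_family D" and f: "\<And>x z. z \<in> {-1<..<1} \<Longrightarrow> f (x, z) = D 0 0 (x, z)"
    and K: "\<And>i j x z. i + j \<le> s \<Longrightarrow> z \<in> {-1<..<1} \<Longrightarrow> \<bar>D i j (x, z)\<bar> \<le> K" "0 \<le> K"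
  shows "sobolev_norm s f \<le> sqrt (real (card {(i, j). i + j \<le> s}) * measure lborel channel) * K"
proof -
  have e: "sobolev_norm s f = sqrt (\<Sum>(i, j)\<in>{(i, j). i + j \<le> s}. (L2_norm_on channel (D i j))^2)"
    using sobolev_norm_family(2)[of D f s] D f by blast
  have "(\<Sum>(i, j)\<in>{(i, j). i + j \<le> s}. (L2_norm_on channel (D i j))^2) \<le> (\<Sum>(i, j)\<in>{(i, j). i + j \<le> s}. measure lborel channel * K^2)"
  proof (rule sum_mono, clarify)
    fix i j assume ij: "i + j \<le> s"
    have c: "continuous_on (UNIV \<times> {-1<..<1}) (D i j)" using D unfolding channel_family_def by blast
    show "(L2_norm_on channel (D i j))^2 \<le> measure lborel channel * K^2"
      by (rule L2_norm_bounded_continuous(2)[OF channel_sets emeasure_channel continuous_on_subset[OF c channel_sub]])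
        (use K(1)[OF ij] in \<open>auto simp: channel_def\<close>)
  qed
  then have "sobolev_norm s f \<le> sqrt ((real (card {(i, j). i + j \<le> s}) * measure lborel channel) * K^2)"
    unfolding e by (intro real_sqrt_le_mono) (simp add: split_beta)
  then show ?thesis using K(2) by (simp add: real_sqrt_mult)
qed

lemma sobolev_norm_lower:
  assumes D: "channel_family D" and f: "\<And>x z. z \<in> {-1<..<1} \<Longrightarrow> f (x, z) = D 0 0 (x, z)"
  shows "L2_norm_on channel f \<le> sobolev_norm s f"
proof -
  have e: "sobolev_norm s f = sqrt (\<Sum>(i, j)\<in>{(i, j). i + j \<le> s}. (L2_norm_on channel (D i j))^2)"
    using sobolev_norm_family(2)[of D f s] D f by blast
  have "(L2_norm_on channel (D 0 0))^2 \<le> (\<Sum>(i, j)\<in>{(i, j). i + j \<le> s}. (L2_norm_on channel (D i j))^2)"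
    using member_le_sum[of "(0, 0)" "{(i, j). i + j \<le> s}" "\<lambda>(i, j). (L2_norm_on channel (D i j))^2"] finite_orders by auto
  then have "L2_norm_on channel (D 0 0) \<le> sobolev_norm s f"
    unfolding e by (rule real_le_rsqrt)
  moreover have "L2_norm_on channel f = L2_norm_on channel (D 0 0)"
    unfolding L2_norm_on_def by (rule arg_cong[of _ _ sqrt], rule set_lebesgue_integral_cong) (simp add: channel_sets, auto simp: channel_def f)
  ultimately show ?thesis by simp
qed

section \<open>The initial label and the Sobolev norm of the data\<close>

text \<open>The odd primitive of \<open>dens\<close>; it maps -1 and 1 to themselves and is the
  height of a label in the shear flow.\<close>

definition flux_label :: "real \<Rightarrow> real" where "flux_label a = 3 * a^5 / 8 + 5 * a^3 / 16 + 5 * a / 16"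

definition mode :: "real \<Rightarrow> real \<Rightarrow> real" where
  "mode X a = (2 * a^2 * cos X - a * sin X) / (a^2 + 1 / 4)"

definition mode_a :: "real \<Rightarrow> real \<Rightarrow> real" where
  "mode_a X a = (a * cos X + (a^2 - 1 / 4) * sin X) / (a^2 + 1 / 4)^2"

text \<open>The integral of \<open>dens * mode_a X\<close> from -1 to \<open>a\<close>, that is, the
  first-order change of the height of label \<open>a\<close>. The last term makes it vanish at -1;
  it vanishes at 1 too, because the mode preserves the height of the column.\<close>

definition mode_Z :: "real \<Rightarrow> real \<Rightarrow> real" where
  "mode_Z X a = dens a * mode X a - 15 * a^4 / 4 * cos X + 5 * a^3 / 2 * sin X - 5 / 4 * cos X"

definition mode_ZX :: "real \<Rightarrow> real \<Rightarrow> real" where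
  "mode_ZX X a = dens a * ((- 2 * a^2 * sin X - a * cos X) / (a^2 + 1 / 4)) + 15 * a^4 / 4 * sin X + 5 * a^3 / 2 * cos X + 5 / 4 * sin X"

lemma quarter_pos: "a^2 + 1 / 4 > (0 :: real)" "a^2 + 1 / 4 \<noteq> (0 :: real)"
  using zero_le_power2[of a] by linarith+

lemma Re_mode: "2 * Re (cis x * (of_real a / (of_real a - \<i> / 2))) = mode x a"
proof -
  have "Re (of_real a / (of_real a - \<i> / 2)) = a^2 / (a^2 + 1 / 4)" "Im (of_real a / (of_real a - \<i> / 2)) = (a / 2) / (a^2 + 1 / 4)"
    by (simp_all add: Re_divide Im_divide power2_eq_square)
  then have "2 * Re (cis x * (of_real a / (of_real a - \<i> / 2))) = 2 * (cos x * (a^2 / (a^2 + 1 / 4)) - sin x * ((a / 2) / (a^2 + 1 / 4)))"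
    by (simp only: times_complex.sel cis.sel)
  also have "\<dots> = mode x a"
  proof -
    have "2 * (C * (a^2 / q) - S * ((a / 2) / q)) = (2 * a^2 * C - a * S) / q" for C S q :: real
      by (simp add: diff_divide_distrib mult.commute mult.left_commute)
    then show ?thesis unfolding mode_def .
  qed
  finally show ?thesis .
qed

lemma flux_label_deriv: "(flux_label has_real_derivative dens a) (at a within S)"
  unfolding flux_label_def[abs_def] dens_def
  by (auto intro!: derivative_eq_intros simp: field_simps power_numeral_reduce)

lemma mode_deriv: "(mode X has_real_derivative mode_a X a) (at a within S)"
proof -
  have "(mode X has_real_derivative ((4 * a * cos X - sin X) * (a^2 + 1 / 4) - (2 * a^2 * cos X - a * sin X) * (2 * a)) / ((a^2 + 1 / 4) * (a^2 + 1 / 4))) (at a within S)"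
    unfolding mode_def[abs_def] by (rule DERIV_divide) (auto intro!: derivative_eq_intros simp: quarter_pos)
  moreover have "(4 * a * cos X - sin X) * (a^2 + 1 / 4) - (2 * a^2 * cos X - a * sin X) * (2 * a) = a * cos X + (a^2 - 1 / 4) * sin X"
    by (simp add: algebra_simps power2_eq_square)
  ultimately show ?thesis by (simp add: mode_a_def power2_eq_square)
qed

lemma mode_Z_deriv: "(mode_Z X has_real_derivative dens a * mode_a X a) (at a within S)"
proof -
  have d: "dens' a * mode X a = 15 * a^3 * cos X - 15 / 2 * a^2 * sin X"
  proof -
    have "dens' a = 15 / 2 * a * (a^2 + 1 / 4)" by (simp add: dens'_def algebra_simps power_numeral_reduce)
    moreover have "15 / 2 * a * q * (n / q) = 15 / 2 * a * n" if "q \<noteq> 0" for n q :: real using that by simp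
    from this[OF quarter_pos(2)] have "15 / 2 * a * (a^2 + 1 / 4) * mode X a = 15 / 2 * a * (2 * a^2 * cos X - a * sin X)"
      unfolding mode_def .
    ultimately have "dens' a * mode X a = 15 / 2 * a * (2 * a^2 * cos X - a * sin X)" by (simp only:)
    then show ?thesis by (simp add: algebra_simps power_numeral_reduce)
  qed
  have "(mode_Z X has_real_derivative (dens' a * mode X a + mode_a X a * dens a) - 15 * a^3 * cos X + 15 / 2 * a^2 * sin X - 0) (at a within S)"
    unfolding mode_Z_def[abs_def]
    by (intro DERIV_diff DERIV_add DERIV_mult dens_deriv mode_deriv DERIV_const) (auto intro!: derivative_eq_intros)
  then show ?thesis unfolding d by (simp add: mult.commute)
qed

lemma mode_Z_X_deriv: "((\<lambda>X. mode_Z X a) has_real_derivative mode_ZX X a) (at X within S)"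
  unfolding mode_Z_def[abs_def] mode_ZX_def mode_def
  by (rule derivative_eq_intros refl | simp add: quarter_pos)+ (simp add: field_simps)

lemma mode_Z_ends: "mode_Z X (-1) = 0" "mode_Z X 1 = 0"
  by (simp_all add: mode_Z_def mode_def dens_def field_simps)

lemma mode_a_bound:
  assumes "\<bar>a\<bar> \<le> 2"
  shows "\<bar>mode_a X a\<bar> \<le> 100"
proof -
  have a2: "a^2 \<le> 4" using assms abs_le_square_iff[of a 2] by simp
  have b: "\<bar>a^2 - 1 / 4\<bar> \<le> 17 / 4" unfolding abs_le_iff using a2 zero_le_power2[of a] by linarith
  have "\<bar>a * cos X + (a^2 - 1 / 4) * sin X\<bar> \<le> \<bar>a\<bar> * \<bar>cos X\<bar> + \<bar>a^2 - 1 / 4\<bar> * \<bar>sin X\<bar>"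
    by (metis abs_mult abs_triangle_ineq)
  also have "\<bar>a\<bar> * \<bar>cos X\<bar> + \<bar>a^2 - 1 / 4\<bar> * \<bar>sin X\<bar> \<le> 2 * 1 + (17 / 4) * 1"
    using assms b by (intro add_mono mult_mono) auto
  finally have n: "\<bar>a * cos X + (a^2 - 1 / 4) * sin X\<bar> \<le> 25 / 4" by simp
  have "(1 / 4)^2 \<le> (a^2 + 1 / 4)^2" by (intro power_mono) auto
  then have m: "1 / 16 \<le> (a^2 + 1 / 4)^2" by (simp add: power2_eq_square)
  have "\<bar>mode_a X a\<bar> = \<bar>a * cos X + (a^2 - 1 / 4) * sin X\<bar> / (a^2 + 1 / 4)^2" by (simp add: mode_a_def abs_div)
  also have "\<dots> \<le> (25 / 4) / (1 / 16)" using n m by (intro frac_le) auto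
  finally show ?thesis by simp
qed

text \<open>The bound 1 / 200 on the amplitude is set against the 100 of
  \<open>mode_a_bound\<close>: the slope in the label stays at least 1 / 2, so heights increase
  strictly with the label.\<close>

lemma slope_ge:
  assumes "\<bar>d\<bar> \<le> 1 / 200" "a \<in> {-2..2}"
  shows "1 / 2 \<le> 1 + d * mode_a X a" "5 / 32 \<le> dens a * (1 + d * mode_a X a)"
proof -
  have "\<bar>d * mode_a X a\<bar> \<le> 1 / 200 * 100" unfolding abs_mult using assms by (intro mult_mono mode_a_bound) auto
  then show h: "1 / 2 \<le> 1 + d * mode_a X a" by (simp add: abs_le_iff)
  show "5 / 32 \<le> dens a * (1 + d * mode_a X a)" using mult_mono[OF dens_ge[of a] h] dens_ge[of a] by simp
qed

definition label_Z :: "real \<Rightarrow> real \<Rightarrow> real \<Rightarrow> real" where "label_Z d X a = flux_label a + d * mode_Z X a"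

lemma label_Z_deriv: "(label_Z d X has_real_derivative dens a * (1 + d * mode_a X a)) (at a within S)"
  unfolding label_Z_def[abs_def]
  using DERIV_add[OF flux_label_deriv DERIV_cmult[OF mode_Z_deriv]] by (simp add: algebra_simps)

lemma label_Z_ends: "label_Z d X (-1) = -1" "label_Z d X 1 = 1"
  by (simp_all add: label_Z_def flux_label_def mode_Z_ends)

definition label :: "real \<Rightarrow> real \<Rightarrow> real \<Rightarrow> real" where
  "label d X z = (SOME a. a \<in> {-1..1} \<and> label_Z d X a = z)"

lemma label:
  assumes z: "z \<in> {-1..1}"
  shows "label d X z \<in> {-1..1}" "label_Z d X (label d X z) = z"
proof -
  have "continuous_on {-1..1} (label_Z d X)" by (rule DERIV_continuous_on[OF label_Z_deriv])
  then have "\<exists>a. a \<in> {-1..1} \<and> label_Z d X a = z"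
    using IVT'[of "label_Z d X" "-1" z 1] z label_Z_ends by auto
  from someI_ex[OF this] show "label d X z \<in> {-1..1}" "label_Z d X (label d X z) = z" by (auto simp: label_def)
qed

lemma label2: "z \<in> {-1..1} \<Longrightarrow> label d X z \<in> {-2..2}"
  using label(1)[of z d X] by auto

lemma label_Z_lipschitz:
  assumes "\<bar>d\<bar> \<le> 1 / 200" "a \<in> {-2..2}" "b \<in> {-2..2}"
  shows "5 / 32 * \<bar>b - a\<bar> \<le> \<bar>label_Z d X b - label_Z d X a\<bar>"
  by (rule implicit_lipschitz[OF label_Z_deriv _ slope_ge(2)]) (use assms in auto)

lemma label_periodic: "label d (X + 2 * pi) z = label d X z"
  by (simp add: label_def label_Z_def mode_Z_def mode_def)

lemma label_0: "label 0 X z = label 0 Y z"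
  by (simp add: label_def label_Z_def)

lemma mode_a_cont [continuous_intros]:
  fixes f g :: "'y::t2_space \<Rightarrow> real"
  shows "continuous_on A f \<Longrightarrow> continuous_on A g \<Longrightarrow> continuous_on A (\<lambda>p. mode_a (f p) (g p))"
  unfolding mode_a_def by (intro continuous_intros ballI) (auto simp: quarter_pos)

lemma mode_Z_cont [continuous_intros]:
  fixes f g :: "'y::t2_space \<Rightarrow> real"
  shows "continuous_on A f \<Longrightarrow> continuous_on A g \<Longrightarrow> continuous_on A (\<lambda>p. mode_Z (f p) (g p))"
  unfolding mode_Z_def mode_def by (intro continuous_intros ballI) (auto simp: quarter_pos)

lemma label_dX:
  assumes d: "\<bar>d\<bar> \<le> 1 / 200" and z: "z \<in> {-1..1}"
  shows "((\<lambda>X. label d X z) has_real_derivative - (d * mode_ZX X (label d X z)) / (dens (label d X z) * (1 + d * mode_a X (label d X z)))) (at X)"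
proof (rule implicit_deriv[where S = UNIV and Z = "\<lambda>X a. label_Z d X a" and z = z and m = "5 / 32" and Za = "\<lambda>X a. dens a * (1 + d * mode_a X a)"])
  show "((\<lambda>X'. label_Z d X' (label d X z)) has_real_derivative d * mode_ZX X (label d X z)) (at X)"
    unfolding label_Z_def using DERIV_add[OF DERIV_const DERIV_cmult[OF mode_Z_X_deriv]] by simp
  show "continuous_on (UNIV \<times> {-2..2}) (\<lambda>(X, a). dens a * (1 + d * mode_a X a))"
    unfolding split_beta by (intro continuous_intros)
qed (use label2[OF z] label(2)[OF z] slope_ge[OF d] label_Z_deriv in auto)

lemma label_dz:
  assumes d: "\<bar>d\<bar> \<le> 1 / 200" and z: "z \<in> {-1..1}"
  shows "((\<lambda>z. label d X z) has_real_derivative 1 / (dens (label d X z) * (1 + d * mode_a X (label d X z)))) (at z within {-1..1})"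
proof -
  have "((\<lambda>z. label d X z) has_real_derivative - (-1) / (dens (label d X z) * (1 + d * mode_a X (label d X z)))) (at z within {-1..1})"
  proof (rule implicit_deriv[where S = "{-1..1}" and Z = "\<lambda>z a. label_Z d X a - z" and z = 0 and m = "5 / 32" and Za = "\<lambda>z a. dens a * (1 + d * mode_a X a)"])
    show "((\<lambda>z'. label_Z d X (label d X z) - z') has_real_derivative -1) (at z within {-1..1})"
      by (auto intro!: derivative_eq_intros)
    show "((\<lambda>a. label_Z d X a - z) has_real_derivative dens a * (1 + d * mode_a X a)) (at a within {-2..2})" for z a
      using DERIV_diff[OF label_Z_deriv DERIV_const] by simp
    show "continuous_on ({-1..1} \<times> {-2..2}) (\<lambda>(z :: real, a). dens a * (1 + d * mode_a X a))"
      unfolding split_beta by (intro continuous_intros)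
  qed (use label2 label(2) slope_ge[OF d] z in auto)
  then show ?thesis by simp
qed

lemma label_continuous:
  assumes d: "\<bar>d\<bar> \<le> 1 / 200"
  shows "continuous_on (UNIV \<times> {-1..1}) (\<lambda>(X, z). label d X z)"
  unfolding continuous_on_def
proof
  fix p :: "real \<times> real" assume p: "p \<in> UNIV \<times> {-1..1}"
  define a where "a = label d (fst p) (snd p)"
  have a: "a \<in> {-2..2}" "label_Z d (fst p) a = snd p" using p label2 label(2) by (auto simp: a_def)
  have "((\<lambda>q. label d (fst q) (snd q) - a) \<longlongrightarrow> 0) (at p within UNIV \<times> {-1..1})"
  proof (rule Lim_null_comparison[where g = "\<lambda>q. 32 / 5 * \<bar>snd q - label_Z d (fst q) a\<bar>"])
    have "\<forall>\<^sub>F q in at p within UNIV \<times> {-1..1}. q \<in> UNIV \<times> {-1..1}" by (simp add: eventually_at_filter)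
    then show "\<forall>\<^sub>F q in at p within UNIV \<times> {-1..1}. norm (label d (fst q) (snd q) - a) \<le> 32 / 5 * \<bar>snd q - label_Z d (fst q) a\<bar>"
    proof eventually_elim
      case (elim q)
      then have "snd q \<in> {-1..1}" by auto
      from label_Z_lipschitz[OF d a(1) label2[OF this, of d "fst q"], of "fst q"] label(2)[OF this, of d "fst q"]
      show ?case by simp
    qed
    have "continuous_on UNIV (\<lambda>q. 32 / 5 * \<bar>snd q - label_Z d (fst q) a\<bar>)"
      unfolding label_Z_def by (intro continuous_intros)
    then have "((\<lambda>q. 32 / 5 * \<bar>snd q - label_Z d (fst q) a\<bar>) \<longlongrightarrow> 32 / 5 * \<bar>snd p - label_Z d (fst p) a\<bar>) (at p within UNIV \<times> {-1..1})"
      using continuous_on_subset[OF _ subset_UNIV] p unfolding continuous_on_def by blast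
    then show "((\<lambda>q. 32 / 5 * \<bar>snd q - label_Z d (fst q) a\<bar>) \<longlongrightarrow> 0) (at p within UNIV \<times> {-1..1})" using a(2) by simp
  qed
  then show "((\<lambda>(X, z). label d X z) \<longlongrightarrow> (case p of (X, z) \<Rightarrow> label d X z)) (at p within UNIV \<times> {-1..1})"
    unfolding split_beta LIM_zero_iff a_def .
qed

section \<open>An algebra of label expressions closed under differentiation\<close>

lemma alg_closed:
  "f \<in> alg A \<Longrightarrow> g \<in> alg A \<Longrightarrow> (\<lambda>x. f x - g x) \<in> alg A"
  "f \<in> alg A \<Longrightarrow> (\<lambda>x. - f x) \<in> alg A"
  "f \<in> alg A \<Longrightarrow> (\<lambda>x. f x / c) \<in> alg A"
  "f \<in> alg A \<Longrightarrow> (\<lambda>x. f x ^ n) \<in> alg A"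
proof -
  show m: "(\<lambda>x. - f x) \<in> alg A" if "f \<in> alg A" for f
    using alg.mult[OF alg.const[of "-1"] that] by simp
  show "(\<lambda>x. f x - g x) \<in> alg A" if "f \<in> alg A" "g \<in> alg A"
    using alg.add[OF that(1) m[OF that(2)]] by simp
  show "(\<lambda>x. f x / c) \<in> alg A" if "f \<in> alg A"
    using alg.mult[OF that alg.const[of "1 / c"]] by simp
  show "(\<lambda>x. f x ^ n) \<in> alg A" if "f \<in> alg A"
    by (induction n) (auto intro: alg.const alg.mult that)
qed

lemma alg_mono: "f \<in> alg B \<Longrightarrow> B \<subseteq> alg A \<Longrightarrow> f \<in> alg A"
  by (induction rule: alg.induct) (auto intro: alg.intros)

lemma alg_bounded:
  assumes "\<And>f. f \<in> A \<Longrightarrow> \<exists>C. \<forall>x\<in>S. \<bar>f x\<bar> \<le> C" and "f \<in> alg A"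
  shows "\<exists>C. \<forall>x\<in>S. \<bar>f x\<bar> \<le> C"
  using assms(2)
proof induction
  case (gen f) then show ?case by (rule assms(1))
next
  case (const c) show ?case by auto
next
  case (add f g)
  then obtain C D where "\<forall>x\<in>S. \<bar>f x\<bar> \<le> C" "\<forall>x\<in>S. \<bar>g x\<bar> \<le> D" by auto
  then have "\<forall>x\<in>S. \<bar>f x + g x\<bar> \<le> C + D" by (meson abs_triangle_ineq add_mono order_trans)
  then show ?case by blast
next
  case (mult f g)
  then obtain C D where "\<forall>x\<in>S. \<bar>f x\<bar> \<le> C" "\<forall>x\<in>S. \<bar>g x\<bar> \<le> D" by auto
  then have "\<forall>x\<in>S. \<bar>f x * g x\<bar> \<le> \<bar>C\<bar> * \<bar>D\<bar>"
    unfolding abs_mult by (meson abs_ge_self abs_ge_zero mult_mono order_trans)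
  then show ?case by blast
qed

lemma alg_continuous:
  assumes "\<And>f. f \<in> A \<Longrightarrow> continuous_on S (\<lambda>p. f (\<gamma> p))" and "f \<in> alg A"
  shows "continuous_on S (\<lambda>p. f (\<gamma> p))"
  using assms(2) by induction (auto intro: continuous_on_add continuous_on_mult continuous_on_const assms(1))

text \<open>\<open>\<Gamma>\<close> selects the admissible curves and parameters. One element of the
  algebra has to represent the derivative along all of them, which makes bounds uniform over the
  curves.\<close>

definition alg_differentiable :: "((real \<Rightarrow> 'a) \<Rightarrow> real \<Rightarrow> bool) \<Rightarrow> ('a \<Rightarrow> real) set \<Rightarrow> ('a \<Rightarrow> real) \<Rightarrow> bool" where
  "alg_differentiable \<Gamma> A f \<longleftrightarrow> f \<in> alg A \<and>
     (\<exists>f'\<in>alg A. \<forall>\<gamma> s. \<Gamma> \<gamma> s \<longrightarrow> ((\<lambda>\<sigma>. f (\<gamma> \<sigma>)) has_real_derivative f' (\<gamma> s)) (at s))"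

lemma alg_differentiable_alg:
  assumes B: "\<And>f. f \<in> B \<Longrightarrow> alg_differentiable \<Gamma> A f" and f: "f \<in> alg B"
  shows "alg_differentiable \<Gamma> A f"
  using f
proof induction
  case (gen f) then show ?case by (rule B)
next
  case (const c)
  show ?case unfolding alg_differentiable_def by (intro conjI bexI[of _ "\<lambda>x. 0"]) (auto intro: alg.const)
next
  case (add f g)
  then obtain f' g' where "f \<in> alg A" "g \<in> alg A" "f' \<in> alg A" "g' \<in> alg A"
    "\<forall>\<gamma> s. \<Gamma> \<gamma> s \<longrightarrow> ((\<lambda>\<sigma>. f (\<gamma> \<sigma>)) has_real_derivative f' (\<gamma> s)) (at s)" "\<forall>\<gamma> s. \<Gamma> \<gamma> s \<longrightarrow> ((\<lambda>\<sigma>. g (\<gamma> \<sigma>)) has_real_derivative g' (\<gamma> s)) (at s)"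
    unfolding alg_differentiable_def by auto
  then show ?case unfolding alg_differentiable_def
    by (intro conjI bexI[of _ "\<lambda>x. f' x + g' x"]) (auto intro: DERIV_add alg.add)
next
  case (mult f g)
  then obtain f' g' where d: "f \<in> alg A" "g \<in> alg A" "f' \<in> alg A" "g' \<in> alg A"
    "\<And>\<gamma> s. \<Gamma> \<gamma> s \<Longrightarrow> ((\<lambda>\<sigma>. f (\<gamma> \<sigma>)) has_real_derivative f' (\<gamma> s)) (at s)" "\<And>\<gamma> s. \<Gamma> \<gamma> s \<Longrightarrow> ((\<lambda>\<sigma>. g (\<gamma> \<sigma>)) has_real_derivative g' (\<gamma> s)) (at s)"
    unfolding alg_differentiable_def by auto
  have "((\<lambda>\<sigma>. f (\<gamma> \<sigma>) * g (\<gamma> \<sigma>)) has_real_derivative f' (\<gamma> s) * g (\<gamma> s) + g' (\<gamma> s) * f (\<gamma> s)) (at s)" if "\<Gamma> \<gamma> s" for \<gamma> s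
    by (rule DERIV_mult[OF d(5,6)[OF that]])
  moreover have "(\<lambda>x. f' x * g x + g' x * f x) \<in> alg A" using d by (intro alg.add alg.mult)
  ultimately show ?case using d(1,2) unfolding alg_differentiable_def
    by (intro conjI bexI[of _ "\<lambda>x. f' x * g x + g' x * f x"] alg.mult allI impI)
qed

text \<open>A reciprocal is adjoined as a generator; its derivative is then a polynomial in it and
  in the derivative of the denominator.\<close>

lemma alg_differentiable_inverse:
  assumes h: "alg_differentiable \<Gamma> A h" and i: "(\<lambda>x. 1 / h x) \<in> A" and nz: "\<And>\<gamma> s. \<Gamma> \<gamma> s \<Longrightarrow> h (\<gamma> s) \<noteq> 0"
  shows "alg_differentiable \<Gamma> A (\<lambda>x. 1 / h x)"
proof -
  obtain h' where h': "h' \<in> alg A" "\<And>\<gamma> s. \<Gamma> \<gamma> s \<Longrightarrow> ((\<lambda>\<sigma>. h (\<gamma> \<sigma>)) has_real_derivative h' (\<gamma> s)) (at s)"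
    using h unfolding alg_differentiable_def by auto
  have i': "(\<lambda>x. 1 / h x) \<in> alg A" by (rule alg.gen[OF i])
  have "((\<lambda>\<sigma>. 1 / h (\<gamma> \<sigma>)) has_real_derivative - (h' (\<gamma> s) * (1 / h (\<gamma> s)) * (1 / h (\<gamma> s)))) (at s)" if "\<Gamma> \<gamma> s" for \<gamma> s
    using DERIV_divide[OF DERIV_const h'(2)[OF that] nz[OF that], of 1] by simp
  moreover have "(\<lambda>x. - (h' x * (1 / h x) * (1 / h x))) \<in> alg A" by (intro alg_closed alg.mult h' i')
  ultimately show ?thesis unfolding alg_differentiable_def
    by (intro conjI i' bexI[of _ "\<lambda>x. - (h' x * (1 / h x) * (1 / h x))"] allI impI)
qed

text \<open>Amplitude, cosine and sine of the phase, perturbed label and base label are treated as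
  independent coordinates. The data divided by the amplitude, and all derivatives of this quotient,
  are then fixed functions of them, bounded uniformly for small amplitudes.\<close>

type_synonym env = "real \<times> real \<times> real \<times> real \<times> real"

definition env_d :: "env \<Rightarrow> real" where "env_d x = fst x"
definition env_c :: "env \<Rightarrow> real" where "env_c x = fst (snd x)"
definition env_s :: "env \<Rightarrow> real" where "env_s x = fst (snd (snd x))"
definition env_g :: "env \<Rightarrow> real" where "env_g x = fst (snd (snd (snd x)))"
definition env_u :: "env \<Rightarrow> real" where "env_u x = snd (snd (snd (snd x)))"

definition label_env :: "real \<Rightarrow> real \<Rightarrow> real \<Rightarrow> env" where
  "label_env d X z = (d, cos X, sin X, label d X z, label 0 0 z)"

lemma label_env_simps [simp]:
  "env_d (label_env d X z) = d" "env_c (label_env d X z) = cos X" "env_s (label_env d X z) = sin X"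
  "env_g (label_env d X z) = label d X z" "env_u (label_env d X z) = label 0 0 z"
  by (simp_all add: label_env_def env_d_def env_c_def env_s_def env_g_def env_u_def)

definition coords :: "(env \<Rightarrow> real) set" where "coords = {env_d, env_c, env_s, env_g, env_u}"

definition "den_q x = (env_g x)^2 + 1 / 4"
definition "den_f x = dens (env_g x)"
definition "den_u x = dens (env_u x)"
definition "den_l x = 1 + env_d x * ((env_g x * env_c x + ((env_g x)^2 - 1 / 4) * env_s x) * (1 / den_q x) * (1 / den_q x))"
text \<open>The divided difference of \<open>flux_label\<close> between the perturbed and the base
  label.\<close>

definition "den_g x = 3 / 8 * ((env_g x)^4 + (env_g x)^3 * env_u x + (env_g x)^2 * (env_u x)^2 + env_g x * (env_u x)^3 + (env_u x)^4)
   + 5 / 16 * ((env_g x)^2 + env_g x * env_u x + (env_u x)^2) + 5 / 16"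

definition gens :: "(env \<Rightarrow> real) set" where
  "gens = coords \<union> {\<lambda>x. 1 / den_q x, \<lambda>x. 1 / den_f x, \<lambda>x. 1 / den_u x, \<lambda>x. 1 / den_g x, \<lambda>x. 1 / den_l x}"

lemma coords_alg: "env_d \<in> alg coords" "env_c \<in> alg coords" "env_s \<in> alg coords" "env_g \<in> alg coords" "env_u \<in> alg coords"
  by (auto simp: coords_def intro: alg.gen)

lemma dens_alg: "f \<in> alg A \<Longrightarrow> (\<lambda>x. dens (f x)) \<in> alg A"
  unfolding dens_def by (intro alg.add alg.mult alg.const alg_closed)

lemma den_alg: "den_q \<in> alg coords" "den_f \<in> alg coords" "den_u \<in> alg coords" "den_g \<in> alg coords"
proof -
  show "den_q \<in> alg coords" unfolding den_q_def[abs_def] by (intro alg.add alg.mult alg.const alg_closed coords_alg)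
  show "den_f \<in> alg coords" "den_u \<in> alg coords" unfolding den_f_def[abs_def] den_u_def[abs_def] by (intro dens_alg coords_alg)+
  show "den_g \<in> alg coords" unfolding den_g_def[abs_def] by (intro alg.add alg.mult alg.const alg_closed(1,4) coords_alg)
qed

text \<open>\<open>den_l\<close> contains \<open>1 / den_q\<close>, so its reciprocal can be treated
  only after that generator; the other denominators are polynomials in the coordinates.\<close>

lemma den_l_alg: "den_l \<in> alg (insert (\<lambda>x. 1 / den_q x) coords)"
proof -
  note c = coords_alg[THEN alg_mono, of "insert (\<lambda>x. 1 / den_q x) coords"]
  have "coords \<subseteq> alg (insert (\<lambda>x. 1 / den_q x) coords)" "(\<lambda>x. 1 / den_q x) \<in> alg (insert (\<lambda>x. 1 / den_q x) coords)"
    by (auto intro: alg.gen)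
  then show ?thesis unfolding den_l_def[abs_def]
    by (intro alg.add alg.mult alg_closed(1,4) c) (auto intro: alg.const)
qed

lemma den_env:
  "den_q (label_env d X z) = (label d X z)^2 + 1 / 4"
  "den_f (label_env d X z) = dens (label d X z)"
  "den_u (label_env d X z) = dens (label 0 0 z)"
  "den_l (label_env d X z) = 1 + d * mode_a X (label d X z)"
  by (simp_all add: den_q_def den_f_def den_u_def den_l_def mode_a_def power2_eq_square)

text \<open>Both brackets are half of a sum of squares.\<close>

lemma quintic_quotient_ge: "5 / 16 \<le> 3 / 8 * (g^4 + g^3 * u + g^2 * u^2 + g * u^3 + u^4) + 5 / 16 * (g^2 + g * u + u^2) + (5 / 16 :: real)"
proof -
  have "g^2 + g * u + u^2 = ((g + u)^2 + g^2 + u^2) / 2" by (simp add: algebra_simps power2_eq_square)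
  also have "\<dots> \<ge> 0" by simp
  finally have a: "0 \<le> g^2 + g * u + u^2" .
  have "g^4 + g^3 * u + g^2 * u^2 + g * u^3 + u^4 = ((g^2 + g * u)^2 + (u^2 + g * u)^2 + g^2 * g^2 + u^2 * u^2) / 2"
    by (simp add: algebra_simps power_numeral_reduce)
  also have "\<dots> \<ge> 0" by simp
  finally have b: "0 \<le> g^4 + g^3 * u + g^2 * u^2 + g * u^3 + u^4" .
  have "5 / 16 \<le> 3 / 8 * p + 5 / 16 * q + (5 / 16 :: real)" if "0 \<le> p" "0 \<le> q" for p q using that by simp
  from this[OF b a] show ?thesis .
qed

lemma den_ge:
  assumes "\<bar>d\<bar> \<le> 1 / 200" "z \<in> {-1..1}"
  shows "1 / 4 \<le> den_q (label_env d X z)" "1 / 4 \<le> den_f (label_env d X z)" "1 / 4 \<le> den_u (label_env d X z)"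
    "1 / 4 \<le> den_g (label_env d X z)" "1 / 4 \<le> den_l (label_env d X z)"
proof -
  show "1 / 4 \<le> den_q (label_env d X z)" by (simp add: den_env)
  show "1 / 4 \<le> den_f (label_env d X z)" "1 / 4 \<le> den_u (label_env d X z)"
    using dens_ge[of "label d X z"] dens_ge[of "label 0 0 z"] by (simp_all add: den_env)
  show "1 / 4 \<le> den_g (label_env d X z)"
    unfolding den_g_def label_env_simps by (rule order_trans[OF _ quintic_quotient_ge]) simp
  show "1 / 4 \<le> den_l (label_env d X z)"
    using slope_ge(1)[OF assms(1) label2[OF assms(2)], of X d X] by (simp add: den_env)
qed

definition envs :: "env set" where "envs = {label_env d X z | d X z. \<bar>d\<bar> \<le> 1 / 200 \<and> z \<in> {-1..1}}"

lemma gens_bounded: "f \<in> gens \<Longrightarrow> \<exists>C. \<forall>x\<in>envs. \<bar>f x\<bar> \<le> C"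
proof -
  assume "f \<in> gens"
  then consider "f \<in> coords" | h where "f = (\<lambda>x. 1 / h x)" "h \<in> {den_q, den_f, den_u, den_g, den_l}" by (auto simp: gens_def)
  then show ?thesis
  proof cases
    case 1
    have "\<bar>f (label_env d X z)\<bar> \<le> 1" if "\<bar>d\<bar> \<le> 1 / 200" "z \<in> {-1..1}" for d X z
      using 1 that label(1)[OF that(2), of d X] label(1)[OF that(2), of 0 0] by (auto simp: coords_def abs_le_iff)
    then show ?thesis by (intro exI[of _ 1]) (auto simp: envs_def)
  next
    case 2
    have "\<bar>f (label_env d X z)\<bar> \<le> 4" if "\<bar>d\<bar> \<le> 1 / 200" "z \<in> {-1..1}" for d X z
    proof -
      have "1 / 4 \<le> h (label_env d X z)" using 2(2) den_ge[OF that, of X] by auto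
      then show ?thesis using 2(1) by (simp add: field_simps)
    qed
    then show ?thesis by (intro exI[of _ 4]) (auto simp: envs_def)
  qed
qed

lemma gens_differentiable:
  assumes c: "\<And>f. f \<in> coords \<Longrightarrow> alg_differentiable \<Gamma> gens f"
    and \<Gamma>: "\<And>\<gamma> s. \<Gamma> \<gamma> s \<Longrightarrow> \<exists>d X z. \<gamma> s = label_env d X z \<and> \<bar>d\<bar> \<le> 1 / 200 \<and> z \<in> {-1..1}"
    and f: "f \<in> alg gens"
  shows "alg_differentiable \<Gamma> gens f"
proof -
  have nz: "h (\<gamma> s) \<noteq> 0" if "\<Gamma> \<gamma> s" "h \<in> {den_q, den_f, den_u, den_g, den_l}" for h \<gamma> s
  proof -
    from \<Gamma>[OF that(1)] obtain d X z where "\<gamma> s = label_env d X z" "\<bar>d\<bar> \<le> 1 / 200" "z \<in> {-1..1}" by blast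
    then show ?thesis using den_ge[of d z X] that(2) by auto
  qed
  have inv: "alg_differentiable \<Gamma> gens (\<lambda>x. 1 / h x)" if "alg_differentiable \<Gamma> gens h" "h \<in> {den_q, den_f, den_u, den_g, den_l}" for h
    by (rule alg_differentiable_inverse[OF that(1)]) (use that(2) nz in \<open>auto simp: gens_def\<close>)
  have h4: "alg_differentiable \<Gamma> gens h" if "h \<in> {den_q, den_f, den_u, den_g}" for h
    using alg_differentiable_alg[OF c] den_alg that by blast
  have q: "alg_differentiable \<Gamma> gens (\<lambda>x. 1 / den_q x)" by (rule inv[OF h4]) auto
  have l: "alg_differentiable \<Gamma> gens den_l"
    by (rule alg_differentiable_alg[OF _ den_l_alg]) (use q c in auto)
  have "alg_differentiable \<Gamma> gens f" if "f \<in> gens" for f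
    using that inv h4 inv[OF l] c by (auto simp: gens_def)
  from alg_differentiable_alg[OF this f] show ?thesis .
qed

lemma gens_sub: "coords \<subseteq> alg gens" by (auto simp: gens_def intro: alg.gen)

lemma gens_alg:
  "env_d \<in> alg gens" "env_c \<in> alg gens" "env_s \<in> alg gens" "env_g \<in> alg gens" "env_u \<in> alg gens"
  "(\<lambda>x. 1 / den_q x) \<in> alg gens" "(\<lambda>x. 1 / den_f x) \<in> alg gens" "(\<lambda>x. 1 / den_u x) \<in> alg gens"
  "(\<lambda>x. 1 / den_g x) \<in> alg gens" "(\<lambda>x. 1 / den_l x) \<in> alg gens"
  by (auto simp: gens_def coords_def intro: alg.gen)

definition \<Gamma>X :: "(real \<Rightarrow> env) \<Rightarrow> real \<Rightarrow> bool" where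
  "\<Gamma>X \<gamma> s \<longleftrightarrow> (\<exists>d z. \<gamma> = (\<lambda>X. label_env d X z) \<and> \<bar>d\<bar> \<le> 1 / 200 \<and> z \<in> {-1<..<1})"

definition \<Gamma>z :: "(real \<Rightarrow> env) \<Rightarrow> real \<Rightarrow> bool" where
  "\<Gamma>z \<gamma> s \<longleftrightarrow> (\<exists>d X. \<gamma> = label_env d X \<and> \<bar>d\<bar> \<le> 1 / 200 \<and> s \<in> {-1<..<1})"

lemma \<Gamma>X_coord:
  assumes "f \<in> alg gens" "f' \<in> alg gens"
    "\<And>d X z. \<bar>d\<bar> \<le> 1 / 200 \<Longrightarrow> z \<in> {-1<..<1} \<Longrightarrow> ((\<lambda>X. f (label_env d X z)) has_real_derivative f' (label_env d X z)) (at X)"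
  shows "alg_differentiable \<Gamma>X gens f"
  using assms unfolding alg_differentiable_def \<Gamma>X_def by blast

lemma \<Gamma>z_coord:
  assumes "f \<in> alg gens" "f' \<in> alg gens"
    "\<And>d X z. \<bar>d\<bar> \<le> 1 / 200 \<Longrightarrow> z \<in> {-1<..<1} \<Longrightarrow> ((\<lambda>z. f (label_env d X z)) has_real_derivative f' (label_env d X z)) (at z)"
  shows "alg_differentiable \<Gamma>z gens f"
  using assms unfolding alg_differentiable_def \<Gamma>z_def by blast

definition "zx_alg x = den_f x * ((- 2 * (env_g x)^2 * env_s x - env_g x * env_c x) * (1 / den_q x))
   + 15 * (env_g x)^4 / 4 * env_s x + 5 * (env_g x)^3 / 2 * env_c x + 5 / 4 * env_s x"

lemma zx_alg: "zx_alg \<in> alg gens"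
  unfolding zx_alg_def[abs_def]
  by (intro alg.add alg.mult alg_closed(1,3,4) gens_alg alg_mono[OF den_alg(2) gens_sub]) (rule alg.const)+

text \<open>Implicit differentiation expresses the derivative of the label by the same coordinates,
  with denominators \<open>den_q\<close>, \<open>den_f\<close> and \<open>den_l\<close> only, so it
  stays in the algebra.\<close>

lemma gens_dX: "f \<in> alg gens \<Longrightarrow> alg_differentiable \<Gamma>X gens f"
proof (rule gens_differentiable)
  fix f assume "f \<in> coords"
  then consider "f = env_d" | "f = env_c" | "f = env_s" | "f = env_g" | "f = env_u" by (auto simp: coords_def)
  then show "alg_differentiable \<Gamma>X gens f"
  proof cases
    case 1
    show ?thesis unfolding 1 by (rule \<Gamma>X_coord[OF gens_alg(1) alg.const[of 0]]) simp
  next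
    case 2
    show ?thesis unfolding 2 by (rule \<Gamma>X_coord[OF gens_alg(2) alg_closed(2)[OF gens_alg(3)]]) (auto intro!: derivative_eq_intros)
  next
    case 3
    show ?thesis unfolding 3 by (rule \<Gamma>X_coord[OF gens_alg(3) gens_alg(2)]) (auto intro!: derivative_eq_intros)
  next
    case 4
    show ?thesis unfolding 4
    proof (rule \<Gamma>X_coord[OF gens_alg(4), of "\<lambda>x. - (env_d x * zx_alg x * (1 / den_f x) * (1 / den_l x))"])
      show "(\<lambda>x. - (env_d x * zx_alg x * (1 / den_f x) * (1 / den_l x))) \<in> alg gens"
        by (intro alg_closed(2) alg.mult gens_alg zx_alg)
      fix d X z :: real assume "\<bar>d\<bar> \<le> 1 / 200" "z \<in> {-1<..<1}"
      from label_dX[OF this(1), of z X] this(2)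
      show "((\<lambda>X. env_g (label_env d X z)) has_real_derivative
        - (env_d (label_env d X z) * zx_alg (label_env d X z) * (1 / den_f (label_env d X z)) * (1 / den_l (label_env d X z)))) (at X)"
        by (simp add: zx_alg_def den_env mode_ZX_def)
    qed
  next
    case 5
    show ?thesis unfolding 5 by (rule \<Gamma>X_coord[OF gens_alg(5) alg.const[of 0]]) simp
  qed
next
  fix \<gamma> s assume "\<Gamma>X \<gamma> s"
  then show "\<exists>d X z. \<gamma> s = label_env d X z \<and> \<bar>d\<bar> \<le> 1 / 200 \<and> z \<in> {-1..1}"
    unfolding \<Gamma>X_def by fastforce
qed

lemma label_dz_open:
  assumes d: "\<bar>d\<bar> \<le> 1 / 200" and z: "z \<in> {-1<..<1}"
  shows "((\<lambda>z. label d X z) has_real_derivative 1 / (dens (label d X z) * (1 + d * mode_a X (label d X z)))) (at z)"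
proof -
  have "at z within {-1..1} = at z" by (rule at_within_interior) (use z in \<open>simp add: interior_atLeastAtMost_real\<close>)
  then show ?thesis using label_dz[OF d, of z X] z by simp
qed

lemma gens_dz: "f \<in> alg gens \<Longrightarrow> alg_differentiable \<Gamma>z gens f"
proof (rule gens_differentiable)
  fix f assume "f \<in> coords"
  then consider "f = env_d" | "f = env_c" | "f = env_s" | "f = env_g" | "f = env_u" by (auto simp: coords_def)
  then show "alg_differentiable \<Gamma>z gens f"
  proof cases
    case 1
    show ?thesis unfolding 1 by (rule \<Gamma>z_coord[OF gens_alg(1) alg.const[of 0]]) simp
  next
    case 2
    show ?thesis unfolding 2 by (rule \<Gamma>z_coord[OF gens_alg(2) alg.const[of 0]]) simp
  next
    case 3
    show ?thesis unfolding 3 by (rule \<Gamma>z_coord[OF gens_alg(3) alg.const[of 0]]) simp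
  next
    case 4
    show ?thesis unfolding 4
      by (rule \<Gamma>z_coord[OF gens_alg(4) alg.mult[OF gens_alg(7) gens_alg(10)]])
        (use label_dz_open in \<open>simp add: den_env\<close>)
  next
    case 5
    show ?thesis unfolding 5
      by (rule \<Gamma>z_coord[OF gens_alg(5) gens_alg(8)]) (use label_dz_open[of 0 _ 0] in \<open>simp add: den_env\<close>)
  qed
next
  fix \<gamma> s assume "\<Gamma>z \<gamma> s"
  then show "\<exists>d X z. \<gamma> s = label_env d X z \<and> \<bar>d\<bar> \<le> 1 / 200 \<and> z \<in> {-1..1}"
    unfolding \<Gamma>z_def by fastforce
qed

lemma gens_continuous:
  assumes d: "\<bar>d\<bar> \<le> 1 / 200" and f: "f \<in> alg gens"
  shows "continuous_on (UNIV \<times> {-1..1}) (\<lambda>p. f (label_env d (fst p) (snd p)))"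
proof -
  let ?S = "UNIV \<times> {-1..1::real} :: (real \<times> real) set"
  have lc: "continuous_on ?S (\<lambda>p. label d (fst p) (snd p))" if "\<bar>d\<bar> \<le> 1 / 200" for d
    using label_continuous[OF that] by (simp add: split_beta)
  have "label 0 (fst p) (snd p) = label 0 0 (snd p)" for p by (rule label_0)
  with lc[of 0] have lu: "continuous_on ?S (\<lambda>p. label 0 0 (snd p))" by simp
  have co: "continuous_on ?S (\<lambda>p. f (label_env d (fst p) (snd p)))" if "f \<in> coords" for f
    using that lc[OF d] lu by (auto simp: coords_def intro!: continuous_intros)
  have inv: "continuous_on ?S (\<lambda>p. 1 / h (label_env d (fst p) (snd p)))"
    if "continuous_on ?S (\<lambda>p. h (label_env d (fst p) (snd p)))" "h \<in> {den_q, den_f, den_u, den_g, den_l}" for h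
  proof (intro continuous_on_divide continuous_on_const that(1) ballI)
    fix p assume "p \<in> ?S"
    then show "h (label_env d (fst p) (snd p)) \<noteq> 0" using that(2) den_ge[OF d, of "snd p" "fst p"] by auto
  qed
  have h4: "continuous_on ?S (\<lambda>p. h (label_env d (fst p) (snd p)))" if "h \<in> {den_q, den_f, den_u, den_g}" for h
    by (rule alg_continuous[where A = coords and \<gamma> = "\<lambda>p. label_env d (fst p) (snd p)", OF co]) (use den_alg that in auto)
  have q: "continuous_on ?S (\<lambda>p. 1 / den_q (label_env d (fst p) (snd p)))" by (rule inv[OF h4]) auto
  have l: "continuous_on ?S (\<lambda>p. den_l (label_env d (fst p) (snd p)))"
    by (rule alg_continuous[where \<gamma> = "\<lambda>p. label_env d (fst p) (snd p)", OF _ den_l_alg]) (use q co in auto)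
  have "continuous_on ?S (\<lambda>p. f (label_env d (fst p) (snd p)))" if "f \<in> gens" for f
    using that inv h4 inv[OF l] co by (auto simp: gens_def)
  then show ?thesis by (rule alg_continuous[where \<gamma> = "\<lambda>p. label_env d (fst p) (snd p)", OF _ f])
qed

definition "mode_alg x = den_f x * ((2 * (env_g x)^2 * env_c x - env_g x * env_s x) * (1 / den_q x))
   - 15 * (env_g x)^4 / 4 * env_c x + 5 * (env_g x)^3 / 2 * env_s x - 5 / 4 * env_c x"

definition "perturbation x = mode_alg x * (1 / den_g x) *
   (15 / 8 * ((env_u x)^3 + (env_u x)^2 * env_g x + env_u x * (env_g x)^2 + (env_g x)^3) + 15 / 16 * (env_u x + env_g x)) *
   (1 / den_f x) * (1 / den_u x)"

lemma perturbation_alg: "perturbation \<in> alg gens"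
proof -
  have "mode_alg \<in> alg gens"
    unfolding mode_alg_def[abs_def]
    by (intro alg.add alg.mult alg_closed(1,3,4) gens_alg alg_mono[OF den_alg(2) gens_sub]) (rule alg.const)+
  moreover have "(\<lambda>x. 15 / 8 * ((env_u x)^3 + (env_u x)^2 * env_g x + env_u x * (env_g x)^2 + (env_g x)^3) + 15 / 16 * (env_u x + env_g x)) \<in> alg gens"
    by (intro alg.add alg.mult alg_closed(1,4) gens_alg) (rule alg.const)+
  ultimately show ?thesis unfolding perturbation_def[abs_def] by (intro alg.mult gens_alg)
qed

text \<open>\<open>g\<close> and \<open>u\<close> are the labels at one and the same height, so
  \<open>u - g\<close> times the divided difference of \<open>flux_label\<close> equals
  \<open>d * mode_Z X g\<close>. Dividing out exhibits the exact factor \<open>d\<close>, and thus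
  all derivatives of the data are of order \<open>d\<close>.\<close>

lemma vorticity_perturbation:
  assumes d: "\<bar>d\<bar> \<le> 1 / 200" and z: "z \<in> {-1..1}"
  shows "1 / dens (label d X z) - 1 / dens (label 0 0 z) = d * perturbation (label_env d X z)"
proof -
  define g u where "g = label d X z" and "u = label 0 0 z"
  define G where "G = 3 / 8 * (g^4 + g^3 * u + g^2 * u^2 + g * u^3 + u^4) + 5 / 16 * (g^2 + g * u + u^2) + 5 / 16"
  define R where "R = 15 / 8 * (u^3 + u^2 * g + u * g^2 + g^3) + 15 / 16 * (u + g)"
  have G: "G > 0" using quintic_quotient_ge[of g u] unfolding G_def by linarith
  have fp: "dens g > 0" "dens u > 0" using dens_ge[of g] dens_ge[of u] by linarith+
  have "flux_label g + d * mode_Z X g = flux_label u"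
    using label(2)[OF z, of d X] label(2)[OF z, of 0 0] by (simp add: label_Z_def g_def u_def)
  moreover have "flux_label g - flux_label u = (g - u) * G"
    by (simp add: flux_label_def G_def algebra_simps power_numeral_reduce add_divide_distrib diff_divide_distrib)
  ultimately have "(u - g) * G = d * mode_Z X g" by (simp add: algebra_simps)
  then have ug: "u - g = d * mode_Z X g * (1 / G)" using G by (simp add: field_simps)
  have "dens u - dens g = (u - g) * R"
    by (simp add: dens_def R_def algebra_simps power_numeral_reduce add_divide_distrib diff_divide_distrib)
  then have R: "dens u - dens g = d * mode_Z X g * (1 / G) * R" by (simp only: ug)
  have "1 / dens g - 1 / dens u = (dens u - dens g) * (1 / dens g) * (1 / dens u)"
    using fp by (simp add: field_simps)
  also have "\<dots> = d * (mode_Z X g * (1 / G) * R * (1 / dens g) * (1 / dens u))" unfolding R by simp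
  finally have "1 / dens g - 1 / dens u = d * (mode_Z X g * (1 / G) * R * (1 / dens g) * (1 / dens u))" .
  moreover have "mode_alg (label_env d X z) = mode_Z X g"
    by (simp add: mode_alg_def mode_Z_def mode_def den_env g_def)
  ultimately show ?thesis
    unfolding perturbation_def by (simp add: den_env den_g_def g_def u_def G_def R_def)
qed

text \<open>In \<open>P i j\<close> the \<open>X\<close>-derivatives are taken before those in
  \<open>z\<close>, as \<open>channel_family\<close> expects.\<close>

lemma perturbation_jet:
  "\<exists>P. P 0 0 = perturbation \<and> (\<forall>i j. P i j \<in> alg gens \<and>
     (\<forall>d X z. \<bar>d\<bar> \<le> 1 / 200 \<longrightarrow> z \<in> {-1<..<1} \<longrightarrow>
       ((\<lambda>X. P i 0 (label_env d X z)) has_real_derivative P (Suc i) 0 (label_env d X z)) (at X) \<and>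
       ((\<lambda>z. P i j (label_env d X z)) has_real_derivative P i (Suc j) (label_env d X z)) (at z)))"
proof -
  have "\<exists>f'. f \<in> alg gens \<longrightarrow> f' \<in> alg gens \<and> (\<forall>d X z. \<bar>d\<bar> \<le> 1 / 200 \<longrightarrow> z \<in> {-1<..<1} \<longrightarrow>
       ((\<lambda>X. f (label_env d X z)) has_real_derivative f' (label_env d X z)) (at X))" for f
    using gens_dX[of f] unfolding alg_differentiable_def \<Gamma>X_def by blast
  then obtain DX where DX: "\<And>f. f \<in> alg gens \<Longrightarrow> DX f \<in> alg gens"
    "\<And>f d X z. f \<in> alg gens \<Longrightarrow> \<bar>d\<bar> \<le> 1 / 200 \<Longrightarrow> z \<in> {-1<..<1} \<Longrightarrow>
       ((\<lambda>X. f (label_env d X z)) has_real_derivative DX f (label_env d X z)) (at X)"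
    by metis
  have "\<exists>f'. f \<in> alg gens \<longrightarrow> f' \<in> alg gens \<and> (\<forall>d X z. \<bar>d\<bar> \<le> 1 / 200 \<longrightarrow> z \<in> {-1<..<1} \<longrightarrow>
       ((\<lambda>z. f (label_env d X z)) has_real_derivative f' (label_env d X z)) (at z))" for f
    using gens_dz[of f] unfolding alg_differentiable_def \<Gamma>z_def by blast
  then obtain Dz where Dz: "\<And>f. f \<in> alg gens \<Longrightarrow> Dz f \<in> alg gens"
    "\<And>f d X z. f \<in> alg gens \<Longrightarrow> \<bar>d\<bar> \<le> 1 / 200 \<Longrightarrow> z \<in> {-1<..<1} \<Longrightarrow>
       ((\<lambda>z. f (label_env d X z)) has_real_derivative Dz f (label_env d X z)) (at z)"
    by metis
  define P where "P i j = (Dz ^^ j) ((DX ^^ i) perturbation)" for i j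
  have X: "(DX ^^ i) perturbation \<in> alg gens" for i by (induction i) (auto intro: perturbation_alg DX)
  have P: "P i j \<in> alg gens" for i j unfolding P_def by (induction j) (auto intro: X Dz)
  show ?thesis
  proof (intro exI[of _ P] conjI allI impI)
    show "P 0 0 = perturbation" by (simp add: P_def)
    fix i j d X z assume d: "\<bar>d\<bar> \<le> 1 / (200 :: real)" and z: "z \<in> {-1<..<1 :: real}"
    show "((\<lambda>X. P i 0 (label_env d X z)) has_real_derivative P (Suc i) 0 (label_env d X z)) (at X)"
      using DX(2)[OF P[of i 0] d z] by (simp add: P_def)
    show "((\<lambda>z. P i j (label_env d X z)) has_real_derivative P i (Suc j) (label_env d X z)) (at z)"
      using Dz(2)[OF P[of i j] d z] by (simp add: P_def)
  qed (rule P)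
qed

lemma label_env_periodic: "label_env d (X + 2 * pi) z = label_env d X z"
  by (simp add: label_env_def label_periodic)

text \<open>Each \<open>x\<close>-derivative brings a factor \<open>2 * pi * N\<close>, each
  \<open>z\<close>-derivative none, and the amplitude factors out by
  \<open>vorticity_perturbation\<close>; what remains is bounded independently of \<open>d\<close>
  and \<open>N\<close>.\<close>

lemma initial_sobolev:
  "\<exists>C>0. \<forall>d N f. 0 \<le> d \<longrightarrow> d \<le> 1 / 200 \<longrightarrow> N \<ge> 1 \<longrightarrow>
     (\<forall>x. \<forall>z\<in>{-1<..<1}. f (x, z) = 1 / dens (label d (2 * pi * real N * x) z) - 1 / dens (label 0 0 z)) \<longrightarrow>
     f \<in> sobolev_space s \<and> sobolev_norm s f \<le> C * d * real N ^ s \<and> L2_norm_on channel f \<le> sobolev_norm s f"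
proof -
  obtain P where P: "P 0 0 = perturbation" "\<And>i j. P i j \<in> alg gens"
    "\<And>i d X z. \<bar>d\<bar> \<le> 1 / 200 \<Longrightarrow> z \<in> {-1<..<1} \<Longrightarrow> ((\<lambda>X. P i 0 (label_env d X z)) has_real_derivative P (Suc i) 0 (label_env d X z)) (at X)"
    "\<And>i j d X z. \<bar>d\<bar> \<le> 1 / 200 \<Longrightarrow> z \<in> {-1<..<1} \<Longrightarrow> ((\<lambda>z. P i j (label_env d X z)) has_real_derivative P i (Suc j) (label_env d X z)) (at z)"
    using perturbation_jet by blast
  have "\<forall>i j. \<exists>C. \<forall>x\<in>envs. \<bar>P i j x\<bar> \<le> C" using alg_bounded[OF gens_bounded P(2)] by blast
  then obtain c where c: "\<And>i j x. x \<in> envs \<Longrightarrow> \<bar>P i j x\<bar> \<le> c i j" by metis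
  define K where "K = (\<Sum>(i, j)\<in>{(i, j). i + j \<le> s}. \<bar>c i j\<bar>)"
  have K: "\<bar>P i j x\<bar> \<le> K" if "x \<in> envs" "i + j \<le> s" for i j x
  proof -
    have "\<bar>c i j\<bar> \<le> K" unfolding K_def using member_le_sum[of "(i, j)" "{(i, j). i + j \<le> s}" "\<lambda>(i, j). \<bar>c i j\<bar>"] finite_orders that(2) by auto
    then show ?thesis using c[OF that(1), of i j] by linarith
  qed
  have K0: "0 \<le> K" unfolding K_def by (intro sum_nonneg) auto
  define A where "A = sqrt (real (card {(i, j). i + j \<le> s}) * measure lborel channel)"
  have A0: "0 \<le> A" by (simp add: A_def)
  define C where "C = A * ((2 * pi)^s * K) + 1"
  have C: "C > 0" using A0 K0 by (auto simp: C_def intro!: add_nonneg_pos mult_nonneg_nonneg)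
  show ?thesis
  proof (intro exI[of _ C] conjI allI impI C)
    fix d :: real and N :: nat and f
    assume d: "0 \<le> d" "d \<le> 1 / 200" and N: "N \<ge> 1"
      and f': "\<forall>x. \<forall>z\<in>{-1<..<1}. f (x, z) = 1 / dens (label d (2 * pi * real N * x) z) - 1 / dens (label 0 0 z)"
    then have d': "\<bar>d\<bar> \<le> 1 / 200" by simp
    define M where "M = 2 * pi * real N"
    have M: "M \<ge> 1" using mult_mono[of 1 "2 * pi" 1 "real N"] N pi_ge_two by (simp add: M_def)
    define D where "D i j p = d * M^i * P i j (label_env d (M * fst p) (snd p))" for i j p
    have env: "label_env d (M * x) z \<in> envs" if "z \<in> {-1<..<1}" for x z
      using that d' unfolding envs_def by fastforce
    have fam: "channel_family D"
      unfolding channel_family_def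
    proof (intro allI conjI ballI)
      fix i j
      have "continuous_on (UNIV \<times> {-1<..<1::real}) (\<lambda>p::real \<times> real. (M * fst p, snd p))" by (intro continuous_intros)
      moreover have "(\<lambda>p::real \<times> real. (M * fst p, snd p)) ` (UNIV \<times> {-1<..<1}) \<subseteq> UNIV \<times> {-1..1}" by auto
      ultimately have "continuous_on (UNIV \<times> {-1<..<1}) (\<lambda>p. P i j (label_env d (M * fst p) (snd p)))"
        using continuous_on_compose2[OF gens_continuous[OF d' P(2)], of "UNIV \<times> {-1<..<1}" "\<lambda>p. (M * fst p, snd p)" i j] by simp
      then show "continuous_on (UNIV \<times> {-1<..<1}) (D i j)" unfolding D_def by (intro continuous_intros)
      have "\<bar>D i j (x, z)\<bar> \<le> d * M^i * c i j" if "z \<in> {-1<..<1}" for x z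
        unfolding D_def abs_mult using c[OF env[OF that], of i j x] d M by (simp add: mult_left_mono)
      then show "\<exists>C. \<forall>x. \<forall>z\<in>{-1<..<1}. \<bar>D i j (x, z)\<bar> \<le> C" by blast
      fix x z :: real assume z: "z \<in> {-1<..<1}"
      have "label_env d (M * (x + 1)) z = label_env d (M * x) z"
        using periodic_nat[of "\<lambda>X. label_env d X z" "2 * pi" "M * x" N, OF label_env_periodic] by (simp add: M_def algebra_simps)
      then show "D i j (x + 1, z) = D i j (x, z)" by (simp add: D_def)
      have "((\<lambda>\<xi>. P i 0 (label_env d (M * \<xi>) z)) has_real_derivative P (Suc i) 0 (label_env d (M * x) z) * M) (at x)"
        by (rule DERIV_chain2[OF P(3)[OF d' z]]) (auto intro!: derivative_eq_intros)
      from DERIV_cmult[OF this, of "d * M^i"]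
      show "((\<lambda>\<xi>. D i 0 (\<xi>, z)) has_real_derivative D (Suc i) 0 (x, z)) (at x)" by (simp add: D_def mult_ac)
      show "((\<lambda>\<zeta>. D i j (x, \<zeta>)) has_real_derivative D i (Suc j) (x, z)) (at z)"
        unfolding D_def using DERIV_cmult[OF P(4)[OF d' z], of "d * M^i" i j "M * x"] by simp
    qed
    have f: "f (x, z) = D 0 0 (x, z)" if "z \<in> {-1<..<1}" for x z
      using vorticity_perturbation[OF d', of z "M * x"] that f' by (simp add: M_def D_def P(1))
    have b: "\<bar>D i j (x, z)\<bar> \<le> d * M^s * K" if "i + j \<le> s" "z \<in> {-1<..<1}" for i j x z
    proof -
      have "\<bar>D i j (x, z)\<bar> = d * M^i * \<bar>P i j (label_env d (M * x) z)\<bar>" using d M by (simp add: D_def abs_mult)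
      also have "\<dots> \<le> d * M^s * K"
        using d M that K0 by (intro mult_mono power_increasing K env mult_left_mono mult_nonneg_nonneg) auto
      finally show ?thesis .
    qed
    show "sobolev_norm s f \<le> C * d * real N ^ s"
    proof -
      have "sobolev_norm s f \<le> A * (d * M^s * K)"
        unfolding A_def by (rule sobolev_norm_upper[OF fam f b]) (use d M K0 in auto)
      also have "\<dots> = A * ((2 * pi)^s * K) * (d * real N^s)" by (simp add: M_def power_mult_distrib)
      also have "\<dots> \<le> C * (d * real N^s)" using d by (intro mult_right_mono) (auto simp: C_def)
      finally show ?thesis by (simp add: mult.assoc)
    qed
    show "f \<in> sobolev_space s" by (rule sobolev_norm_family(1)[OF fam f])
    show "L2_norm_on channel f \<le> sobolev_norm s f" by (rule sobolev_norm_lower[OF fam f])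
  qed
qed

section \<open>Growth of the perturbation\<close>

lemma Bop_cong:
  assumes "\<And>a. a \<in> {-2..2} \<Longrightarrow> f a = g a" "a \<in> {-2..2}"
  shows "Bop f a = Bop g a"
proof -
  have "integral {-2..b} (\<lambda>a. dens' a * f a) = integral {-2..b} (\<lambda>a. dens' a * g a)" if "b \<in> {-2..2}" for b
    by (rule integral_cong) (use assms(1) that in auto)
  then show ?thesis using assms by (simp add: Bop_def)
qed

lemma Bop_mode: "a \<in> {-2..2} \<Longrightarrow> Bop (\<lambda>a. a + d * mode X a) a = label_Z d X a + 1"
proof -
  assume a: "a \<in> {-2..2}"
  have h: "((\<lambda>a. a + d * mode X a) has_real_derivative 1 + d * mode_a X a) (at a within {-2..2})" for a
    by (intro DERIV_add DERIV_ident DERIV_cmult mode_deriv)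
  have "((\<lambda>a. Bop (\<lambda>a. a + d * mode X a) a - label_Z d X a) has_real_derivative 0) (at a within {-2..2})" if "a \<in> {-2..2}" for a
    using DERIV_diff[OF Bop_deriv[OF h that] label_Z_deriv[of d X a "{-2..2}"]] by simp
  from mean_value_within[OF this, of "-1" a] show ?thesis
    using a by (auto simp: Bop_minus1 label_Z_ends)
qed

lemma Bop_diff:
  assumes "continuous_on {-2..2} f" "continuous_on {-2..2} g" "a \<in> {-2..2}"
  shows "Bop f a - Bop g a = Bop (\<lambda>a. f a - g a) a"
proof -
  have "integral {-2..b} (\<lambda>a. dens' a * (f a - g a)) = integral {-2..b} (\<lambda>a. dens' a * f a) - integral {-2..b} (\<lambda>a. dens' a * g a)"
    if "b \<in> {-2..2}" for b
    unfolding right_diff_distrib using that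
    by (intro Henstock_Kurzweil_Integration.integral_diff integrable_continuous_interval continuous_intros
        continuous_on_subset[OF assms(1)] continuous_on_subset[OF assms(2)]) auto
  then show ?thesis using assms(3) by (simp add: Bop_def algebra_simps)
qed

text \<open>On labels up to 2 the two densities give \<open>2 * 40\<close> and the two integrals
  \<open>2 * 256\<close>, rounded up to 600.\<close>

lemma Bop_bound:
  assumes h: "continuous_on {-2..2} h" "\<And>a. a \<in> {-2..2} \<Longrightarrow> \<bar>h a\<bar> \<le> r" and a: "a \<in> {-2..2}"
  shows "\<bar>Bop h a\<bar> \<le> 600 * r"
proof -
  have r: "0 \<le> r" using h(2)[of 0] by simp
  have p: "\<bar>b\<bar>^n \<le> 2^n" if "b \<in> {-2..2}" for b :: real and n using that by (intro power_mono) auto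
  have d: "\<bar>dens b\<bar> \<le> 40" if "b \<in> {-2..2}" for b
    using p[OF that, of 2] p[OF that, of 4] dens_ge[of b] by (simp add: dens_def)
  have d': "\<bar>dens' b\<bar> \<le> 64" if "b \<in> {-2..2}" for b
    using p[OF that, of 1] p[OF that, of 3] unfolding dens'_def power_abs[symmetric] by (auto simp: abs_le_iff)
  have I: "\<bar>integral {-2..b} (\<lambda>a. dens' a * h a)\<bar> \<le> 64 * r * 4" if b: "b \<in> {-2..2}" for b
  proof -
    have "norm (integral {-2..b} (\<lambda>a. dens' a * h a)) \<le> 64 * r * (b - (-2))"
    proof (rule integral_bound)
      show "continuous_on {-2..b} (\<lambda>a. dens' a * h a)"
        using b by (intro continuous_intros continuous_on_subset[OF h(1)]) auto
      show "norm (dens' t * h t) \<le> 64 * r" if "t \<in> {-2..b}" for t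
        using d'[of t] h(2)[of t] b that by (auto simp: abs_mult intro!: mult_mono)
    qed (use b in auto)
    also have "\<dots> \<le> 64 * r * 4" using b r by (intro mult_left_mono) auto
    finally show ?thesis by simp
  qed
  have D: "\<bar>dens b * h b\<bar> \<le> 40 * r" if "b \<in> {-2..2}" for b
    unfolding abs_mult using d[OF that] h(2)[OF that] by (intro mult_mono) auto
  have "\<bar>p - q - (y - v)\<bar> \<le> \<bar>p\<bar> + \<bar>q\<bar> + \<bar>y\<bar> + \<bar>v\<bar>" for p q y v :: real by linarith
  from this[of "dens a * h a" "dens (-1) * h (-1)" "integral {-2..a} (\<lambda>a. dens' a * h a)" "integral {-2..-1} (\<lambda>a. dens' a * h a)"]
  have "\<bar>Bop h a\<bar> \<le> 40 * r + 40 * r + 64 * r * 4 + 64 * r * 4"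
    unfolding Bop_def using I[OF a] I[of "-1"] D[OF a] D[of "-1"] by simp
  then show ?thesis using r by linarith
qed

lemma dens_le: "\<bar>a\<bar> \<le> 1 \<Longrightarrow> dens a \<le> 25 / 8"
  using power_le_one[of "\<bar>a\<bar>" 2] power_le_one[of "\<bar>a\<bar>" 4] by (simp add: dens_def)

lemma mode_Z_bound:
  assumes a: "\<bar>a\<bar> \<le> 1"
  shows "\<bar>mode_Z X a\<bar> \<le> 45"
proof -
  have p: "\<bar>a^n\<bar> \<le> 1" for n using a by (simp add: power_abs power_le_one)
  have t: "\<bar>c * y\<bar> \<le> \<bar>c\<bar>" if "\<bar>y\<bar> \<le> 1" for c y :: real
    using that by (simp add: abs_mult mult_left_le)
  have "\<bar>2 * a^2 * cos X - a * sin X\<bar> \<le> \<bar>2 * a^2\<bar> + \<bar>a\<bar>"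
    by (rule order_trans[OF abs_triangle_ineq4 add_mono[OF t t]]) auto
  also have "\<dots> \<le> 3" using p[of 2] a by (simp add: abs_mult)
  finally have n: "\<bar>2 * a^2 * cos X - a * sin X\<bar> \<le> 3" .
  have "\<bar>mode X a\<bar> = \<bar>2 * a^2 * cos X - a * sin X\<bar> / (a^2 + 1 / 4)"
    using quarter_pos(1)[of a] by (simp add: mode_def abs_div)
  also have "\<dots> \<le> 3 / (1 / 4)" using n by (intro frac_le) auto
  finally have m: "\<bar>mode X a\<bar> \<le> 12" by simp
  have "\<bar>dens a * mode X a\<bar> \<le> 25 / 8 * 12"
    unfolding abs_mult using dens_le[OF a] dens_ge[of a] m by (intro mult_mono) auto
  moreover have q: "\<bar>k * a^n / l * y\<bar> \<le> k / l" if "\<bar>y\<bar> \<le> 1" "0 \<le> k" "0 < l" for k l y n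
  proof -
    have "\<bar>a^n\<bar> * \<bar>y\<bar> \<le> 1 * 1" using p[of n] that(1) by (intro mult_mono) auto
    from mult_left_mono[OF this, of "k / l"] that(2,3) show ?thesis by (simp add: abs_mult)
  qed
  have "\<bar>15 * a^4 / 4 * cos X\<bar> \<le> 15 / 4" "\<bar>5 * a^3 / 2 * sin X\<bar> \<le> 5 / 2" "\<bar>5 / 4 * cos X\<bar> \<le> 5 / 4"
    using q[of "cos X" 15 4 4] q[of "sin X" 5 2 3] t[of "cos X" "5 / 4"] by auto
  moreover have "\<bar>p - q + r - y\<bar> \<le> \<bar>p\<bar> + \<bar>q\<bar> + \<bar>r\<bar> + \<bar>y\<bar>" for p q r y :: real by linarith
  from this[of "dens a * mode X a" "15 * a^4 / 4 * cos X" "5 * a^3 / 2 * sin X" "5 / 4 * cos X"]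
  have "\<bar>mode_Z X a\<bar> \<le> \<bar>dens a * mode X a\<bar> + \<bar>15 * a^4 / 4 * cos X\<bar> + \<bar>5 * a^3 / 2 * sin X\<bar> + \<bar>5 / 4 * cos X\<bar>"
    unfolding mode_Z_def .
  ultimately show ?thesis by linarith
qed

lemma label_Z_upper:
  assumes "\<bar>d\<bar> \<le> 1 / 200" "\<bar>a\<bar> \<le> 1" "\<bar>b\<bar> \<le> 1"
  shows "\<bar>label_Z d X b - label_Z d X a\<bar> \<le> 5 * \<bar>b - a\<bar>"
proof -
  obtain \<xi> where \<xi>: "\<xi> \<in> {-1..1}" "label_Z d X b - label_Z d X a = dens \<xi> * (1 + d * mode_a X \<xi>) * (b - a)"
    using mean_value_within[OF label_Z_deriv, of a "-1" 1 b d X] assms by (auto simp: abs_le_iff)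
  have "\<bar>d * mode_a X \<xi>\<bar> \<le> 1 / 200 * 100" unfolding abs_mult using assms \<xi>(1) by (intro mult_mono mode_a_bound) auto
  then have "\<bar>1 + d * mode_a X \<xi>\<bar> \<le> 3 / 2" by (simp add: abs_le_iff)
  moreover have "\<bar>dens \<xi>\<bar> \<le> 25 / 8" using dens_le[of \<xi>] dens_ge[of \<xi>] \<xi>(1) by (simp add: abs_le_iff)
  ultimately have "\<bar>dens \<xi> * (1 + d * mode_a X \<xi>)\<bar> \<le> 25 / 8 * (3 / 2)" unfolding abs_mult by (intro mult_mono) auto
  then show ?thesis unfolding \<xi>(2) abs_mult[of _ "b - a"] by (intro mult_right_mono) auto
qed

text \<open>\<open>g\<close> and \<open>u\<close> have almost the same height under the perturbed
  and the base map, so they differ by an amount comparable to \<open>D\<close>. As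
  \<open>dens\<close> is even, this shows in the vorticity only if \<open>u + g\<close> stays away
  from 0, which is why \<open>u \<ge> 1 / 4\<close> is imposed.\<close>

lemma vorticity_gap:
  assumes D: "0 \<le> D" "D \<le> 1 / 4000" and u: "u \<in> {1/4..1}" and g: "g \<in> {-1..1}"
    and m: "1 / 2 \<le> \<bar>mode_Z X u\<bar>" and e: "\<bar>label_Z D X g - label_Z 0 0 u\<bar> \<le> D / 4"
  shows "D / 1000 \<le> \<bar>1 / dens g - 1 / dens u\<bar>"
proof -
  have u0: "label_Z D X u = label_Z 0 0 u + D * mode_Z X u" by (simp add: label_Z_def)
  have Dm: "D * (1 / 2) \<le> \<bar>D * mode_Z X u\<bar>" "\<bar>D * mode_Z X u\<bar> \<le> D * 45"
    using mult_left_mono[OF m D(1)] mult_left_mono[OF mode_Z_bound[of u X] D(1)] D(1) u by (simp_all add: abs_mult)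
  have "\<bar>D * mode_Z X u\<bar> \<le> \<bar>label_Z D X g - label_Z D X u\<bar> + D / 4" using e u0 by linarith
  moreover have "\<bar>label_Z D X g - label_Z D X u\<bar> \<le> 5 * \<bar>g - u\<bar>" by (rule label_Z_upper) (use D u g in auto)
  ultimately have lo: "D / 20 \<le> \<bar>g - u\<bar>" using Dm(1) by argo
  have "5 / 32 * \<bar>g - u\<bar> \<le> \<bar>label_Z D X g - label_Z D X u\<bar>" by (rule label_Z_lipschitz) (use D u g in auto)
  also have "\<dots> \<le> D * 45 + D / 4" using e u0 Dm(2) by linarith
  finally have "\<bar>g - u\<bar> \<le> 1 / 8" using D by argo
  \<comment> \<open>\<open>D \<le> 1 / 4000\<close> has kept \<open>g\<close> within 1 / 8 of
    \<open>u\<close>, and \<open>2 * u - 1 / 8 \<ge> 3 / 8\<close>.\<close>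
  then have gu: "3 / 8 \<le> u + g" using u unfolding abs_le_iff atLeastAtMost_iff by argo
  have R: "dens u - dens g = (u - g) * ((u + g) * (15 / 8 * (u^2 + g^2) + 15 / 16))"
    by (simp add: dens_def algebra_simps power_numeral_reduce add_divide_distrib diff_divide_distrib)
  have "3 / 8 * (15 / 16) \<le> (u + g) * (15 / 8 * (u^2 + g^2) + 15 / 16)" using gu by (intro mult_mono) auto
  then have R1: "1 / 4 \<le> \<bar>(u + g) * (15 / 8 * (u^2 + g^2) + 15 / 16)\<bar>" by linarith
  have "D / 20 * (1 / 4) \<le> \<bar>g - u\<bar> * \<bar>(u + g) * (15 / 8 * (u^2 + g^2) + 15 / 16)\<bar>"
    using lo R1 by (intro mult_mono) auto
  then have num: "D / 80 \<le> \<bar>dens u - dens g\<bar>" unfolding R abs_mult[of "u - g"] by (simp add: abs_minus_commute)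
  have f: "0 < dens g" "0 < dens u" "dens g \<le> 25 / 8" "dens u \<le> 25 / 8"
    using dens_ge[of g] dens_ge[of u] dens_le[of g] dens_le[of u] u g by (auto simp: abs_le_iff)
  have lower: "D / 80 / (25 / 8 * (25 / 8)) \<le> \<bar>dens u - dens g\<bar> / (dens g * dens u)"
    using num f D by (intro frac_le mult_mono mult_pos_pos) auto
  have const: "D / 1000 \<le> D / 80 / (25 / 8 * (25 / 8))" using D by simp
  have "\<bar>1 / dens g - 1 / dens u\<bar> = \<bar>dens u - dens g\<bar> / (dens g * dens u)"
    using f by (simp add: diff_frac_eq abs_div abs_mult)
  then show ?thesis using order_trans[OF const lower] by simp
qed

text \<open>The height of label 1 / 2 in the shear flow. Label 0 would be a bad choice, since
  \<open>dens\<close> is even and hides a small displacement there.\<close>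

definition z_star :: real where "z_star = flux_label (1 / 2)"

lemma z_star_range: "z_star \<in> {-1<..<1}"
  by (simp add: z_star_def flux_label_def power_numeral_reduce)

lemma base_label_near:
  assumes "z \<in> {-1..1}"
  shows "\<bar>label 0 0 z - 1 / 2\<bar> \<le> 32 / 5 * \<bar>z - z_star\<bar>"
  using label_Z_lipschitz[of 0 "1 / 2" "label 0 0 z" 0] label2[OF assms, of 0 0] label(2)[OF assms, of 0 0]
  by (simp add: z_star_def label_Z_def)

text \<open>Continuity at phase 0 and label 1 / 2, where the value is
  \<open>- 105 / 128\<close>.\<close>

lemma mode_Z_nonzero_near:
  "\<exists>r>0. \<forall>X a. \<bar>X\<bar> < r \<longrightarrow> \<bar>a - 1 / 2\<bar> < r \<longrightarrow> 1 / 2 \<le> \<bar>mode_Z X a\<bar>"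
proof -
  have "continuous_on UNIV (\<lambda>p. mode_Z (fst p) (snd p))" by (intro continuous_intros)
  then have "isCont (\<lambda>p. \<bar>mode_Z (fst p) (snd p)\<bar>) (0, 1 / 2)"
    by (intro isCont_rabs) (simp add: continuous_on_eq_continuous_at)
  moreover have "mode_Z 0 (1 / 2) = - 105 / 128"
    by (simp add: mode_Z_def mode_def dens_def power_numeral_reduce)
  ultimately have "((\<lambda>p. \<bar>mode_Z (fst p) (snd p)\<bar>) \<longlongrightarrow> 105 / 128) (nhds (0, 1 / 2))"
    using tendsto_at_iff_tendsto_nhds[of "\<lambda>p. \<bar>mode_Z (fst p) (snd p)\<bar>" "(0, 1 / 2)"] unfolding isCont_def by simp
  then have "\<forall>\<^sub>F p in nhds (0, 1 / 2). 1 / 2 < \<bar>mode_Z (fst p) (snd p)\<bar>"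
    by (rule order_tendstoD(1)) simp
  then obtain r where r: "r > 0" "\<And>p. dist p (0, 1 / 2) < r \<Longrightarrow> 1 / 2 < \<bar>mode_Z (fst p) (snd p)\<bar>"
    unfolding eventually_nhds_metric by blast
  show ?thesis
  proof (intro exI[of _ "r / 2"] conjI allI impI)
    fix X a :: real assume "\<bar>X\<bar> < r / 2" "\<bar>a - 1 / 2\<bar> < r / 2"
    moreover have "dist (X, a) (0, 1 / 2) \<le> \<bar>X\<bar> + \<bar>a - 1 / 2\<bar>"
      using sqrt_sum_squares_le_sum_abs[of X "a - 1 / 2"] by (simp add: dist_prod_def dist_real_def)
    ultimately show "1 / 2 \<le> \<bar>mode_Z X a\<bar>" using r(2)[of "(X, a)"] by simp
  qed (use r in simp)
qed

text \<open>At time 0 both labels are chosen by the same equation, since \<open>Bop\<close> of the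
  exact mode is \<open>label_Z\<close> up to the shift 1 of the heights.\<close>

lemma lab_initial:
  assumes lf: "label_flow T w wt wx wa \<kappa>" and w: "\<And>x a. a \<in> {-2..2} \<Longrightarrow> w 0 x a = a + d * mode x a"
  shows "lab w 0 X z = label d X z"
proof -
  have "Bop (w 0 X) a = label_Z d X a + 1" if "a \<in> {-1..1}" for a
    using that Bop_cong[of "w 0 X" "\<lambda>a. a + d * mode X a" a] w Bop_mode[of a d X] by auto
  then have "(\<lambda>a. a \<in> {-1..1} \<and> Bop (w 0 X) a = z + 1) = (\<lambda>a. a \<in> {-1..1} \<and> label_Z d X a = z)" by auto
  then show ?thesis unfolding lab_def[OF lf] label_def by (rule arg_cong)
qed

text \<open>\<open>D\<close> stands for \<open>d * exp (t / 2)\<close>. At any time the height map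
  differs from that of an exact mode of amplitude \<open>D\<close> by at most
  \<open>600 * r \<le> D / 4\<close>, so the comparison at time 0 carries over.\<close>

lemma flow_gap:
  "\<exists>\<rho>>0. \<forall>T w wt wx wa \<kappa> t X z D r. label_flow T w wt wx wa \<kappa> \<longrightarrow> t \<in> {0..T} \<longrightarrow> z \<in> {-1..1} \<longrightarrow>
     \<bar>X\<bar> < \<rho> \<longrightarrow> \<bar>z - z_star\<bar> < \<rho> \<longrightarrow> 0 \<le> D \<longrightarrow> D \<le> \<rho> \<longrightarrow> (\<forall>a\<in>{-2..2}. \<bar>w t X a - a - D * mode X a\<bar> \<le> r) \<longrightarrow> r \<le> \<rho> * D \<longrightarrow>
     D / 1000 \<le> \<bar>1 / dens (lab w t X z) - 1 / dens (label 0 0 z)\<bar>"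
proof -
  obtain r0 where r0: "r0 > 0" "\<And>X a. \<bar>X\<bar> < r0 \<Longrightarrow> \<bar>a - 1 / 2\<bar> < r0 \<Longrightarrow> 1 / 2 \<le> \<bar>mode_Z X a\<bar>"
    using mode_Z_nonzero_near by blast
  \<comment> \<open>The value 1 / 4000 serves \<open>vorticity_gap\<close> and gives
    \<open>600 * \<rho> \<le> 1 / 4\<close>; the second entry keeps the base label within
    \<open>r0\<close> of 1 / 2, by \<open>base_label_near\<close>.\<close>
  define \<rho> where "\<rho> = min (1 / 4000) (5 / 32 * r0)"
  have \<rho>: "0 < \<rho>" "\<rho> \<le> 1 / 4000" "\<rho> \<le> 5 / 32 * r0" using r0(1) by (auto simp: \<rho>_def)
  show ?thesis
  proof (intro exI[of _ \<rho>] conjI allI impI \<rho>(1))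
    fix T w wt wx wa \<kappa> t X z D r
    assume lf: "label_flow T w wt wx wa \<kappa>" and t: "t \<in> {0..T}" and z: "z \<in> {-1..1}" and X: "\<bar>X\<bar> < \<rho>" and zs: "\<bar>z - z_star\<bar> < \<rho>"
      and D: "0 \<le> D" "D \<le> \<rho>" and w: "\<forall>a\<in>{-2..2}. \<bar>w t X a - a - D * mode X a\<bar> \<le> r" and r: "r \<le> \<rho> * D"
    have u: "\<bar>label 0 0 z - 1 / 2\<bar> < 32 / 5 * \<rho>" by (rule le_less_trans[OF base_label_near[OF z]]) (use zs in simp)
    have c: "continuous_on {-2..2} (w t X)" "continuous_on {-2..2} (\<lambda>a. a + D * mode X a)"
      using w_slice[OF lf t] by (auto intro!: continuous_intros DERIV_continuous_on[OF mode_deriv])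
    have g: "lab w t X z \<in> {-1..1}" "Bop (w t X) (lab w t X z) = z + 1" using lab[OF lf t z] by auto
    have g2: "lab w t X z \<in> {-2..2}" using g(1) by auto
    have "\<bar>Bop (\<lambda>a. w t X a - (a + D * mode X a)) (lab w t X z)\<bar> \<le> 600 * r"
      by (rule Bop_bound[OF _ _ g2]) (use w in \<open>auto intro!: continuous_intros c simp: algebra_simps\<close>)
    then have "\<bar>z - label_Z D X (lab w t X z)\<bar> \<le> 600 * r"
      using Bop_diff[OF c g2] g(2) Bop_mode[OF g2, of D X] by simp
    moreover have "600 * r \<le> D / 4" using r mult_right_mono[OF \<rho>(2) D(1)] D(1) by linarith
    ultimately have e: "\<bar>label_Z D X (lab w t X z) - label_Z 0 0 (label 0 0 z)\<bar> \<le> D / 4"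
      using label(2)[OF z, of 0 0] by linarith
    show "D / 1000 \<le> \<bar>1 / dens (lab w t X z) - 1 / dens (label 0 0 z)\<bar>"
    proof (rule vorticity_gap[OF D(1) _ _ g(1) _ e])
      show "label 0 0 z \<in> {1/4..1}"
        using u \<rho>(2) label(1)[OF z, of 0 0] unfolding abs_less_iff atLeastAtMost_iff by argo
      show "1 / 2 \<le> \<bar>mode_Z X (label 0 0 z)\<bar>" using r0(2)[of X "label 0 0 z"] X u \<rho> by linarith
    qed (use D \<rho> in linarith)
  qed
qed

text \<open>The velocity of the shear is the label itself: the inverse of \<open>flux_label\<close>
  on \<open>[-1, 1]\<close>, with derivative \<open>1 / dens\<close> of it.\<close>

definition base_flow :: "real \<Rightarrow> real" where "base_flow z = label 0 0 z"

lemma base_flow_deriv: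
  "z \<in> {-1..1} \<Longrightarrow> (base_flow has_real_derivative 1 / dens (base_flow z)) (at z within {-1..1})"
  using label_dz[of 0 z 0] by (simp add: base_flow_def[abs_def])

lemma base_vorticity:
  assumes "z \<in> {-1..1}"
  shows "shear_vorticity base_flow z = 1 / dens (base_flow z)"
  unfolding shear_vorticity_def
  using vector_derivative_within_cbox[of "-1" 1 z base_flow "1 / dens (base_flow z)"] assms base_flow_deriv
  by (simp add: has_real_derivative_iff_has_vector_derivative)

lemma base_flow_ends: "base_flow (-1) = -1" "base_flow 1 = 1"
proof -
  have "5 / 32 * \<bar>label 0 0 z - z\<bar> \<le> \<bar>label_Z 0 0 (label 0 0 z) - label_Z 0 0 z\<bar>" if "z \<in> {-1..1}" for z
    using label_Z_lipschitz[of 0 z "label 0 0 z" 0] label2[OF that, of 0 0] that by auto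
  from this[of "-1"] this[of 1] show "base_flow (-1) = -1" "base_flow 1 = 1"
    using label(2)[of "-1" 0 0] label(2)[of 1 0 0] by (simp_all add: base_flow_def label_Z_ends)
qed

lemma base_flow_cont: "continuous_on {-1..1} base_flow"
  by (rule DERIV_continuous_on[OF base_flow_deriv])

lemma base_flow_euler:
  "\<exists>\<phi>. \<forall>T>0. hydrostatic_Euler T (\<lambda>t x z. shear_vorticity base_flow z) (\<lambda>t. \<phi>) (\<lambda>t x z. base_flow z) (\<lambda>t x z. 0)"
proof (intro exI allI impI)
  fix T :: real assume "T > 0"
  \<comment> \<open>A primitive of \<open>a * dens a\<close>; being even, it gives the stream
    function equal values at both walls.\<close>
  define \<Psi> where "\<Psi> a = 5 * a^6 / 16 + 15 * a^4 / 64 + 5 * a^2 / 32" for a :: real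
  define W where "W z = - (dens' (base_flow z) * (1 / dens (base_flow z))) / (dens (base_flow z) * dens (base_flow z))" for z
  have \<Psi>: "(\<Psi> has_real_derivative a * dens a) (at a)" for a
    unfolding \<Psi>_def[abs_def] dens_def
    by (auto intro!: derivative_eq_intros simp: field_simps power_numeral_reduce)
  have nz: "dens a \<noteq> 0" for a using dens_ge[of a] by auto
  have Wd: "((\<lambda>z. shear_vorticity base_flow z) has_real_derivative W z) (at z within {-1..1})" if z: "z \<in> {-1..1}" for z
  proof -
    have "((\<lambda>z. 1 / dens (base_flow z)) has_real_derivative W z) (at z within {-1..1})"
      using DERIV_divide[OF DERIV_const DERIV_chain2[OF dens_deriv base_flow_deriv[OF z]] nz, of 1] by (simp add: W_def)
    then show ?thesis
      by (rule has_field_derivative_transform_within[OF _ zero_less_one z]) (simp add: base_vorticity)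
  qed
  have "continuous_on {-1..1} W"
    unfolding W_def dens'_def by (intro continuous_intros base_flow_cont ballI) (auto simp: nz)
  then have Wc: "continuous_on ({0..T} \<times> UNIV \<times> {-1..1}) (\<lambda>(t, x, z). W z)"
    unfolding split_beta by (rule continuous_on_compose2[of _ _ _ "\<lambda>p. snd (snd p)"]) (auto intro!: continuous_intros)
  show "hydrostatic_Euler T (\<lambda>t x z. shear_vorticity base_flow z) (\<lambda>t x z. \<Psi> (base_flow z) - \<Psi> 1) (\<lambda>t x z. base_flow z) (\<lambda>t x z. 0)"
    unfolding hydrostatic_Euler_def
  proof (intro conjI ballI allI)
    fix z :: real assume z: "z \<in> {-1..1}"
    show "((\<lambda>\<zeta>. \<Psi> (base_flow \<zeta>) - \<Psi> 1) has_real_derivative base_flow z) (at z within {-1..1})"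
      using DERIV_diff[OF DERIV_chain2[OF \<Psi> base_flow_deriv[OF z]] DERIV_const] nz by simp
    show "(base_flow has_real_derivative shear_vorticity base_flow z) (at z within {-1..1})"
      using base_flow_deriv[OF z] by (simp add: base_vorticity[OF z])
  next
    show "\<exists>\<omega>\<^sub>t \<omega>\<^sub>x \<omega>\<^sub>z.
        continuous_on ({0..T} \<times> UNIV \<times> {-1..1}) (\<lambda>(t, x, z). \<omega>\<^sub>t t x z) \<and>
        continuous_on ({0..T} \<times> UNIV \<times> {-1..1}) (\<lambda>(t, x, z). \<omega>\<^sub>x t x z) \<and>
        continuous_on ({0..T} \<times> UNIV \<times> {-1..1}) (\<lambda>(t, x, z). \<omega>\<^sub>z t x z) \<and>
        (\<forall>t\<in>{0..T}. \<forall>x. \<forall>z\<in>{-1..1}.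
           ((\<lambda>\<theta>. shear_vorticity base_flow z) has_real_derivative \<omega>\<^sub>t t x z) (at t within {0..T}) \<and>
           ((\<lambda>\<xi>. shear_vorticity base_flow z) has_real_derivative \<omega>\<^sub>x t x z) (at x) \<and>
           ((\<lambda>\<zeta>. shear_vorticity base_flow \<zeta>) has_real_derivative \<omega>\<^sub>z t x z) (at z within {-1..1}) \<and>
           \<omega>\<^sub>t t x z + base_flow z * \<omega>\<^sub>x t x z + 0 * \<omega>\<^sub>z t x z = 0)"
      by (rule exI[of _ "\<lambda>t x z. 0"], rule exI[of _ "\<lambda>t x z. 0"], rule exI[of _ "\<lambda>t x z. W z"])
        (use Wc Wd in \<open>auto intro!: continuous_intros simp: split_beta\<close>)
  qed (auto simp: base_flow_ends \<Psi>_def)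
qed

lemma stationary_base_flow: "stationary_shear_flow base_flow"
  unfolding stationary_shear_flow_def by (rule base_flow_euler)

lemma base_flow_solution: "T > 0 \<Longrightarrow> hydrostatic_Euler_solution T (\<lambda>t x z. shear_vorticity base_flow z)"
  unfolding hydrostatic_Euler_solution_def using base_flow_euler by blast

lemma zero_sobolev: "(\<lambda>p. 0) \<in> sobolev_space s"
proof (rule sobolev_norm_family(1)[of "\<lambda>i j p. 0"])
  show "channel_family (\<lambda>i j p. 0)" unfolding channel_family_def by (auto intro!: exI[of _ 0])
qed simp

lemma L2_norm_lower:
  fixes f :: "'a::euclidean_space \<Rightarrow> real"
  assumes A: "A \<in> sets borel" "emeasure lborel A < \<infinity>" and f: "continuous_on A f" "\<And>p. p \<in> A \<Longrightarrow> \<bar>f p\<bar> \<le> C"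
    and b: "cbox a b \<subseteq> A" "\<And>p. p \<in> cbox a b \<Longrightarrow> c \<le> \<bar>f p\<bar>" "0 \<le> c"
  shows "c * sqrt (measure lborel (cbox a b)) \<le> L2_norm_on A f"
proof -
  have i: "set_integrable lborel A (\<lambda>p. (f p)^2)"
    using L2_norm_bounded_continuous(1)[OF A f] by (simp add: square_integrable_on_def)
  have "(LINT p:cbox a b|lborel. c^2) \<le> (LINT p:A|lborel. (f p)^2)"
    unfolding set_lebesgue_integral_def
  proof (rule integral_mono)
    show "integrable lborel (\<lambda>p. indicat_real (cbox a b) p *\<^sub>R c^2)"
      using emeasure_lborel_cbox_finite[of a b] by (simp add: integrable_indicator_iff)
    show "integrable lborel (\<lambda>p. indicat_real A p *\<^sub>R (f p)^2)" using i by (simp add: set_integrable_def)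
    have "c^2 \<le> (f p)^2" if "p \<in> cbox a b" for p
      using power_mono[OF b(2)[OF that] b(3), of 2] by simp
    then show "indicat_real (cbox a b) p *\<^sub>R c^2 \<le> indicat_real A p *\<^sub>R (f p)^2" for p
      using b(1) by (auto simp: indicator_def)
  qed
  then have "sqrt (measure lborel (cbox a b) * c^2) \<le> L2_norm_on A f"
    unfolding L2_norm_on_def by (intro real_sqrt_le_mono) (simp add: set_lebesgue_integral_def)
  then show ?thesis using b(3) by (simp add: real_sqrt_mult mult.commute)
qed

lemma torus_ball_borel: "torus_ball a r \<in> sets borel"
proof -
  have "torus_ball a r = {0..<1} \<inter> (\<Union>n::int. ball (a + of_int n) r)" by (auto simp: torus_ball_def)
  also have "\<dots> \<in> sets borel" by (rule sets.Int) (auto intro!: borel_open)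
  finally show ?thesis .
qed

lemma Omega_box_borel:
  fixes \<tau> :: real
  shows "{0..\<tau>} \<times> Omega_box x0 z0 r \<in> sets borel"
proof -
  have p: "A \<times> B \<in> sets borel" if "A \<in> sets borel" "B \<in> sets borel" for A :: "'x::second_countable_topology set" and B :: "'y::second_countable_topology set"
    using pair_measureI[OF that] unfolding borel_prod .
  show ?thesis unfolding Omega_box_def by (intro p torus_ball_borel) auto
qed

lemma Omega_box_finite:
  fixes \<tau> :: real
  shows "emeasure lborel ({0..\<tau>} \<times> Omega_box x0 z0 r) < \<infinity>"
proof -
  have "{0..\<tau>} \<times> Omega_box x0 z0 r \<subseteq> cbox (0, 0, -1) (\<tau>, 1, 1)" by (auto simp: Omega_box_def torus_ball_def cbox_interval)
  then have "emeasure lborel ({0..\<tau>} \<times> Omega_box x0 z0 r) \<le> emeasure lborel (cbox (0, 0, -1) (\<tau>, 1, 1) :: (real \<times> real \<times> real) set)"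
    by (intro emeasure_mono) auto
  also have "\<dots> < \<infinity>" by (rule emeasure_lborel_cbox_finite)
  finally show ?thesis .
qed

text \<open>The smallness conditions say that the series converges up to \<open>T\<close>, that the
  leading term stays in the range of \<open>flow_gap\<close>, and that it dominates the quadratic
  remainder at all times. The last condition on \<open>h\<close> keeps the phase
  \<open>2 * pi * N * x\<close> near 0 on the box.\<close>

lemma unstable_solution:
  assumes \<beta>: "0 < \<beta>" "\<beta> < 1" and \<sigma>: "1 / 2 < \<sigma>"
  shows "\<exists>C>0. \<exists>\<rho>>0. \<exists>B>0. \<forall>d T N h R. 0 < d \<longrightarrow> d \<le> 1 / 200 \<longrightarrow> N \<ge> 1 \<longrightarrow> 0 < T \<longrightarrow> ok d B \<sigma> T \<longrightarrow>
     d * exp (T / 2) \<le> \<rho> \<longrightarrow> (\<forall>t\<in>{0..T}. 17 * (d * B * exp (\<sigma> * t))^2 \<le> \<rho> * (d * exp (t / 2))) \<longrightarrow>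
     0 < h \<longrightarrow> h < R \<longrightarrow> h \<le> 1 / 2 \<longrightarrow> 2 * pi * real N * h < \<rho> \<longrightarrow>
     (\<exists>\<omega>. hydrostatic_Euler_solution (T / (2 * pi * real N)) \<omega> \<and>
        (\<lambda>(x, z). \<omega> 0 x z - shear_vorticity base_flow z) \<in> sobolev_space s \<and>
        0 < sobolev_norm s (\<lambda>(x, z). \<omega> 0 x z - shear_vorticity base_flow z) \<and>
        sobolev_norm s (\<lambda>(x, z). \<omega> 0 x z - shear_vorticity base_flow z) \<le> C * d * real N ^ s \<and>
        d * exp ((1 - \<beta>) * T / 2) / 1000 * sqrt (\<beta> * (T / (2 * pi * real N)) * (h * (2 * h))) \<le>
          L2_norm_on ({0..T / (2 * pi * real N)} \<times> Omega_box 0 z_star R) (\<lambda>(t, x, z). \<omega> t x z - shear_vorticity base_flow z))"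
proof -
  obtain C where C: "C > 0" "\<And>d N f. 0 \<le> d \<Longrightarrow> d \<le> 1 / 200 \<Longrightarrow> N \<ge> 1 \<Longrightarrow>
     (\<forall>x. \<forall>z\<in>{-1<..<1}. f (x, z) = 1 / dens (label d (2 * pi * real N * x) z) - 1 / dens (label 0 0 z)) \<Longrightarrow>
     f \<in> sobolev_space s \<and> sobolev_norm s f \<le> C * d * real N ^ s \<and> L2_norm_on channel f \<le> sobolev_norm s f"
    using initial_sobolev[of s] by blast
  obtain \<rho> where \<rho>: "\<rho> > 0" "\<And>T w wt wx wa \<kappa> t X z D r. label_flow T w wt wx wa \<kappa> \<Longrightarrow> t \<in> {0..T} \<Longrightarrow> z \<in> {-1..1} \<Longrightarrow>
     \<bar>X\<bar> < \<rho> \<Longrightarrow> \<bar>z - z_star\<bar> < \<rho> \<Longrightarrow> 0 \<le> D \<Longrightarrow> D \<le> \<rho> \<Longrightarrow> (\<forall>a\<in>{-2..2}. \<bar>w t X a - a - D * mode X a\<bar> \<le> r) \<Longrightarrow> r \<le> \<rho> * D \<Longrightarrow>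
     D / 1000 \<le> \<bar>1 / dens (lab w t X z) - 1 / dens (label 0 0 z)\<bar>"
    using flow_gap by blast
  obtain B where B: "B > 0" "\<And>d T. ok d B \<sigma> T \<Longrightarrow> (\<exists>w wt wx wa \<kappa>. label_flow T w wt wx wa \<kappa> \<and>
     (\<forall>t\<in>{0..T}. \<forall>x. \<forall>a\<in>{-2..2}. \<bar>w t x a - a - d * exp (t / 2) * (2 * Re (cis x * (of_real a / (of_real a - \<i> / 2))))\<bar> \<le> 17 * (d * B * exp (\<sigma> * t))^2) \<and>
     (\<forall>x. \<forall>a\<in>{-2..2}. w 0 x a = a + d * (2 * Re (cis x * (of_real a / (of_real a - \<i> / 2))))))"
    using label_flow_exists[OF \<sigma>] by blast
  show ?thesis
  proof (rule exI[of _ C], rule conjI[OF C(1)], rule exI[of _ \<rho>], rule conjI[OF \<rho>(1)], rule exI[of _ B], rule conjI[OF B(1)], intro allI impI)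
    fix d T :: real and N :: nat and h R :: real
    assume d: "0 < d" "d \<le> 1 / 200" and N: "N \<ge> 1" and T: "0 < T" and o: "ok d B \<sigma> T" and D: "d * exp (T / 2) \<le> \<rho>"
      and r: "\<forall>t\<in>{0..T}. 17 * (d * B * exp (\<sigma> * t))^2 \<le> \<rho> * (d * exp (t / 2))"
      and h: "0 < h" "h < R" "h \<le> 1 / 2" "2 * pi * real N * h < \<rho>"
    obtain w wt wx wa \<kappa> where lf: "label_flow T w wt wx wa \<kappa>"
      and w: "\<And>t x a. t \<in> {0..T} \<Longrightarrow> a \<in> {-2..2} \<Longrightarrow> \<bar>w t x a - a - d * exp (t / 2) * mode x a\<bar> \<le> 17 * (d * B * exp (\<sigma> * t))^2"
      and w0: "\<And>x a. a \<in> {-2..2} \<Longrightarrow> w 0 x a = a + d * mode x a"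
      using B(2)[OF o] unfolding Re_mode by blast
    define M where "M = 2 * pi * real N"
    define \<tau> where "\<tau> = T / M"
    define \<omega> where "\<omega> t x z = 1 / dens (lab w (M * t) (M * x) z)" for t x z
    define f where "f = (\<lambda>(t, x, z). \<omega> t x z - shear_vorticity base_flow z)"
    have M: "M \<ge> 1" using mult_mono[of 1 "2 * pi" 1 "real N"] N pi_ge_two by (simp add: M_def)
    have \<tau>: "0 < \<tau>" "M * \<tau> = T" using T M by (simp_all add: \<tau>_def)
    have tM: "M * t \<in> {0..T}" if "t \<in> {0..\<tau>}" for t
      using that M mult_left_mono[of t \<tau> M] \<tau>(2) by auto
    have euler: "hydrostatic_Euler_solution \<tau> \<omega>"
      using flow_euler[OF lf T N] unfolding \<tau>_def \<omega>_def[abs_def] M_def .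
    have f': "f (t, x, z) = 1 / dens (lab w (M * t) (M * x) z) - 1 / dens (label 0 0 z)" if "z \<in> {-1..1}" for t x z
      using base_vorticity[OF that] by (simp add: f_def \<omega>_def base_flow_def)
    have gap: "d * exp (M * t / 2) / 1000 \<le> \<bar>f (t, x, z)\<bar>" if t: "t \<in> {0..\<tau>}" and x: "x \<in> {0..h}" and z: "z \<in> {z_star - h..z_star + h}" for t x z
    proof -
      have z1: "z \<in> {-1..1}" using z h(3) by (auto simp: z_star_def flux_label_def power_numeral_reduce)
      have "\<bar>M * x\<bar> \<le> M * h" using x M by (simp add: abs_mult mult_left_mono)
      then have x1: "\<bar>M * x\<bar> < \<rho>" using h(4) by (simp add: M_def)
      have "\<bar>z - z_star\<bar> \<le> 1 * h" using z by (auto simp: abs_le_iff)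
      also have "\<dots> \<le> M * h" using M h by (intro mult_right_mono) auto
      finally have z2: "\<bar>z - z_star\<bar> < \<rho>" using h(4) by (simp add: M_def)
      have "d * exp (M * t / 2) \<le> d * exp (T / 2)" using tM[OF t] d by simp
      then have D': "d * exp (M * t / 2) \<le> \<rho>" using D by linarith
      show ?thesis unfolding f'[OF z1]
        by (rule \<rho>(2)[OF lf tM[OF t] z1 x1 z2 _ D', where r = "17 * (d * B * exp (\<sigma> * (M * t)))^2"])
          (use d w[OF tM[OF t]] r tM[OF t] in auto)
    qed
    have fb: "\<bar>f (t, x, z)\<bar> \<le> 4" if "z \<in> {-1..1}" for t x z
    proof -
      have a: "0 \<le> 1 / dens a" "1 / dens a \<le> 4" for a using dens_ge[of a] by (auto simp: field_simps)
      have "\<bar>p - q\<bar> \<le> 4" if "0 \<le> p" "p \<le> 4" "0 \<le> q" "q \<le> 4" for p q :: real using that by linarith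
      from this[OF a a] show ?thesis unfolding f'[OF that] .
    qed
    have fc: "continuous_on ({0..\<tau>} \<times> UNIV \<times> {-1..1}) f"
    proof -
      have "continuous_on ({0..\<tau>} \<times> UNIV \<times> {-1..1}) (\<lambda>p. (M * fst p, M * fst (snd p), snd (snd p)))" by (intro continuous_intros)
      moreover have "(\<lambda>p. (M * fst p, M * fst (snd p), snd (snd p))) ` ({0..\<tau>} \<times> UNIV \<times> {-1..1}) \<subseteq> {0..T} \<times> UNIV \<times> {-1..1}"
        using tM by auto
      ultimately have l: "continuous_on ({0..\<tau>} \<times> UNIV \<times> {-1..1}) (\<lambda>p. lab w (M * fst p) (M * fst (snd p)) (snd (snd p)))"
        using continuous_on_compose2[OF lab_cont[OF lf], of "{0..\<tau>} \<times> UNIV \<times> {-1..1}" "\<lambda>p. (M * fst p, M * fst (snd p), snd (snd p))"] by simp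
      have "continuous_on ({0..\<tau>} \<times> (UNIV :: real set) \<times> {-1..1}) (\<lambda>p. snd (snd p))" by (intro continuous_intros)
      then have u: "continuous_on ({0..\<tau>} \<times> (UNIV :: real set) \<times> {-1..1}) (\<lambda>p. base_flow (snd (snd p)))"
        by (rule continuous_on_compose2[OF base_flow_cont]) auto
      have nz: "dens a \<noteq> 0" for a using dens_ge[of a] by auto
      have "continuous_on ({0..\<tau>} \<times> UNIV \<times> {-1..1}) (\<lambda>p. 1 / dens (lab w (M * fst p) (M * fst (snd p)) (snd (snd p))) - 1 / dens (base_flow (snd (snd p))))"
        by (intro continuous_intros l u ballI nz)
      then show ?thesis by (rule continuous_on_eq) (auto simp: f' base_flow_def)
    qed
    define f0 where "f0 = (\<lambda>(x, z). \<omega> 0 x z - shear_vorticity base_flow z)"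
    have f0: "f0 (x, z) = f (0, x, z)" for x z by (simp add: f0_def f_def)
    have sob: "f0 \<in> sobolev_space s \<and> sobolev_norm s f0 \<le> C * d * real N ^ s \<and> L2_norm_on channel f0 \<le> sobolev_norm s f0"
    proof (rule C(2))
      show "\<forall>x. \<forall>z\<in>{-1<..<1}. f0 (x, z) = 1 / dens (label d (2 * pi * real N * x) z) - 1 / dens (label 0 0 z)"
        using f' lab_initial[OF lf w0] by (simp add: f0 M_def)
    qed (use d N in auto)
    have zs: "-1 < z_star - h" "z_star + h < 1" using h(3) by (auto simp: z_star_def flux_label_def power_numeral_reduce)
    \<comment> \<open>This gives positivity of the data norm, which matters because a quotient with
      denominator 0 would be 0.\<close>
    have "d / 1000 * sqrt (measure lborel (cbox (0, z_star - h) (h, z_star + h))) \<le> L2_norm_on channel f0"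
    proof (rule L2_norm_lower[OF channel_sets emeasure_channel, of _ 4])
      have "continuous_on channel (\<lambda>p. f (0, p))"
        by (rule continuous_on_compose2[OF fc]) (use \<tau>(1) in \<open>auto intro!: continuous_intros simp: channel_def\<close>)
      then show "continuous_on channel f0" by (rule continuous_on_eq) (auto simp: f0)
      show "\<bar>f0 p\<bar> \<le> 4" if "p \<in> channel" for p using that fb by (cases p) (auto simp: f0 channel_def)
      show "cbox (0, z_star - h) (h, z_star + h) \<subseteq> channel" using zs h by (auto simp: channel_def cbox_interval)
      show "d / 1000 \<le> \<bar>f0 p\<bar>" if "p \<in> cbox (0, z_star - h) (h, z_star + h)" for p
        using that gap[of 0 "fst p" "snd p"] \<tau>(1) by (cases p) (auto simp: f0 cbox_interval)
    qed (use d in simp)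
    moreover have "0 < d / 1000 * sqrt (measure lborel (cbox (0, z_star - h) (h, z_star + h)))"
      using d h by (simp add: content_Pair)
    ultimately have pos: "0 < sobolev_norm s f0" using sob by linarith
    define A where "A = {0..\<tau>} \<times> Omega_box 0 z_star R"
    have Asub: "A \<subseteq> {0..\<tau>} \<times> UNIV \<times> {-1..1}" by (auto simp: A_def Omega_box_def)
    \<comment> \<open>The box uses the last fraction \<beta> of the time interval, where the mode
      has grown at least to \<open>d * exp ((1 - \<beta>) * T / 2)\<close>, and only
      \<open>x \<ge> 0\<close>, the half of the torus ball next to 0 in the fundamental
      domain.\<close>
    have "d * exp ((1 - \<beta>) * T / 2) / 1000 * sqrt (measure lborel (cbox ((1 - \<beta>) * \<tau>, 0, z_star - h) (\<tau>, h, z_star + h))) \<le> L2_norm_on A f"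
      unfolding A_def
    proof (rule L2_norm_lower[OF Omega_box_borel Omega_box_finite, of _ _ _ _ _ 4], unfold A_def[symmetric])
      show "continuous_on A f" by (rule continuous_on_subset[OF fc Asub])
      show "\<bar>f p\<bar> \<le> 4" if "p \<in> A" for p using that Asub fb by (cases p) auto
      have \<tau>': "0 \<le> (1 - \<beta>) * \<tau>" using \<beta> \<tau> by simp
      show "cbox ((1 - \<beta>) * \<tau>, 0, z_star - h) (\<tau>, h, z_star + h) \<subseteq> A"
      proof
        fix p assume p: "p \<in> cbox ((1 - \<beta>) * \<tau>, 0, z_star - h) (\<tau>, h, z_star + h)"
        obtain t x z where pe: "p = (t, x, z)" by (cases p) auto
        have t: "(1 - \<beta>) * \<tau> \<le> t" "t \<le> \<tau>" and x: "0 \<le> x" "x \<le> h" and z: "z_star - h \<le> z" "z \<le> z_star + h"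
          using p by (auto simp: pe cbox_interval)
        have "x \<in> torus_ball 0 R" unfolding torus_ball_def using x h by (auto intro!: exI[of _ "0 :: int"] simp: dist_real_def)
        moreover have "z \<in> ball z_star R \<inter> {-1<..<1}" using z zs h by (auto simp: dist_real_def abs_less_iff)
        ultimately show "p \<in> A" using t \<tau>' by (auto simp: pe A_def Omega_box_def)
      qed
      show "d * exp ((1 - \<beta>) * T / 2) / 1000 \<le> \<bar>f p\<bar>" if p: "p \<in> cbox ((1 - \<beta>) * \<tau>, 0, z_star - h) (\<tau>, h, z_star + h)" for p
      proof -
        obtain t x z where pe: "p = (t, x, z)" by (cases p) auto
        have t: "(1 - \<beta>) * \<tau> \<le> t" "t \<le> \<tau>" and x: "x \<in> {0..h}" and z: "z \<in> {z_star - h..z_star + h}"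
          using p by (auto simp: pe cbox_interval)
        have "(1 - \<beta>) * T = M * ((1 - \<beta>) * \<tau>)" using \<tau>(2) by (simp add: algebra_simps)
        also have "\<dots> \<le> M * t" using t M by (intro mult_left_mono) auto
        finally have "d * exp ((1 - \<beta>) * T / 2) / 1000 \<le> d * exp (M * t / 2) / 1000" using d by simp
        also have "\<dots> \<le> \<bar>f p\<bar>" unfolding pe by (rule gap[OF _ x z]) (use t \<tau>' in auto)
        finally show ?thesis .
      qed
    qed (use d in simp)
    moreover have "measure lborel (cbox ((1 - \<beta>) * \<tau>, 0, z_star - h) (\<tau>, h, z_star + h)) = \<beta> * \<tau> * (h * (2 * h))"
    proof -
      have "(1 - \<beta>) * \<tau> \<le> \<tau>" using \<beta> \<tau> by (simp add: algebra_simps)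
      then show ?thesis using h by (simp add: content_Pair) (simp add: algebra_simps)
    qed
    ultimately have "d * exp ((1 - \<beta>) * T / 2) / 1000 * sqrt (\<beta> * \<tau> * (h * (2 * h))) \<le> L2_norm_on A f" by simp
    with euler sob pos show "\<exists>\<omega>. hydrostatic_Euler_solution (T / (2 * pi * real N)) \<omega> \<and>
        (\<lambda>(x, z). \<omega> 0 x z - shear_vorticity base_flow z) \<in> sobolev_space s \<and>
        0 < sobolev_norm s (\<lambda>(x, z). \<omega> 0 x z - shear_vorticity base_flow z) \<and>
        sobolev_norm s (\<lambda>(x, z). \<omega> 0 x z - shear_vorticity base_flow z) \<le> C * d * real N ^ s \<and>
        d * exp ((1 - \<beta>) * T / 2) / 1000 * sqrt (\<beta> * (T / (2 * pi * real N)) * (h * (2 * h))) \<le>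
          L2_norm_on ({0..T / (2 * pi * real N)} \<times> Omega_box 0 z_star R) (\<lambda>(t, x, z). \<omega> t x z - shear_vorticity base_flow z)"
      by (intro exI[of _ \<omega>]) (simp add: f0_def f_def A_def \<tau>_def M_def)
  qed
qed

section \<open>Choice of the parameters\<close>

lemma powr_at_right_0: "0 < q \<Longrightarrow> ((\<lambda>\<epsilon>::real. \<epsilon> powr q) \<longlongrightarrow> 0) (at_right 0)"
  by (rule tendsto_zero_powrI[OF tendsto_ident_at tendsto_const]) (auto simp: eventually_at_filter)

lemma powr_small: "0 < q \<Longrightarrow> 0 < c \<Longrightarrow> \<forall>\<^sub>F \<epsilon>::real in at_right 0. K * \<epsilon> powr q \<le> c"
proof -
  assume "0 < q" "0 < c"
  then have "((\<lambda>\<epsilon>::real. K * \<epsilon> powr q) \<longlongrightarrow> K * 0) (at_right 0)" by (intro tendsto_intros powr_at_right_0)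
  then have "\<forall>\<^sub>F \<epsilon>::real in at_right 0. K * \<epsilon> powr q < c" using \<open>0 < c\<close> by (intro order_tendstoD(2)[where y = "K * 0"]) auto
  then show ?thesis by eventually_elim simp
qed

text \<open>The box contributes \<open>\<epsilon> ^ (k + 1)\<close>, and the length of the time
  interval a half power of \<epsilon>, rounded up to a full one.\<close>

lemma box_size_lower:
  fixes n :: real
  assumes e: "0 < \<epsilon>" "\<epsilon> < 1" and \<beta>: "0 < \<beta>" and \<kappa>: "0 < \<kappa>" and T: "1 \<le> T" and n: "1 \<le> n" "n \<le> 2 / \<epsilon>"
  shows "sqrt (\<beta> / 8) * \<kappa> * \<epsilon>^(k + 2) \<le> sqrt (\<beta> * (T / (2 * pi * n)) * (\<kappa> * \<epsilon>^(k + 1) * (2 * (\<kappa> * \<epsilon>^(k + 1)))))"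
proof (rule real_le_rsqrt)
  have "2 * pi * n \<le> 8 * (2 / \<epsilon>)" by (rule mult_mono[OF _ n(2)]) (use pi_less_4 n in auto)
  then have "1 / (8 * (2 / \<epsilon>)) \<le> T / (2 * pi * n)" using T n by (intro frac_le) auto
  then have t: "\<epsilon> / 16 \<le> T / (2 * pi * n)" by simp
  have "(sqrt (\<beta> / 8) * \<kappa> * \<epsilon>^(k + 2))^2 = (sqrt (\<beta> / 8))^2 * \<kappa>^2 * (\<epsilon>^(k + 1))^2 * \<epsilon>^2"
    by (simp add: power2_eq_square mult_ac)
  also have "\<dots> = \<beta> / 8 * \<kappa>^2 * (\<epsilon>^(k + 1))^2 * \<epsilon>^2" using \<beta> by simp
  also have "\<dots> \<le> \<beta> / 8 * \<kappa>^2 * (\<epsilon>^(k + 1))^2 * \<epsilon>"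
  proof (rule mult_left_mono)
    show "\<epsilon>^2 \<le> \<epsilon>" using e by (simp add: power2_eq_square mult_left_le)
  qed (use \<beta> in simp)
  also have "\<dots> = \<beta> * (\<epsilon> / 16) * (\<kappa> * \<epsilon>^(k + 1) * (2 * (\<kappa> * \<epsilon>^(k + 1))))" by (simp add: power2_eq_square mult_ac)
  also have "\<dots> \<le> \<beta> * (T / (2 * pi * n)) * (\<kappa> * \<epsilon>^(k + 1) * (2 * (\<kappa> * \<epsilon>^(k + 1))))"
  proof (rule mult_right_mono)
    show "\<beta> * (\<epsilon> / 16) \<le> \<beta> * (T / (2 * pi * n))" by (rule mult_left_mono[OF t]) (use \<beta> in simp)
  qed (use \<kappa> e in simp)
  finally show "(sqrt (\<beta> / 8) * \<kappa> * \<epsilon>^(k + 2))^2 \<le> \<beta> * (T / (2 * pi * n)) * (\<kappa> * \<epsilon>^(k + 1) * (2 * (\<kappa> * \<epsilon>^(k + 1))))" .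
qed

text \<open>This is \<open>1 - (1 - \<beta>)\<^sup>3 \<le> 3 * \<beta>\<close>, multiplied by
  \<open>m\<close>.\<close>

lemma growth_exponent:
  fixes \<beta> m :: real
  assumes "0 < \<beta>" "\<beta> < 1" "0 < m"
  shows "m - (1 - \<beta>) / 2 * (2 * (1 - \<beta>)^2 * m) \<le> m * (3 * \<beta>)"
proof -
  have "m - (1 - \<beta>) / 2 * (2 * (1 - \<beta>)^2 * m) = m * (3 * \<beta> - \<beta>^2 * (3 - \<beta>))"
    by (simp add: power2_eq_square algebra_simps add_divide_distrib diff_divide_distrib)
  also have "\<dots> \<le> m * (3 * \<beta>)" using assms by (intro mult_left_mono) auto
  finally show ?thesis .
qed

lemma data_size_powr:
  fixes \<epsilon> :: real
  assumes e: "0 < \<epsilon>" and C: "0 < C" and n: "0 < n" "n \<le> C * \<epsilon> powr m * (2 / \<epsilon>)^s" and \<alpha>: "0 < \<alpha>"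
  shows "n powr \<alpha> \<le> (C * 2^s) powr \<alpha> * \<epsilon> powr ((m - real s) * \<alpha>)"
proof -
  have eq: "C * \<epsilon> powr m * (2 / \<epsilon>)^s = (C * 2^s) * \<epsilon> powr (m - real s)"
    using e by (simp add: power_divide powr_diff powr_realpow)
  have "n \<le> (C * 2^s) * \<epsilon> powr (m - real s)" using n(2) unfolding eq .
  then have "n powr \<alpha> \<le> ((C * 2^s) * \<epsilon> powr (m - real s)) powr \<alpha>"
    using \<alpha> n(1) by (intro powr_mono2) auto
  also have "\<dots> = (C * 2^s) powr \<alpha> * \<epsilon> powr ((m - real s) * \<alpha>)"
    using C e powr_mult[of "C * 2^s" "\<epsilon> powr (m - real s)" \<alpha>] by (simp add: powr_powr)
  finally show ?thesis .
qed

lemma quotient_powr: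
  fixes \<epsilon> :: real
  assumes e: "0 < \<epsilon>" and x: "x + y - w = -1"
  shows "a / b * inverse \<epsilon> = a * (\<epsilon> powr x * \<epsilon> powr y) / (b * \<epsilon> powr w)"
proof -
  have "inverse \<epsilon> = \<epsilon> powr (x + y - w)" unfolding x using e by (simp add: powr_minus)
  then have i: "inverse \<epsilon> = \<epsilon> powr x * \<epsilon> powr y / \<epsilon> powr w" by (simp only: powr_diff powr_add)
  show ?thesis unfolding i by (simp only: times_divide_times_eq)
qed

text \<open>The exponents are matched so that the quotient is at least a constant times
  \<open>1 / \<epsilon>\<close>; for this the exponent \<open>m\<close> of the amplitude is adapted
  to \<open>k\<close>, \<open>s\<close> and \<alpha>.\<close>

lemma unstable_family:
  fixes s k :: nat and \<alpha> :: real
  assumes \<alpha>: "0 < \<alpha>" "\<alpha> \<le> 1"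
  shows "\<exists>(\<omega> :: real \<Rightarrow> real \<Rightarrow> real \<Rightarrow> real \<Rightarrow> real) (\<tau> :: real \<Rightarrow> real).
     (\<forall>\<epsilon>>0. 0 < \<tau> \<epsilon> \<and> hydrostatic_Euler_solution (\<tau> \<epsilon>) (\<omega> \<epsilon>) \<and>
        (\<lambda>(x, z). \<omega> \<epsilon> 0 x z - shear_vorticity base_flow z) \<in> sobolev_space s) \<and>
     \<tau> \<in> O[at_right 0](\<lambda>\<epsilon>. \<epsilon> * \<bar>ln \<epsilon>\<bar>) \<and>
     filterlim
       (\<lambda>\<epsilon>. L2_norm_on ({0..\<tau> \<epsilon>} \<times> Omega_box 0 z_star (\<epsilon> ^ k)) (\<lambda>(t, x, z). \<omega> \<epsilon> t x z - shear_vorticity base_flow z)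
          / (sobolev_norm s (\<lambda>(x, z). \<omega> \<epsilon> 0 x z - shear_vorticity base_flow z)) powr \<alpha>)
       at_top (at_right 0)"
proof -
  \<comment> \<open>The growth leaves at most the exponent \<open>3 * \<beta> * m\<close> by
    \<open>growth_exponent\<close>; with this \<beta> it is \<open>m * \<alpha> / 2\<close>, half of
    the \<open>m * \<alpha>\<close> of the data.\<close>
  define \<beta> where "\<beta> = \<alpha> / 6"
  \<comment> \<open>Slightly above 1 / 2, and such that
    \<open>\<sigma> * \<nu> = (1 - \<beta>) * m\<close> below.\<close>
  define \<sigma> where "\<sigma> = 1 / (2 * (1 - \<beta>))"
  have \<beta>: "0 < \<beta>" "\<beta> < 1" using \<alpha> by (auto simp: \<beta>_def)
  have \<sigma>: "1 / 2 < \<sigma>" using \<beta> by (simp add: \<sigma>_def field_simps)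
  obtain C \<rho> B where C: "C > 0" and \<rho>: "\<rho> > 0" and B: "B > 0"
    and sol: "\<And>d T N h R. 0 < d \<Longrightarrow> d \<le> 1 / 200 \<Longrightarrow> N \<ge> 1 \<Longrightarrow> 0 < T \<Longrightarrow> ok d B \<sigma> T \<Longrightarrow>
     d * exp (T / 2) \<le> \<rho> \<Longrightarrow> (\<forall>t\<in>{0..T}. 17 * (d * B * exp (\<sigma> * t))^2 \<le> \<rho> * (d * exp (t / 2))) \<Longrightarrow>
     0 < h \<Longrightarrow> h < R \<Longrightarrow> h \<le> 1 / 2 \<Longrightarrow> 2 * pi * real N * h < \<rho> \<Longrightarrow>
     (\<exists>\<omega>. hydrostatic_Euler_solution (T / (2 * pi * real N)) \<omega> \<and>
        (\<lambda>(x, z). \<omega> 0 x z - shear_vorticity base_flow z) \<in> sobolev_space s \<and>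
        0 < sobolev_norm s (\<lambda>(x, z). \<omega> 0 x z - shear_vorticity base_flow z) \<and>
        sobolev_norm s (\<lambda>(x, z). \<omega> 0 x z - shear_vorticity base_flow z) \<le> C * d * real N ^ s \<and>
        d * exp ((1 - \<beta>) * T / 2) / 1000 * sqrt (\<beta> * (T / (2 * pi * real N)) * (h * (2 * h))) \<le>
          L2_norm_on ({0..T / (2 * pi * real N)} \<times> Omega_box 0 z_star R) (\<lambda>(t, x, z). \<omega> t x z - shear_vorticity base_flow z))"
    using unstable_solution[OF \<beta> \<sigma>, of s] by blast
  \<comment> \<open>Solves \<open>m * \<alpha> / 2 + (k + 2) - (m - s) * \<alpha> = - 1\<close>, the
    balance of the exponents in the quotient.\<close>
  define m where "m = 2 * (real k + 3 + real s * \<alpha>) / \<alpha>"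
  have "0 < real k + 3 + real s * \<alpha>" using \<alpha> by (intro add_pos_nonneg add_nonneg_pos) auto
  then have m: "m > 0" "m * \<alpha> / 2 = real k + 3 + real s * \<alpha>" using \<alpha> by (simp_all add: m_def)
  \<comment> \<open>With the square of \<open>1 - \<beta>\<close> the final time makes
    \<open>d * exp (\<sigma> * T)\<close> equal to \<open>\<epsilon> powr (m * \<beta>)\<close>, and
    the ratio of the quadratic remainder to the leading term is of order
    \<open>\<epsilon> powr (m * \<beta>\<^sup>2)\<close>; both tend to 0.\<close>
  define \<nu> where "\<nu> = 2 * (1 - \<beta>)^2 * m"
  have \<nu>: "\<nu> > 0" using \<beta> m by (simp add: \<nu>_def)
  \<comment> \<open>With half-height \<open>\<kappa> * \<epsilon> ^ (k + 1)\<close> and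
    \<open>N \<le> 2 / \<epsilon>\<close> the phase on the box is at most
    \<open>16 * \<kappa>\<close>, which has to stay below \<rho>.\<close>
  define \<kappa> where "\<kappa> = min (1 / 2) (\<rho> / 20)"
  have \<kappa>: "0 < \<kappa>" "\<kappa> \<le> 1 / 2" "16 * \<kappa> < \<rho>" using \<rho> by (auto simp: \<kappa>_def)
  define d where "d \<epsilon> = \<epsilon> powr m" for \<epsilon> :: real
  define T where "T \<epsilon> = - \<nu> * ln \<epsilon>" for \<epsilon>
  define N where "N \<epsilon> = nat \<lceil>1 / \<epsilon>\<rceil>" for \<epsilon> :: real
  define h where "h \<epsilon> = \<kappa> * \<epsilon> ^ (k + 1)" for \<epsilon> :: real
  \<comment> \<open>The conditions that hold for all small \<epsilon>, since every exponent of
    \<epsilon> in them is positive.\<close>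
  define good where "good \<epsilon> \<longleftrightarrow> 0 < \<epsilon> \<and> \<epsilon> < 1 \<and> 1 \<le> T \<epsilon> \<and> d \<epsilon> \<le> 1 / 200 \<and> B * \<epsilon> powr (m * \<beta>) \<le> 1 / 64 \<and>
    1 * \<epsilon> powr (m - \<nu> / 2) \<le> \<rho> \<and> 17 * B^2 * \<epsilon> powr (m * \<beta>^2) \<le> \<rho>" for \<epsilon>
  have expT: "exp (q * T \<epsilon>) = \<epsilon> powr (- (q * \<nu>))" if "0 < \<epsilon>" for q \<epsilon>
    using that by (simp add: T_def powr_def)
  have "1 / (2 * b) * (2 * b^2 * m) = b * m" if "b \<noteq> 0" for b using that by (simp add: power2_eq_square)
  from this[of "1 - \<beta>"] have l\<sigma>: "\<sigma> * \<nu> = (1 - \<beta>) * m" using \<beta> by (simp add: \<sigma>_def \<nu>_def)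
  have e2: "m - \<nu> / 2 = m * (\<beta> * (2 - \<beta>))" by (simp add: \<nu>_def power2_eq_square algebra_simps add_divide_distrib diff_divide_distrib)
  have e3: "m - (2 * \<sigma> - 1 / 2) * \<nu> = m * \<beta>^2"
  proof -
    have "m - (2 * \<sigma> - 1 / 2) * \<nu> = m - 2 * (\<sigma> * \<nu>) + \<nu> / 2" by (simp add: algebra_simps)
    then show ?thesis unfolding l\<sigma> by (simp add: \<nu>_def power2_eq_square algebra_simps add_divide_distrib diff_divide_distrib)
  qed
  have good_ev: "\<forall>\<^sub>F \<epsilon> in at_right 0. good \<epsilon>"
  proof -
    have "\<forall>\<^sub>F \<epsilon> in at_right 0. 0 < (\<epsilon> :: real)" by (simp add: eventually_at_filter)
    moreover have lt: "\<forall>\<^sub>F \<epsilon> in at_right 0. \<epsilon> < c" if "0 < c" for c :: real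
      by (rule order_tendstoD(2)[OF tendsto_ident_at that])
    from lt[of 1] have "\<forall>\<^sub>F \<epsilon> in at_right 0. \<epsilon> < (1 :: real)" by simp
    moreover have "\<forall>\<^sub>F \<epsilon> in at_right 0. 1 \<le> T \<epsilon>"
      using lt[OF exp_gt_zero[of "- (1 / \<nu>)"]] \<open>\<forall>\<^sub>F \<epsilon> in at_right 0. 0 < (\<epsilon> :: real)\<close>
    proof eventually_elim
      case (elim \<epsilon>)
      then have "ln \<epsilon> < - (1 / \<nu>)" by (metis ln_exp ln_less_cancel_iff exp_gt_zero)
      then have "\<nu> * ln \<epsilon> < \<nu> * (- (1 / \<nu>))" using \<nu> by (intro mult_strict_left_mono)
      then show ?case using \<nu> by (simp add: T_def)
    qed
    moreover have "\<forall>\<^sub>F \<epsilon> in at_right 0. d \<epsilon> \<le> 1 / 200" using powr_small[OF m(1), of "1 / 200" 1] by (simp add: d_def)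
    moreover have "\<forall>\<^sub>F \<epsilon> in at_right 0. B * \<epsilon> powr (m * \<beta>) \<le> 1 / 64" using m \<beta> by (intro powr_small) auto
    moreover have "\<forall>\<^sub>F \<epsilon> in at_right 0. 1 * \<epsilon> powr (m - \<nu> / 2) \<le> \<rho>" unfolding e2 using m \<beta> \<rho> by (intro powr_small mult_pos_pos) auto
    moreover have "\<forall>\<^sub>F \<epsilon> in at_right 0. 17 * B^2 * \<epsilon> powr (m * \<beta>^2) \<le> \<rho>" using m \<beta> \<rho> by (intro powr_small mult_pos_pos) auto
    ultimately show ?thesis unfolding good_def by eventually_elim blast
  qed
  have N: "N \<epsilon> \<ge> 1" "1 / \<epsilon> \<le> real (N \<epsilon>)" "real (N \<epsilon>) \<le> 2 / \<epsilon>" if "0 < \<epsilon>" "\<epsilon> < 1" for \<epsilon>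
  proof -
    have e: "1 < 1 / \<epsilon>" using that by simp
    then have "real (N \<epsilon>) = of_int \<lceil>1 / \<epsilon>\<rceil>" unfolding N_def by (subst of_nat_nat) (auto simp: ceiling_le_iff le_of_int_ceiling intro: order_trans[of 0 1])
    then have r: "1 / \<epsilon> \<le> real (N \<epsilon>)" "real (N \<epsilon>) \<le> 1 / \<epsilon> + 1" using ceiling_correct[of "1 / \<epsilon>"] by linarith+
    then show "1 / \<epsilon> \<le> real (N \<epsilon>)" by simp
    have "2 / \<epsilon> = 1 / \<epsilon> + 1 / \<epsilon>" by simp
    then show "real (N \<epsilon>) \<le> 2 / \<epsilon>" using r(2) e by linarith
    show "N \<epsilon> \<ge> 1" using r(1) e by linarith
  qed
  define lower where "lower \<epsilon> = d \<epsilon> * exp ((1 - \<beta>) * T \<epsilon> / 2) / 1000 * sqrt (\<beta> * (T \<epsilon> / (2 * pi * real (N \<epsilon>))) * (h \<epsilon> * (2 * h \<epsilon>)))" for \<epsilon>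
  define Q where "Q \<epsilon> \<omega> \<longleftrightarrow> hydrostatic_Euler_solution (T \<epsilon> / (2 * pi * real (N \<epsilon>))) \<omega> \<and>
        (\<lambda>(x, z). \<omega> 0 x z - shear_vorticity base_flow z) \<in> sobolev_space s \<and>
        0 < sobolev_norm s (\<lambda>(x, z). \<omega> 0 x z - shear_vorticity base_flow z) \<and>
        sobolev_norm s (\<lambda>(x, z). \<omega> 0 x z - shear_vorticity base_flow z) \<le> C * d \<epsilon> * real (N \<epsilon>) ^ s \<and>
        lower \<epsilon> \<le> L2_norm_on ({0..T \<epsilon> / (2 * pi * real (N \<epsilon>))} \<times> Omega_box 0 z_star (\<epsilon> ^ k)) (\<lambda>(t, x, z). \<omega> t x z - shear_vorticity base_flow z)" for \<epsilon> and \<omega> :: "real \<Rightarrow> real \<Rightarrow> real \<Rightarrow> real"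
  have ex: "\<exists>\<omega>. Q \<epsilon> \<omega>"
    if g: "good \<epsilon>" for \<epsilon>
    unfolding Q_def lower_def
  proof (rule sol)
    have e: "0 < \<epsilon>" "\<epsilon> < 1" using g by (auto simp: good_def)
    show d0: "0 < d \<epsilon>" using e by (simp add: d_def)
    show "d \<epsilon> \<le> 1 / 200" "0 < T \<epsilon>" using g by (auto simp: good_def)
    show "1 \<le> N \<epsilon>" by (rule N(1)[OF e])
    have okB: "d \<epsilon> * B * exp (\<sigma> * T \<epsilon>) = B * \<epsilon> powr (m * \<beta>)"
      unfolding expT[OF e(1)] l\<sigma> d_def by (simp add: powr_add[symmetric] algebra_simps)
    show "ok (d \<epsilon>) B \<sigma> (T \<epsilon>)" unfolding ok_def okB using g d0 B \<sigma> by (auto simp: good_def)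
    have "d \<epsilon> * exp (T \<epsilon> / 2) = \<epsilon> powr (m - \<nu> / 2)"
      using expT[OF e(1), of "1 / 2"] by (simp add: d_def powr_add[symmetric])
    then show "d \<epsilon> * exp (T \<epsilon> / 2) \<le> \<rho>" using g by (simp add: good_def)
    show "\<forall>t\<in>{0..T \<epsilon>}. 17 * (d \<epsilon> * B * exp (\<sigma> * t))^2 \<le> \<rho> * (d \<epsilon> * exp (t / 2))"
    proof
      fix t assume t: "t \<in> {0..T \<epsilon>}"
      \<comment> \<open>The ratio of the quadratic remainder to the leading term grows with time, so
        its value at the final time decides.\<close>
      have "(2 * \<sigma> - 1 / 2) * t \<le> (2 * \<sigma> - 1 / 2) * T \<epsilon>" using t \<sigma> by (intro mult_left_mono) auto
      then have "17 * B^2 * d \<epsilon> * exp ((2 * \<sigma> - 1 / 2) * t) \<le> 17 * B^2 * d \<epsilon> * exp ((2 * \<sigma> - 1 / 2) * T \<epsilon>)"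
        using d0 by (intro mult_left_mono) auto
      also have "\<dots> = 17 * B^2 * \<epsilon> powr (m * \<beta>^2)"
        unfolding expT[OF e(1)] d_def e3[symmetric] by (simp add: powr_add[symmetric])
      also have "\<dots> \<le> \<rho>" using g by (simp add: good_def)
      finally have "17 * B^2 * d \<epsilon> * exp ((2 * \<sigma> - 1 / 2) * t) * (d \<epsilon> * exp (t / 2)) \<le> \<rho> * (d \<epsilon> * exp (t / 2))"
        using d0 by (intro mult_right_mono) auto
      moreover have "exp (\<sigma> * t)^2 = exp ((2 * \<sigma> - 1 / 2) * t) * exp (t / 2)"
        by (simp add: exp_add[symmetric] power2_eq_square algebra_simps)
      ultimately show "17 * (d \<epsilon> * B * exp (\<sigma> * t))^2 \<le> \<rho> * (d \<epsilon> * exp (t / 2))"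
        by (simp add: power_mult_distrib power2_eq_square mult_ac)
    qed
    show h0: "0 < h \<epsilon>" using \<kappa> e by (simp add: h_def)
    have p: "0 < \<epsilon>^k" "\<epsilon>^k \<le> 1" using e by (auto simp: power_le_one)
    have "\<kappa> * \<epsilon> < 1" using mult_strict_mono[of \<kappa> 1 \<epsilon> 1] \<kappa> e by simp
    then show "h \<epsilon> < \<epsilon> ^ k" using p(1) by (simp add: h_def)
    have "\<kappa> * \<epsilon>^(k + 1) \<le> 1 / 2 * 1" using \<kappa> e by (intro mult_mono power_le_one) auto
    then show "h \<epsilon> \<le> 1 / 2" by (simp add: h_def)
    have "real (N \<epsilon>) * h \<epsilon> \<le> 2 / \<epsilon> * h \<epsilon>" using N(3)[OF e] \<kappa> e by (intro mult_right_mono) (auto simp: h_def)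
    also have "\<dots> = 2 * \<kappa> * \<epsilon>^k" using e by (simp add: h_def)
    also have "\<dots> \<le> 2 * \<kappa> * 1" using p \<kappa> by (intro mult_left_mono) auto
    finally have nh: "real (N \<epsilon>) * h \<epsilon> \<le> 2 * \<kappa>" by simp
    have "2 * pi * (real (N \<epsilon>) * h \<epsilon>) \<le> 8 * (2 * \<kappa>)"
      by (rule mult_mono[OF _ nh]) (use pi_less_4 h0 in auto)
    then show "2 * pi * real (N \<epsilon>) * h \<epsilon> < \<rho>" using \<kappa>(3) by (simp only: mult.assoc)
  qed
  define \<omega>' where "\<omega>' \<epsilon> = (SOME \<omega>. Q \<epsilon> \<omega>)" for \<epsilon>
  have "Q \<epsilon> (\<omega>' \<epsilon>)" if "good \<epsilon>" for \<epsilon> unfolding \<omega>'_def using ex[OF that] by (rule someI_ex)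
  then have \<omega>': "\<And>\<epsilon>. good \<epsilon> \<Longrightarrow> hydrostatic_Euler_solution (T \<epsilon> / (2 * pi * real (N \<epsilon>))) (\<omega>' \<epsilon>)"
    "\<And>\<epsilon>. good \<epsilon> \<Longrightarrow> (\<lambda>(x, z). \<omega>' \<epsilon> 0 x z - shear_vorticity base_flow z) \<in> sobolev_space s"
    "\<And>\<epsilon>. good \<epsilon> \<Longrightarrow> 0 < sobolev_norm s (\<lambda>(x, z). \<omega>' \<epsilon> 0 x z - shear_vorticity base_flow z)"
    "\<And>\<epsilon>. good \<epsilon> \<Longrightarrow> sobolev_norm s (\<lambda>(x, z). \<omega>' \<epsilon> 0 x z - shear_vorticity base_flow z) \<le> C * d \<epsilon> * real (N \<epsilon>) ^ s"
    "\<And>\<epsilon>. good \<epsilon> \<Longrightarrow> lower \<epsilon> \<le> L2_norm_on ({0..T \<epsilon> / (2 * pi * real (N \<epsilon>))} \<times> Omega_box 0 z_star (\<epsilon> ^ k)) (\<lambda>(t, x, z). \<omega>' \<epsilon> t x z - shear_vorticity base_flow z)"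
    unfolding Q_def by simp_all
  \<comment> \<open>Away from small \<epsilon> the shear flow itself serves, on the time interval
    \<open>[0, 1]\<close>; these values do not influence the limit.\<close>
  define \<omega> where "\<omega> \<epsilon> = (if good \<epsilon> then \<omega>' \<epsilon> else (\<lambda>t x z. shear_vorticity base_flow z))" for \<epsilon>
  define \<tau> where "\<tau> \<epsilon> = (if good \<epsilon> then T \<epsilon> / (2 * pi * real (N \<epsilon>)) else 1)" for \<epsilon>
  have NT: "0 < T \<epsilon> / (2 * pi * real (N \<epsilon>))" if "good \<epsilon>" for \<epsilon>
    using that N(1)[of \<epsilon>] by (auto simp: good_def)
  have "0 < \<tau> \<epsilon> \<and> hydrostatic_Euler_solution (\<tau> \<epsilon>) (\<omega> \<epsilon>) \<and> (\<lambda>(x, z). \<omega> \<epsilon> 0 x z - shear_vorticity base_flow z) \<in> sobolev_space s" for \<epsilon>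
    using \<omega>'(1,2)[of \<epsilon>] NT[of \<epsilon>] base_flow_solution[of 1] zero_sobolev[of s]
    by (cases "good \<epsilon>") (auto simp: \<omega>_def \<tau>_def case_prod_unfold)
  moreover have "\<tau> \<in> O[at_right 0](\<lambda>\<epsilon>. \<epsilon> * \<bar>ln \<epsilon>\<bar>)"
  proof (rule bigoI[where c = \<nu>])
    show "\<forall>\<^sub>F \<epsilon> in at_right 0. norm (\<tau> \<epsilon>) \<le> \<nu> * norm (\<epsilon> * \<bar>ln \<epsilon>\<bar>)"
      using good_ev
    proof eventually_elim
      case (elim \<epsilon>)
      then have e: "0 < \<epsilon>" "\<epsilon> < 1" by (auto simp: good_def)
      have T: "0 < T \<epsilon>" "T \<epsilon> = \<nu> * \<bar>ln \<epsilon>\<bar>" using elim e by (auto simp: good_def T_def)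
      have "1 * (1 / \<epsilon>) \<le> 2 * pi * real (N \<epsilon>)" by (rule mult_mono[OF _ N(2)[OF e]]) (use pi_ge_two e in auto)
      then have "T \<epsilon> / (2 * pi * real (N \<epsilon>)) \<le> T \<epsilon> / (1 * (1 / \<epsilon>))" using T(1) N(1)[OF e] e by (intro divide_left_mono mult_pos_pos) auto
      also have "\<dots> = \<nu> * norm (\<epsilon> * \<bar>ln \<epsilon>\<bar>)" using e by (simp add: T(2) abs_mult)
      finally show ?case using elim NT[OF elim] by (simp add: \<tau>_def)
    qed
  qed
  moreover have "filterlim (\<lambda>\<epsilon>. L2_norm_on ({0..\<tau> \<epsilon>} \<times> Omega_box 0 z_star (\<epsilon> ^ k)) (\<lambda>(t, x, z). \<omega> \<epsilon> t x z - shear_vorticity base_flow z)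
          / (sobolev_norm s (\<lambda>(x, z). \<omega> \<epsilon> 0 x z - shear_vorticity base_flow z)) powr \<alpha>) at_top (at_right 0)"
  proof (rule filterlim_at_top_mono)
    define c where "c = (1 / 1000 * (sqrt (\<beta> / 8) * \<kappa>)) / (C * 2^s) powr \<alpha>"
    have c: "c > 0" using \<beta> \<kappa> C by (simp add: c_def)
    show "filterlim (\<lambda>\<epsilon>. c * inverse \<epsilon>) at_top (at_right 0)"
      by (rule filterlim_tendsto_pos_mult_at_top[OF tendsto_const c filterlim_inverse_at_top_right])
    show "\<forall>\<^sub>F \<epsilon> in at_right 0. c * inverse \<epsilon> \<le> L2_norm_on ({0..\<tau> \<epsilon>} \<times> Omega_box 0 z_star (\<epsilon> ^ k)) (\<lambda>(t, x, z). \<omega> \<epsilon> t x z - shear_vorticity base_flow z)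
          / (sobolev_norm s (\<lambda>(x, z). \<omega> \<epsilon> 0 x z - shear_vorticity base_flow z)) powr \<alpha>"
      using good_ev
    proof eventually_elim
      case (elim \<epsilon>)
      then have e: "0 < \<epsilon>" "\<epsilon> < 1" and T: "1 \<le> T \<epsilon>" by (auto simp: good_def)
      let ?n = "sobolev_norm s (\<lambda>(x, z). \<omega>' \<epsilon> 0 x z - shear_vorticity base_flow z)"
      have "?n \<le> C * \<epsilon> powr m * (2 / \<epsilon>)^s"
        by (rule order_trans[OF \<omega>'(4)[OF elim]]) (use C e N(3)[OF e] in \<open>auto simp: d_def intro!: mult_left_mono power_mono\<close>)
      then have den: "?n powr \<alpha> \<le> (C * 2^s) powr \<alpha> * \<epsilon> powr ((m - real s) * \<alpha>)"
        by (rule data_size_powr[OF e(1) C \<omega>'(3)[OF elim] _ \<alpha>(1)])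
      have den0: "0 < ?n powr \<alpha>" using \<omega>'(3)[OF elim] by simp
      have g1: "\<epsilon> powr (m * \<alpha> / 2) \<le> d \<epsilon> * exp ((1 - \<beta>) * T \<epsilon> / 2)"
      proof -
        have "d \<epsilon> * exp ((1 - \<beta>) * T \<epsilon> / 2) = \<epsilon> powr (m - (1 - \<beta>) / 2 * \<nu>)"
          using expT[OF e(1), of "(1 - \<beta>) / 2"] by (simp add: d_def powr_add[symmetric])
        moreover have "m - (1 - \<beta>) / 2 * \<nu> \<le> m * \<alpha> / 2"
          using growth_exponent[OF \<beta> m(1)] by (simp add: \<nu>_def \<beta>_def)
        ultimately show ?thesis using e by (simp add: powr_mono')
      qed
      have g2: "sqrt (\<beta> / 8) * \<kappa> * \<epsilon>^(k + 2) \<le> sqrt (\<beta> * (T \<epsilon> / (2 * pi * real (N \<epsilon>))) * (h \<epsilon> * (2 * h \<epsilon>)))"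
        unfolding h_def by (rule box_size_lower[OF e \<beta>(1) \<kappa>(1) T _ N(3)[OF e]]) (use N(1)[OF e] in simp)
      have "\<epsilon> powr (m * \<alpha> / 2) / 1000 * (sqrt (\<beta> / 8) * \<kappa> * \<epsilon>^(k + 2)) \<le> lower \<epsilon>"
        unfolding lower_def
      proof (rule mult_mono[OF _ g2])
        show "\<epsilon> powr (m * \<alpha> / 2) / 1000 \<le> d \<epsilon> * exp ((1 - \<beta>) * T \<epsilon> / 2) / 1000" by (rule divide_right_mono[OF g1]) simp
      qed (use \<beta> \<kappa> e in \<open>auto simp: d_def\<close>)
      moreover have "\<epsilon> powr (real k + 2) = \<epsilon>^(k + 2)" using e powr_realpow[of \<epsilon> "k + 2"] by (simp add: add.commute)
      ultimately have num: "1 / 1000 * (sqrt (\<beta> / 8) * \<kappa>) * (\<epsilon> powr (m * \<alpha> / 2) * \<epsilon> powr (real k + 2)) \<le> lower \<epsilon>"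
        by (simp only: mult_ac times_divide_eq_left times_divide_eq_right mult_1)
      \<comment> \<open>The powers of \<epsilon> combine to the exponent -1; this is the equation
        that defined \<open>m\<close>.\<close>
      have "c * inverse \<epsilon> = 1 / 1000 * (sqrt (\<beta> / 8) * \<kappa>) * (\<epsilon> powr (m * \<alpha> / 2) * \<epsilon> powr (real k + 2)) / ((C * 2^s) powr \<alpha> * \<epsilon> powr ((m - real s) * \<alpha>))"
        unfolding c_def by (rule quotient_powr[OF e(1)]) (use m(2) in \<open>simp add: algebra_simps\<close>)
      also have "\<dots> \<le> lower \<epsilon> / ?n powr \<alpha>"
      proof (rule frac_le[OF _ num den0 den])
        have "0 \<le> 1 / 1000 * (sqrt (\<beta> / 8) * \<kappa>) * (\<epsilon> powr (m * \<alpha> / 2) * \<epsilon> powr (real k + 2))" using \<beta> \<kappa> by simp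
        then show "0 \<le> lower \<epsilon>" using num by linarith
      qed
      also have "\<dots> \<le> L2_norm_on ({0..T \<epsilon> / (2 * pi * real (N \<epsilon>))} \<times> Omega_box 0 z_star (\<epsilon> ^ k)) (\<lambda>(t, x, z). \<omega>' \<epsilon> t x z - shear_vorticity base_flow z) / ?n powr \<alpha>"
        using \<omega>'(5)[OF elim] by (rule divide_right_mono) simp
      finally show ?case using elim by (simp add: \<omega>_def \<tau>_def)
    qed
  qed
  ultimately show ?thesis by blast
qed

theorem theorem1p1:
  shows "\<exists>U :: real \<Rightarrow> real. stationary_shear_flow U \<and>
    (\<forall>(s::nat) (\<alpha>::real) (k::nat). 0 < \<alpha> \<and> \<alpha> \<le> 1 \<longrightarrow>
      (\<exists>(\<omega> :: real \<Rightarrow> real \<Rightarrow> real \<Rightarrow> real \<Rightarrow> real) (\<tau> :: real \<Rightarrow> real) (x0::real) (z0::real).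
         (\<forall>\<epsilon>>0. 0 < \<tau> \<epsilon> \<and> hydrostatic_Euler_solution (\<tau> \<epsilon>) (\<omega> \<epsilon>) \<and>
            (\<lambda>(x, z). \<omega> \<epsilon> 0 x z - shear_vorticity U z) \<in> sobolev_space s) \<and>
         \<tau> \<in> O[at_right 0](\<lambda>\<epsilon>. \<epsilon> * \<bar>ln \<epsilon>\<bar>) \<and>
         z0 \<in> {-1<..<1} \<and>
         filterlim
           (\<lambda>\<epsilon>. L2_norm_on ({0..\<tau> \<epsilon>} \<times> Omega_box x0 z0 (\<epsilon> ^ k))
                   (\<lambda>(t, x, z). \<omega> \<epsilon> t x z - shear_vorticity U z)
                 / (sobolev_norm s (\<lambda>(x, z). \<omega> \<epsilon> 0 x z - shear_vorticity U z)) powr \<alpha>)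
           at_top (at_right 0)))"
proof (intro exI[of _ base_flow] conjI stationary_base_flow allI impI)
  fix s k :: nat and \<alpha> :: real assume "0 < \<alpha> \<and> \<alpha> \<le> 1"
  then obtain \<omega> \<tau> where o: "\<forall>\<epsilon>>0. 0 < \<tau> \<epsilon> \<and> hydrostatic_Euler_solution (\<tau> \<epsilon>) (\<omega> \<epsilon>) \<and>
        (\<lambda>(x, z). \<omega> \<epsilon> 0 x z - shear_vorticity base_flow z) \<in> sobolev_space s"
     "\<tau> \<in> O[at_right 0](\<lambda>\<epsilon>. \<epsilon> * \<bar>ln \<epsilon>\<bar>)"
     "filterlim
       (\<lambda>\<epsilon>. L2_norm_on ({0..\<tau> \<epsilon>} \<times> Omega_box 0 z_star (\<epsilon> ^ k)) (\<lambda>(t, x, z). \<omega> \<epsilon> t x z - shear_vorticity base_flow z)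
          / (sobolev_norm s (\<lambda>(x, z). \<omega> \<epsilon> 0 x z - shear_vorticity base_flow z)) powr \<alpha>)
       at_top (at_right 0)"
    using unstable_family[of \<alpha> s k] by blast
  show "\<exists>(\<omega> :: real \<Rightarrow> real \<Rightarrow> real \<Rightarrow> real \<Rightarrow> real) (\<tau> :: real \<Rightarrow> real) (x0::real) (z0::real).
         (\<forall>\<epsilon>>0. 0 < \<tau> \<epsilon> \<and> hydrostatic_Euler_solution (\<tau> \<epsilon>) (\<omega> \<epsilon>) \<and>
            (\<lambda>(x, z). \<omega> \<epsilon> 0 x z - shear_vorticity base_flow z) \<in> sobolev_space s) \<and>
         \<tau> \<in> O[at_right 0](\<lambda>\<epsilon>. \<epsilon> * \<bar>ln \<epsilon>\<bar>) \<and>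
         z0 \<in> {-1<..<1} \<and>
         filterlim
           (\<lambda>\<epsilon>. L2_norm_on ({0..\<tau> \<epsilon>} \<times> Omega_box x0 z0 (\<epsilon> ^ k))
                   (\<lambda>(t, x, z). \<omega> \<epsilon> t x z - shear_vorticity base_flow z)
                 / (sobolev_norm s (\<lambda>(x, z). \<omega> \<epsilon> 0 x z - shear_vorticity base_flow z)) powr \<alpha>)
           at_top (at_right 0)"
    by (rule exI[of _ \<omega>], rule exI[of _ \<tau>], rule exI[of _ 0], rule exI[of _ z_star]) (use o z_star_range in blast)
qed

end
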